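(* Let $G$ be a finite group, $H$ a subgroup of $G$ of index $s\ge 2$, $H_1$ a subgroup of $H$ of index $d\ge 1$, and $U$ an $H_1$-module of dimension $a$ over a field $\mathbb{F}$ of characteristic $p>0$. Let $V:=U\uparrow^H_{H_1}$ and $W:=V\uparrow^G_H$. Let $\Omega$ be the set of right cosets of $H$ in $G$ and $\Omega_1$ the set of right cosets of $H_1$ in $H$. Let $K:=\mathrm{core}_G(H)$, let $K'$ be a subgroup of $K$, and let $$m:=\min\{\chi(Q,\Omega_1) : Q\le K' \text{ and } V \text{ is semisimple as an } \mathbb{F}[Q]\text{-module}\}.$$ For a prime $q\ne p$, let $P_q$ be a Sylow $q$-subgroup of $G$. Also let $P'$ be a maximal $p'$-subgroup of $G$. Let $M$ be a submodule of $W$. Then: (i) If $G$ is soluble, then $$d_G(M)\le \min\left\{\frac{ad-a\chi(P'\cap K,\Omega_1)}{R_{\mathbb{F}}(P'\cap K)}+a\chi(P'\cap K,\Omega_1),\ \chi(P'\cap K,V^* )\right\}s_p.$$ (ii) Let $N$ be a subgroup of $G$ such that $N^{\Omega}$ is soluble, and let $s_i$, $1\le i\le t$, be the sizes of the orbits of $N$ on $\Omega$. Then: (a) $$d_G(M)\le \min\left\{\frac{ad-a\chi(N\cap P'\cap K,\Omega_1)}{R_{\mathbb{F}}(N\cap P'\cap K)}+a\chi(N\cap P'\cap K,\Omega_1),\ \chi(N\cap P'\cap K,V^* )\right\}\sum_{i=1}^t\widetilde{\omega}(s_i).$$ (b) If $N$ is soluble, and $P_N'$ is a $p$-complement in $N$,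 then $$d_G(M)\le \min\left\{\frac{ad-a\chi(P_N'\cap K,\Omega_1)}{R_{\mathbb{F}}(P_N'\cap K)}+a\chi(P_N'\cap K,\Omega_1),\ \chi(P_N'\cap K,V^* )\right\}\sum_{i=1}^t E_{sol}(s_i,p).$$ (iii) $$d_G(M)\le \min\left\{\frac{ad-a\chi(P_q\cap K,\Omega_1)}{R_{\mathbb{F}}(P_q\cap K)}+a\chi(P_q\cap K,\Omega_1),\ \chi(P_q\cap K,V^* )\right\}\frac{s}{s_q}.$$ (iv) Assume that $s_p>1$. Then $$d_G(M)\le \min\left\{\frac{ad-am}{R_{\mathbb{F}}(K')}+am,\ \chi(K,V^* )\right\}\left\lfloor\frac{bs}{\sqrt{\log s_p}}\right\rfloor.$$
   Context: $d_G(M)$ is the minimal number of elements required to generate $M$ as an $\mathbb{F}[G]$-module. $V^*$ is the set of non-zero elements of $V$. For a group $X$ acting on a set $\Sigma$, $\chi(X,\Sigma)$ is the number of orbits of $X$ on $\Sigma$. $N^{\Omega}$ is the permutation group induced by $N$ on $\Omega$. For a non-trivial finite group $X$, $R_{\mathbb{F}}(X)$ is the smallest dimension of a non-trivial representation of $X$ over $\mathbb{F}$; if $X$ is trivial then the numerator of the corresponding fraction is $0$ and the fraction is read as $0$. If the second entry of a minimum is infinite, the minimum is its first entry. For a positive integer $s$ and a prime $r$, $s_r$ is the $r$-part of $s$ (while $s_i$ with $1\le i\le t$ in (ii) are orbit sizes). For a positive integer $x=p_1^{r_1}\cdots p_l^{r_l}$ (prime factorisation), $K(x):=\sum_i r_i(p_i-1)$,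 $\widetilde{\omega}(x):=\frac{x}{2^{K(x)}}\binom{K(x)}{\lfloor K(x)/2\rfloor}$, and $E_{sol}(x,p):=\min\{\widetilde{\omega}(x),x_p\}$, where $x_p$ is the $p$-part of $x$. $b:=\sqrt{2/\pi}$, and $\log$ is logarithm to base $2$. A $p$-complement in a soluble group is a Hall $p'$-subgroup. *)

theory Defs
  imports
    Complex_Main
    "HOL-Library.Function_Algebras"
    "HOL-Computational_Algebra.Primes"
    "HOL-Algebra.Group_Action"
    "HOL-Algebra.Solvable_Groups"
    "Jordan_Normal_Form.Matrix"
begin

section \<open>Modules for group algebras\<close>

text \<open>
  Groups are HOL-Algebra groups; a subgroup \<open>H\<close> of \<open>G\<close> is a set, and as a group it is
  \<open>G\<lparr>carrier := H\<rparr>\<close>. Fields are types of class \<open>field\<close>.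

  In line with the use of right cosets, modules are right modules: \<open>act V v g\<close> is \<open>v g\<close>. The
  vector space underlying a module is a subspace \<open>vecs V\<close> of an ambient vector space, so that
  induced modules, which are spaces of functions, need no type of their own.
\<close>

record ('f, 'g, 'v) gmodule =
  vecs :: "'v set"
  smul :: "'f \<Rightarrow> 'v \<Rightarrow> 'v"
  act :: "'v \<Rightarrow> 'g \<Rightarrow> 'v"

locale group_module = group G + vector_space "smul V"
  for G :: "('g, 'b) monoid_scheme" (structure)
    and V :: "('f::field, 'g, 'v::ab_group_add) gmodule" +
  assumes subspace_vecs: "subspace (vecs V)"
    and act_closed: "\<lbrakk>v \<in> vecs V; g \<in> carrier G\<rbrakk> \<Longrightarrow> act V v g \<in> vecs V"
    and act_add: "\<lbrakk>v \<in> vecs V; w \<in> vecs V; g \<in> carrier G\<rbrakk>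
      \<Longrightarrow> act V (v + w) g = act V v g + act V w g"
    and act_smul: "\<lbrakk>v \<in> vecs V; g \<in> carrier G\<rbrakk>
      \<Longrightarrow> act V (smul V c v) g = smul V c (act V v g)"
    and act_one: "v \<in> vecs V \<Longrightarrow> act V v \<one> = v"
    and act_mult: "\<lbrakk>v \<in> vecs V; g \<in> carrier G; h \<in> carrier G\<rbrakk>
      \<Longrightarrow> act V v (g \<otimes> h) = act V (act V v g) h"

text \<open>Having no finite basis is different from having dimension \<open>0\<close>, unlike for \<open>dim\<close>.\<close>

definition has_dimension :: "('f::field, 'g, 'v::ab_group_add) gmodule \<Rightarrow> nat \<Rightarrow> bool" where
  "has_dimension V n \<longleftrightarrow>
     (\<exists>B. finite B \<and> card B = n \<and> \<not> module.dependent (smul V) B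
          \<and> module.span (smul V) B = vecs V)"

definition submod ::
  "('g, 'b) monoid_scheme \<Rightarrow> ('f::field, 'g, 'v::ab_group_add) gmodule \<Rightarrow> 'v set \<Rightarrow> bool" where
  "submod G V M \<longleftrightarrow> M \<subseteq> vecs V \<and> module.subspace (smul V) M
     \<and> (\<forall>v\<in>M. \<forall>g\<in>carrier G. act V v g \<in> M)"

definition submod_generated ::
  "('g, 'b) monoid_scheme \<Rightarrow> ('f::field, 'g, 'v::ab_group_add) gmodule \<Rightarrow> 'v set \<Rightarrow> 'v set" where
  "submod_generated G V S = \<Inter>{M. submod G V M \<and> S \<subseteq> M}"

text \<open>\<open>d_G(M)\<close> for a submodule \<open>M\<close> of \<open>V\<close>.\<close>

definition min_gens ::
  "('g, 'b) monoid_scheme \<Rightarrow> ('f::field, 'g, 'v::ab_group_add) gmodule \<Rightarrow> 'v set \<Rightarrow> nat" where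
  "min_gens G V M =
     (LEAST n. \<exists>S. S \<subseteq> M \<and> finite S \<and> card S = n \<and> submod_generated G V S = M)"

definition simple_submod ::
  "('g, 'b) monoid_scheme \<Rightarrow> ('f::field, 'g, 'v::ab_group_add) gmodule \<Rightarrow> 'v set \<Rightarrow> bool" where
  "simple_submod G V S \<longleftrightarrow> submod G V S \<and> S \<noteq> {0}
     \<and> (\<forall>T. submod G V T \<and> T \<subseteq> S \<longrightarrow> T = {0} \<or> T = S)"

text \<open>A direct sum of simple submodules.\<close>

definition semisimple ::
  "('g, 'b) monoid_scheme \<Rightarrow> ('f::field, 'g, 'v::ab_group_add) gmodule \<Rightarrow> bool" where
  "semisimple G V \<longleftrightarrow>
     (\<exists>\<S>. (\<forall>S\<in>\<S>. simple_submod G V S)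
        \<and> (\<forall>S\<in>\<S>. S \<inter> module.span (smul V) (\<Union>(\<S> - {S})) = {0})
        \<and> module.span (smul V) (\<Union>\<S>) = vecs V)"


section \<open>Induced modules\<close>

text \<open>
  The induced module \<open>U \<otimes> F[G]\<close> (tensor product over \<open>F[L]\<close>) for a subgroup \<open>L\<close> of \<open>G\<close>
  is realised by the functions \<open>f\<close> from \<open>G\<close> to \<open>U\<close> with \<open>f (h x) = f(x) h\<^sup>-\<^sup>1\<close> for \<open>h\<close> in \<open>L\<close>; such an
  \<open>f\<close> stands for the sum of the elements \<open>f(x) \<otimes> x\<close>, where \<open>x\<close> ranges over any right
  transversal of \<open>L\<close> in \<open>G\<close>. Functions are zero outside the group. That this is the module
  \<open>U \<otimes> F[G]\<close> is the content of the lemmas about \<open>ind_tensor\<close> below.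
\<close>

definition induced ::
  "('g, 'b) monoid_scheme \<Rightarrow> 'g set \<Rightarrow> ('f::field, 'g, 'v::ab_group_add) gmodule
    \<Rightarrow> ('f, 'g, 'g \<Rightarrow> 'v) gmodule" where
  "induced G L U =
    \<lparr>vecs = {f. (\<forall>x\<in>carrier G. f x \<in> vecs U) \<and> (\<forall>x. x \<notin> carrier G \<longrightarrow> f x = 0)
              \<and> (\<forall>h\<in>L. \<forall>x\<in>carrier G. f (h \<otimes>\<^bsub>G\<^esub> x) = act U (f x) (inv\<^bsub>G\<^esub> h))},
     smul = (\<lambda>c f x. smul U c (f x)),
     act = (\<lambda>f g x. if x \<in> carrier G then f (x \<otimes>\<^bsub>G\<^esub> inv\<^bsub>G\<^esub> g) else 0)\<rparr>"

lemma (in group) group_module_induced: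
  assumes L: "subgroup L G" and U: "group_module (G\<lparr>carrier := L\<rparr>) U"
  shows "group_module G (induced G L U)"
proof -
  interpret L: subgroup L G by fact
  interpret U: group_module "G\<lparr>carrier := L\<rparr>" U by fact
  have LG: "\<And>h. h \<in> L \<Longrightarrow> h \<in> carrier G" by (rule L.mem_carrier)
  interpret VV: vector_space "smul (induced G L U)"
    by unfold_locales
      (auto simp: induced_def fun_eq_iff U.scale_right_distrib U.scale_left_distrib)
  note sub = U.subspace_vecs[unfolded U.subspace_def]
  have act0: "act U 0 h = 0" if "h \<in> L" for h
    using U.act_add[of 0 0 h] sub that by simp
  show ?thesis
  proof (unfold_locales, goal_cases)
    case 1
    show ?case
      unfolding VV.subspace_def using sub act0
      by (auto simp: induced_def U.act_add U.act_smul)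
  next
    case (2 v g)
    then show ?case
      by (auto simp: induced_def LG m_assoc)
  next
    case (3 v w g)
    then show ?case by (auto simp: induced_def fun_eq_iff)
  next
    case (4 v g c)
    then show ?case by (auto simp: induced_def fun_eq_iff)
  next
    case (5 v)
    then show ?case by (auto simp: induced_def fun_eq_iff)
  next
    case (6 v g h)
    then show ?case by (auto simp: induced_def fun_eq_iff inv_mult_group m_assoc)
  qed
qed

text \<open>The element \<open>u \<otimes> x\<close> of the induced module.\<close>

definition ind_tensor ::
  "('g, 'b) monoid_scheme \<Rightarrow> 'g set \<Rightarrow> ('f::field, 'g, 'v::ab_group_add) gmodule
    \<Rightarrow> 'v \<Rightarrow> 'g \<Rightarrow> 'g \<Rightarrow> 'v" where
  "ind_tensor G L U u x =
     (\<lambda>y. if y \<in> L #>\<^bsub>G\<^esub> x then act U u (x \<otimes>\<^bsub>G\<^esub> inv\<^bsub>G\<^esub> y) else 0)"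

context group
begin

context
  fixes L :: "'a set" and U :: "('f::field, 'a, 'v::ab_group_add) gmodule"
  assumes L: "subgroup L G" and U: "group_module (G\<lparr>carrier := L\<rparr>) U"
begin

interpretation L: subgroup L G by (fact L)
interpretation U: group_module "G\<lparr>carrier := L\<rparr>" U by (fact U)

lemma mem_r_coset_iff: "x \<in> carrier G \<Longrightarrow> y \<in> L #> x \<longleftrightarrow> y \<in> carrier G \<and> x \<otimes> inv y \<in> L"
proof
  assume x: "x \<in> carrier G" and "y \<in> L #> x"
  then obtain h where h: "h \<in> L" "y = h \<otimes> x" by (auto simp: r_coset_def)
  then have "x \<otimes> inv y = inv h"
    using x by (simp add: inv_mult_group m_assoc[symmetric])
  then show "y \<in> carrier G \<and> x \<otimes> inv y \<in> L" using h x by simp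
next
  assume x: "x \<in> carrier G" and y: "y \<in> carrier G \<and> x \<otimes> inv y \<in> L"
  then have "inv (x \<otimes> inv y) \<in> L" by simp
  moreover have "y = inv (x \<otimes> inv y) \<otimes> x"
    using x y by (simp add: inv_mult_group m_assoc)
  ultimately show "y \<in> L #> x" unfolding r_coset_def by blast
qed

lemma act_zero: "h \<in> L \<Longrightarrow> act U 0 h = 0"
  using U.act_add[of 0 0 h] U.subspace_vecs by (simp add: U.subspace_def)

lemma ind_tensor_mem:
  assumes u: "u \<in> vecs U" and x: "x \<in> carrier G"
  shows "ind_tensor G L U u x \<in> vecs (induced G L U)"
proof -
  have 0: "0 \<in> vecs U" using U.subspace_vecs by (simp add: U.subspace_def)
  have "ind_tensor G L U u x (h \<otimes> y) = act U (ind_tensor G L U u x y) (inv h)"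
    if h: "h \<in> L" and y: "y \<in> carrier G" for h y
  proof (cases "y \<in> L #> x")
    case True
    have eq: "x \<otimes> inv (h \<otimes> y) = (x \<otimes> inv y) \<otimes> inv h"
      using x y h by (simp add: inv_mult_group m_assoc)
    have "x \<otimes> inv y \<in> L" using True x mem_r_coset_iff by blast
    moreover from this have "h \<otimes> y \<in> L #> x"
      using h x y eq by (simp add: mem_r_coset_iff)
    ultimately show ?thesis
      using True u h by (simp add: ind_tensor_def eq U.act_mult[simplified])
  next
    case False
    have "h \<otimes> y \<notin> L #> x"
    proof
      assume "h \<otimes> y \<in> L #> x"
      then have "(x \<otimes> inv (h \<otimes> y)) \<otimes> h \<in> L" using h x mem_r_coset_iff by blast
      moreover have "(x \<otimes> inv (h \<otimes> y)) \<otimes> h = x \<otimes> inv y"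
        using x y h by (simp add: inv_mult_group m_assoc)
      ultimately show False using False x y by (simp add: mem_r_coset_iff)
    qed
    then show ?thesis using False h by (simp add: ind_tensor_def act_zero)
  qed
  then show ?thesis
    using u x 0 by (auto simp: induced_def ind_tensor_def mem_r_coset_iff U.act_closed[simplified])
qed

lemma ind_tensor_add:
  "\<lbrakk>u \<in> vecs U; w \<in> vecs U; x \<in> carrier G\<rbrakk> \<Longrightarrow>
     ind_tensor G L U (u + w) x = ind_tensor G L U u x + ind_tensor G L U w x"
  by (auto simp: ind_tensor_def fun_eq_iff mem_r_coset_iff U.act_add[simplified])

lemma ind_tensor_smul:
  "\<lbrakk>u \<in> vecs U; x \<in> carrier G\<rbrakk> \<Longrightarrow>
     ind_tensor G L U (smul U c u) x = smul (induced G L U) c (ind_tensor G L U u x)"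
  by (auto simp: ind_tensor_def induced_def fun_eq_iff mem_r_coset_iff U.act_smul[simplified])

lemma ind_tensor_balanced:
  assumes "u \<in> vecs U" "h \<in> L" "x \<in> carrier G"
  shows "ind_tensor G L U (act U u h) x = ind_tensor G L U u (h \<otimes> x)"
proof
  fix y
  have *: "h \<otimes> x \<otimes> inv y = h \<otimes> (x \<otimes> inv y)" if "y \<in> carrier G"
    using assms that by (simp add: m_assoc)
  have "h \<otimes> (x \<otimes> inv y) \<in> L \<longleftrightarrow> x \<otimes> inv y \<in> L" if "y \<in> carrier G"
  proof
    assume "h \<otimes> (x \<otimes> inv y) \<in> L"
    then have "inv h \<otimes> (h \<otimes> (x \<otimes> inv y)) \<in> L" using assms by simp
    then show "x \<otimes> inv y \<in> L" using assms that by (simp add: m_assoc[symmetric])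
  qed (use assms in simp)
  then show "ind_tensor G L U (act U u h) x y = ind_tensor G L U u (h \<otimes> x) y"
    using assms by (auto simp: ind_tensor_def mem_r_coset_iff * U.act_mult[simplified])
qed

lemma ind_tensor_act:
  assumes "u \<in> vecs U" "x \<in> carrier G" "g \<in> carrier G"
  shows "act (induced G L U) (ind_tensor G L U u x) g = ind_tensor G L U u (x \<otimes> g)"
proof
  fix y
  have "x \<otimes> inv (y \<otimes> inv g) = x \<otimes> g \<otimes> inv y" if "y \<in> carrier G"
    using assms that by (simp add: inv_mult_group m_assoc)
  then show "act (induced G L U) (ind_tensor G L U u x) g y = ind_tensor G L U u (x \<otimes> g) y"
    using assms by (auto simp: ind_tensor_def induced_def mem_r_coset_iff)
qed

text \<open>The induced module is the direct sum of the spaces \<open>U \<otimes> x\<close> over a right transversal.\<close>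

lemma induced_direct_sum:
  assumes T: "finite T" "T \<subseteq> carrier G" "\<And>y. y \<in> carrier G \<Longrightarrow> \<exists>!x. x \<in> T \<and> y \<in> L #> x"
  shows "bij_betw (\<lambda>w. \<Sum>x\<in>T. ind_tensor G L U (w x) x)
           {w. (\<forall>x\<in>T. w x \<in> vecs U) \<and> (\<forall>x. x \<notin> T \<longrightarrow> w x = 0)} (vecs (induced G L U))"
    (is "bij_betw ?S ?W ?V")
proof -
  interpret V: group_module G "induced G L U"
    by (rule group_module_induced[OF L U])
  have val: "?S w y = act U (w x) (x \<otimes> inv y)"
    if "x \<in> T" "y \<in> L #> x" for w x y
  proof -
    have y: "y \<in> carrier G" using that T(2) mem_r_coset_iff by blast
    have sumapp: "?S w y = (\<Sum>x\<in>T. ind_tensor G L U (w x) x y)"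
      using T(1) by (induction T rule: finite_induct) auto
    also have "\<dots> = (\<Sum>x'\<in>{x}. ind_tensor G L U (w x') x' y)"
      using T(1) that T(3)[OF y]
      by (intro sum.mono_neutral_right) (auto simp: ind_tensor_def)
    finally show ?thesis using that by (simp add: ind_tensor_def)
  qed
  have val_T: "?S w x = w x" if "x \<in> T" "w \<in> ?W" for w x
  proof -
    have x: "x \<in> carrier G" using that T(2) by blast
    then have "x \<in> L #> x" by (simp add: mem_r_coset_iff)
    then show ?thesis using val[OF that(1)] that x by (simp add: U.act_one[simplified])
  qed
  show ?thesis
  proof (rule bij_betw_byWitness[where f' = "\<lambda>f x. if x \<in> T then f x else 0"])
    show "\<forall>w\<in>?W. (\<lambda>x. if x \<in> T then ?S w x else 0) = w"
      using val_T by (auto simp: fun_eq_iff)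
    show "\<forall>f\<in>?V. ?S (\<lambda>x. if x \<in> T then f x else 0) = f"
    proof (intro ballI ext)
      fix f y assume f: "f \<in> ?V"
      show "?S (\<lambda>x. if x \<in> T then f x else 0) y = f y"
      proof (cases "y \<in> carrier G")
        case True
        then obtain x where x: "x \<in> T" "y \<in> L #> x" using T(3) by blast
        have xG: "x \<in> carrier G" and xy: "x \<otimes> inv y \<in> L"
          using x T(2) mem_r_coset_iff by blast+
        have "f (inv (x \<otimes> inv y) \<otimes> x) = act U (f x) (inv (inv (x \<otimes> inv y)))"
          using f xG xy by (auto simp: induced_def)
        moreover have "inv (x \<otimes> inv y) \<otimes> x = y" "inv (inv (x \<otimes> inv y)) = x \<otimes> inv y"
          using xG True by (simp_all add: inv_mult_group m_assoc)
        ultimately show ?thesis using val[OF x, of "\<lambda>x. if x \<in> T then f x else 0"] x by simp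
      next
        case False
        have SV: "?S w \<in> ?V" if "w \<in> ?W" for w
          by (rule V.subspace_sum[OF V.subspace_vecs]) (use that T(2) ind_tensor_mem in blast)
        have "(\<lambda>x. if x \<in> T then f x else 0) \<in> ?W"
          using f T(2) by (auto simp: induced_def)
        from SV[OF this] have "?S (\<lambda>x. if x \<in> T then f x else 0) \<in> ?V" .
        then show ?thesis using False f by (simp add: induced_def)
      qed
    qed
    show "?S ` ?W \<subseteq> ?V"
    proof (rule image_subsetI)
      fix w assume "w \<in> ?W"
      then show "?S w \<in> ?V"
        by (intro V.subspace_sum[OF V.subspace_vecs]) (use T(2) ind_tensor_mem in blast)
    qed
    show "(\<lambda>f x. if x \<in> T then f x else 0) ` ?V \<subseteq> ?W"
      using T(2) by (auto simp: induced_def)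
  qed
qed

end

end


section \<open>Groups and permutation groups\<close>

definition core :: "('g, 'b) monoid_scheme \<Rightarrow> 'g set \<Rightarrow> 'g set" where
  "core G H = (\<Inter>g\<in>carrier G. (inv\<^bsub>G\<^esub> g) <#\<^bsub>G\<^esub> H #>\<^bsub>G\<^esub> g)"

definition r_part :: "nat \<Rightarrow> nat \<Rightarrow> nat" where
  "r_part r s = r ^ multiplicity r s"

definition sylow_subgroup :: "('g, 'b) monoid_scheme \<Rightarrow> nat \<Rightarrow> 'g set \<Rightarrow> bool" where
  "sylow_subgroup G q P \<longleftrightarrow> subgroup P G \<and> card P = r_part q (order G)"

definition p'_subgroup :: "('g, 'b) monoid_scheme \<Rightarrow> nat \<Rightarrow> 'g set \<Rightarrow> bool" where
  "p'_subgroup G p P \<longleftrightarrow> subgroup P G \<and> \<not> p dvd card P"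

definition maximal_p'_subgroup :: "('g, 'b) monoid_scheme \<Rightarrow> nat \<Rightarrow> 'g set \<Rightarrow> bool" where
  "maximal_p'_subgroup G p P \<longleftrightarrow>
     p'_subgroup G p P \<and> (\<forall>R. p'_subgroup G p R \<and> P \<subseteq> R \<longrightarrow> R = P)"

text \<open>A Hall \<open>p'\<close>-subgroup: a \<open>p'\<close>-subgroup whose index is a power of \<open>p\<close>.\<close>

definition p_complement :: "('g, 'b) monoid_scheme \<Rightarrow> nat \<Rightarrow> 'g set \<Rightarrow> bool" where
  "p_complement G p P \<longleftrightarrow> p'_subgroup G p P \<and> (\<exists>k. card (rcosets\<^bsub>G\<^esub> P) = p ^ k)"

text \<open>The permutation group induced by \<open>N\<close> on a set of right cosets, under right multiplication.\<close>

definition induced_perm_group ::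
  "('g, 'b) monoid_scheme \<Rightarrow> 'g set \<Rightarrow> 'g set set \<Rightarrow> ('g set \<Rightarrow> 'g set) monoid" where
  "induced_perm_group G N \<Omega> =
     (BijGroup \<Omega>)\<lparr>carrier := (\<lambda>g. \<lambda>C\<in>\<Omega>. C #>\<^bsub>G\<^esub> g) ` N\<rparr>"

definition coset_orbits :: "('g, 'b) monoid_scheme \<Rightarrow> 'g set \<Rightarrow> 'g set set \<Rightarrow> 'g set set set" where
  "coset_orbits G X \<Omega> = orbits (G\<lparr>carrier := X\<rparr>) \<Omega> (\<lambda>g C. C #>\<^bsub>G\<^esub> g)"

text \<open>The orbits of \<open>X\<close> on \<open>V\<^sup>*\<close>; there may be infinitely many.\<close>

definition vector_orbits ::
  "('g, 'b) monoid_scheme \<Rightarrow> 'g set \<Rightarrow> ('f::field, 'g, 'v::ab_group_add) gmodule \<Rightarrow> 'v set set" where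
  "vector_orbits G X V = orbits (G\<lparr>carrier := X\<rparr>) (vecs V - {0}) (\<lambda>g v. act V v g)"


section \<open>The numerical bounds\<close>

text \<open>\<open>R\<^sub>F(X)\<close>, with representations as homomorphisms into \<open>GL\<^sub>n(F)\<close>.\<close>

definition min_rep_dim :: "'f::field itself \<Rightarrow> ('g, 'b) monoid_scheme \<Rightarrow> nat" where
  "min_rep_dim F X =
     (LEAST n. \<exists>\<rho>\<in>hom X (units_of (ring_mat F n ())). \<exists>x\<in>carrier X. \<rho> x \<noteq> 1\<^sub>m n)"

text \<open>\<open>(ad - ac) / R\<^sub>F(X) + ac\<close>, where the fraction is read as \<open>0\<close> for trivial \<open>X\<close>.\<close>

definition rep_bound ::
  "'f::field itself \<Rightarrow> ('g, 'b) monoid_scheme \<Rightarrow> nat \<Rightarrow> nat \<Rightarrow> 'g set \<Rightarrow> nat \<Rightarrow> real" where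
  "rep_bound F G a d X c =
     (if X = {\<one>\<^bsub>G\<^esub>} then 0
      else (real (a * d) - real (a * c)) / real (min_rep_dim F (G\<lparr>carrier := X\<rparr>)))
     + real (a * c)"

text \<open>The minimum of \<open>r\<close> and the size of \<open>A\<close>, also when \<open>A\<close> is infinite.\<close>

definition min_card :: "real \<Rightarrow> 'a set \<Rightarrow> real" where
  "min_card r A = (if finite A then min r (real (card A)) else r)"

definition K_sum :: "nat \<Rightarrow> nat" where
  "K_sum x = (\<Sum>p\<in>prime_factors x. multiplicity p x * (p - 1))"

definition omega_tilde :: "nat \<Rightarrow> real" where
  "omega_tilde x = real x / 2 ^ K_sum x * real (K_sum x choose (K_sum x div 2))"

definition E_sol :: "nat \<Rightarrow> nat \<Rightarrow> real" where
  "E_sol x p = min (omega_tilde x) (real (r_part p x))"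

end

theory Submission
  imports Defs "HOL-Analysis.Gamma_Function" "HOL-Real_Asymp.Real_Asymp"
    "HOL-Algebra.Sylow" "HOL-Algebra.Multiplicative_Group"
begin

text \<open>
  Let \<open>l\<close> be the length of a composition series of \<open>V\<close> as a module for the normal subgroup \<open>K\<close>.
  All parts follow from two facts: every bound on \<open>V\<close> in the theorem is at least \<open>l\<close>, and
  \<open>d_G(M)\<close> is at most \<open>l\<close> times a number that depends only on the action on \<open>\<Omega>\<close>.

  For the first fact, each step of a chain of \<open>K\<close>-submodules of \<open>V\<close> contributes a new orbit of
  vectors. A factor on which \<open>X \<le> K\<close> acts nontrivially has dimension at least \<open>R_F(X)\<close>; a factor on
  which it acts trivially contributes a new dimension to the fixed space of a subgroup \<open>Q \<le> X\<close> for
  which \<open>V\<close> is semisimple, and this fixed space has dimension at most \<open>a \<chi>(Q, \<Omega>1)\<close>.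

  For the second fact, restrict \<open>M\<close> to \<open>N K\<close> for a subgroup \<open>N\<close> of \<open>G\<close> and filter by the orbits of \<open>N\<close>
  on \<open>\<Omega>\<close>. If the orbits of a Hall \<open>p'\<close>-subgroup \<open>P\<close> are used, a relative version of Maschke's theorem
  gives \<open>l\<close> generators for each orbit. If \<open>N\<close> acts as a soluble group, then a subnormal series with
  factors of prime order identifies an orbit with a product of chains of prime lengths, ordered in
  such a way that elements of \<open>N\<close> move leading positions upwards. The leading coefficients of \<open>M\<close>
  increase along each chain of the product, so each chain of a symmetric chain decomposition needs
  at most \<open>l\<close> generators, and there are at most \<open>\<omega>\<close>-tilde many chains.
\<close>

section \<open>Products of chains\<close>

text \<open>If p divides the orders involved, neither W nor V need be semisimple, so d_G(M) cannot
  be read off from a decomposition. What survives is that K fixes every coset: the coefficients that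
  occur at one position form a K-submodule of V, and only l strict enlargements of such a submodule
  are possible. Hence l counts chains for K alone, and is multiplied by a number of chains or orbits
  in \<Omega>. The order on an orbit has to be respected by enough elements of N. A factor of prime
  order q provides a chain of length q, because the powers of one element move its copies cyclically
  and only the copies below the leading one have to stay low. The chains of the product are compared
  with those of a Boolean lattice: one chain of length q weighs at most q / 2^(q-1) times as much as
  q - 1 chains of length 2. This is the origin of x / 2^K(x) and of the middle binomial coefficient.
  The constant b comes from the estimate of that coefficient, and log s_p from p \<le> 2^(p-1),
  which gives K(x) \<ge> log x.\<close>

text \<open>
  \<open>hook_lengths qs\<close> lists the lengths of the chains in a symmetric chain decomposition of the
  product of chains of lengths \<open>qs\<close>. They are counted by a reflection principle: on functions of
  the chain length, extended to odd functions on the integers, the replacement of a chain by the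
  hooks of its product with a chain of length \<open>q\<close> becomes the convolution \<open>spread q\<close>.
\<close>

primrec hook_lengths :: "nat list \<Rightarrow> nat list" where
  "hook_lengths [] = [1]"
| "hook_lengths (q # qs) =
     concat (map (\<lambda>r. map (\<lambda>j. q + r - 1 - 2 * j) [0..<min q r]) (hook_lengths qs))"

definition spread :: "nat \<Rightarrow> (int \<Rightarrow> real) \<Rightarrow> int \<Rightarrow> real" where
  "spread q f r = (\<Sum>j<q. f (r + int q - 1 - 2 * int j))"

definition odd_fun :: "(int \<Rightarrow> real) \<Rightarrow> bool" where
  "odd_fun f \<longleftrightarrow> (\<forall>r. f (- r) = - f r)"

lemma spread_odd:
  assumes "odd_fun f"
  shows "odd_fun (spread q f)"
  unfolding odd_fun_def
proof
  fix r
  have "spread q f (- r) = (\<Sum>j<q. f (- r + int q - 1 - 2 * int (q - Suc j)))"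
    unfolding spread_def by (rule sum.nat_diff_reindex[symmetric])
  also have "\<dots> = (\<Sum>j<q. - f (r + int q - 1 - 2 * int j))"
  proof (rule sum.cong)
    fix j assume "j \<in> {..<q}"
    then have "- r + int q - 1 - 2 * int (q - Suc j) = - (r + int q - 1 - 2 * int j)"
      by auto
    then show "f (- r + int q - 1 - 2 * int (q - Suc j)) = - f (r + int q - 1 - 2 * int j)"
      using assms unfolding odd_fun_def by metis
  qed simp
  also have "\<dots> = - spread q f r" by (simp add: spread_def sum_negf)
  finally show "spread q f (- r) = - spread q f r" .
qed

lemma spread_commute: "spread q (spread q' f) r = spread q' (spread q f) r"
  unfolding spread_def by (subst sum.swap) (simp add: algebra_simps)

text \<open>The arguments n - 1, n - 3, ..., 1 - n are symmetric about 0, so this is the value at 0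
  of the odd function \<open>spread n f\<close>.\<close>

lemma odd_fun_sum_zero:
  assumes "odd_fun f"
  shows "(\<Sum>j<n. f (int n - 1 - 2 * int j)) = 0"
proof -
  have "spread n f 0 = - spread n f 0"
    using spread_odd[OF assms] unfolding odd_fun_def by (metis minus_zero)
  then show ?thesis by (simp add: spread_def)
qed

lemma sum_lessThan_add:
  "(\<Sum>j<m + n. g j) = (\<Sum>j<m. g j) + (\<Sum>j<n. g (m + j))" for g :: "nat \<Rightarrow> real"
  by (induction n) simp_all

text \<open>For \<open>r < q\<close> the additional terms cancel in pairs.\<close>

lemma spread_eq_hooks:
  assumes "odd_fun f"
  shows "spread q f (int r) = (\<Sum>j<min q r. f (int (q + r - 1 - 2 * j)))"
proof -
  have *: "(\<Sum>j<min q r. f (int (q + r - 1 - 2 * j))) = (\<Sum>j<min q r. f (int r + int q - 1 - 2 * int j))"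
    by (rule sum.cong) (auto simp: of_nat_diff intro!: arg_cong[of _ _ f])
  show ?thesis
  proof (cases "q \<le> r")
    case True
    then show ?thesis unfolding * spread_def by (simp add: min_def)
  next
    case False
    have "spread q f (int r) = (\<Sum>j<r + (q - r). f (int r + int q - 1 - 2 * int j))"
      using False by (simp add: spread_def)
    also have "\<dots> = (\<Sum>j<r. f (int r + int q - 1 - 2 * int j))
        + (\<Sum>j<q - r. f (int r + int q - 1 - 2 * int (r + j)))"
      by (rule sum_lessThan_add)
    also have "(\<Sum>j<q - r. f (int r + int q - 1 - 2 * int (r + j)))
        = (\<Sum>j<q - r. f (int (q - r) - 1 - 2 * int j))"
      by (rule sum.cong) (use False in \<open>auto simp: of_nat_diff intro!: arg_cong[of _ _ f]\<close>)
    also have "\<dots> = 0" by (rule odd_fun_sum_zero[OF assms])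
    finally show ?thesis unfolding * using False by (simp add: min_def)
  qed
qed

text \<open>Although \<open>spread\<close> looks at negative arguments as well, a comparison on the
  naturals is enough: on odd functions it is the sum over hook lengths, and these are natural
  numbers.\<close>

lemma spread_mono:
  assumes "odd_fun f" "odd_fun g" "\<And>r. f (int r) \<le> g (int r)"
  shows "spread q f (int r) \<le> spread q g (int r)"
  by (simp only: spread_eq_hooks assms sum_mono)

text \<open>The odd extension of the constant 1 on the positive integers; summed over a list of
  chain lengths it counts the chains.\<close>

abbreviation sgnf :: "int \<Rightarrow> real" where "sgnf r \<equiv> of_int (sgn r)"

lemma odd_sgnf: "odd_fun sgnf" by (simp add: odd_fun_def)

lemma odd_spread_pow: "odd_fun f \<Longrightarrow> odd_fun ((spread 2 ^^ m) f)"
  by (induction m) (simp_all add: spread_odd)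

lemma spread_2: "spread 2 f r = f (r + 1) + f (r - 1)"
  by (simp add: spread_def numeral_2_eq_2 add.commute)

lemma spread_pow_Suc: "(spread 2 ^^ Suc m) f r = (spread 2 ^^ m) f (r + 1) + (spread 2 ^^ m) f (r - 1)"
proof -
  have "(spread 2 ^^ Suc m) f = spread 2 ((spread 2 ^^ m) f)" by simp
  then show ?thesis using spread_2[of "(spread 2 ^^ m) f" r] by metis
qed

lemma spread_sgnf_eq: "spread q sgnf (int r) = real (min q r)"
proof -
  have "(\<Sum>j<min q r. sgnf (int (q + r - 1 - 2 * j))) = (\<Sum>j<min q r. 1)"
  proof (rule sum.cong)
    fix j assume "j \<in> {..<min q r}"
    then have "0 < q + r - 1 - 2 * j" by auto
    then show "sgnf (int (q + r - 1 - 2 * j)) = 1" by (simp add: sgn_1_pos)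
  qed simp
  then show ?thesis by (simp add: spread_eq_hooks[OF odd_sgnf])
qed

lemma spread_pow_sgnf_large: "r > m \<Longrightarrow> (spread 2 ^^ m) sgnf (int r) = 2 ^ m"
proof (induction m arbitrary: r)
  case (Suc m)
  have e: "int r + 1 = int (r + 1)" "int r - 1 = int (r - 1)" using Suc.prems by auto
  have "(spread 2 ^^ m) sgnf (int (r + 1)) = 2 ^ m" by (rule Suc.IH) (use Suc.prems in simp)
  moreover have "(spread 2 ^^ m) sgnf (int (r - 1)) = 2 ^ m" by (rule Suc.IH) (use Suc.prems in simp)
  ultimately show ?case unfolding spread_pow_Suc e by simp
qed simp

text \<open>A sum of two translates inherits concavity, except that \<open>r = 1\<close> involves
  the concavity of \<open>f\<close> at 0, outside the range of the hypothesis. Oddness supplies it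
  as the equality f(1) + f(-1) = 0 = 2 f(0).\<close>

lemma spread_concave:
  assumes f: "odd_fun f" "\<And>r. r \<ge> 1 \<Longrightarrow> f (r + 1) + f (r - 1) \<le> 2 * f r" and r: "r \<ge> 1"
  shows "spread 2 f (r + 1) + spread 2 f (r - 1) \<le> 2 * spread 2 f r"
proof -
  have e: "r + 1 + 1 = r + 2" "r - 1 - 1 = r - 2" "r - 1 + 1 = r" "r + 1 - 1 = r" by simp_all
  have 1: "f (r + 2) + f r \<le> 2 * f (r + 1)" using f(2)[of "r + 1"] r by (simp only: e)
  have 2: "f r + f (r - 2) \<le> 2 * f (r - 1)"
  proof (cases "r = 1")
    case True
    have "f (- 1) = - f 1" "f (- 0) = - f 0" using f(1) unfolding odd_fun_def by blast+
    then show ?thesis using True by simp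
  next
    case False
    then show ?thesis using f(2)[of "r - 1"] r by (simp only: e)
  qed
  show ?thesis using 1 2 by (simp only: spread_2 e) argo
qed

lemma spread_pow_concave:
  "r \<ge> 1 \<Longrightarrow> (spread 2 ^^ m) sgnf (r + 1) + (spread 2 ^^ m) sgnf (r - 1) \<le> 2 * (spread 2 ^^ m) sgnf r"
proof (induction m arbitrary: r)
  case 0
  then show ?case by (cases "r = 1") (auto simp: sgn_1_pos)
next
  case (Suc m)
  have "(spread 2 ^^ Suc m) sgnf = spread 2 ((spread 2 ^^ m) sgnf)" by simp
  then show ?case using spread_concave[OF odd_spread_pow[OF odd_sgnf] Suc.IH Suc.prems] by metis
qed

text \<open>By concavity and \<open>h 0 = 0\<close>, the slope h(r) / r does not increase with
  r.\<close>

lemma concave_seq_ge_chord: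
  fixes h :: "nat \<Rightarrow> real"
  assumes "\<And>r. r \<ge> 1 \<Longrightarrow> h (r + 1) + h (r - 1) \<le> 2 * h r" and "h 0 = 0" and "r \<le> n"
  shows "real r * h n \<le> real n * h r"
proof -
  have step: "real r * h (Suc r) \<le> real (Suc r) * h r" for r
  proof (induction r)
    case (Suc r)
    have "h (Suc (Suc r)) + h r \<le> 2 * h (Suc r)" using assms(1)[of "Suc r"] by simp
    then have "real (Suc r) * (h (Suc (Suc r)) + h r) \<le> real (Suc r) * (2 * h (Suc r))"
      by (intro mult_left_mono) auto
    then show ?case using Suc by (simp add: algebra_simps)
  qed (simp add: assms)
  have "r \<ge> 1 \<Longrightarrow> h n / real n \<le> h r / real r"
    using \<open>r \<le> n\<close>
  proof (induction n rule: dec_induct)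
    case (step n)
    then have "h (Suc n) / real (Suc n) \<le> h n / real n"
      using step(1) \<open>\<And>r. real r * h (Suc r) \<le> real (Suc r) * h r\<close>[of n] by (simp add: field_simps)
    then show ?case using step by simp
  qed simp
  then show ?thesis
  proof (cases "r = 0")
    case False
    then show ?thesis using \<open>r \<ge> 1 \<Longrightarrow> h n / real n \<le> h r / real r\<close> assms(3) by (simp add: field_simps)
  qed (simp add: assms)
qed

text \<open>Both sides vanish at 0 and equal q from r = q on. In between, the left side is the
  linear function r, while the right side is concave and so lies above its chord. This compares one
  chain of length q with q - 1 chains of length 2 and fixes the factor q / 2^(q-1).\<close>

lemma spread_le_spread_pow:
  assumes "q \<ge> 1"
  shows "spread q sgnf (int r) \<le> real q / 2 ^ (q - 1) * (spread 2 ^^ (q - 1)) sgnf (int r)"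
proof (cases "r < q")
  case True
  define h where "h r = (spread 2 ^^ (q - 1)) sgnf (int r)" for r
  have "real r * h q \<le> real q * h r"
  proof (rule concave_seq_ge_chord)
    show "h (r + 1) + h (r - 1) \<le> 2 * h r" if "r \<ge> 1" for r
      using spread_pow_concave[of "int r" "q - 1"] that by (simp add: h_def of_nat_diff add.commute)
    show "h 0 = 0"
      using odd_spread_pow[OF odd_sgnf, of "q - 1"] unfolding odd_fun_def h_def
      by (metis neg_equal_zero of_nat_0 neg_0_equal_iff_equal minus_zero)
  qed (use True in simp)
  moreover have "h q = 2 ^ (q - 1)"
    unfolding h_def using assms by (intro spread_pow_sgnf_large) simp
  ultimately show ?thesis using True by (simp add: spread_sgnf_eq h_def field_simps)
next
  case False
  then have "(spread 2 ^^ (q - 1)) sgnf (int r) = 2 ^ (q - 1)"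
    using assms by (intro spread_pow_sgnf_large) simp
  then show ?thesis using False by (simp add: spread_sgnf_eq)
qed

lemma sum_list_concat_map: "sum_list (concat xss) = sum_list (map sum_list xss)"
  by (induction xss) simp_all

text \<open>A further chain of length \<open>q\<close> in the product turns the summand
  \<open>f\<close> into \<open>spread q f\<close>; the empty product leaves the single length 1,
  hence the evaluation at 1. The head of the list acts first, which explains
  \<open>rev\<close>.\<close>

lemma sum_list_hook_lengths:
  assumes "odd_fun f"
  shows "sum_list (map (\<lambda>r. f (int r)) (hook_lengths qs)) = foldr (\<lambda>q f. spread q f) (rev qs) f 1"
  using assms
proof (induction qs arbitrary: f)
  case (Cons q qs)
  have "sum_list (map (\<lambda>r. f (int r)) (hook_lengths (q # qs)))
     = sum_list (map (\<lambda>r. spread q f (int r)) (hook_lengths qs))"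
    by (simp add: map_concat sum_list_concat_map o_def spread_eq_hooks[OF Cons.prems]
        interv_sum_list_conv_sum_set_nat lessThan_atLeast0)
  also have "\<dots> = foldr (\<lambda>q f. spread q f) (rev qs) (spread q f) 1"
    by (rule Cons.IH) (rule spread_odd[OF Cons.prems])
  finally show ?case by simp
qed simp

lemma hook_lengths_pos: "\<forall>q\<in>set qs. q \<ge> 1 \<Longrightarrow> r \<in> set (hook_lengths qs) \<Longrightarrow> r \<ge> 1"
  by (induction qs arbitrary: r) fastforce+

lemma foldr_spread_odd: "odd_fun f \<Longrightarrow> odd_fun (foldr (\<lambda>q f. spread q f) qs f)"
  by (induction qs) (auto simp: spread_odd)

lemma spread_cmult: "spread q (\<lambda>r. c * f r) r = c * spread q f r"
  by (simp add: spread_def sum_distrib_left)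

lemma spread_pow_commute: "spread q ((spread 2 ^^ m) f) = (spread 2 ^^ m) (spread q f)"
  by (induction m) (auto simp: fun_eq_iff, metis spread_commute ext)

lemma spread_pow_cmult: "(spread q ^^ m) (\<lambda>r. c * f r) r = c * (spread q ^^ m) f r"
  by (induction m arbitrary: r) (simp_all add: spread_cmult spread_def sum_distrib_left)

lemma spread_pow_mono:
  assumes "odd_fun f" "odd_fun g" "\<And>r. f (int r) \<le> g (int r)"
  shows "(spread 2 ^^ m) f (int r) \<le> (spread 2 ^^ m) g (int r)"
  by (induction m arbitrary: r) (auto simp: assms intro!: spread_mono odd_spread_pow)

text \<open>The chains are replaced one at a time. Since convolutions commute,
  \<open>spread q\<close> can be moved through the power of \<open>spread 2\<close> already obtained
  and onto \<open>sgnf\<close>, where the comparison for a single chain applies.\<close>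

lemma foldr_spread_le:
  assumes "\<forall>q\<in>set qs. q \<ge> 1"
  shows "foldr (\<lambda>q f. spread q f) qs sgnf (int r)
      \<le> (\<Prod>q\<leftarrow>qs. real q / 2 ^ (q - 1)) * (spread 2 ^^ (\<Sum>q\<leftarrow>qs. q - 1)) sgnf (int r)"
  using assms
proof (induction qs arbitrary: r)
  case (Cons q qs)
  let ?c = "\<Prod>q\<leftarrow>qs. real q / 2 ^ (q - 1)" and ?m = "\<Sum>q\<leftarrow>qs. q - 1"
  have odd: "odd_fun (\<lambda>r. c * f r)" if "odd_fun f" for c f using that by (simp add: odd_fun_def)
  have c: "0 \<le> ?c" by (intro prod_list_nonneg) auto
  have "foldr (\<lambda>q f. spread q f) (q # qs) sgnf (int r)
      \<le> spread q (\<lambda>r. ?c * (spread 2 ^^ ?m) sgnf r) (int r)"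
    unfolding foldr.simps o_apply
  proof (rule spread_mono)
    show "odd_fun (foldr (\<lambda>q f. spread q f) qs sgnf)" by (rule foldr_spread_odd[OF odd_sgnf])
    show "odd_fun (\<lambda>r. ?c * (spread 2 ^^ ?m) sgnf r)" by (rule odd[OF odd_spread_pow[OF odd_sgnf]])
    show "foldr (\<lambda>q f. spread q f) qs sgnf (int r) \<le> ?c * (spread 2 ^^ ?m) sgnf (int r)" for r
      by (rule Cons.IH) (use Cons.prems in simp)
  qed
  also have "\<dots> = ?c * (spread 2 ^^ ?m) (spread q sgnf) (int r)"
    by (simp add: spread_cmult spread_pow_commute)
  also have "\<dots> \<le> ?c * (spread 2 ^^ ?m) (\<lambda>r. real q / 2 ^ (q - 1) * (spread 2 ^^ (q - 1)) sgnf r) (int r)"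
  proof (rule mult_left_mono[OF spread_pow_mono c])
    show "odd_fun (\<lambda>r. real q / 2 ^ (q - 1) * (spread 2 ^^ (q - 1)) sgnf r)"
      by (rule odd[OF odd_spread_pow[OF odd_sgnf]])
    show "odd_fun (spread q sgnf)" by (rule spread_odd[OF odd_sgnf])
    show "spread q sgnf (int r) \<le> real q / 2 ^ (q - 1) * (spread 2 ^^ (q - 1)) sgnf (int r)" for r
      by (rule spread_le_spread_pow) (use Cons.prems in simp)
  qed
  also have "\<dots> = ?c * (real q / 2 ^ (q - 1)) * (spread 2 ^^ (?m + (q - 1))) sgnf (int r)"
    by (simp only: spread_pow_cmult funpow_add o_apply mult.assoc)
  finally show ?case by (simp add: ac_simps)
qed simp

lemma spread_pow_diff:
  "(spread 2 ^^ m) (\<lambda>r. f (r + 1) - f (r - 1)) r = (spread 2 ^^ m) f (r + 1) - (spread 2 ^^ m) f (r - 1)"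
  proof (induction m arbitrary: r)
  case (Suc m)
  show ?case using Suc.IH[of "r + 1"] Suc.IH[of "r - 1"] unfolding spread_pow_Suc by simp
qed simp

lemma spread_pow_binomial:
  "(spread 2 ^^ m) f r = (\<Sum>i\<le>m. real (m choose i) * f (r + int m - 2 * int i))"
proof (induction m arbitrary: r)
  case (Suc m)
  have "(spread 2 ^^ Suc m) f r = (\<Sum>i\<le>m. real (m choose i) * f (r + 1 + int m - 2 * int i))
      + (\<Sum>i\<le>m. real (m choose i) * f (r - 1 + int m - 2 * int i))"
    unfolding spread_pow_Suc Suc.IH ..
  also have "(\<Sum>i\<le>m. real (m choose i) * f (r + 1 + int m - 2 * int i))
      = f (r + int (Suc m)) + (\<Sum>i\<le>m. real (m choose Suc i) * f (r + int (Suc m) - 2 * int (Suc i)))"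
  proof -
    have "(\<Sum>i\<le>m. real (m choose i) * f (r + 1 + int m - 2 * int i))
       = (\<Sum>i\<le>Suc m. real (m choose i) * f (r + 1 + int m - 2 * int i))" by simp
    also have "\<dots> = f (r + int (Suc m)) + (\<Sum>i\<le>m. real (m choose Suc i) * f (r + 1 + int m - 2 * int (Suc i)))"
    proof -
      have "r + 1 + int m - 2 * int 0 = r + int (Suc m)" by simp
      then show ?thesis by (subst sum.atMost_Suc_shift) (simp only: binomial_n_0 of_nat_1 mult_1)
    qed
    finally show ?thesis by simp
  qed
  also have "(\<Sum>i\<le>m. real (m choose i) * f (r - 1 + int m - 2 * int i))
      = (\<Sum>i\<le>m. real (m choose i) * f (r + int (Suc m) - 2 * int (Suc i)))"
    by (simp add: algebra_simps)
  finally show ?case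
    by (subst sum.atMost_Suc_shift) (simp add: sum.distrib[symmetric] algebra_simps)
qed simp

text \<open>This counts the symmetric chains of the Boolean lattice with m atoms, one through each
  element of middle rank. By oddness, twice the value is a difference across 0, so that only the
  discrete derivative of the sign enters.\<close>

lemma spread_pow_sgnf_one: "(spread 2 ^^ m) sgnf 1 = real (m choose (m div 2))"
proof -
  have "(spread 2 ^^ m) sgnf (- 1) = - (spread 2 ^^ m) sgnf 1"
    using odd_spread_pow[OF odd_sgnf, of m] unfolding odd_fun_def by blast
  then have "2 * (spread 2 ^^ m) sgnf 1
     = (spread 2 ^^ m) (\<lambda>r. sgnf (r + 1) - sgnf (r - 1)) 0"
    using spread_pow_diff[of m sgnf 0] by simp
  also have "\<dots> = (\<Sum>i\<le>m. real (m choose i) *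
      (sgnf (int m - 2 * int i + 1) - sgnf (int m - 2 * int i - 1)))"
    by (simp add: spread_pow_binomial)
  \<comment> \<open>The derivative vanishes outside {-1, 0, 1}, so only indices with |m - 2i| \<le>
    1 remain: one of weight 2 if m is even, two of weight 1 if m is odd.\<close>
  also have "\<dots> = (\<Sum>i\<in>{m div 2, m - m div 2}. real (m choose i) *
      (sgnf (int m - 2 * int i + 1) - sgnf (int m - 2 * int i - 1)))"
  proof (rule sum.mono_neutral_right)
    show "\<forall>i\<in>{..m} - {m div 2, m - m div 2}. real (m choose i) *
      (sgnf (int m - 2 * int i + 1) - sgnf (int m - 2 * int i - 1)) = 0"
    proof
      fix i assume "i \<in> {..m} - {m div 2, m - m div 2}"
      then have "int m - 2 * int i \<ge> 2 \<or> int m - 2 * int i \<le> - 2" by auto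
      then show "real (m choose i) *
        (sgnf (int m - 2 * int i + 1) - sgnf (int m - 2 * int i - 1)) = 0"
        by (auto simp: sgn_if)
    qed
  qed auto
  also have "\<dots> = 2 * real (m choose (m div 2))"
  proof (cases "even m")
    case True
    then obtain k where "m = 2 * k" by (elim evenE)
    then show ?thesis by simp
  next
    case False
    then obtain k where k: "m = 2 * k + 1" by (elim oddE)
    have "(2 * k + 1) choose Suc k = (2 * k + 1) choose k"
      by (subst binomial_symmetric) auto
    then show ?thesis using k by (simp add: Suc_diff_le)
  qed
  finally show ?thesis by simp
qed

lemma prod_list_divide_pow:
  "(\<Prod>q\<leftarrow>qs. real q / 2 ^ (q - 1)) = real (prod_list qs) / 2 ^ (\<Sum>q\<leftarrow>qs. q - 1)"
  by (induction qs) (simp_all add: power_add)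

lemma length_hook_lengths:
  assumes "\<forall>q\<in>set qs. q \<ge> 1"
  shows "real (length (hook_lengths qs)) \<le> real (prod_list qs) / 2 ^ (\<Sum>q\<leftarrow>qs. q - 1)
     * real ((\<Sum>q\<leftarrow>qs. q - 1) choose ((\<Sum>q\<leftarrow>qs. q - 1) div 2))"
proof -
  have "sgnf (int r) = 1" if "r \<in> set (hook_lengths qs)" for r
    using hook_lengths_pos[OF assms that] by (simp add: sgn_1_pos)
  then have *: "map (\<lambda>r. sgnf (int r)) (hook_lengths qs) = map (\<lambda>_. 1) (hook_lengths qs)"
    by (intro map_cong) auto
  then have "real (length (hook_lengths qs)) = foldr (\<lambda>q f. spread q f) (rev qs) sgnf 1"
    using sum_list_hook_lengths[OF odd_sgnf, of qs] unfolding * by (simp add: sum_list_triv)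
  also have "\<dots> \<le> (\<Prod>q\<leftarrow>rev qs. real q / 2 ^ (q - 1)) * (spread 2 ^^ (\<Sum>q\<leftarrow>rev qs. q - 1)) sgnf (int 1)"
    using foldr_spread_le[of "rev qs" 1] assms by simp
  also have "(\<Prod>q\<leftarrow>rev qs. real q / 2 ^ (q - 1)) = (\<Prod>q\<leftarrow>qs. real q / 2 ^ (q - 1))"
    by (simp flip: rev_map)
  also have "(\<Sum>q\<leftarrow>rev qs. q - 1) = (\<Sum>q\<leftarrow>qs. q - 1)"
    by (simp flip: rev_map)
  finally show ?thesis unfolding prod_list_divide_pow by (simp add: spread_pow_sgnf_one)
qed

section \<open>The invariant K on prime factorisations\<close>

lemma K_sum_prime_times:
  assumes "prime q" "n > 0"
  shows "K_sum (q * n) = K_sum n + (q - 1)"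
proof -
  define A where "A = insert q (prime_factors n)"
  have A: "finite A" "q \<in> A" "\<forall>p\<in>A. prime p" using assms by (auto simp: A_def)
  have K: "K_sum m = (\<Sum>p\<in>A. multiplicity p m * (p - 1))" if "prime_factors m \<subseteq> A" "m > 0" for m
    unfolding K_sum_def
  proof (rule sum.mono_neutral_left)
    show "\<forall>p\<in>A - prime_factors m. multiplicity p m * (p - 1) = 0"
      using that A by (auto simp: prime_factors_multiplicity)
  qed (use A that in auto)
  have "q > 0" using assms prime_gt_0_nat by blast
  have "K_sum (q * n) = (\<Sum>p\<in>A. multiplicity p (q * n) * (p - 1))"
    by (rule K) (use assms \<open>q > 0\<close> in \<open>auto simp: A_def prime_factors_product prime_prime_factors\<close>)
  also have "\<dots> = (\<Sum>p\<in>A. (if p = q then q - 1 else 0) + multiplicity p n * (p - 1))"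
  proof (rule sum.cong)
    fix p assume "p \<in> A"
    then have "multiplicity p (q * n) = multiplicity p q + multiplicity p n"
      using A assms \<open>q > 0\<close> by (intro prime_elem_multiplicity_mult_distrib) auto
    moreover have "multiplicity p q = (if p = q then 1 else 0)"
      using assms A \<open>p \<in> A\<close> by (auto simp: prime_multiplicity_other)
    ultimately show "multiplicity p (q * n) * (p - 1) = (if p = q then q - 1 else 0) + multiplicity p n * (p - 1)"
      by (simp add: algebra_simps)
  qed simp
  also have "\<dots> = (q - 1) + (\<Sum>p\<in>A. multiplicity p n * (p - 1))"
    using A by (simp add: sum.distrib sum.delta)
  also have "(\<Sum>p\<in>A. multiplicity p n * (p - 1)) = K_sum n"
    by (rule K[symmetric]) (use assms in \<open>auto simp: A_def\<close>)
  finally show ?thesis by simp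
qed

lemma K_sum_prod_list:
  assumes "\<forall>q\<in>set qs. prime q"
  shows "K_sum (prod_list qs) = (\<Sum>q\<leftarrow>qs. q - 1)"
  using assms
proof (induction qs)
  case Nil
  then show ?case by (simp add: K_sum_def)
next
  case (Cons q qs)
  then have "0 \<notin> set qs" by (metis list.set_intros(2) not_prime_0)
  then have "prod_list qs > 0" by (auto intro!: Nat.gr0I simp: prod_list_zero_iff)
  then show ?case using Cons by (simp add: K_sum_prime_times)
qed

lemma length_hook_lengths_prime:
  assumes "\<forall>q\<in>set qs. prime q"
  shows "real (length (hook_lengths qs)) \<le> omega_tilde (prod_list qs)"
proof -
  have "\<forall>q\<in>set qs. q \<ge> 1" using assms prime_ge_1_nat by blast
  then show ?thesis
    using length_hook_lengths[of qs] by (simp add: omega_tilde_def K_sum_prod_list[OF assms])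
qed

section \<open>Estimates of middle binomial coefficients\<close>

lemma central_binomial_Suc:
  "real (Suc n) * real ((2 * Suc n) choose Suc n) = 2 * (2 * real n + 1) * real ((2 * n) choose n)"
proof -
  have 1: "real ((2 * Suc n) choose Suc n) = fact (2 * Suc n) / (fact (Suc n) * fact (Suc n))"
    by (subst binomial_fact) (simp_all add: mult_2 del: fact_Suc)
  have 2: "real ((2 * n) choose n) = fact (2 * n) / (fact n * fact n)"
    by (subst binomial_fact) (simp_all add: mult_2)
  have 3: "(fact (2 * Suc n) :: real) = (2 * (1 + real n)) * (2 * real n + 1) * fact (2 * n)"
    by (simp add: algebra_simps)
  have 4: "(fact (Suc n) :: real) = (1 + real n) * fact n" by (simp add: algebra_simps)
  have "N * ((2 * N) * c * F / ((N * f) * (N * f))) = 2 * c * (F / (f * f))"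
    if "N \<noteq> 0" "f \<noteq> 0" for N c F f :: real
    using that by (simp add: field_simps)
  moreover have "1 + real n \<noteq> 0" by linarith
  ultimately show ?thesis unfolding 1 2 3 4 of_nat_Suc using fact_nonzero by blast
qed

text \<open>The normalised square B(n)^2 n / 16^n increases with n and is therefore bounded by its
  limit, which Wallis' product identifies as 1 / \<pi>.\<close>

lemma central_binomial_le:
  assumes "n > 0"
  shows "real ((2 * n) choose n) \<le> 4 ^ n / sqrt (pi * real n)"
proof -
  define B where "B n = real ((2 * n) choose n)" for n
  define P where "P n = (\<Prod>k=1..n. (4 * real k ^ 2) / (4 * real k ^ 2 - 1))" for n
  have B_pos: "B n > 0" for n by (simp add: B_def)
  have B_Suc: "B (Suc n) = 2 * (2 * real n + 1) / (real n + 1) * B n" for n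
    using central_binomial_Suc[of n] unfolding B_def by (simp add: field_simps)
  \<comment> \<open>This ties the central coefficients to the partial Wallis products
    \<open>P n\<close>, so that the limit of \<open>c\<close> can be read off from that of
    \<open>P\<close>.\<close>
  have BP: "B n ^ 2 * (2 * real n + 1) * P n = 16 ^ n" for n
  proof (induction n)
    case (Suc n)
    have e: "4 * real (Suc n) ^ 2 - 1 = (2 * real n + 1) * (2 * real n + 3)"
      by (simp add: power2_eq_square algebra_simps)
    have P: "P (Suc n) = P n * ((4 * (real n + 1) ^ 2) / ((2 * real n + 1) * (2 * real n + 3)))"
      using e unfolding P_def by (simp add: add.commute)
    have nz: "2 * real n + 1 \<noteq> 0" "2 * real n + 3 \<noteq> 0" "real n + 1 \<noteq> 0" by linarith+
    have "B (Suc n) ^ 2 * (2 * real (Suc n) + 1) * P (Suc n)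
      = (4 * (2 * real n + 1) ^ 2 / (real n + 1) ^ 2 * B n ^ 2) * (2 * real n + 3)
         * (P n * ((4 * (real n + 1) ^ 2) / ((2 * real n + 1) * (2 * real n + 3))))"
    proof -
      have "(2 * (2 * real n + 1)) ^ 2 = 4 * (2 * real n + 1) ^ 2" by (simp only: power_mult_distrib) simp
      moreover have "2 * real (Suc n) + 1 = 2 * real n + 3" by simp
      ultimately show ?thesis unfolding B_Suc P by (simp only: power_mult_distrib power_divide)
    qed
    also have "\<dots> = 16 * (B n ^ 2 * (2 * real n + 1) * P n)"
      using nz by (simp add: divide_simps) (simp add: power2_eq_square algebra_simps)
    finally show ?case using Suc.IH by simp
  qed (simp add: B_def P_def)
  define c where "c n = B n ^ 2 * real n / 16 ^ n" for n
  have "c n \<le> c (Suc n)" for n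
  proof -
    \<comment> \<open>After expansion the two sides differ by n + 1.\<close>
    have "real n * (4 * (real n + 1) ^ 2) \<le> (2 * real n + 1) ^ 2 * (real n + 1)"
      by (simp add: power2_eq_square algebra_simps)
    then have "real n \<le> (2 * real n + 1) ^ 2 * (real n + 1) / (4 * (real n + 1) ^ 2)"
      by (subst pos_le_divide_eq) auto
    then have "B n ^ 2 / 16 ^ n * real n \<le> B n ^ 2 / 16 ^ n * ((2 * real n + 1) ^ 2 * (real n + 1) / (4 * (real n + 1) ^ 2))"
      by (rule mult_left_mono) simp
    also have "\<dots> = c (Suc n)"
      unfolding c_def B_Suc by (simp add: power_mult_distrib power_divide add.commute divide_simps) (simp add: power2_eq_square algebra_simps)
    finally show ?thesis by (simp add: c_def)
  qed
  then have inc: "incseq c" by (rule incseq_SucI)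
  have c_eq: "c n = (real n / (2 * real n + 1)) * (1 / P n)" for n
  proof -
    have "c n = (B n ^ 2 * real n) / (B n ^ 2 * ((2 * real n + 1) * P n))"
      unfolding c_def BP[of n, symmetric] by (simp only: mult.assoc)
    also have "\<dots> = real n / ((2 * real n + 1) * P n)"
      using B_pos[of n] by (intro mult_divide_mult_cancel_left) simp
    finally show ?thesis by simp
  qed
  have "P \<longlonglongrightarrow> pi / 2" using wallis unfolding P_def by simp
  then have "(\<lambda>n. 1 / P n) \<longlonglongrightarrow> 1 / (pi / 2)" by (intro tendsto_intros) auto
  moreover have "(\<lambda>n. real n / (2 * real n + 1)) \<longlonglongrightarrow> 1 / 2" by real_asymp
  ultimately have "c \<longlonglongrightarrow> 1 / 2 * (1 / (pi / 2))" unfolding c_eq by (intro tendsto_mult)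
  then have "c n \<le> 1 / 2 * (1 / (pi / 2))" by (rule incseq_le[OF inc])
  then have "B n ^ 2 * (pi * real n) \<le> 16 ^ n" by (simp add: c_def field_simps)
  then have "sqrt (B n ^ 2 * (pi * real n)) \<le> sqrt (16 ^ n)" by (rule real_sqrt_le_mono)
  also have "sqrt (16 ^ n :: real) = 4 ^ n"
    by (rule real_sqrt_unique) (simp_all add: power_mult[symmetric] power2_eq_square power_mult_distrib[symmetric])
  finally have "B n * sqrt (pi * real n) \<le> 4 ^ n" using B_pos[of n] by (simp add: real_sqrt_mult)
  then show ?thesis using assms by (simp add: B_def field_simps)
qed

text \<open>Even m is the central case. For m = 2n + 1 the middle coefficient is half of the central
  one for n + 1, and m \<le> 2(n + 1) preserves the constant.\<close>

lemma binomial_middle_le: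
  assumes "m > 0"
  shows "real (m choose (m div 2)) \<le> 2 ^ m * sqrt (2 / (pi * real m))"
proof (cases "even m")
  case True
  then obtain n where n: "m = 2 * n" by (elim evenE)
  have "sqrt (2 / (pi * real m)) = 1 / sqrt (pi * real n)" using n by (simp add: real_sqrt_divide)
  then show ?thesis using central_binomial_le[of n] assms n by (simp add: power_mult)
next
  case False
  then obtain n where n: "m = 2 * n + 1" by (elim oddE)
  have "(2 * Suc n) choose Suc n = (m choose n) + (m choose Suc n)" using n by simp
  moreover have "m choose Suc n = m choose n" using n by (subst binomial_symmetric) auto
  ultimately have "2 * real (m choose n) = real ((2 * Suc n) choose Suc n)" by simp
  also have "\<dots> \<le> 4 ^ Suc n / sqrt (pi * real (Suc n))" by (rule central_binomial_le) simp
  also have "\<dots> = 2 * (2 ^ m * (1 / sqrt (pi * real (Suc n))))" using n by (simp add: power_mult)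
  also have "1 / sqrt (pi * real (Suc n)) = sqrt (1 / (pi * real (Suc n)))" by (simp add: real_sqrt_divide)
  also have "\<dots> \<le> sqrt (2 / (pi * real m))"
  proof (rule real_sqrt_le_mono)
    have "pi * real m \<le> 2 * (pi * real (Suc n))" using n by simp
    then have "2 / (2 * (pi * real (Suc n))) \<le> 2 / (pi * real m)"
      using assms by (intro divide_left_mono) auto
    then show "1 / (pi * real (Suc n)) \<le> 2 / (pi * real m)" by simp
  qed
  finally show ?thesis using n by simp
qed

lemma omega_tilde_le:
  assumes "x > 0" "K_sum x > 0"
  shows "omega_tilde x \<le> sqrt (2 / pi) * real x / sqrt (real (K_sum x))"
proof -
  have "omega_tilde x \<le> real x / 2 ^ K_sum x * (2 ^ K_sum x * sqrt (2 / (pi * real (K_sum x))))"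
    unfolding omega_tilde_def by (intro mult_left_mono binomial_middle_le assms) simp
  then show ?thesis by (simp add: real_sqrt_divide real_sqrt_mult field_simps)
qed

section \<open>Right actions and subnormal series\<close>

lemma (in group) card_subgroup_dvd:
  assumes "subgroup A G" "subgroup B G" "A \<subseteq> B"
  shows "card A dvd card B"
proof -
  have "card (rcosets\<^bsub>G\<lparr>carrier := B\<rparr>\<^esub> A) * card A = card B"
    using group.lagrange[OF subgroup.subgroup_is_group[OF assms(2) is_group] subgroup_incl[OF assms]]
    by (simp add: order_def)
  then show ?thesis by (metis dvd_triv_right)
qed

locale right_action = group G for G :: "('g, 'b) monoid_scheme" (structure) +
  fixes X :: "'x set" and act :: "'x \<Rightarrow> 'g \<Rightarrow> 'x" (infixl "\<star>" 65)
  assumes act_in: "\<lbrakk>a \<in> X; g \<in> carrier G\<rbrakk> \<Longrightarrow> a \<star> g \<in> X"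
    and act_1: "a \<in> X \<Longrightarrow> a \<star> \<one> = a"
    and act_m: "\<lbrakk>a \<in> X; g \<in> carrier G; h \<in> carrier G\<rbrakk> \<Longrightarrow> a \<star> (g \<otimes> h) = a \<star> g \<star> h"
begin

definition rorbit :: "'g set \<Rightarrow> 'x \<Rightarrow> 'x set" where
  "rorbit N a = (\<lambda>g. a \<star> g) ` N"

lemma act_inv: "\<lbrakk>a \<in> X; g \<in> carrier G\<rbrakk> \<Longrightarrow> a \<star> g \<star> inv g = a"
  by (simp add: act_m[symmetric] act_1)

lemma act_inv': "\<lbrakk>a \<in> X; g \<in> carrier G\<rbrakk> \<Longrightarrow> a \<star> inv g \<star> g = a"
  by (simp add: act_m[symmetric] act_1)

lemma act_inj: "\<lbrakk>a \<in> X; b \<in> X; g \<in> carrier G; a \<star> g = b \<star> g\<rbrakk> \<Longrightarrow> a = b"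
  by (metis act_inv)

lemma rorbit_subset: "\<lbrakk>N \<subseteq> carrier G; a \<in> X\<rbrakk> \<Longrightarrow> rorbit N a \<subseteq> X"
  by (auto simp: rorbit_def act_in)

lemma rorbit_self: "\<lbrakk>subgroup N G; a \<in> X\<rbrakk> \<Longrightarrow> a \<in> rorbit N a"
  unfolding rorbit_def by (metis act_1 imageI subgroup.one_closed)

lemma rorbit_act:
  assumes N: "subgroup N G" and a: "a \<in> X" and b: "b \<in> rorbit N a" and g: "g \<in> N"
  shows "b \<star> g \<in> rorbit N a"
proof -
  obtain h where h: "h \<in> N" "b = a \<star> h" using b by (auto simp: rorbit_def)
  then have "b \<star> g = a \<star> (h \<otimes> g)" using a g subgroup.mem_carrier[OF N] by (simp add: act_m)
  moreover have "h \<otimes> g \<in> N" using h g subgroup.m_closed[OF N] by blast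
  ultimately show ?thesis by (auto simp: rorbit_def)
qed

lemma rorbit_eq:
  assumes N: "subgroup N G" and a: "a \<in> X" and b: "b \<in> rorbit N a"
  shows "rorbit N b = rorbit N a"
proof
  have bX: "b \<in> X" using rorbit_subset[OF subgroup.subset[OF N] a] b by blast
  show "rorbit N b \<subseteq> rorbit N a" using rorbit_act[OF N a b] by (auto simp: rorbit_def)
  obtain h where h: "h \<in> N" "b = a \<star> h" using b by (auto simp: rorbit_def)
  then have "a = b \<star> inv h" using a subgroup.mem_carrier[OF N] by (simp add: act_inv)
  then have "a \<in> rorbit N b" using h subgroup.m_inv_closed[OF N] by (auto simp: rorbit_def)
  then show "rorbit N a \<subseteq> rorbit N b" using rorbit_act[OF N bX] by (auto simp: rorbit_def)
qed

definition rstab :: "'g set \<Rightarrow> 'x \<Rightarrow> 'g set" where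
  "rstab N a = {g \<in> N. a \<star> g = a}"

lemma rstab_subgroup:
  assumes N: "subgroup N G" and a: "a \<in> X"
  shows "subgroup (rstab N a) G"
proof (rule subgroupI)
  show "rstab N a \<subseteq> carrier G" using subgroup.subset[OF N] by (auto simp: rstab_def)
  show "rstab N a \<noteq> {}" using subgroup.one_closed[OF N] act_1[OF a] by (auto simp: rstab_def)
  show "inv g \<in> rstab N a" if "g \<in> rstab N a" for g
    using that act_inv[OF a, of g] subgroup.m_inv_closed[OF N] subgroup.mem_carrier[OF N]
    by (auto simp: rstab_def)
  show "g \<otimes> h \<in> rstab N a" if "g \<in> rstab N a" "h \<in> rstab N a" for g h
    using that subgroup.m_closed[OF N] subgroup.mem_carrier[OF N] a
    by (auto simp: rstab_def act_m)
qed

lemma card_rorbit_rstab: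
  assumes N: "subgroup N G" and fin: "finite N" and a: "a \<in> X"
  shows "card (rorbit N a) * card (rstab N a) = card N"
proof -
  note NG = subgroup.mem_carrier[OF N]
  have "card {g \<in> N. a \<star> g = b} = card (rstab N a)" if b: "b \<in> rorbit N a" for b
  proof -
    obtain h where h: "h \<in> N" "b = a \<star> h" using b by (auto simp: rorbit_def)
    have "bij_betw (\<lambda>g. g \<otimes> h) (rstab N a) {g \<in> N. a \<star> g = b}"
    proof (rule bij_betw_byWitness[where f' = "\<lambda>g. g \<otimes> inv h"])
      show "\<forall>g\<in>rstab N a. g \<otimes> h \<otimes> inv h = g"
        using h NG by (auto simp: rstab_def m_assoc)
      show "\<forall>g\<in>{g \<in> N. a \<star> g = b}. g \<otimes> inv h \<otimes> h = g"
        using h NG by (auto simp: m_assoc)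
      show "(\<lambda>g. g \<otimes> h) ` rstab N a \<subseteq> {g \<in> N. a \<star> g = b}"
        using h NG a subgroup.m_closed[OF N] by (auto simp: rstab_def act_m)
      show "(\<lambda>g. g \<otimes> inv h) ` {g \<in> N. a \<star> g = b} \<subseteq> rstab N a"
        using h NG a subgroup.m_closed[OF N] subgroup.m_inv_closed[OF N]
        by (auto simp: rstab_def act_m act_inv)
    qed
    then show ?thesis by (simp add: bij_betw_same_card)
  qed
  moreover have "card N = (\<Sum>b\<in>rorbit N a. card {g \<in> N. a \<star> g = b})"
    using sum.image_gen[OF fin, of "\<lambda>_. 1::nat" "\<lambda>g. a \<star> g"] by (simp add: rorbit_def)
  ultimately show ?thesis by simp
qed

text \<open>\<open>P\<close> is a Hall subgroup of \<open>N\<close>, and \<open>s'\<close> is the corresponding part of the degree.\<close>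

lemma card_rorbit_hall_ge:
  assumes N: "subgroup N G" and fin: "finite N" and P: "subgroup P G" "P \<subseteq> N" and a: "a \<in> X"
    and card: "card N = card P * m" "card (rorbit N a) = s' * c"
    and coprime: "coprime (card P) m" "coprime s' m"
  shows "s' \<le> card (rorbit P a)"
proof -
  have finP: "finite P" using P fin finite_subset by blast
  have "card (rstab P a) dvd card (rstab N a)"
    by (rule card_subgroup_dvd[OF rstab_subgroup[OF P(1) a] rstab_subgroup[OF N a]])
      (use P in \<open>auto simp: rstab_def\<close>)
  then obtain t where t: "card (rstab N a) = card (rstab P a) * t" by (elim dvdE)
  have o: "card P = card (rorbit P a) * card (rstab P a)"
    using card_rorbit_rstab[OF P(1) finP a] by simp
  \<comment> \<open>Orbit-stabiliser for \<open>N\<close> with both factorisations inserted. As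
    \<open>m\<close> is prime to \<open>s'\<close> and to the order of \<open>P\<close>, the
    divisibility can be moved into \<open>P\<close>, where the stabiliser in \<open>P\<close>
    cancels.\<close>
  have "s' * c * (card (rstab P a) * t) = card P * m"
    using card_rorbit_rstab[OF N fin a] card t by simp
  then have "s' * card (rstab P a) dvd card P * m"
    by (metis dvd_triv_left mult.assoc mult.left_commute)
  moreover have "coprime (s' * card (rstab P a)) m"
    using coprime o by (metis coprime_mult_left_iff)
  ultimately have "s' * card (rstab P a) dvd card P" by (simp add: coprime_dvd_mult_left_iff)
  then have "s' * card (rstab P a) dvd card (rorbit P a) * card (rstab P a)" using o by simp
  moreover have pos: "card P > 0"
    using finP subgroup.one_closed[OF P(1)] by (auto simp: card_gt_0_iff)
  ultimately have "s' dvd card (rorbit P a)" using o by auto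
  moreover have "card (rorbit P a) > 0" using o pos by (auto intro: Nat.gr0I)
  ultimately show ?thesis by (simp add: dvd_imp_le)
qed

text \<open>The orbits of \<open>P\<close> inside the orbit of \<open>N\<close> are disjoint, and
  each takes up at least \<open>s'\<close> of its s' c points.\<close>

lemma card_rorbits_hall_le:
  assumes N: "subgroup N G" and fin: "finite N" and P: "subgroup P G" "P \<subseteq> N" and a: "a \<in> X"
    and card: "card N = card P * m" "card (rorbit N a) = s' * c"
    and coprime: "coprime (card P) m" "coprime s' m" and pos: "s' > 0"
  shows "card (rorbit P ` rorbit N a) \<le> c"
proof -
  have NX: "rorbit N a \<subseteq> X" by (rule rorbit_subset[OF subgroup.subset[OF N] a])
  have "rorbit N a = \<Union> (rorbit P ` rorbit N a)"
  proof
    show "rorbit N a \<subseteq> \<Union> (rorbit P ` rorbit N a)" using rorbit_self[OF P(1)] NX by blast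
    show "\<Union> (rorbit P ` rorbit N a) \<subseteq> rorbit N a"
      using rorbit_act[OF N a] P(2) by (force simp: rorbit_def[of P])
  qed
  moreover have "card (\<Union> (rorbit P ` rorbit N a)) = sum card (rorbit P ` rorbit N a)"
  proof (rule card_Union_disjoint)
    show "pairwise disjnt (rorbit P ` rorbit N a)"
    proof (rule pairwise_imageI)
      fix x y assume xy: "x \<in> rorbit N a" "y \<in> rorbit N a" "rorbit P x \<noteq> rorbit P y"
      then have "x \<in> X" "y \<in> X" using NX by auto
      then show "disjnt (rorbit P x) (rorbit P y)"
        using xy(3) rorbit_eq[OF P(1), of x] rorbit_eq[OF P(1), of y] unfolding disjnt_iff by blast
    qed
    show "finite A" if "A \<in> rorbit P ` rorbit N a" for A
      using that finite_subset[OF P(2) fin] by (auto simp: rorbit_def)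
  qed
  moreover have "s' * card (rorbit P ` rorbit N a) \<le> sum card (rorbit P ` rorbit N a)"
  proof -
    have "s' \<le> card A" if A: "A \<in> rorbit P ` rorbit N a" for A
    proof -
      obtain b where b: "b \<in> rorbit N a" "A = rorbit P b" using A by blast
      then have "rorbit N b = rorbit N a" using rorbit_eq[OF N a] by blast
      then show ?thesis
        using card_rorbit_hall_ge[OF N fin P _ card(1) _ coprime, of b c] b NX card(2) by auto
    qed
    then have "(\<Sum>A\<in>rorbit P ` rorbit N a. s') \<le> sum card (rorbit P ` rorbit N a)"
      by (intro sum_mono) auto
    then show ?thesis by (simp add: mult.commute)
  qed
  ultimately have "s' * card (rorbit P ` rorbit N a) \<le> s' * c" using card(2) by simp
  then show ?thesis using pos by simp
qed

end

text \<open>A subnormal series that reaches down into \<open>K\<close>, written without quotients: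
  the powers of \<open>x\<close> with exponent below \<open>q\<close> meet all cosets of
  \<open>N'\<close>, so each factor has order 1 or \<open>q\<close>. In the application
  \<open>K\<close> fixes all points, so the orbits of the bottom term are single points.\<close>

inductive prime_series :: "('g, 'b) monoid_scheme \<Rightarrow> 'g set \<Rightarrow> 'g set \<Rightarrow> bool" for G K where
  base: "\<lbrakk>subgroup N G; N \<subseteq> K\<rbrakk> \<Longrightarrow> prime_series G K N"
| step: "\<lbrakk>prime_series G K N'; subgroup N' G; subgroup N G; N' \<subseteq> N;
     \<And>g h. \<lbrakk>g \<in> N; h \<in> N'\<rbrakk> \<Longrightarrow> g \<otimes>\<^bsub>G\<^esub> h \<otimes>\<^bsub>G\<^esub> inv\<^bsub>G\<^esub> g \<in> N'; prime q; x \<in> N;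
     x [^]\<^bsub>G\<^esub> q \<in> N'; \<And>g. g \<in> N \<Longrightarrow> \<exists>h\<in>N'. \<exists>j<q. g = h \<otimes>\<^bsub>G\<^esub> x [^]\<^bsub>G\<^esub> (j::nat)\<rbrakk>
   \<Longrightarrow> prime_series G K N"

lemma prime_series_subgroup: "prime_series G K N \<Longrightarrow> subgroup N G"
  by (induction rule: prime_series.induct)

context group begin

text \<open>The quotient of \<open>N\<close> by \<open>N'\<close> has no proper nontrivial subgroup
  and so is cyclic of prime order. In terms of elements: any \<open>y\<close> in \<open>N\<close>
  outside \<open>N'\<close> generates \<open>N\<close> together with \<open>N'\<close>, since by
  normality the products of elements of \<open>N'\<close> with powers of \<open>y\<close> form a
  subgroup.\<close>

lemma maximal_normal_step:
  assumes fin: "finite (carrier G)" and N: "subgroup N G" and N': "subgroup N' G" "N' \<subset> N"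
    and normal: "\<And>g h. \<lbrakk>g \<in> N; h \<in> N'\<rbrakk> \<Longrightarrow> g \<otimes> h \<otimes> inv g \<in> N'"
    and max: "\<And>L. \<lbrakk>subgroup L G; N' \<subset> L; L \<subseteq> N\<rbrakk> \<Longrightarrow> L = N"
    and series: "prime_series G K N'"
  shows "prime_series G K N"
proof -
  note NG = subgroup.mem_carrier[OF N] and N'G = subgroup.mem_carrier[OF N'(1)]
  obtain x where x: "x \<in> N" "x \<notin> N'" using N' by blast
  have xG: "x \<in> carrier G" using x NG by blast
  have powN: "y [^] (i::int) \<in> N" if "y \<in> N" for y i
    using subgroup_int_pow_closed[OF N that] .
  have gen: "\<exists>h\<in>N'. \<exists>i::int. g = h \<otimes> y [^] i" if y: "y \<in> N" "y \<notin> N'" and g: "g \<in> N" for y g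
  proof -
    have yG: "y \<in> carrier G" using y NG by blast
    define L where "L = {h \<otimes> y [^] (i::int) | h i. h \<in> N'}"
    have conj: "y [^] (i::int) \<otimes> h \<otimes> y [^] (- i) \<in> N'" if "h \<in> N'" for h i
      using normal[OF powN[OF y(1)] that, of i] yG by (simp add: int_pow_neg)
    have "subgroup L G"
    proof (rule subgroupI)
      show "L \<subseteq> carrier G" using N'G yG by (auto simp: L_def)
      show "L \<noteq> {}" using subgroup.one_closed[OF N'(1)] by (auto simp: L_def)
      show "inv a \<in> L" if aL: "a \<in> L" for a
      proof -
        obtain h i where a: "a = h \<otimes> y [^] (i::int)" "h \<in> N'" using aL by (auto simp: L_def)
        have "inv a = y [^] (- i) \<otimes> inv h"
          using a N'G yG by (simp add: inv_mult_group int_pow_neg)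
        also have "\<dots> = (y [^] (- i) \<otimes> inv h \<otimes> y [^] (- (- i))) \<otimes> y [^] (- i)"
          using a N'G yG by (simp add: m_assoc int_pow_mult[symmetric])
        finally show ?thesis using conj[of "inv h" "- i"] a subgroup.m_inv_closed[OF N'(1)]
          unfolding L_def by blast
      qed
      show "a \<otimes> b \<in> L" if ab: "a \<in> L" "b \<in> L" for a b
      proof -
        obtain h i where a: "a = h \<otimes> y [^] (i::int)" "h \<in> N'" using ab by (auto simp: L_def)
        obtain k j where b: "b = k \<otimes> y [^] (j::int)" "k \<in> N'" using ab by (auto simp: L_def)
        have "a \<otimes> b = (h \<otimes> (y [^] i \<otimes> k \<otimes> y [^] (- i))) \<otimes> y [^] (i + j)"
          using a b N'G yG by (simp add: m_assoc int_pow_mult int_pow_neg inv_solve_left)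
        then show ?thesis using conj[OF b(2), of i] a subgroup.m_closed[OF N'(1)]
          unfolding L_def by blast
      qed
    qed
    moreover have "N' \<subset> L"
    proof
      show "N' \<subseteq> L"
      proof
        fix h assume "h \<in> N'"
        then have "h = h \<otimes> y [^] (0::int)" using N'G by simp
        then show "h \<in> L" using \<open>h \<in> N'\<close> unfolding L_def by blast
      qed
      have "y = \<one> \<otimes> y [^] (1::int)" using yG by (simp add: int_pow_1)
      then have "y \<in> L" using subgroup.one_closed[OF N'(1)] unfolding L_def by blast
      then show "N' \<noteq> L" using y by blast
    qed
    moreover have "L \<subseteq> N"
      using powN[OF y(1)] N'(2) subgroup.m_closed[OF N] by (auto simp: L_def)
    ultimately have "L = N" by (rule max)
    then show ?thesis using g by (auto simp: L_def)
  qed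
  \<comment> \<open>The exponents that bring \<open>x\<close> into \<open>N'\<close> form an ideal
    of the integers; \<open>q\<close> will be its positive generator.\<close>
  define I where "I = {i::int. x [^] i \<in> N'}"
  have I_minus: "i - j \<in> I" if "i \<in> I" "j \<in> I" for i j
    using that xG subgroup.m_closed[OF N'(1)] subgroup.m_inv_closed[OF N'(1)]
    by (simp add: I_def int_pow_diff)
  have I_mult: "i * k \<in> I" if "i \<in> I" for i k
    using that xG subgroup_int_pow_closed[OF N'(1), of "x [^] i" k] by (simp add: I_def int_pow_pow)
  define q where "q = (LEAST q::nat. q > 0 \<and> int q \<in> I)"
  have ex: "\<exists>q::nat. q > 0 \<and> int q \<in> I"
  proof (intro exI conjI)
    show "order G > 0" using fin by (simp add: order_gt_0_iff_finite)
    show "int (order G) \<in> I"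
      using pow_order_eq_1[OF xG] subgroup.one_closed[OF N'(1)] by (simp add: I_def int_pow_int)
  qed
  have q: "q > 0" "int q \<in> I" using LeastI_ex[OF ex] unfolding q_def by blast+
  have q_least: "q \<le> r" if "r > 0" "int r \<in> I" for r
    unfolding q_def using that by (intro Least_le) blast
  have q_dvd: "int q dvd i" if "i \<in> I" for i
  proof -
    have "i mod int q = i - int q * (i div int q)" by (simp add: minus_mult_div_eq_mod)
    then have "i mod int q \<in> I" using I_minus[OF that I_mult[OF q(2)]] by metis
    moreover have "0 \<le> i mod int q" "i mod int q < int q" using q(1) by simp_all
    ultimately have "nat (i mod int q) = 0"
      using q_least[of "nat (i mod int q)"] by (cases "nat (i mod int q) > 0") auto
    then have "i mod int q = 0" using \<open>0 \<le> i mod int q\<close> by simp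
    then show ?thesis by (rule mod_0_imp_dvd)
  qed
  have "1 \<notin> I" using x xG by (simp add: I_def int_pow_1)
  then have "q \<noteq> 1" using q by auto
  \<comment> \<open>For a proper factor u > 1 of q, the power x^u is outside \<open>N'\<close> and
    generates as well. Writing \<open>x\<close> through it puts some 1 - u i into the ideal, so that
    u divides 1.\<close>
  have "prime q"
  proof (rule ccontr)
    assume "\<not> prime q"
    then obtain u v where uv: "q = u * v" "1 < u" "u < q"
      using \<open>q \<noteq> 1\<close> q(1) by (metis One_nat_def dvdE gr_implies_not0 less_one linorder_neqE_nat mult_0 mult_is_0 n_less_m_mult_n nat_dvd_not_less nat_neq_iff not_prime_eq_prod_nat prime_nat_iff)
    have "int u \<notin> I" using q_least[of u] uv by auto
    then have "x [^] int u \<notin> N'" by (simp add: I_def)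
    from gen[OF powN[OF x(1)] this x(1)] obtain h i where h: "h \<in> N'" "x = h \<otimes> (x [^] int u) [^] (i::int)" by blast
    then have "x \<otimes> inv ((x [^] int u) [^] i) = h"
      using xG N'G by (metis inv_solve_right int_pow_closed)
    moreover have "x \<otimes> inv ((x [^] int u) [^] i) = x [^] (1 - int u * i)"
      using xG by (simp add: int_pow_pow int_pow_diff int_pow_1)
    ultimately have "1 - int u * i \<in> I" using h by (simp add: I_def)
    then have "int q dvd 1 - int u * i" by (rule q_dvd)
    then have "int u dvd 1 - int u * i" using uv(1) by (metis dvd_mult_left of_nat_mult)
    then have "int u dvd 1" by (metis dvd_diff_commute dvd_diff_right_iff dvd_triv_left diff_zero dvd_0_right zdvd_zdiffD)
    then show False using uv(2) by simp
  qed
  moreover have "x [^] q \<in> N'" using q(2) xG by (simp add: I_def int_pow_int)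
  moreover have "\<exists>h\<in>N'. \<exists>j<q. g = h \<otimes> x [^] (j::nat)" if gN: "g \<in> N" for g
  proof -
    obtain h i where h: "h \<in> N'" "g = h \<otimes> x [^] (i::int)" using gen[OF x gN] by blast
    have "x [^] i = x [^] (int q * (i div int q)) \<otimes> x [^] (i mod int q)"
      using xG by (simp add: int_pow_mult[symmetric])
    moreover have "x [^] (i mod int q) = x [^] nat (i mod int q)"
      using xG q(1) by (simp flip: int_pow_int)
    ultimately have "g = (h \<otimes> x [^] (int q * (i div int q))) \<otimes> x [^] nat (i mod int q)"
      using h xG N'G by (simp add: m_assoc)
    moreover have "h \<otimes> x [^] (int q * (i div int q)) \<in> N'"
      using h I_mult[OF q(2)] subgroup.m_closed[OF N'(1)] by (simp add: I_def)
    moreover have "nat (i mod int q) < q" using q(1) by (simp add: nat_less_iff)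
    ultimately show ?thesis by blast
  qed
  ultimately show ?thesis
    using prime_series.step[OF series N'(1) N psubset_imp_subset[OF N'(2)] normal _ x(1)] by blast
qed

text \<open>A maximal proper subgroup above the derived subgroup contains all commutators and is
  therefore normal, which allows induction on the order. If \<open>N\<close> were its own derived
  subgroup, its derived series would be constant and \<open>N\<close> would already lie in
  \<open>K\<close>.\<close>

lemma prime_series_derived:
  assumes fin: "finite (carrier G)" and "subgroup N G" and "(derived G ^^ n) N \<subseteq> K"
  shows "prime_series G K N"
  using assms(2,3)
proof (induction "card N" arbitrary: N rule: less_induct)
  case less
  note N = less.prems(1)
  show ?case
  proof (cases "N \<subseteq> K")
    case True
    then show ?thesis using N by (rule prime_series.base[rotated])
  next
    case False
    note NG = subgroup.subset[OF N]
    have D: "subgroup (derived G N) G" by (rule derived_is_subgroup[OF NG])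
    have DN: "derived G N \<subseteq> N" by (rule derived_incl[OF subset_refl N])
    have "derived G N \<noteq> N"
    proof
      assume "derived G N = N"
      then have "(derived G ^^ n) N = N" by (induction n) simp_all
      then show False using less.prems(2) False by simp
    qed
    define S where "S = {L. subgroup L G \<and> derived G N \<subseteq> L \<and> L \<subset> N}"
    have "finite S" by (rule finite_subset[of _ "Pow (carrier G)"]) (use fin NG in \<open>auto simp: S_def\<close>)
    moreover have "derived G N \<in> S" using D DN \<open>derived G N \<noteq> N\<close> by (auto simp: S_def)
    ultimately obtain N' where N': "N' \<in> S" "\<And>L. L \<in> S \<Longrightarrow> N' \<subseteq> L \<Longrightarrow> N' = L"
      using finite_has_maximal[of S] by blast
    then have N's: "subgroup N' G" "N' \<subset> N" "derived G N \<subseteq> N'" by (auto simp: S_def)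
    have normal: "g \<otimes> h \<otimes> inv g \<in> N'" if "g \<in> N" "h \<in> N'" for g h
    proof -
      have gG: "g \<in> carrier G" and hN: "h \<in> N" and hG: "h \<in> carrier G"
        using that NG N's by auto
      have "g \<otimes> h \<otimes> inv g \<otimes> inv h \<in> derived G N"
        unfolding derived_def using that hN by (intro generate.incl) blast
      then have "(g \<otimes> h \<otimes> inv g \<otimes> inv h) \<otimes> h \<in> N'"
        using N's that subgroup.m_closed[OF N's(1)] by blast
      then show ?thesis using gG hG by (simp add: m_assoc)
    qed
    have max: "L = N" if "subgroup L G" "N' \<subset> L" "L \<subseteq> N" for L
      using that N'(2)[of L] N's by (auto simp: S_def)
    have "finite N" using fin NG finite_subset by blast
    then have "card N' < card N" using N's by (simp add: psubset_card_mono)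
    moreover have "(derived G ^^ n) N' \<subseteq> K"
      using mono_exp_of_derived[OF psubset_imp_subset[OF N's(2)], of n] less.prems(2) by blast
    ultimately have "prime_series G K N'" using less.hyps N's by blast
    then show ?thesis
      using normal max by (intro maximal_normal_step[OF fin N N's(1,2)])
  qed
qed

lemma right_action_rcosets: "subgroup H G \<Longrightarrow> right_action G (rcosets H) (#>)"
proof
  fix C g h assume H: "subgroup H G" and C: "C \<in> rcosets H"
  obtain x where x: "x \<in> carrier G" "C = H #> x" using C by (auto simp: RCOSETS_def)
  note HG = subgroup.subset[OF H]
  show "C #> \<one> = C" using x HG by (simp add: coset_mult_assoc)
  { assume g: "g \<in> carrier G"
    then show "C #> g \<in> rcosets H" using x HG by (auto simp: coset_mult_assoc RCOSETS_def)
    assume "h \<in> carrier G"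
    then show "C #> (g \<otimes> h) = C #> g #> h" using x g HG by (simp add: coset_mult_assoc m_assoc) }
qed

text \<open>\<open>P'\<close> acts by right multiplication on its p cosets in \<open>P\<close> and
  fixes the coset \<open>P'\<close>. Every other orbit has p-power size below p, hence size 1, and
  that \<open>P' #> g\<close> is fixed means that conjugation by \<open>g\<close> maps
  \<open>P'\<close> into itself.\<close>

lemma index_prime_normal:
  assumes fin: "finite (carrier G)" and P: "subgroup P G" and p: "prime p"
    and P': "subgroup P' G" "P' \<subseteq> P" and card: "card P = p ^ Suc n" "card P' = p ^ n"
    and g: "g \<in> P" and h: "h \<in> P'"
  shows "g \<otimes> h \<otimes> inv g \<in> P'"
proof -
  interpret right_action G "rcosets P'" "(#>)" by (rule right_action_rcosets[OF P'(1)])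
  note PG = subgroup.mem_carrier[OF P] and P'G = subgroup.mem_carrier[OF P'(1)]
  have P'in: "P' \<in> rcosets P'" using subgroup.subgroup_in_rcosets[OF P'(1) is_group] .
  have finP: "finite P" "finite P'" using fin P P' finite_subset subgroup.subset by metis+
  have fixP': "P' #> k = P'" if "k \<in> P'" for k
    using subgroup.rcos_const[OF P'(1) is_group that] .
  have "rstab P P' = P'"
  proof
    show "P' \<subseteq> rstab P P'" using fixP' P'(2) by (auto simp: rstab_def)
    show "rstab P P' \<subseteq> P'"
      using rcos_self[OF _ P'(1)] PG by (auto simp: rstab_def)
  qed
  then have "card (rorbit P P') * p ^ n = p ^ Suc n"
    using card_rorbit_rstab[OF P finP(1) P'in] card by simp
  then have cp: "card (rorbit P P') = p" using prime_gt_0_nat[OF p] by simp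
  define C where "C = P' #> g"
  have CP: "C \<in> rorbit P P'" using g by (auto simp: C_def rorbit_def)
  have CX: "C \<in> rcosets P'" using rorbit_subset[OF subgroup.subset[OF P] P'in] CP by blast
  have orbC: "card (rorbit P' C) dvd p ^ n"
    using card_rorbit_rstab[OF P'(1) finP(2) CX] card by (metis dvd_triv_left)
  have "rorbit P' C = {C}"
  proof (cases "C = P'")
    case True
    then show ?thesis using fixP' subgroup.one_closed[OF P'(1)] by (force simp: rorbit_def)
  next
    case False
    have "rorbit P' C \<subseteq> rorbit P P' - {P'}"
    proof
      fix D assume D: "D \<in> rorbit P' C"
      then have "D \<in> rorbit P P'" using rorbit_act[OF P P'in CP] P' by (auto simp: rorbit_def)
      moreover have "D \<noteq> P'"
      proof
        assume "D = P'"
        then have "rorbit P' C = rorbit P' P'" using rorbit_eq[OF P'(1) CX D] by simp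
        then have "C \<in> rorbit P' P'" using rorbit_self[OF P'(1) CX] by simp
        then show False using False fixP' by (auto simp: rorbit_def)
      qed
      ultimately show "D \<in> rorbit P P' - {P'}" by blast
    qed
    moreover have "P' \<in> rorbit P P'" by (rule rorbit_self[OF P P'in])
    moreover have "finite (rorbit P P')" using finP by (simp add: rorbit_def)
    ultimately have "card (rorbit P' C) < p"
      using cp by (metis Diff_subset card_Diff1_less card_mono finite_Diff le_less_trans)
    moreover obtain i where i: "card (rorbit P' C) = p ^ i" using orbC p
      by (metis divides_primepow_nat)
    ultimately have "i = 0"
      by (metis One_nat_def Suc_leI not_less p power_increasing power_one_right prime_ge_1_nat not_gr_zero)
    then have "card (rorbit P' C) = 1" using i by simp
    then show ?thesis using rorbit_self[OF P'(1) CX] by (metis card_1_singletonE singletonD)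
  qed
  then have "P' #> g #> h = P' #> g" using h by (auto simp: rorbit_def C_def)
  then have "P' #> (g \<otimes> h) = P' #> g"
    using g h PG P'G subgroup.subset[OF P'(1)] by (simp add: coset_mult_assoc)
  then have "g \<otimes> h \<in> P' #> g"
    using g h PG P'G rcos_self[OF _ P'(1)] by (metis m_closed)
  then obtain k where "k \<in> P'" "g \<otimes> h = k \<otimes> g" by (auto simp: r_coset_def)
  moreover from this have "g \<otimes> h \<otimes> inv g = k" using g h PG P'G by (simp add: m_assoc)
  ultimately show ?thesis by simp
qed

text \<open>Sylow's theorem inside \<open>P\<close> yields a subgroup of index p. It is normal by
  the previous lemma and maximal because the orders in between would be powers of p.\<close>

lemma prime_series_p_group:
  assumes fin: "finite (carrier G)" and p: "prime p" and "subgroup P G" and "card P = p ^ n"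
  shows "prime_series G {\<one>} P"
  using assms(3,4)
proof (induction n arbitrary: P)
  case 0
  then have "P = {\<one>}" using subgroup.one_closed by (metis card_1_singletonE power_0 singletonD)
  then show ?case using 0 by (intro prime_series.base) auto
next
  case (Suc n)
  note P = Suc.prems(1)
  have finP: "finite P" using fin P finite_subset subgroup.subset by metis
  have "group (G\<lparr>carrier := P\<rparr>)" by (rule subgroup.subgroup_is_group[OF P is_group])
  moreover have "order (G\<lparr>carrier := P\<rparr>) = p ^ n * p" using Suc.prems by (simp add: order_def)
  ultimately obtain P' where P': "subgroup P' (G\<lparr>carrier := P\<rparr>)" "card P' = p ^ n"
    using sylow_thm[OF p, of "G\<lparr>carrier := P\<rparr>"] finP by auto
  have sub: "subgroup P' G" by (rule incl_subgroup[OF P P'(1)])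
  have P'P: "P' \<subseteq> P" using subgroup.subset[OF P'(1)] by simp
  have "P' \<noteq> P" using P'(2) Suc.prems(2) prime_gt_1_nat[OF p] by auto
  note normal = index_prime_normal[OF fin P p sub P'P Suc.prems(2) P'(2)]
  have max: "L = P" if L: "subgroup L G" "P' \<subset> L" "L \<subseteq> P" for L
  proof -
    have finL: "finite L" using L finP finite_subset by blast
    have "card L dvd card P" by (rule card_subgroup_dvd[OF L(1) P L(3)])
    then obtain i where i: "card L = p ^ i" "i \<le> Suc n"
      using Suc.prems(2) p by (metis divides_primepow_nat)
    have "p ^ n < p ^ i" using L finL P'(2) i by (metis psubset_card_mono)
    then have "n < i" using p prime_gt_1_nat power_less_imp_less_exp by blast
    then have "i = Suc n" using i(2) by simp
    then have "card L = card P" using i(1) Suc.prems(2) by simp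
    then show ?thesis using L finP by (simp add: card_subset_eq)
  qed
  have psub: "P' \<subset> P" using P'P \<open>P' \<noteq> P\<close> by blast
  show ?case
    using Suc.IH[OF sub P'(2)] normal max by (intro maximal_normal_step[OF fin P sub psub])
qed

end

section \<open>Symmetric chain decompositions of orbits\<close>

context right_action begin

text \<open>
  If \<open>lower_le N D r a b\<close>, then an element of \<open>N\<close> maps functions with leading position \<open>a\<close> to
  functions with leading position \<open>b\<close>.
\<close>

definition lower_le :: "'g set \<Rightarrow> 'x set \<Rightarrow> ('x \<Rightarrow> nat) \<Rightarrow> 'x \<Rightarrow> 'x \<Rightarrow> bool" where
  "lower_le N D r a b \<longleftrightarrow>
     a \<in> D \<and> b \<in> D \<and> (\<exists>g\<in>N. a \<star> g = b \<and> (\<forall>c\<in>D. r c < r a \<longrightarrow> r (c \<star> g) < r b))"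

text \<open>The injective rank \<open>r\<close> makes the leading position of a function unique. The
  chains are asked to cover \<open>D\<close>, since what is counted later is their number.\<close>

definition chain_partition :: "'g set \<Rightarrow> 'x set \<Rightarrow> ('x \<Rightarrow> nat) \<Rightarrow> 'x list list \<Rightarrow> bool" where
  "chain_partition N D r css \<longleftrightarrow> inj_on r D \<and> \<Union> (set ` set css) = D
     \<and> (\<forall>cs\<in>set css. successively (lower_le N D r) cs)"

lemma chain_partition_mono:
  assumes "chain_partition N' D r css" "N' \<subseteq> N"
  shows "chain_partition N D r css"
proof -
  have "lower_le N D r a b" if "lower_le N' D r a b" for a b
    using that assms(2) unfolding lower_le_def by blast
  then show ?thesis using assms(1) unfolding chain_partition_def by (metis successively_mono)
qed

lemma nat_pow_conj:
  assumes x: "x \<in> N" and N: "subgroup N G" and N': "subgroup N' G" "N' \<subseteq> N"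
    and normal: "\<And>g h. \<lbrakk>g \<in> N; h \<in> N'\<rbrakk> \<Longrightarrow> g \<otimes> h \<otimes> inv g \<in> N'" and h: "h \<in> N'"
  obtains k where "k \<in> N'" "h \<otimes> x [^] (j::nat) = x [^] j \<otimes> k"
proof -
  have xj: "x [^] j \<in> N" using x N by (induction j) (auto simp: subgroup.one_closed subgroup.m_closed)
  note xG = subgroup.mem_carrier[OF N xj] and hG = subgroup.mem_carrier[OF N'(1) h]
  have "inv (x [^] j) \<otimes> h \<otimes> inv (inv (x [^] j)) \<in> N'"
    by (rule normal[OF subgroup.m_inv_closed[OF N xj] h])
  moreover have "h \<otimes> x [^] j = x [^] j \<otimes> (inv (x [^] j) \<otimes> h \<otimes> inv (inv (x [^] j)))"
    using xG hG by (simp add: m_assoc[symmetric])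
  ultimately show ?thesis using that by blast
qed

text \<open>
  In the grid \<open>{0..<q} \<times> cs\<close>, where \<open>t i c\<close> is the entry at \<open>(i, c)\<close>, the \<open>j\<close>-th hook follows the
  row \<open>j\<close> up to the column \<open>length cs - Suc j\<close> and then that column.
\<close>

definition hook :: "nat \<Rightarrow> (nat \<Rightarrow> 'x \<Rightarrow> 'x) \<Rightarrow> 'x list \<Rightarrow> nat \<Rightarrow> 'x list" where
  "hook q t cs j = map (t j) (take (length cs - j) cs)
     @ map (\<lambda>i. t i (cs ! (length cs - Suc j))) [Suc j..<q]"

lemma length_hook:
  assumes "j < min q (length cs)"
  shows "length (hook q t cs j) = q + length cs - 1 - 2 * j"
  using assms by (auto simp: hook_def)

text \<open>The cell in row i and column k lies on the i-th hook if i + k is less than the number of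
  columns, and otherwise on the hook that turns into column k.\<close>

lemma set_hook:
  "(\<Union>j<min q (length cs). set (hook q t cs j)) = (\<Union>i<q. t i ` set cs)"
proof
  show "(\<Union>j<min q (length cs). set (hook q t cs j)) \<subseteq> (\<Union>i<q. t i ` set cs)"
    by (fastforce simp: hook_def dest: in_set_takeD)
  show "(\<Union>i<q. t i ` set cs) \<subseteq> (\<Union>j<min q (length cs). set (hook q t cs j))"
  proof (intro UN_least subsetI)
    fix i y assume i: "i \<in> {..<q}" and "y \<in> t i ` set cs"
    then obtain k where k: "k < length cs" "y = t i (cs ! k)" by (auto simp: in_set_conv_nth)
    show "y \<in> (\<Union>j<min q (length cs). set (hook q t cs j))"
    proof (cases "i + k < length cs")
      case True
      then have "cs ! k \<in> set (take (length cs - i) cs)"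
        using k by (auto simp: in_set_conv_nth intro!: exI[of _ k])
      then have "y \<in> set (hook q t cs i)" using k by (auto simp: hook_def)
      then show ?thesis using i True by force
    next
      case False
      define j where "j = length cs - Suc k"
      have j: "j < i" "length cs - Suc j = k" "j < length cs" using False k by (auto simp: j_def)
      then have "y \<in> set (hook q t cs j)" using i k by (auto simp: hook_def)
      then show ?thesis using i j by force
    qed
  qed
qed

text \<open>Consecutive entries of a hook differ by a step along the row or by one row in the same
  column, and \<open>mono\<close> covers both.\<close>

lemma successively_hook:
  assumes j: "j < min q (length cs)" and cs: "successively R cs"
    and mono: "\<And>i i' a b. \<lbrakk>i \<le> i'; i' < q; a \<in> set cs; b \<in> set cs; a = b \<or> R a b\<rbrakk> \<Longrightarrow> S (t i a) (t i' b)"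
  shows "successively S (hook q t cs j)"
  unfolding successively_conv_nth
proof (intro allI impI)
  fix k assume k: "Suc k < length (hook q t cs j)"
  let ?n = "length cs - j"
  have nth: "hook q t cs j ! k = (if k < ?n then t j (cs ! k) else t (Suc j + (k - ?n)) (cs ! (length cs - Suc j)))"
    if "k < length (hook q t cs j)" for k
    using that j by (auto simp: hook_def nth_append)
  consider "Suc k < ?n" | "Suc k = ?n" | "Suc k > ?n" by linarith
  then show "S (hook q t cs j ! k) (hook q t cs j ! Suc k)"
  proof cases
    case 1
    then have "R (cs ! k) (cs ! Suc k)" using cs by (auto simp: successively_conv_nth)
    then show ?thesis using 1 nth[of k] nth[of "Suc k"] k j by (auto intro!: mono)
  next
    case 2
    have "Suc j < q"
    proof -
      have "length (hook q t cs j) = q + length cs - 1 - 2 * j" by (rule length_hook[OF j])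
      then show ?thesis using k 2 j by linarith
    qed
    moreover have "k = length cs - Suc j" using 2 by simp
    ultimately show ?thesis using 2 nth[of k] nth[of "Suc k"] k j by (auto intro!: mono)
  next
    case 3
    have "Suc j + (Suc k - ?n) < q"
    proof -
      have "length (hook q t cs j) = q + length cs - 1 - 2 * j" by (rule length_hook[OF j])
      then show ?thesis using k 3 j by linarith
    qed
    then show ?thesis using 3 nth[of k] nth[of "Suc k"] k j by (auto intro!: mono)
  qed
qed

text \<open>As \<open>N'\<close> is normal in \<open>N\<close> and no power of \<open>x\<close> with
  exponent strictly between 0 and \<open>q\<close> returns \<open>a\<close> to \<open>D0\<close>,
  the orbit of \<open>N\<close> is the disjoint union of q translates of \<open>D0\<close>. Each
  chain of \<open>D0\<close> thus spans a grid with one row for each exponent, and this grid is cut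
  into hooks.\<close>

lemma chain_partition_orbit_step:
  assumes N': "subgroup N' G" and N: "subgroup N G" "N' \<subseteq> N"
    and normal: "\<And>g h. \<lbrakk>g \<in> N; h \<in> N'\<rbrakk> \<Longrightarrow> g \<otimes> h \<otimes> inv g \<in> N'"
    and x: "x \<in> N" and cover: "\<And>g. g \<in> N \<Longrightarrow> \<exists>h\<in>N'. \<exists>j<q. g = h \<otimes> x [^] (j::nat)"
    and a: "a \<in> X" and D0: "D0 = rorbit N' a" and fin: "finite D0"
    and free: "\<And>j. \<lbrakk>0 < j; j < q\<rbrakk> \<Longrightarrow> a \<star> x [^] j \<notin> D0"
    and part: "chain_partition N' D0 r css"
  obtains r' where "chain_partition N (rorbit N a) r'
      (concat (map (\<lambda>cs. map (hook q (\<lambda>i c. c \<star> x [^] i) cs) [0..<min q (length cs)]) css))"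
    and "card (rorbit N a) = q * card D0"
proof -
  let ?D = "rorbit N a"
  let ?t = "\<lambda>i c. c \<star> x [^] (i::nat)"
  have xG[simp]: "x \<in> carrier G" using x subgroup.mem_carrier[OF N(1)] by blast
  have xN: "x [^] (j::nat) \<in> N" for j using x N by (induction j) (auto simp: subgroup.one_closed subgroup.m_closed)
  note NG = subgroup.mem_carrier[OF N(1)] and N'G = subgroup.mem_carrier[OF N']
  have D0X: "D0 \<subseteq> X" unfolding D0 by (rule rorbit_subset[OF subgroup.subset[OF N'] a])
  \<comment> \<open>If points of two rows i < i' coincided, normality would allow the element of
    \<open>N'\<close> to be moved to the right of the power of \<open>x\<close>, and
    \<open>a \<star> x [^] (i' - i)\<close> would lie in \<open>D0\<close>.\<close>
  have disj: "i = i'" if eq: "c \<star> x [^] i = c' \<star> x [^] i'" and c: "c \<in> D0" "c' \<in> D0"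
    and i: "i < q" "i' < q" for c c' i i'
  proof -
    have *: False if lt: "i < i'" and eq: "c \<star> x [^] i = c' \<star> x [^] i'" and c: "c \<in> D0" "c' \<in> D0"
      and i: "i' < q" for c c' i i'
    proof -
      have cX: "c \<in> X" "c' \<in> X" using c D0X by auto
      have "c' \<star> x [^] i' = c' \<star> x [^] (i' - i) \<star> x [^] i"
        using lt cX by (simp add: act_m[symmetric] nat_pow_mult)
      then have e: "c \<star> x [^] i = c' \<star> x [^] (i' - i) \<star> x [^] i" using eq by simp
      have c_eq: "c = c' \<star> x [^] (i' - i)"
        by (rule act_inj[OF _ _ _ e]) (use cX in \<open>auto simp: act_in\<close>)
      obtain h where h: "h \<in> N'" "c' = a \<star> h" using c by (auto simp: D0 rorbit_def)
      obtain k where k: "k \<in> N'" "h \<otimes> x [^] (i' - i) = x [^] (i' - i) \<otimes> k"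
        using nat_pow_conj[OF x N(1) N' N(2) normal h(1)] by blast
      have "c = a \<star> x [^] (i' - i) \<star> k"
        using c_eq h k a N'G by (simp add: act_m[symmetric])
      then have "a \<star> x [^] (i' - i) = c \<star> inv k" using a k N'G by (simp add: act_inv act_in)
      also have "\<dots> \<in> D0"
        using rorbit_act[OF N' a, folded D0, OF c(1)] subgroup.m_inv_closed[OF N' k(1)] by blast
      finally show False using free[of "i' - i"] lt i by simp
    qed
    show ?thesis
    proof (rule ccontr)
      assume "i \<noteq> i'"
      then consider "i < i'" | "i' < i" by linarith
      then show False
      proof cases
        case 1
        show False by (rule *[OF 1 eq c i(2)])
      next
        case 2
        show False by (rule *[OF 2 eq[symmetric] c(2,1) i(1)])
      qed
    qed
  qed
  have D_eq: "?D = (\<Union>i<q. ?t i ` D0)"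
  proof
    show "?D \<subseteq> (\<Union>i<q. ?t i ` D0)"
    proof
      fix b assume "b \<in> ?D"
      then obtain g where g: "g \<in> N" "b = a \<star> g" by (auto simp: rorbit_def)
      then obtain h j where h: "h \<in> N'" "j < q" "g = h \<otimes> x [^] j" using cover by blast
      then have "b = ?t j (a \<star> h)" using g a N'G by (simp add: act_m)
      then show "b \<in> (\<Union>i<q. ?t i ` D0)" using h by (auto simp: D0 rorbit_def)
    qed
    have "D0 \<subseteq> ?D" using N(2) by (auto simp: D0 rorbit_def)
    then show "(\<Union>i<q. ?t i ` D0) \<subseteq> ?D" using rorbit_act[OF N(1) a] xN by blast
  qed
  have inj_t: "inj_on (?t i) D0" for i
    using D0X by (intro inj_onI) (metis act_inj nat_pow_closed subsetD xG)
  show ?thesis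
  proof (rule that)
    have "card ?D = (\<Sum>i<q. card (?t i ` D0))"
      unfolding D_eq using fin disj by (intro card_UN_disjoint) auto
    then show "card ?D = q * card D0" by (simp add: card_image[OF inj_t])
  next
    define M where "M = Suc (Max (r ` D0))"
    have rM: "r c < M" if "c \<in> D0" for c using that fin by (simp add: M_def less_Suc_eq_le)
    \<comment> \<open>The lexicographic rank, with the row compared before the position in the row;
      \<open>M\<close> exceeds all ranks in \<open>D0\<close>.\<close>
    define r' where "r' b = (THE n. \<exists>i c. i < q \<and> c \<in> D0 \<and> b = ?t i c \<and> n = i * M + r c)" for b
    have r': "r' (?t i c) = i * M + r c" if "i < q" "c \<in> D0" for i c
      unfolding r'_def
    proof (rule the_equality)
      show "\<exists>i' c'. i' < q \<and> c' \<in> D0 \<and> ?t i c = ?t i' c' \<and> i * M + r c = i' * M + r c'" using that by blast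
      fix n assume "\<exists>i' c'. i' < q \<and> c' \<in> D0 \<and> ?t i c = ?t i' c' \<and> n = i' * M + r c'"
      then obtain i' c' where ic: "i' < q" "c' \<in> D0" "?t i c = ?t i' c'" "n = i' * M + r c'" by blast
      then have "i = i'" using disj that by blast
      moreover from this have "c = c'" using ic inj_t[of i] that by (auto dest: inj_onD)
      ultimately show "n = i * M + r c" using ic by simp
    qed
    have less: "i * M + r c < i' * M + r c' \<longleftrightarrow> i < i' \<or> i = i' \<and> r c < r c'"
      if "c \<in> D0" "c' \<in> D0" for i i' c c'
    proof -
      have "i * M + r c < i' * M + r c'" if "i < i'" "c \<in> D0" for i i' c c'
      proof -
        have "i * M + r c < Suc i * M" using rM[OF that(2)] by simp
        also have "\<dots> \<le> i' * M" using that(1) by (intro mult_right_mono) auto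
        finally show ?thesis by simp
      qed
      from this[of i i' c c'] this[of i' i c' c] show ?thesis
        using that by (cases i i' rule: linorder_cases) auto
    qed
    have inj': "inj_on r' ?D"
    proof (rule inj_onI)
      fix b b' assume "b \<in> ?D" "b' \<in> ?D" and eq: "r' b = r' b'"
      then obtain i c i' c' where b: "i < q" "c \<in> D0" "b = ?t i c" "i' < q" "c' \<in> D0" "b' = ?t i' c'"
        unfolding D_eq by blast
      then have "i = i'" "\<not> r c < r c'" "\<not> r c' < r c"
        using eq less[of c c' i i'] less[of c' c i' i] by (auto simp: r')
      then have "r c = r c'" by simp
      then have "c = c'" using part b by (auto simp: chain_partition_def inj_on_def)
      then show "b = b'" using b \<open>i = i'\<close> by simp
    qed
    have lift: "lower_le N ?D r' (?t i b) (?t i' c)"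
      if i: "i \<le> i'" "i' < q" and bD: "b \<in> D0" "c \<in> D0" and bc: "b = c \<or> lower_le N' D0 r b c" for i i' b c
    proof -
      obtain h where h: "h \<in> N'" "b \<star> h = c" "\<And>e. \<lbrakk>e \<in> D0; r e < r b\<rbrakk> \<Longrightarrow> r (e \<star> h) < r c"
      proof (cases "b = c")
        case True
        then show ?thesis using that[of \<one>] bD D0X subgroup.one_closed[OF N'] by (auto simp: act_1 subset_iff)
      next
        case False
        then show ?thesis using that bc unfolding lower_le_def by blast
      qed
      \<comment> \<open>On row i this acts as \<open>h\<close> followed by the shift to row i'. A
        lower row k goes to row k + (i' - i), still below i'. Rows above i may wrap around, but
        \<open>lower_le\<close> asks nothing about them.\<close>
      define g where "g = inv (x [^] i) \<otimes> h \<otimes> x [^] i'"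
      have gN: "g \<in> N"
        unfolding g_def using h N xN by (auto intro!: subgroup.m_closed subgroup.m_inv_closed)
      have hG: "h \<in> carrier G" using h N'G by blast
      have t_g: "\<exists>e'\<in>D0. ?t k e \<star> g = ?t (k + (i' - i)) e'" if k: "k \<le> i" and e: "e \<in> D0" for k e
      proof -
        have eX: "e \<in> X" using e D0X by blast
        have inv_pow: "x [^] k \<otimes> inv (x [^] i) = inv (x [^] (i - k))"
        proof -
          have "x [^] i = x [^] (i - k) \<otimes> x [^] k" using k by (simp add: nat_pow_mult)
          then show ?thesis by (simp add: inv_mult_group m_assoc[symmetric])
        qed
        have "inv (x [^] (i - k)) \<otimes> h \<otimes> inv (inv (x [^] (i - k))) \<in> N'"
          by (rule normal[OF subgroup.m_inv_closed[OF N(1) xN] h(1)])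
        then have e'D: "e \<star> (inv (x [^] (i - k)) \<otimes> h \<otimes> x [^] (i - k)) \<in> D0"
          using rorbit_act[OF N' a, folded D0, OF e] by simp
        have "x [^] i' = x [^] (i - k) \<otimes> x [^] (k + (i' - i))"
          using k i by (simp add: nat_pow_mult)
        then have "x [^] k \<otimes> g = (inv (x [^] (i - k)) \<otimes> h \<otimes> x [^] (i - k)) \<otimes> x [^] (k + (i' - i))"
          unfolding g_def using hG inv_pow by (simp add: m_assoc[symmetric])
        moreover have "?t k e \<star> g = e \<star> (x [^] k \<otimes> g)" using eX NG[OF gN] by (simp add: act_m)
        ultimately have "?t k e \<star> g = ?t (k + (i' - i)) (e \<star> (inv (x [^] (i - k)) \<otimes> h \<otimes> x [^] (i - k)))"
          using eX hG by (simp add: act_m)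
        then show ?thesis using e'D by blast
      qed
      have t_i: "?t i e \<star> g = ?t i' (e \<star> h)" if "e \<in> D0" for e
      proof -
        have "?t i e \<star> g = e \<star> (x [^] i \<otimes> g)" using that D0X NG[OF gN] by (simp add: act_m subset_iff)
        also have "x [^] i \<otimes> g = h \<otimes> x [^] i'" unfolding g_def using hG by (simp add: m_assoc[symmetric])
        finally show ?thesis using that D0X hG by (simp add: act_m subset_iff)
      qed
      show ?thesis unfolding lower_le_def
      proof (intro conjI bexI[OF _ gN] ballI impI)
        show "?t i b \<in> ?D" "?t i' c \<in> ?D" unfolding D_eq using i bD by auto
        show "?t i b \<star> g = ?t i' c" using t_i[OF bD(1)] h by simp
        fix f assume "f \<in> ?D" and lt: "r' f < r' (?t i b)"
        then obtain k e where f: "k < q" "e \<in> D0" "f = ?t k e" unfolding D_eq by blast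
        then have "k < i \<or> k = i \<and> r e < r b" using lt less[OF f(2) bD(1)] i bD by (simp add: r')
        then show "r' (f \<star> g) < r' (?t i' c)"
        proof
          assume k: "k < i"
          then obtain e' where e': "e' \<in> D0" "f \<star> g = ?t (k + (i' - i)) e'" using t_g[of k e] f by auto
          moreover have "k + (i' - i) < i'" using k i by simp
          ultimately show ?thesis using r' less[OF e'(1) bD(2)] i bD by simp
        next
          assume k: "k = i \<and> r e < r b"
          then have "f \<star> g = ?t i' (e \<star> h)" using t_i f by simp
          moreover have "e \<star> h \<in> D0" using rorbit_act[OF N' a, folded D0] f h by blast
          moreover have "r (e \<star> h) < r c" using h(3) f k by blast
          ultimately show ?thesis using r' i bD by simp
        qed
      qed
    qed
    have csD: "set cs \<subseteq> D0" if "cs \<in> set css" for cs using that part by (auto simp: chain_partition_def)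
    show "chain_partition N ?D r'
        (concat (map (\<lambda>cs. map (hook q ?t cs) [0..<min q (length cs)]) css))"
      unfolding chain_partition_def
    proof (intro conjI ballI)
      show "inj_on r' ?D" by (rule inj')
      have "\<Union> (set ` set (concat (map (\<lambda>cs. map (hook q ?t cs) [0..<min q (length cs)]) css)))
        = (\<Union>cs\<in>set css. \<Union>j<min q (length cs). set (hook q ?t cs j))"
        by (auto; fastforce)
      also have "\<dots> = (\<Union>cs\<in>set css. \<Union>i<q. ?t i ` set cs)" by (simp only: set_hook)
      also have "\<dots> = (\<Union>i<q. ?t i ` \<Union> (set ` set css))" by auto
      finally show "\<Union> (set ` set (concat (map (\<lambda>cs. map (hook q ?t cs) [0..<min q (length cs)]) css))) = ?D"
        using part D_eq by (simp add: chain_partition_def)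
    next
      fix l assume "l \<in> set (concat (map (\<lambda>cs. map (hook q ?t cs) [0..<min q (length cs)]) css))"
      then obtain cs j where l: "cs \<in> set css" "j < min q (length cs)" "l = hook q ?t cs j" by auto
      have "successively (lower_le N' D0 r) cs" using part l by (auto simp: chain_partition_def)
      then show "successively (lower_le N ?D r') l"
        unfolding l(3) using csD[OF l(1)] by (intro successively_hook[OF l(2)] lift) auto
    qed
  qed
qed

text \<open>Passing from \<open>N'\<close> to \<open>N\<close> either leaves the orbit of
  \<open>a\<close> unchanged or multiplies its size by the prime \<open>q\<close>; only in the
  second case does \<open>q\<close> join the list. At the bottom the orbit is a point because
  \<open>K\<close> fixes \<open>a\<close>.\<close>

theorem prime_series_chain_partition:
  assumes "prime_series G K N" and fin: "finite (carrier G)" and a: "a \<in> X"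
    and trivial: "\<And>g. g \<in> K \<Longrightarrow> a \<star> g = a"
  shows "\<exists>r css qs. chain_partition N (rorbit N a) r css \<and> (\<forall>q\<in>set qs. prime q)
    \<and> prod_list qs = card (rorbit N a) \<and> map length css = hook_lengths qs"
  using assms(1)
proof (induction rule: prime_series.induct)
  case (base N)
  then have orb: "rorbit N a = {a}" using trivial subgroup.one_closed[OF base(1)] by (force simp: rorbit_def)
  have "chain_partition N {a} (\<lambda>_. 0) [[a]]" by (simp add: chain_partition_def)
  then show ?case unfolding orb by (intro exI[of _ "\<lambda>_. 0"] exI[of _ "[[a]]"] exI[of _ "[]"]) simp
next
  case (step N' N q x)
  note N' = step.hyps(2) and N = step.hyps(3,4) and normal = step.hyps(5) and q = step.hyps(6)
    and x = step.hyps(7) and xq = step.hyps(8) and cover = step.hyps(9)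
  let ?D0 = "rorbit N' a"
  obtain r css qs where IH: "chain_partition N' ?D0 r css" "\<forall>q\<in>set qs. prime q"
    "prod_list qs = card ?D0" "map length css = hook_lengths qs" using step.IH by blast
  have xG[simp]: "x \<in> carrier G" using x subgroup.mem_carrier[OF N(1)] by blast
  note N'G = subgroup.mem_carrier[OF N']
  have finD0: "finite ?D0"
    using fin finite_subset[OF subgroup.subset[OF N']] by (auto simp: rorbit_def)
  show ?case
  proof (cases "\<exists>j>0. j < q \<and> a \<star> x [^] j \<in> ?D0")
    case False
    from chain_partition_orbit_step[OF N' N normal x cover a refl finD0 _ IH(1)] False
    obtain r' where r': "chain_partition N (rorbit N a) r'
      (concat (map (\<lambda>cs. map (hook q (\<lambda>i c. c \<star> x [^] i) cs) [0..<min q (length cs)]) css))"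
      "card (rorbit N a) = q * card ?D0" by blast
    have "map length (concat (map (\<lambda>cs. map (hook q (\<lambda>i c. c \<star> x [^] i) cs) [0..<min q (length cs)]) css))
      = concat (map (\<lambda>cs. map (\<lambda>j. q + length cs - 1 - 2 * j) [0..<min q (length cs)]) css)"
      unfolding map_concat map_map o_def
      by (intro arg_cong[of _ _ concat] map_cong refl) (auto simp: length_hook)
    also have "\<dots> = hook_lengths (q # qs)" by (simp flip: IH(4) add: o_def)
    finally show ?thesis using r' IH q
      by (intro exI[of _ r'] exI[of _ "q # qs"]
        exI[of _ "concat (map (\<lambda>cs. map (hook q (\<lambda>i c. c \<star> x [^] i) cs) [0..<min q (length cs)]) css)"] conjI)
        (simp_all del: map_concat)
  next
    case True
    then obtain j where j: "0 < j" "j < q" "a \<star> x [^] j \<in> ?D0" by blast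
    \<comment> \<open>The exponents that keep \<open>a\<close> in \<open>?D0\<close> are closed
      under addition. One of them is prime to \<open>q\<close>, and x^q lies in \<open>N'\<close>,
      so 1 is among them and the orbit does not grow.\<close>
    have mult: "a \<star> x [^] (i + k) \<in> ?D0" if ik: "a \<star> x [^] i \<in> ?D0" "a \<star> x [^] k \<in> ?D0" for i k :: nat
    proof -
      obtain h where h: "h \<in> N'" "a \<star> x [^] i = a \<star> h" using ik by (auto simp: rorbit_def)
      obtain h' where h': "h' \<in> N'" "h \<otimes> x [^] k = x [^] k \<otimes> h'"
        using nat_pow_conj[OF x N(1) N' N(2) normal h(1)] by blast
      have "a \<star> x [^] (i + k) = a \<star> x [^] k \<star> h'"
        using a h h' N'G by (metis act_m nat_pow_closed nat_pow_mult xG)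
      then show ?thesis using rorbit_act[OF N' a ik(2) h'(1)] by simp
    qed
    have zero: "a \<star> x [^] (0::nat) \<in> ?D0" using rorbit_self[OF N' a] by (simp add: act_1 a)
    have mults: "a \<star> x [^] (i * u) \<in> ?D0" if "a \<star> x [^] i \<in> ?D0" for i u :: nat
      by (induction u) (use zero mult that in \<open>auto simp: add.commute\<close>)
    have "coprime j q" using q j by (metis coprime_commute nat_dvd_not_less prime_imp_coprime)
    then obtain u v where v: "j * u = 1 + q * v"
      using bezout_nat[of j q] j(1) by (auto simp: coprime_iff_gcd_eq_1 add.commute)
    have "x [^] (q * v) \<in> N'"
      using xq N' by (induction v) (auto simp: subgroup.one_closed nat_pow_mult[symmetric] subgroup.m_closed)
    moreover have "a \<star> x [^] (j * u) = a \<star> x \<star> x [^] (q * v)"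
    proof -
      have "x [^] (1 + q * v) = x \<otimes> x [^] (q * v)"
        using nat_pow_mult[OF xG, of 1 "q * v"] nat_pow_eone[OF xG] by metis
      then show ?thesis unfolding v using a by (simp only: act_m xG nat_pow_closed)
    qed
    ultimately have "a \<star> x = a \<star> x [^] (j * u) \<star> inv (x [^] (q * v))" "inv (x [^] (q * v)) \<in> N'"
      using a by (simp_all add: act_inv act_in subgroup.m_inv_closed[OF N'])
    then have ax: "a \<star> x [^] (1::nat) \<in> ?D0" using rorbit_act[OF N' a mults[OF j(3)]] by simp
    have "rorbit N a \<subseteq> ?D0"
    proof
      fix b assume "b \<in> rorbit N a"
      then obtain h i where h: "h \<in> N'" "b = a \<star> (h \<otimes> x [^] (i::nat))" using cover by (fastforce simp: rorbit_def)
      obtain k where k: "k \<in> N'" "h \<otimes> x [^] i = x [^] i \<otimes> k"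
        using nat_pow_conj[OF x N(1) N' N(2) normal h(1)] by blast
      have "b = a \<star> x [^] i \<star> k" using h k a N'G by (simp add: act_m)
      then show "b \<in> ?D0" using rorbit_act[OF N' a mults[OF ax, of i] k(1)] by simp
    qed
    moreover have "?D0 \<subseteq> rorbit N a" using N(2) by (auto simp: rorbit_def)
    ultimately have "rorbit N a = ?D0" by blast
    then show ?thesis using IH chain_partition_mono[OF IH(1) N(2)] by metis
  qed
qed

end

section \<open>Submodules for a set of operators\<close>

text \<open>
  The modifier \<open>carrier := A\<close> is also applied with a set \<open>A\<close> that is not a subgroup:
  \<open>submod (G\<lparr>carrier := A\<rparr>) V M\<close> only says that the subspace \<open>M\<close> is invariant under \<open>A\<close>.
\<close>

primrec height_le :: "('v set \<Rightarrow> bool) \<Rightarrow> nat \<Rightarrow> 'v set \<Rightarrow> bool" where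
  "height_le P 0 Z = (\<forall>Z'. P Z' \<longrightarrow> \<not> Z \<subset> Z')"
| "height_le P (Suc n) Z = (\<forall>Z'. P Z' \<longrightarrow> Z \<subset> Z' \<longrightarrow> height_le P n Z')"

lemma height_le_psubset:
  "\<lbrakk>height_le P n Z; P Z'; Z \<subset> Z'\<rbrakk> \<Longrightarrow> \<exists>m. n = Suc m \<and> height_le P m Z'"
  by (cases n) auto

text \<open>\<open>height_le P n Z\<close> means that at most n strict steps lead upwards from
  \<open>Z\<close>. Turning its failure into an explicit chain makes the height comparable with the
  numerical bounds on V.\<close>

lemma not_height_le_chain:
  "\<not> height_le P n Z \<Longrightarrow> \<exists>c. c 0 = Z \<and> (\<forall>i<Suc n. P (c (Suc i)) \<and> c i \<subset> c (Suc i))"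
proof (induction n arbitrary: Z)
  case 0
  then obtain Z' where "P Z'" "Z \<subset> Z'" by auto
  then show ?case by (intro exI[of _ "\<lambda>i. if i = 0 then Z else Z'"]) auto
next
  case (Suc n)
  then obtain Z' where Z': "P Z'" "Z \<subset> Z'" "\<not> height_le P n Z'" by auto
  then obtain c where c: "c 0 = Z'" "\<forall>i<Suc n. P (c (Suc i)) \<and> c i \<subset> c (Suc i)" using Suc.IH by blast
  show ?case
  proof (intro exI conjI allI impI)
    show "(\<lambda>i. case i of 0 \<Rightarrow> Z | Suc j \<Rightarrow> c j) 0 = Z" by simp
    fix i assume "i < Suc (Suc n)"
    then show "P ((\<lambda>i. case i of 0 \<Rightarrow> Z | Suc j \<Rightarrow> c j) (Suc i))"
      "(\<lambda>i. case i of 0 \<Rightarrow> Z | Suc j \<Rightarrow> c j) i \<subset> (\<lambda>i. case i of 0 \<Rightarrow> Z | Suc j \<Rightarrow> c j) (Suc i)"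
      using c Z' by (cases i; auto)+
  qed
qed

text \<open>Anything strictly between \<open>Z\<close> and a set \<open>T\<close> has greater height
  than \<open>T\<close>, so a set of greatest height is minimal. A greatest height exists because
  the heights of sets above \<open>Z\<close> are less than n.\<close>

lemma minimal_above:
  assumes "height_le P n Z" "P Z0" "Z \<subset> Z0"
  obtains T where "P T" "Z \<subset> T" "\<And>T'. \<lbrakk>P T'; Z \<subset> T'; T' \<subseteq> T\<rbrakk> \<Longrightarrow> T' = T"
proof -
  define h where "h T = (LEAST m. height_le P m T)" for T
  have h: "height_le P (h T) T \<and> h T < n" if T: "P T" "Z \<subset> T" for T
  proof -
    obtain m where m: "n = Suc m" "height_le P m T" using height_le_psubset[OF assms(1) T] by blast
    then have "h T \<le> m" "height_le P (h T) T" unfolding h_def by (auto intro: Least_le LeastI)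
    then show ?thesis using m by simp
  qed
  define k where "k = Max {h T | T. P T \<and> Z \<subset> T}"
  have fin: "finite {h T | T. P T \<and> Z \<subset> T}" by (rule finite_subset[of _ "{..<n}"]) (use h in auto)
  have "k \<in> {h T | T. P T \<and> Z \<subset> T}" unfolding k_def by (rule Max_in[OF fin]) (use assms in auto)
  then obtain T where T: "P T" "Z \<subset> T" "h T = k" by blast
  show ?thesis
  proof (rule that[OF T(1,2)])
    fix T' assume T': "P T'" "Z \<subset> T'" "T' \<subseteq> T"
    show "T' = T"
    proof (rule ccontr)
      assume "T' \<noteq> T"
      then obtain m where m: "h T' = Suc m" "height_le P m T"
        using height_le_psubset[of P "h T'" T' T] h[OF T'(1,2)] T T' by blast
      then have "h T \<le> m" unfolding h_def by (auto intro: Least_le)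
      moreover have "h T' \<le> k" unfolding k_def by (rule Max_ge[OF fin]) (use T' in auto)
      ultimately show False using m T by simp
    qed
  qed
qed

section \<open>Invariant subspaces and the submodules generated by sets of operators\<close>

context group_module begin

abbreviation inv_sub :: "'g set \<Rightarrow> 'v set \<Rightarrow> bool" where
  "inv_sub A M \<equiv> submod (G\<lparr>carrier := A\<rparr>) V M"

abbreviation gen :: "'g set \<Rightarrow> 'v set \<Rightarrow> 'v set" where
  "gen A S \<equiv> submod_generated (G\<lparr>carrier := A\<rparr>) V S"

lemma inv_subD:
  assumes "inv_sub A M"
  shows "M \<subseteq> vecs V" "subspace M" "0 \<in> M" "\<lbrakk>v \<in> M; w \<in> M\<rbrakk> \<Longrightarrow> v + w \<in> M" "\<lbrakk>v \<in> M; w \<in> M\<rbrakk> \<Longrightarrow> v - w \<in> M"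
    "v \<in> M \<Longrightarrow> smul V c v \<in> M" "\<lbrakk>v \<in> M; g \<in> A\<rbrakk> \<Longrightarrow> act V v g \<in> M"
  using assms subspace_0 subspace_add subspace_diff subspace_scale by (auto simp: submod_def)

lemma inv_sub_sum: "inv_sub A M \<Longrightarrow> (\<And>y. y \<in> I \<Longrightarrow> f y \<in> M) \<Longrightarrow> (\<Sum>y\<in>I. f y) \<in> M"
  by (metis inv_subD(2) subspace_sum)

lemma inv_sub_vecs: "A \<subseteq> carrier G \<Longrightarrow> inv_sub A (vecs V)"
  using subspace_vecs act_closed by (auto simp: submod_def)

lemma inv_sub_mono: "inv_sub A M \<Longrightarrow> B \<subseteq> A \<Longrightarrow> inv_sub B M"
  by (auto simp: submod_def)

lemma inv_sub_0: "A \<subseteq> carrier G \<Longrightarrow> inv_sub A {0}"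
proof -
  assume A: "A \<subseteq> carrier G"
  have "0 \<in> vecs V" using subspace_vecs subspace_0 by blast
  moreover from this have "act V 0 g = 0" if "g \<in> A" for g
    using act_smul[of 0 g 0] A that by auto
  ultimately show ?thesis by (simp add: submod_def subspace_single_0)
qed

lemma inv_sub_Int: "inv_sub A M \<Longrightarrow> inv_sub A N \<Longrightarrow> inv_sub A (M \<inter> N)"
  by (auto simp: submod_def subspace_inter)

lemma inv_sub_plus:
  assumes A: "A \<subseteq> carrier G" and M: "inv_sub A M" "inv_sub A N"
  shows "inv_sub A {m + n | m n. m \<in> M \<and> n \<in> N}"
  unfolding submod_def
proof (intro conjI ballI)
  note sub = inv_subD[OF M(1)] inv_subD[OF M(2)]
  show "{m + n | m n. m \<in> M \<and> n \<in> N} \<subseteq> vecs V"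
    using sub(1,8) subspace_add[OF subspace_vecs] by blast
  show "subspace {m + n | m n. m \<in> M \<and> n \<in> N}"
    using subspace_sums[OF sub(2,9)] by simp
  fix v g assume v: "v \<in> {m + n | m n. m \<in> M \<and> n \<in> N}" and g: "g \<in> carrier (G\<lparr>carrier := A\<rparr>)"
  then obtain m n where mn: "v = m + n" "m \<in> M" "n \<in> N" by blast
  have "act V v g = act V m g + act V n g" using mn g A sub(1,8) by (auto intro!: act_add)
  moreover have "act V m g \<in> M" "act V n g \<in> N" using mn g sub(7)[of m g] sub(14)[of n g] by simp_all
  ultimately show "act V v g \<in> {m + n | m n. m \<in> M \<and> n \<in> N}" by blast
qed

lemma gen_least: "inv_sub A M \<Longrightarrow> S \<subseteq> M \<Longrightarrow> gen A S \<subseteq> M"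
  by (auto simp: submod_generated_def)

lemma gen_superset: "S \<subseteq> gen A S"
  by (auto simp: submod_generated_def)

lemma inv_sub_gen:
  assumes A: "A \<subseteq> carrier G" and S: "S \<subseteq> vecs V"
  shows "inv_sub A (gen A S)"
proof -
  have "gen A S \<subseteq> vecs V" by (rule gen_least[OF inv_sub_vecs[OF A] S])
  moreover have "subspace (gen A S)"
    unfolding submod_generated_def by (rule subspace_Inter) (auto simp: submod_def)
  moreover have "act V v g \<in> gen A S" if "v \<in> gen A S" "g \<in> A" for v g
    using that unfolding submod_generated_def by (auto dest: inv_subD(7))
  ultimately show ?thesis by (simp add: submod_def)
qed

lemma gen_mono: "A \<subseteq> B \<Longrightarrow> S \<subseteq> T \<Longrightarrow> gen A S \<subseteq> gen B T"
  unfolding submod_generated_def by (intro Inter_anti_mono) (auto intro: inv_sub_mono)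

lemma act_0: "g \<in> carrier G \<Longrightarrow> act V 0 g = 0"
  using inv_subD(7)[OF inv_sub_0[OF subset_refl]] by blast

lemma act_diff:
  assumes "v \<in> vecs V" "w \<in> vecs V" "g \<in> carrier G"
  shows "act V (v - w) g = act V v g - act V w g"
proof -
  have "v - w \<in> vecs V" using assms subspace_diff[OF subspace_vecs] by blast
  then have "act V (v - w + w) g = act V (v - w) g + act V w g" using assms by (intro act_add)
  then show ?thesis by (simp add: algebra_simps)
qed

lemma act_sum:
  assumes "finite I" "\<And>y. y \<in> I \<Longrightarrow> f y \<in> vecs V" "g \<in> carrier G"
  shows "act V (\<Sum>y\<in>I. f y) g = (\<Sum>y\<in>I. act V (f y) g)"
  using assms
proof (induction I rule: finite_induct)
  case (insert x I)
  have "(\<Sum>y\<in>I. f y) \<in> vecs V" using insert by (intro subspace_sum[OF subspace_vecs]) auto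
  then show ?case using insert by (simp add: act_add)
qed (simp add: act_0)

lemma act_inv_cancel: "\<lbrakk>v \<in> vecs V; g \<in> carrier G\<rbrakk> \<Longrightarrow> act V (act V v g) (inv g) = v"
  by (metis act_mult act_one inv_closed r_inv)

lemma act_inv_cancel': "\<lbrakk>v \<in> vecs V; g \<in> carrier G\<rbrakk> \<Longrightarrow> act V (act V v (inv g)) g = v"
  by (metis act_mult act_one inv_closed l_inv)

text \<open>Acting by k after g is the same as acting by g k g^(-1) before g, and normality returns
  this conjugate to \<open>K\<close>.\<close>

lemma inv_sub_translate:
  assumes K: "subgroup K G" and normal: "\<And>g k. \<lbrakk>g \<in> carrier G; k \<in> K\<rbrakk> \<Longrightarrow> g \<otimes> k \<otimes> inv g \<in> K"
    and T: "inv_sub K T" and g: "g \<in> carrier G"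
  shows "inv_sub K ((\<lambda>v. act V v g) ` T)"
  unfolding submod_def
proof (intro conjI ballI)
  note sub = inv_subD[OF T]
  have TV: "v \<in> vecs V" if "v \<in> T" for v using sub(1) that by blast
  show "(\<lambda>v. act V v g) ` T \<subseteq> vecs V" using TV g act_closed by auto
  show "subspace ((\<lambda>v. act V v g) ` T)"
    unfolding subspace_def
  proof (intro conjI ballI allI)
    show "0 \<in> (\<lambda>v. act V v g) ` T" using act_0[OF g] sub(3) by force
    show "x + y \<in> (\<lambda>v. act V v g) ` T" if "x \<in> (\<lambda>v. act V v g) ` T" "y \<in> (\<lambda>v. act V v g) ` T" for x y
      using that act_add[OF TV TV g, symmetric] sub(4) by auto
    show "smul V c x \<in> (\<lambda>v. act V v g) ` T" if "x \<in> (\<lambda>v. act V v g) ` T" for c x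
      using that act_smul[OF TV g, symmetric] sub(6) by auto
  qed
  fix w k assume w: "w \<in> (\<lambda>v. act V v g) ` T" and k: "k \<in> carrier (G\<lparr>carrier := K\<rparr>)"
  then obtain v where v: "v \<in> T" "w = act V v g" by blast
  have kG: "k \<in> carrier G" and kK: "k \<in> K" using k subgroup.mem_carrier[OF K] by auto
  have "act V w k = act V v ((g \<otimes> k \<otimes> inv g) \<otimes> g)"
    using v TV g kG by (simp add: m_assoc act_mult)
  also have "\<dots> = act V (act V v (g \<otimes> k \<otimes> inv g)) g"
    using v TV g kG by (intro act_mult) auto
  finally show "act V w k \<in> (\<lambda>v. act V v g) ` T" using sub(7)[OF v(1) normal[OF g kK]] by auto
qed

text \<open>Modulo \<open>C\<close>, the module generated by \<open>C\<close> and \<open>T\<close>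
  is a sum of translates of \<open>T\<close> under \<open>P\<close>, each zero or simple for
  \<open>K\<close>. Hence its intersection B with \<open>M\<close> has a K-complement D modulo
  \<open>C\<close>, made of translates. The projection onto B along D commutes with
  \<open>K\<close>; averaged over \<open>P\<close> it commutes with \<open>P\<close> too. As
  \<open>e\<close> generates \<open>T\<close> modulo \<open>C\<close>, its projection generates the
  image, which is B modulo \<open>C\<close>.\<close>

lemma relative_maschke_step:
  assumes fin: "finite (carrier G)" and K: "subgroup K G"
    and normal: "\<And>g k. \<lbrakk>g \<in> carrier G; k \<in> K\<rbrakk> \<Longrightarrow> g \<otimes> k \<otimes> inv g \<in> K"
    and P: "subgroup P G" and char: "of_nat (card P) \<noteq> (0 :: 'f)"
    and M: "inv_sub (P \<union> K) M" and C: "inv_sub (P \<union> K) C" and T: "inv_sub K T"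
    and simple: "\<And>T'. \<lbrakk>inv_sub K T'; T \<inter> C \<subseteq> T'; T' \<subseteq> T\<rbrakk> \<Longrightarrow> T' = T \<inter> C \<or> T' = T"
    and e: "e \<in> T" "e \<notin> C"
  obtains b where "b \<in> M" "\<And>f. f \<in> M \<inter> gen (P \<union> K) (C \<union> T) \<Longrightarrow> \<exists>f'\<in>gen (P \<union> K) {b}. f - f' \<in> C"
proof -
  let ?A = "P \<union> K"
  note PG = subgroup.mem_carrier[OF P] and KG = subgroup.mem_carrier[OF K]
  have finP: "finite P" using fin finite_subset[OF subgroup.subset[OF P]] by blast
  have AG: "?A \<subseteq> carrier G" "K \<subseteq> carrier G" using PG KG by auto
  have CT: "C \<union> T \<subseteq> vecs V" using inv_subD(1)[OF C] inv_subD(1)[OF T] by blast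
  define C' where "C' = gen ?A (C \<union> T)"
  have C': "inv_sub ?A C'" unfolding C'_def by (rule inv_sub_gen[OF AG(1) CT])
  have CC': "C \<subseteq> C'" "T \<subseteq> C'" using gen_superset[of "C \<union> T" ?A] by (auto simp: C'_def)
  define B where "B = M \<inter> C'"
  have B: "inv_sub ?A B" unfolding B_def by (rule inv_sub_Int[OF M C'])
  have KA: "K \<subseteq> ?A" by blast
  note B_K = inv_sub_mono[OF B KA] and C_K = inv_sub_mono[OF C KA]
  define Ty where "Ty y = (\<lambda>v. act V v y) ` T" for y
  have Ty: "inv_sub K (Ty y)" if "y \<in> P" for y
    unfolding Ty_def using PG[OF that] by (intro inv_sub_translate[OF K normal T])
  define DD where "DD I = gen K (C \<union> (\<Union>y\<in>I. Ty y))" for I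
  have DD_sub: "C \<union> (\<Union>y\<in>I. Ty y) \<subseteq> vecs V" if "I \<subseteq> P" for I
    using that inv_subD(1)[OF C] inv_subD(1)[OF Ty] by blast
  have DD: "inv_sub K (DD I)" if "I \<subseteq> P" for I
    unfolding DD_def by (rule inv_sub_gen[OF AG(2) DD_sub[OF that]])
  have C_DD: "C \<subseteq> DD I" and Ty_DD: "y \<in> I \<Longrightarrow> Ty y \<subseteq> DD I" for I y
    using gen_superset[of "C \<union> (\<Union>y\<in>I. Ty y)" K] by (auto simp: DD_def)
  \<comment> \<open>The complement is a sum over a largest set of translates that meets
    \<open>B\<close> only inside \<open>C\<close>; finiteness of \<open>P\<close> provides
    it.\<close>
  define Q where "Q I \<longleftrightarrow> I \<subseteq> P \<and> DD I \<inter> B \<subseteq> C" for I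
  have "DD {} \<subseteq> C" unfolding DD_def by (rule gen_least[OF C_K]) simp
  then have "Q {}" by (auto simp: Q_def)
  moreover have "finite (Collect Q)" by (rule finite_subset[of _ "Pow P"]) (use finP in \<open>auto simp: Q_def\<close>)
  ultimately obtain I where I: "Q I" "\<And>J. Q J \<Longrightarrow> I \<subseteq> J \<Longrightarrow> I = J"
    using finite_has_maximal[of "Collect Q"] by auto
  define D where "D = DD I"
  have IP: "I \<subseteq> P" and DB: "D \<inter> B \<subseteq> C" using I(1) by (auto simp: Q_def D_def)
  have D: "inv_sub K D" unfolding D_def by (rule DD[OF IP])
  have CD: "C \<subseteq> D" unfolding D_def by (rule C_DD)
  define S where "S = {d + b | d b. d \<in> D \<and> b \<in> B}"
  have S: "inv_sub K S" unfolding S_def by (rule inv_sub_plus[OF AG(2) D B_K])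
  have DS: "D \<subseteq> S" and BS: "B \<subseteq> S"
    using inv_subD(3)[OF D] inv_subD(3)[OF B] unfolding S_def by force+
  \<comment> \<open>Otherwise, by simplicity, the translate would meet D + B only inside
    \<open>C\<close> and could be added to the complement.\<close>
  have TyS: "Ty y \<subseteq> S" if y: "y \<in> P" for y
  proof (rule ccontr)
    assume not: "\<not> Ty y \<subseteq> S"
    have yG: "y \<in> carrier G" by (rule PG[OF y])
    define T' where "T' = T \<inter> (\<lambda>v. act V v (inv y)) ` (S \<inter> vecs V)"
    have S_Int: "S \<inter> vecs V = S" using inv_subD(1)[OF S] by blast
    have T'_iff: "v \<in> T' \<longleftrightarrow> v \<in> T \<and> act V v y \<in> S" for v
    proof
      assume "v \<in> T'"
      then obtain w where "w \<in> S" "w \<in> vecs V" "v = act V w (inv y)" "v \<in> T" by (auto simp: T'_def)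
      then show "v \<in> T \<and> act V v y \<in> S" using act_inv_cancel'[OF _ yG] by simp
    next
      assume v: "v \<in> T \<and> act V v y \<in> S"
      then have "v \<in> vecs V" using inv_subD(1)[OF T] by blast
      then have "v = act V (act V v y) (inv y)" "act V v y \<in> vecs V"
        using act_inv_cancel[OF _ yG] act_closed yG by auto
      then show "v \<in> T'" using v by (auto simp: T'_def)
    qed
    have "inv_sub K T'"
      unfolding T'_def S_Int
      by (intro inv_sub_Int[OF T] inv_sub_translate[OF K normal S]) (use yG in auto)
    moreover have "T \<inter> C \<subseteq> T'"
    proof
      fix v assume v: "v \<in> T \<inter> C"
      then have "act V v y \<in> C" using inv_subD(7)[OF C, of v y] y by blast
      then show "v \<in> T'" using v CD DS unfolding T'_iff by blast
    qed
    moreover have "T' \<subseteq> T" by (auto simp: T'_def)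
    moreover have "T' \<noteq> T" using not unfolding Ty_def by (metis T'_iff image_subsetI)
    ultimately have T'C: "T' = T \<inter> C" using simple by blast
    have TyC: "Ty y \<inter> S \<subseteq> C"
    proof
      fix w assume w: "w \<in> Ty y \<inter> S"
      then obtain v where v: "v \<in> T" "w = act V v y" by (auto simp: Ty_def)
      then have "v \<in> C" using w T'C T'_iff by blast
      then show "w \<in> C" using v inv_subD(7)[OF C, of v y] y by blast
    qed
    have "DD (insert y I) \<subseteq> {d + t | d t. d \<in> D \<and> t \<in> Ty y}"
      unfolding DD_def
    proof (rule gen_least[OF inv_sub_plus[OF AG(2) D Ty[OF y]]])
      have "D \<subseteq> {d + t | d t. d \<in> D \<and> t \<in> Ty y}" using inv_subD(3)[OF Ty[OF y]] by force
      moreover have "Ty y \<subseteq> {d + t | d t. d \<in> D \<and> t \<in> Ty y}" using inv_subD(3)[OF D] by force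
      ultimately show "C \<union> (\<Union>y\<in>insert y I. Ty y) \<subseteq> {d + t | d t. d \<in> D \<and> t \<in> Ty y}"
        using CD Ty_DD[of _ I] unfolding D_def by blast
    qed
    moreover have "{d + t | d t. d \<in> D \<and> t \<in> Ty y} \<inter> B \<subseteq> C"
    proof
      fix w assume "w \<in> {d + t | d t. d \<in> D \<and> t \<in> Ty y} \<inter> B"
      then obtain d t where w: "w = d + t" "d \<in> D" "t \<in> Ty y" "w \<in> B" by blast
      have "t = w - d" using w by simp
      then have "t \<in> S" using inv_subD(5)[OF S] w BS DS by blast
      then have "t \<in> C" using TyC w by blast
      then have "w \<in> D" using w CD inv_subD(4)[OF D] by blast
      then show "w \<in> C" using DB w by blast
    qed
    ultimately have "Q (insert y I)" using IP y unfolding Q_def by blast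
    then have "y \<in> I" using I(2) by blast
    then have "Ty y \<subseteq> D" unfolding D_def by (rule Ty_DD)
    then show False using not DS by blast
  qed
  have C'S: "C' \<subseteq> S"
  proof -
    let ?X = "C \<union> (\<Union>y\<in>P. Ty y)"
    have gX: "inv_sub K (gen K ?X)" by (rule inv_sub_gen[OF AG(2) DD_sub[OF subset_refl]])
    have "gen K ?X \<subseteq> S" by (rule gen_least[OF S]) (use CD DS TyS in blast)
    moreover have "C' \<subseteq> gen K ?X"
      unfolding C'_def
    proof (rule gen_least)
      have "T = Ty \<one>" using act_one inv_subD(1)[OF T] by (force simp: Ty_def)
      then show "C \<union> T \<subseteq> gen K ?X" using gen_superset[of ?X K] subgroup.one_closed[OF P] by blast
      \<comment> \<open>Right multiplication by \<open>z\<close> permutes the translates, so the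
        K-module generated by \<open>C\<close> and all of them is invariant under
        \<open>P\<close>.\<close>
      have "act V v z \<in> gen K ?X" if v: "v \<in> gen K ?X" and z: "z \<in> P" for v z
      proof -
        have zG: "z \<in> carrier G" using PG[OF z] .
        have "gen K ?X \<subseteq> (\<lambda>v. act V v (inv z)) ` gen K ?X"
        proof (rule gen_least[OF inv_sub_translate[OF K normal gX]])
          show "inv z \<in> carrier G" using zG by simp
          show "?X \<subseteq> (\<lambda>v. act V v (inv z)) ` gen K ?X"
          proof
            fix x assume x: "x \<in> ?X"
            then have xV: "x \<in> vecs V" using DD_sub[OF subset_refl] by blast
            have "act V x z \<in> ?X"
            proof (cases "x \<in> C")
              case True
              then show ?thesis using inv_subD(7)[OF C] z by blast
            next
              case False
              then obtain y t where y: "y \<in> P" "t \<in> T" "x = act V t y" using x by (auto simp: Ty_def)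
              then have "act V x z = act V t (y \<otimes> z)" using inv_subD(1)[OF T] PG zG by (subst act_mult) auto
              then have "act V x z \<in> Ty (y \<otimes> z)" using y by (auto simp: Ty_def)
              then show ?thesis using subgroup.m_closed[OF P y(1) z] by blast
            qed
            then show "x \<in> (\<lambda>v. act V v (inv z)) ` gen K ?X"
              using act_inv_cancel[OF xV zG, symmetric] gen_superset[of ?X K] by blast
          qed
        qed
        then obtain u where "u \<in> gen K ?X" "v = act V u (inv z)" using v by blast
        then show ?thesis using act_inv_cancel'[OF _ zG, of u] inv_subD(1)[OF gX] by auto
      qed
      then show "inv_sub ?A (gen K ?X)" using gX by (auto simp: submod_def)
    qed
    ultimately show ?thesis by blast
  qed
  define c where "c = inverse (of_nat (card P) :: 'f)"
  \<comment> \<open>The averaged projection is determined only modulo \<open>C\<close> and is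
    therefore kept as a relation: \<open>b y\<close> is some B-component of w y^(-1). By
    \<open>\<rho>_0\<close> the choices change the result only by elements of
    \<open>C\<close>.\<close>
  define \<rho> where "\<rho> w v \<longleftrightarrow> (\<exists>b. (\<forall>y\<in>P. b y \<in> B \<and> act V w (inv y) - b y \<in> D)
     \<and> v = smul V c (\<Sum>y\<in>P. act V (b y) y))" for w v
  have BV: "b \<in> vecs V" if "b \<in> B" for b using that inv_subD(1)[OF B] by blast
  have C'V: "b \<in> vecs V" if "b \<in> C'" for b using that inv_subD(1)[OF C'] by blast
  have avg: "smul V c (\<Sum>y\<in>P. x) = x" for x
    using char by (simp add: sum_constant_scale c_def)
  have PA: "y \<in> ?A" "y \<in> carrier G" "inv y \<in> P" if "y \<in> P" for y
    using that PG subgroup.m_inv_closed[OF P] by auto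
  have \<rho>_add: "\<rho> (w + w') (v + v')" if "\<rho> w v" "\<rho> w' v'" "w \<in> C'" "w' \<in> C'" for w w' v v'
  proof -
    obtain b where b: "\<forall>y\<in>P. b y \<in> B \<and> act V w (inv y) - b y \<in> D" "v = smul V c (\<Sum>y\<in>P. act V (b y) y)"
      using \<open>\<rho> w v\<close> unfolding \<rho>_def by blast
    obtain b' where b': "\<forall>y\<in>P. b' y \<in> B \<and> act V w' (inv y) - b' y \<in> D" "v' = smul V c (\<Sum>y\<in>P. act V (b' y) y)"
      using \<open>\<rho> w' v'\<close> unfolding \<rho>_def by blast
    have "act V (w + w') (inv y) - (b y + b' y) \<in> D" if y: "y \<in> P" for y
    proof -
      have "act V (w + w') (inv y) - (b y + b' y) = (act V w (inv y) - b y) + (act V w' (inv y) - b' y)"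
        using C'V \<open>w \<in> C'\<close> \<open>w' \<in> C'\<close> PA[OF y] by (simp add: act_add)
      also have "\<dots> \<in> D" by (rule inv_subD(4)[OF D]) (use b b' y in auto)
      finally show ?thesis .
    qed
    moreover have "v + v' = smul V c (\<Sum>y\<in>P. act V (b y + b' y) y)"
    proof -
      have "(\<Sum>y\<in>P. act V (b y + b' y) y) = (\<Sum>y\<in>P. act V (b y) y + act V (b' y) y)"
        using b b' BV PA by (intro sum.cong refl act_add) auto
      then show ?thesis using b b' by (simp add: sum.distrib scale_right_distrib)
    qed
    ultimately show ?thesis unfolding \<rho>_def using b b' inv_subD(4)[OF B]
      by (intro exI[of _ "\<lambda>y. b y + b' y"]) auto
  qed
  have \<rho>_smul: "\<rho> (smul V a w) (smul V a v)" if "\<rho> w v" "w \<in> C'" for a w v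
  proof -
    obtain b where b: "\<forall>y\<in>P. b y \<in> B \<and> act V w (inv y) - b y \<in> D" "v = smul V c (\<Sum>y\<in>P. act V (b y) y)"
      using \<open>\<rho> w v\<close> unfolding \<rho>_def by blast
    have "act V (smul V a w) (inv y) - smul V a (b y) \<in> D" if y: "y \<in> P" for y
    proof -
      have "act V (smul V a w) (inv y) - smul V a (b y) = smul V a (act V w (inv y) - b y)"
        using C'V \<open>w \<in> C'\<close> PA[OF y] by (simp add: act_smul scale_right_diff_distrib)
      then show ?thesis using b y inv_subD(6)[OF D] by simp
    qed
    moreover have "smul V a v = smul V c (\<Sum>y\<in>P. act V (smul V a (b y)) y)"
    proof -
      have "(\<Sum>y\<in>P. act V (smul V a (b y)) y) = (\<Sum>y\<in>P. smul V a (act V (b y) y))"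
        using b BV PA by (intro sum.cong refl act_smul) auto
      then show ?thesis using b by (simp add: scale_sum_right[symmetric] scale_left_commute)
    qed
    ultimately show ?thesis unfolding \<rho>_def using b inv_subD(6)[OF B]
      by (intro exI[of _ "\<lambda>y. smul V a (b y)"]) auto
  qed
  \<comment> \<open>Acting by \<open>z\<close> permutes the terms of the average: the component used
    at y is the former one at y z^(-1).\<close>
  have \<rho>_P: "\<rho> (act V w z) (act V v z)" if "\<rho> w v" "w \<in> C'" and z: "z \<in> P" for w v z
  proof -
    obtain b where b: "\<forall>y\<in>P. b y \<in> B \<and> act V w (inv y) - b y \<in> D" "v = smul V c (\<Sum>y\<in>P. act V (b y) y)"
      using \<open>\<rho> w v\<close> unfolding \<rho>_def by blast
    note zP = PA[OF z]
    have yz: "y \<otimes> inv z \<in> P" if "y \<in> P" for y using that zP subgroup.m_closed[OF P] by blast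
    have "act V (act V w z) (inv y) - b (y \<otimes> inv z) \<in> D" if y: "y \<in> P" for y
    proof -
      have "act V (act V w z) (inv y) = act V w (inv (y \<otimes> inv z))"
        using C'V[OF \<open>w \<in> C'\<close>] PA[OF y] zP by (simp add: inv_mult_group act_mult)
      then show ?thesis using b yz[OF y] by simp
    qed
    moreover have "act V v z = smul V c (\<Sum>y\<in>P. act V (b (y \<otimes> inv z)) y)"
    proof -
      have "act V v z = smul V c (\<Sum>y\<in>P. act V (act V (b y) y) z)"
        using b BV PA zP by (simp add: act_smul act_sum[OF finP] act_closed subspace_sum[OF subspace_vecs])
      also have "(\<Sum>y\<in>P. act V (act V (b y) y) z) = (\<Sum>y\<in>P. act V (b y) (y \<otimes> z))"
        using b BV PA zP by (intro sum.cong refl act_mult[symmetric]) auto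
      also have "\<dots> = (\<Sum>y\<in>P. act V (b (y \<otimes> inv z)) y)"
        by (rule sum.reindex_bij_witness[where i = "\<lambda>y. y \<otimes> inv z" and j = "\<lambda>y. y \<otimes> z"])
          (use PA zP z yz subgroup.m_closed[OF P] in \<open>auto simp: m_assoc\<close>)
      finally show ?thesis .
    qed
    ultimately show ?thesis unfolding \<rho>_def using b yz
      by (intro exI[of _ "\<lambda>y. b (y \<otimes> inv z)"]) auto
  qed
  \<comment> \<open>Acting by \<open>k\<close> changes the component at y by y k y^(-1), which lies
    in \<open>K\<close> and so preserves both \<open>B\<close> and \<open>D\<close>.\<close>
  have \<rho>_K: "\<rho> (act V w k) (act V v k)" if "\<rho> w v" "w \<in> C'" and k: "k \<in> K" for w v k
  proof -
    obtain b where b: "\<forall>y\<in>P. b y \<in> B \<and> act V w (inv y) - b y \<in> D" "v = smul V c (\<Sum>y\<in>P. act V (b y) y)"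
      using \<open>\<rho> w v\<close> unfolding \<rho>_def by blast
    have kG: "k \<in> carrier G" using KG k by blast
    have conj: "y \<otimes> k \<otimes> inv y \<in> K" "y \<otimes> k \<otimes> inv y \<in> carrier G" if "y \<in> P" for y
      using normal[OF _ k] PA[OF that] KG by auto
    have bB: "b y \<in> B" if "y \<in> P" for y using b that by blast
    have bB': "act V (b y) (y \<otimes> k \<otimes> inv y) \<in> B" if "y \<in> P" for y
      using inv_subD(7)[OF B bB[OF that], of "y \<otimes> k \<otimes> inv y"] conj[OF that] by blast
    have "act V (act V w k) (inv y) - act V (b y) (y \<otimes> k \<otimes> inv y) \<in> D" if y: "y \<in> P" for y
    proof -
      have wV: "w \<in> vecs V" using C'V[OF \<open>w \<in> C'\<close>] .
      have "act V (act V w k) (inv y) = act V w (inv y \<otimes> (y \<otimes> k \<otimes> inv y))"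
        using wV PA[OF y] kG by (simp add: act_mult[symmetric] m_assoc[symmetric])
      also have "\<dots> = act V (act V w (inv y)) (y \<otimes> k \<otimes> inv y)"
        using wV PA[OF y] conj[OF y] by (intro act_mult) auto
      finally have "act V (act V w k) (inv y) - act V (b y) (y \<otimes> k \<otimes> inv y)
         = act V (act V w (inv y) - b y) (y \<otimes> k \<otimes> inv y)"
        using wV PA[OF y] conj[OF y] BV[OF bB[OF y]] by (simp add: act_diff act_closed)
      then show ?thesis using b y conj[OF y] inv_subD(7)[OF D] by simp
    qed
    moreover have "act V v k = smul V c (\<Sum>y\<in>P. act V (act V (b y) (y \<otimes> k \<otimes> inv y)) y)"
    proof -
      have "act V v k = smul V c (\<Sum>y\<in>P. act V (act V (b y) y) k)"
        using b BV PA kG by (simp add: act_smul act_sum[OF finP] act_closed subspace_sum[OF subspace_vecs])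
      also have "(\<Sum>y\<in>P. act V (act V (b y) y) k) = (\<Sum>y\<in>P. act V (act V (b y) (y \<otimes> k \<otimes> inv y)) y)"
      proof (rule sum.cong[OF refl])
        fix y assume y: "y \<in> P"
        have "act V (act V (b y) y) k = act V (b y) ((y \<otimes> k \<otimes> inv y) \<otimes> y)"
          using BV[OF bB[OF y]] PA[OF y] kG by (simp add: act_mult[symmetric] m_assoc)
        also have "\<dots> = act V (act V (b y) (y \<otimes> k \<otimes> inv y)) y"
          using BV[OF bB[OF y]] PA[OF y] conj[OF y] by (intro act_mult) auto
        finally show "act V (act V (b y) y) k = act V (act V (b y) (y \<otimes> k \<otimes> inv y)) y" .
      qed
      finally show ?thesis .
    qed
    ultimately show ?thesis unfolding \<rho>_def using bB'
      by (intro exI[of _ "\<lambda>y. act V (b y) (y \<otimes> k \<otimes> inv y)"]) auto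
  qed
  have \<rho>_B: "\<rho> b b" if b: "b \<in> B" for b
  proof -
    have "act V b (inv y) \<in> B" if "y \<in> P" for y using inv_subD(7)[OF B b] PA[OF that] by blast
    moreover have "(\<Sum>y\<in>P. act V (act V b (inv y)) y) = (\<Sum>y\<in>P. b)"
      using BV[OF b] PA act_inv_cancel' by (intro sum.cong) auto
    ultimately show ?thesis unfolding \<rho>_def using inv_subD(3)[OF D] avg
      by (intro exI[of _ "\<lambda>y. act V b (inv y)"]) auto
  qed
  have \<rho>_C: "\<rho> x 0" if x: "x \<in> C" for x
  proof -
    have "act V x (inv y) \<in> D" if "y \<in> P" for y using inv_subD(7)[OF C x] PA[OF that] CD by blast
    moreover have "(\<Sum>y\<in>P. act V 0 y) = 0" using PA act_0 by (intro sum.neutral) auto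
    ultimately show ?thesis unfolding \<rho>_def using inv_subD(3)[OF B]
      by (intro exI[of _ "\<lambda>_. 0"]) auto
  qed
  have \<rho>_0: "v \<in> C" if v: "\<rho> 0 v" for v
  proof -
    obtain b where b: "\<forall>y\<in>P. b y \<in> B \<and> act V 0 (inv y) - b y \<in> D" "v = smul V c (\<Sum>y\<in>P. act V (b y) y)"
      using v unfolding \<rho>_def by blast
    have "b y \<in> C" if y: "y \<in> P" for y
    proof -
      have "act V 0 (inv y) - b y \<in> D" using b y by blast
      then have "0 - b y \<in> D" using PA[OF y] by (simp add: act_0)
      then have "0 - (0 - b y) \<in> D" using inv_subD(3,5)[OF D] by blast
      then show ?thesis using b y DB by auto
    qed
    then have "act V (b y) y \<in> C" if "y \<in> P" for y using inv_subD(7)[OF C] that by blast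
    then have "(\<Sum>y\<in>P. act V (b y) y) \<in> C" by (rule inv_sub_sum[OF C])
    then show ?thesis using b inv_subD(6)[OF C] by simp
  qed
  have "\<forall>y\<in>P. \<exists>b\<in>B. act V e (inv y) - b \<in> D"
  proof
    fix y assume y: "y \<in> P"
    have "act V e (inv y) \<in> S" using inv_subD(7)[OF C', of e "inv y"] CC' e PA[OF y] C'S by blast
    then obtain d b where "act V e (inv y) = d + b" "d \<in> D" "b \<in> B" by (auto simp: S_def)
    then show "\<exists>b\<in>B. act V e (inv y) - b \<in> D" by (intro bexI[of _ b]) auto
  qed
  then obtain be where be: "\<forall>y\<in>P. be y \<in> B \<and> act V e (inv y) - be y \<in> D" by metis
  define b where "b = smul V c (\<Sum>y\<in>P. act V (be y) y)"
  have \<rho>_e: "\<rho> e b" unfolding \<rho>_def b_def using be by blast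
  have "act V (be y) y \<in> B" if "y \<in> P" for y using inv_subD(7)[OF B] be PA that by blast
  then have bB: "b \<in> B" unfolding b_def by (intro inv_subD(6)[OF B] inv_sub_sum[OF B])
  have gb: "inv_sub ?A (gen ?A {b})" using BV[OF bB] by (intro inv_sub_gen[OF AG(1)]) auto
  \<comment> \<open>The elements that have a projection in the module generated by \<open>b\<close>.
    They form a submodule containing \<open>C\<close> and \<open>e\<close>, hence \<open>T\<close>
    by simplicity, hence all of \<open>C'\<close>.\<close>
  define \<Theta> where "\<Theta> = {w \<in> C'. \<exists>v\<in>gen ?A {b}. \<rho> w v}"
  have \<Theta>: "inv_sub ?A \<Theta>"
    unfolding submod_def
  proof (intro conjI ballI)
    show "\<Theta> \<subseteq> vecs V" using C'V by (auto simp: \<Theta>_def)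
    show "subspace \<Theta>"
      unfolding subspace_def
    proof (intro conjI ballI allI)
      show "0 \<in> \<Theta>" using \<rho>_C[OF inv_subD(3)[OF C]] inv_subD(3)[OF C'] inv_subD(3)[OF gb] by (auto simp: \<Theta>_def)
      show "x + y \<in> \<Theta>" if "x \<in> \<Theta>" "y \<in> \<Theta>" for x y
        using that \<rho>_add[of x _ y] inv_subD(4)[OF C'] inv_subD(4)[OF gb] unfolding \<Theta>_def by blast
      show "smul V a x \<in> \<Theta>" if "x \<in> \<Theta>" for a x
        using that \<rho>_smul[of x] inv_subD(6)[OF C'] inv_subD(6)[OF gb] unfolding \<Theta>_def by blast
    qed
    fix w g assume w: "w \<in> \<Theta>" and "g \<in> carrier (G\<lparr>carrier := ?A\<rparr>)"
    then have g: "g \<in> ?A" by simp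
    obtain v where v: "v \<in> gen ?A {b}" "\<rho> w v" "w \<in> C'" using w by (auto simp: \<Theta>_def)
    have "\<rho> (act V w g) (act V v g)" using g \<rho>_P[OF v(2,3)] \<rho>_K[OF v(2,3)] by blast
    then show "act V w g \<in> \<Theta>"
      using v inv_subD(7)[OF C' _ g] inv_subD(7)[OF gb _ g] unfolding \<Theta>_def by blast
  qed
  have "T \<inter> \<Theta> = T \<inter> C \<or> T \<inter> \<Theta> = T"
  proof (rule simple)
    show "inv_sub K (T \<inter> \<Theta>)" by (rule inv_sub_Int[OF T inv_sub_mono[OF \<Theta> KA]])
    have "C \<subseteq> \<Theta>" using \<rho>_C CC' inv_subD(3)[OF gb] by (auto simp: \<Theta>_def)
    then show "T \<inter> C \<subseteq> T \<inter> \<Theta>" by blast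
  qed blast
  moreover have "e \<in> \<Theta>" using \<rho>_e CC' e gen_superset[of "{b}" ?A] by (auto simp: \<Theta>_def)
  ultimately have "T \<subseteq> \<Theta>" using e by blast
  moreover have "C \<subseteq> \<Theta>" using \<rho>_C CC' inv_subD(3)[OF gb] by (auto simp: \<Theta>_def)
  ultimately have C'\<Theta>: "C' \<subseteq> \<Theta>" unfolding C'_def by (intro gen_least[OF \<Theta>]) blast
  show ?thesis
  proof (rule that)
    show "b \<in> M" using bB by (simp add: B_def)
    fix f assume "f \<in> M \<inter> gen ?A (C \<union> T)"
    then have f: "f \<in> B" "f \<in> C'" by (auto simp: B_def C'_def)
    then obtain v where v: "v \<in> gen ?A {b}" "\<rho> f v" using C'\<Theta> by (auto simp: \<Theta>_def)
    \<comment> \<open>On \<open>B\<close> the projection is the identity. Comparing this value with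
      \<open>v\<close> exhibits f - v as a projection of 0, hence as an element of
      \<open>C\<close>.\<close>
    have "\<rho> (smul V (- 1) f) (smul V (- 1) v)" by (rule \<rho>_smul[OF v(2) f(2)])
    then have "\<rho> (f + smul V (- 1) f) (f + smul V (- 1) v)"
      by (rule \<rho>_add[OF \<rho>_B[OF f(1)] _ f(2) inv_subD(6)[OF C' f(2)]])
    then have "\<rho> 0 (f - v)" by simp
    then show "\<exists>f'\<in>gen ?A {b}. f - f' \<in> C" using \<rho>_0 v(1) by blast
  qed
qed

end

section \<open>Generating submodules of induced modules\<close>

locale induced_module = group G for G :: "('g, 'b) monoid_scheme" (structure) +
  fixes H K :: "'g set" and V :: "('f::field, 'g, 'v::ab_group_add) gmodule"
  assumes fin: "finite (carrier G)" and H: "subgroup H G"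
    and V: "group_module (G\<lparr>carrier := H\<rparr>) V"
    and K: "subgroup K G" and KH: "K \<subseteq> H"
    and K_normal: "\<lbrakk>g \<in> carrier G; k \<in> K\<rbrakk> \<Longrightarrow> g \<otimes> k \<otimes> inv g \<in> K"
begin

sublocale V: group_module "G\<lparr>carrier := H\<rparr>" V by (fact V)
sublocale W: group_module G "induced G H V" by (rule group_module_induced[OF H V])
sublocale \<Omega>: right_action G "rcosets H" "(#>)" by (rule right_action_rcosets[OF H])

abbreviation "W \<equiv> induced G H V"
abbreviation subK :: "'v set \<Rightarrow> bool" where "subK Z \<equiv> submod (G\<lparr>carrier := K\<rparr>) V Z"

lemma HG: "h \<in> H \<Longrightarrow> h \<in> carrier G" and KG: "k \<in> K \<Longrightarrow> k \<in> carrier G"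
  using subgroup.mem_carrier[OF H] subgroup.mem_carrier[OF K] by auto

lemma rcosetI: "x \<in> carrier G \<Longrightarrow> H #> x \<in> rcosets H"
  by (auto simp: RCOSETS_def)

lemma rcosetE: "C \<in> rcosets H \<Longrightarrow> (\<And>x. x \<in> carrier G \<Longrightarrow> C = H #> x \<Longrightarrow> P) \<Longrightarrow> P"
  by (auto simp: RCOSETS_def)

lemma coset_act: "\<lbrakk>x \<in> carrier G; g \<in> carrier G\<rbrakk> \<Longrightarrow> H #> x #> g = H #> (x \<otimes> g)"
  using subgroup.subset[OF H] by (simp add: coset_mult_assoc)

lemma K_trivial:
  assumes C: "C \<in> rcosets H" and k: "k \<in> K"
  shows "C #> k = C"
proof -
  obtain x where x: "x \<in> carrier G" "C = H #> x" using rcosetE[OF C] .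
  have "x \<otimes> k \<otimes> inv x \<in> H" using K_normal[OF x(1) k] KH by blast
  moreover have "x \<otimes> k = (x \<otimes> k \<otimes> inv x) \<otimes> x" using x KG[OF k] by (simp add: m_assoc)
  ultimately have "x \<otimes> k \<in> H #> x" unfolding r_coset_def by blast
  then have e: "H #> x = H #> (x \<otimes> k)" by (rule repr_independence[OF _ x(1) H])
  have "C #> k = H #> (x \<otimes> k)" unfolding x(2) by (rule coset_act[OF x(1) KG[OF k]])
  then show ?thesis using e x(2) by metis
qed

lemma WD:
  assumes "f \<in> vecs W"
  shows "x \<in> carrier G \<Longrightarrow> f x \<in> vecs V" "x \<notin> carrier G \<Longrightarrow> f x = 0"
    "\<lbrakk>h \<in> H; x \<in> carrier G\<rbrakk> \<Longrightarrow> f (h \<otimes> x) = act V (f x) (inv h)"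
  using assms by (auto simp: induced_def)

lemma act_W: "x \<in> carrier G \<Longrightarrow> act W f g x = f (x \<otimes> inv g)"
  by (simp add: induced_def)

lemma smul_W: "smul W c f x = smul V c (f x)"
  by (simp add: induced_def)

definition supported :: "'g set set \<Rightarrow> ('g \<Rightarrow> 'v) set" where
  "supported D = {f \<in> vecs W. \<forall>x\<in>carrier G. f x \<noteq> 0 \<longrightarrow> H #> x \<in> D}"

text \<open>The quantifier runs over all invariant subspaces supported on \<open>D\<close>, not over
  the restrictions of one module, so that bounds for disjoint invariant sets of cosets add up along
  a filtration. In use, \<open>A\<close> is a union of two subgroups.\<close>

definition gen_by :: "'g set \<Rightarrow> nat \<Rightarrow> 'g set set \<Rightarrow> bool" where
  "gen_by A n D \<longleftrightarrow> (\<forall>M. W.inv_sub A M \<and> M \<subseteq> supported D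
     \<longrightarrow> (\<exists>S\<subseteq>M. finite S \<and> card S \<le> n \<and> M \<subseteq> W.gen A S))"

lemma gen_by_empty: 
  assumes "A \<subseteq> carrier G"
  shows "gen_by A 0 {}"
  unfolding gen_by_def
proof (intro allI impI)
  fix M assume M: "W.inv_sub A M \<and> M \<subseteq> supported {}"
  have "f = 0" if "f \<in> M" for f
  proof
    fix x show "f x = 0 x" using that M WD(2)[of f x] by (auto simp: supported_def zero_fun_def)
  qed
  moreover have "0 \<in> W.gen A {}" by (rule W.inv_subD(3)[OF W.inv_sub_gen[OF assms]]) simp
  ultimately show "\<exists>S\<subseteq>M. finite S \<and> card S \<le> 0 \<and> M \<subseteq> W.gen A S" by (intro exI[of _ "{}"]) auto
qed

lemma gen_by_mono:
  assumes "gen_by A n D" "A \<subseteq> B" "n \<le> m"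
  shows "gen_by B m D"
  unfolding gen_by_def
proof (intro allI impI)
  fix M assume M: "W.inv_sub B M \<and> M \<subseteq> supported D"
  then have "W.inv_sub A M" using W.inv_sub_mono assms(2) by blast
  then obtain S where "S \<subseteq> M" "finite S" "card S \<le> n" "M \<subseteq> W.gen A S"
    using assms(1) M unfolding gen_by_def by blast
  then show "\<exists>S\<subseteq>M. finite S \<and> card S \<le> m \<and> M \<subseteq> W.gen B S"
    using W.gen_mono[OF assms(2) subset_refl, of S] assms(3) by (intro exI[of _ S]) auto
qed

text \<open>Restriction of functions to the cosets in \<open>D\<close> commutes with
  \<open>A\<close> because \<open>D\<close> is invariant. Generators of the restricted module are
  lifted to \<open>M\<close>; the remaining error lies in the kernel of the restriction and is
  supported on \<open>E\<close>.\<close>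

lemma gen_by_Un:
  assumes A: "A \<subseteq> carrier G" and gen: "gen_by A n D" "gen_by A m E"
    and D: "\<And>C g. \<lbrakk>C \<in> rcosets H; g \<in> A\<rbrakk> \<Longrightarrow> C #> g \<in> D \<longleftrightarrow> C \<in> D"
  shows "gen_by A (n + m) (D \<union> E)"
  unfolding gen_by_def
proof (intro allI impI)
  fix M assume "W.inv_sub A M \<and> M \<subseteq> supported (D \<union> E)"
  then have M: "W.inv_sub A M" and MDE: "M \<subseteq> supported (D \<union> E)" by auto
  define r where "r f = (\<lambda>x. if x \<in> carrier G \<and> H #> x \<in> D then f x else 0)" for f :: "'g \<Rightarrow> 'v"
  have r_supp: "r f \<in> supported D" if f: "f \<in> vecs W" for f
  proof -
    have "H #> (h \<otimes> x) = H #> x" if "h \<in> H" "x \<in> carrier G" for h x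
      using that HG coset_mult_assoc[OF subgroup.subset[OF H], of h x] subgroup.rcos_const[OF H is_group] by simp
    moreover have "0 \<in> vecs V" using V.subspace_0[OF V.subspace_vecs] .
    moreover have "act V 0 (inv h) = 0" if "h \<in> H" for h
      using that V.act_0[of "inv h"] subgroup.m_inv_closed[OF H] by simp
    ultimately have "r f \<in> vecs W" using f HG by (auto simp: r_def induced_def)
    then show ?thesis by (auto simp: supported_def r_def)
  qed
  have r_add: "r (f + g) = r f + r g" and r_smul: "r (smul W c f) = smul W c (r f)" for f g c
    by (auto simp: r_def fun_eq_iff smul_W)
  have r_diff: "r (f - g) = r f - r g" for f g by (auto simp: r_def fun_eq_iff)
  have r_act: "r (act W f g) = act W (r f) g" if g: "g \<in> A" for f g
  proof
    fix x
    have gG: "g \<in> carrier G" using g A by blast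
    show "r (act W f g) x = act W (r f) g x"
    proof (cases "x \<in> carrier G")
      case True
      have "H #> (x \<otimes> inv g) #> g = H #> x" using True gG by (simp add: coset_act m_assoc)
      then have "H #> (x \<otimes> inv g) \<in> D \<longleftrightarrow> H #> x \<in> D"
        using D[OF rcosetI g, of "x \<otimes> inv g"] True gG by simp
      then show ?thesis using True gG by (simp add: r_def act_W)
    qed (simp add: r_def induced_def)
  qed
  have image: "W.inv_sub A (r ` N)" if N: "W.inv_sub A N" for N
    unfolding submod_def W.subspace_def
  proof (intro conjI ballI allI)
    note sub = W.inv_subD[OF N]
    show "r ` N \<subseteq> vecs W" using r_supp sub(1) by (auto simp: supported_def)
    have "r 0 = 0" by (auto simp: r_def fun_eq_iff)
    then show "0 \<in> r ` N" using sub(3) by (metis imageI)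
    show "v + w \<in> r ` N" if "v \<in> r ` N" "w \<in> r ` N" for v w
      using that sub(4) r_add by (metis (no_types, lifting) image_iff)
    show "smul W c v \<in> r ` N" if "v \<in> r ` N" for c v
      using that sub(6) r_smul by (metis (no_types, lifting) image_iff)
    fix v g assume v: "v \<in> r ` N" and "g \<in> carrier (G\<lparr>carrier := A\<rparr>)"
    then have g: "g \<in> A" by simp
    obtain f where f: "f \<in> N" "v = r f" using v by blast
    have "act W v g = r (act W f g)" using r_act[OF g, of f] f by simp
    then show "act W v g \<in> r ` N" using sub(7)[OF f(1) g] by blast
  qed
  note subM = W.inv_subD[OF M]
  have "r ` M \<subseteq> supported D" using r_supp subM(1) by auto
  with image[OF M] have "W.inv_sub A (r ` M) \<and> r ` M \<subseteq> supported D" by (rule conjI)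
  then have "\<exists>S\<subseteq>r ` M. finite S \<and> card S \<le> n \<and> r ` M \<subseteq> W.gen A S"
    by (rule gen(1)[unfolded gen_by_def, THEN spec, THEN mp])
  then obtain S1 where S1: "S1 \<subseteq> r ` M" "finite S1" "card S1 \<le> n" "r ` M \<subseteq> W.gen A S1"
    by blast
  obtain T1 where T1: "T1 \<subseteq> M" "inj_on r T1" "S1 = r ` T1" using S1(1) unfolding subset_image_inj by blast
  define M0 where "M0 = {f \<in> M. r f = 0}"
  have M0: "W.inv_sub A M0"
    unfolding submod_def W.subspace_def
  proof (intro conjI ballI allI)
    show "M0 \<subseteq> vecs W" using subM(1) by (auto simp: M0_def)
    have "r 0 = 0" by (auto simp: r_def fun_eq_iff)
    then show "0 \<in> M0" using subM(3) by (simp add: M0_def)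
    show "v + w \<in> M0" if "v \<in> M0" "w \<in> M0" for v w using that subM(4) by (simp add: M0_def r_add)
    show "smul W c v \<in> M0" if "v \<in> M0" for c v using that subM(6) by (simp add: M0_def r_smul)
    show "act W v g \<in> M0" if "v \<in> M0" "g \<in> carrier (G\<lparr>carrier := A\<rparr>)" for v g
      using that subM(7) A W.act_0 by (auto simp: M0_def r_act)
  qed
  have "M0 \<subseteq> supported E"
  proof
    fix f assume f: "f \<in> M0"
    have "H #> x \<in> E" if x: "x \<in> carrier G" "f x \<noteq> 0" for x
    proof -
      have "H #> x \<in> D \<union> E" using f x MDE by (auto simp: M0_def supported_def)
      moreover have "r f x = 0" using f by (simp add: M0_def)
      ultimately show ?thesis using x by (auto simp: r_def split: if_splits)
    qed
    then show "f \<in> supported E" using f subM(1) by (auto simp: supported_def M0_def)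
  qed
  then obtain S2 where S2: "S2 \<subseteq> M0" "finite S2" "card S2 \<le> m" "M0 \<subseteq> W.gen A S2"
    using gen(2) M0 unfolding gen_by_def by blast
  have finT1: "finite T1" using T1 S1 finite_imageD by blast
  show "\<exists>S\<subseteq>M. finite S \<and> card S \<le> n + m \<and> M \<subseteq> W.gen A S"
  proof (intro exI[of _ "T1 \<union> S2"] conjI)
    show "T1 \<union> S2 \<subseteq> M" using T1 S2 by (auto simp: M0_def)
    show "finite (T1 \<union> S2)" using finT1 S2 by simp
    have "card T1 \<le> n" using T1 S1 card_image by metis
    then show "card (T1 \<union> S2) \<le> n + m" using card_Un_le[of T1 S2] S2 by simp
    have gV: "T1 \<subseteq> vecs W" "T1 \<union> S2 \<subseteq> vecs W" using T1 S2 subM(1) by (auto simp: M0_def)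
    have g: "W.inv_sub A (W.gen A (T1 \<union> S2))" by (rule W.inv_sub_gen[OF A gV(2)])
    have g1: "W.inv_sub A (W.gen A T1)" by (rule W.inv_sub_gen[OF A gV(1)])
    have "S1 \<subseteq> r ` W.gen A T1" using T1 W.gen_superset by blast
    then have "r ` M \<subseteq> r ` W.gen A T1" using S1(4) W.gen_least[OF image[OF g1]] by blast
    show "M \<subseteq> W.gen A (T1 \<union> S2)"
    proof
      fix f assume f: "f \<in> M"
      then obtain f' where f': "f' \<in> W.gen A T1" "r f = r f'" using \<open>r ` M \<subseteq> r ` W.gen A T1\<close> by blast
      have "f' \<in> M" using f' W.gen_least[OF M T1(1)] by blast
      then have "f - f' \<in> M0" using f f' subM(5) by (simp add: M0_def r_diff)
      then have "f - f' \<in> W.gen A (T1 \<union> S2)" using S2(4) W.gen_mono[OF subset_refl, of S2 "T1 \<union> S2" A] by blast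
      moreover have "f' \<in> W.gen A (T1 \<union> S2)" using f' W.gen_mono[OF subset_refl, of T1 "T1 \<union> S2" A] by blast
      ultimately have "f - f' + f' \<in> W.gen A (T1 \<union> S2)" by (rule W.inv_subD(4)[OF g])
      then show "f \<in> W.gen A (T1 \<union> S2)" by simp
    qed
  qed
qed

lemma gen_by_Union:
  assumes A: "A \<subseteq> carrier G" and "finite \<D>" and "\<And>D. D \<in> \<D> \<Longrightarrow> gen_by A (n D) D"
    and "\<And>D C g. \<lbrakk>D \<in> \<D>; C \<in> rcosets H; g \<in> A\<rbrakk> \<Longrightarrow> C #> g \<in> D \<longleftrightarrow> C \<in> D"
  shows "gen_by A (\<Sum>D\<in>\<D>. n D) (\<Union>\<D>)"
  using assms(2-)
proof (induction \<D> rule: finite_induct)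
  case empty
  show ?case using gen_by_empty[OF A] by simp
next
  case (insert D \<D>)
  have "gen_by A (n D + (\<Sum>D\<in>\<D>. n D)) (D \<union> \<Union>\<D>)"
    by (rule gen_by_Un[OF A]) (use insert in auto)
  then show ?case using insert by simp
qed

lemma min_gens_le:
  assumes A: "A \<subseteq> carrier G" and gen: "gen_by A n (rcosets H)" and M: "submod G W M"
  shows "min_gens G W M \<le> n"
proof -
  have GM: "W.inv_sub (carrier G) M" using M by (simp add: submod_def)
  have "M \<subseteq> supported (rcosets H)" using M by (auto simp: supported_def submod_def rcosetI)
  then obtain S where S: "S \<subseteq> M" "finite S" "card S \<le> n" "M \<subseteq> W.gen A S"
    using gen W.inv_sub_mono[OF GM A] unfolding gen_by_def by blast
  have "submod_generated G W S = W.gen (carrier G) S"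
    by (simp add: submod_generated_def submod_def)
  moreover have "W.gen (carrier G) S = M"
    using S W.gen_mono[OF A subset_refl, of S] W.gen_least[OF GM S(1)] by blast
  ultimately have "\<exists>S'. S' \<subseteq> M \<and> finite S' \<and> card S' = card S \<and> submod_generated G W S' = M" using S by blast
  then have "min_gens G W M \<le> card S" unfolding min_gens_def by (rule Least_le)
  then show ?thesis using S by simp
qed

subsection \<open>Leading coefficients\<close>

text \<open>The analogue of the ideals of leading coefficients in Hilbert's basis theorem, with
  \<open>r\<close> in the role of the monomial order. It depends on the representative
  \<open>x\<close> and not only on its coset, because values along a coset differ by the action of
  \<open>H\<close>.\<close>

definition leading :: "('g \<Rightarrow> 'v) set \<Rightarrow> ('g set \<Rightarrow> nat) \<Rightarrow> 'g \<Rightarrow> 'v set" where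
  "leading M r x = {f x | f. f \<in> M \<and> (\<forall>y\<in>carrier G. f y \<noteq> 0 \<longrightarrow> r (H #> y) \<le> r (H #> x))}"

text \<open>The conjugate x^(-1) k x lies in \<open>K\<close>. It acts on the value at
  \<open>x\<close> as \<open>k\<close> does, and it fixes every coset, so no position in the support
  moves.\<close>

lemma subK_leading:
  assumes M: "W.inv_sub A M" and A: "A \<subseteq> carrier G" and KA: "K \<subseteq> A" and x: "x \<in> carrier G"
  shows "subK (leading M r x)"
  unfolding submod_def V.subspace_def
proof (intro conjI ballI allI)
  note sub = W.inv_subD[OF M]
  show "leading M r x \<subseteq> vecs V" using WD(1)[OF _ x] sub(1) by (auto simp: leading_def)
  show "0 \<in> leading M r x" unfolding leading_def using sub(3) by (auto intro!: exI[of _ 0])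
  show "v + w \<in> leading M r x" if vw: "v \<in> leading M r x" "w \<in> leading M r x" for v w
  proof -
    obtain f g where fg: "v = f x" "f \<in> M" "\<forall>y\<in>carrier G. f y \<noteq> 0 \<longrightarrow> r (H #> y) \<le> r (H #> x)"
      "w = g x" "g \<in> M" "\<forall>y\<in>carrier G. g y \<noteq> 0 \<longrightarrow> r (H #> y) \<le> r (H #> x)"
      using vw unfolding leading_def by blast
    moreover have "r (H #> y) \<le> r (H #> x)" if "y \<in> carrier G" "(f + g) y \<noteq> 0" for y
    proof -
      have "f y \<noteq> 0 \<or> g y \<noteq> 0" using that(2) by auto
      then show ?thesis using fg that(1) by blast
    qed
    moreover have "f + g \<in> M" using sub(4) fg by blast
    ultimately show ?thesis unfolding leading_def using fg
      by (intro CollectI exI[of _ "f + g"]) simp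
  qed
  show "smul V c v \<in> leading M r x" if v: "v \<in> leading M r x" for c v
  proof -
    obtain f where "v = f x" "f \<in> M" "\<forall>y\<in>carrier G. f y \<noteq> 0 \<longrightarrow> r (H #> y) \<le> r (H #> x)"
      using v unfolding leading_def by blast
    then show ?thesis unfolding leading_def using sub(6)
      by (intro CollectI exI[of _ "smul W c f"]) (auto simp: smul_W)
  qed
  fix v k assume v: "v \<in> leading M r x" and "k \<in> carrier (G\<lparr>carrier := K\<rparr>)"
  then have k: "k \<in> K" by simp
  obtain f where f: "v = f x" "f \<in> M" "\<forall>y\<in>carrier G. f y \<noteq> 0 \<longrightarrow> r (H #> y) \<le> r (H #> x)"
    using v by (auto simp: leading_def)
  define g where "g = inv x \<otimes> k \<otimes> inv (inv x)"
  have g: "g \<in> K" "g \<in> carrier G" unfolding g_def using K_normal[OF _ k, of "inv x"] x KG by auto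
  have gi: "inv g \<in> K" using subgroup.m_inv_closed[OF K g(1)] .
  have "x \<otimes> inv g = inv k \<otimes> x"
    using x KG[OF k] by (simp add: g_def inv_mult_group m_assoc[symmetric])
  then have "act W f g x = f (inv k \<otimes> x)" using x by (simp add: act_W)
  also have "\<dots> = act V v k"
    using WD(3)[of f "inv k" x] f x k KH KG[OF k] sub(1) subgroup.m_inv_closed[OF H, of k] by auto
  finally have "act V v k = act W f g x" ..
  moreover have "act W f g \<in> M" using sub(7)[OF f(2)] g KA by blast
  moreover have "r (H #> y) \<le> r (H #> x)" if y: "y \<in> carrier G" "act W f g y \<noteq> 0" for y
  proof -
    have "f (y \<otimes> inv g) \<noteq> 0" using y by (simp add: act_W)
    moreover have "H #> (y \<otimes> inv g) = H #> y"
      using K_trivial[OF rcosetI[OF y(1)] gi] y g by (simp add: coset_act)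
    ultimately show ?thesis using f(3) y g by (metis m_closed inv_closed)
  qed
  ultimately show "act V v k \<in> leading M r x" unfolding leading_def by blast
qed

text \<open>Translation by \<open>g\<close> carries the value at \<open>x\<close> to x g. A position
  of the translated support comes either from the coset of \<open>x\<close>, by injectivity of
  \<open>r\<close>, or from a lower one, which stays low by \<open>lower\<close>.\<close>

lemma leading_mono:
  assumes "inj_on r D" and "M \<subseteq> supported D" and "W.inv_sub A M" and x: "x \<in> carrier G"
    and D: "H #> x \<in> D" and g: "g \<in> A" "g \<in> carrier G"
    and lower: "\<And>C. \<lbrakk>C \<in> D; r C < r (H #> x)\<rbrakk> \<Longrightarrow> r (C #> g) < r (H #> (x \<otimes> g))"
  shows "leading M r x \<subseteq> leading M r (x \<otimes> g)"
proof
  fix v assume "v \<in> leading M r x"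
  then obtain f where f: "v = f x" "f \<in> M" "\<And>y. \<lbrakk>y \<in> carrier G; f y \<noteq> 0\<rbrakk> \<Longrightarrow> r (H #> y) \<le> r (H #> x)"
    by (auto simp: leading_def)
  have "act W f g (x \<otimes> g) = v" using x g f by (simp add: act_W m_assoc)
  moreover have "act W f g \<in> M" using W.inv_subD(7)[OF assms(3)] f g by blast
  moreover have "r (H #> y) \<le> r (H #> (x \<otimes> g))" if y: "y \<in> carrier G" "act W f g y \<noteq> 0" for y
  proof -
    define z where "z = y \<otimes> inv g"
    have z: "z \<in> carrier G" "f z \<noteq> 0" using y g by (auto simp: z_def act_W)
    have zy: "H #> z #> g = H #> y" using y g by (simp add: z_def coset_act m_assoc)
    have "H #> z \<in> D" using z f(2) assms(2) by (auto simp: supported_def)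
    show ?thesis
    proof (cases "r (H #> z) < r (H #> x)")
      case True
      then show ?thesis using lower[OF \<open>H #> z \<in> D\<close>] zy by simp
    next
      case False
      then have "r (H #> z) = r (H #> x)" using f(3)[OF z] by simp
      then have "H #> z = H #> x" using assms(1) D \<open>H #> z \<in> D\<close> by (simp add: inj_on_def)
      then show ?thesis using zy x g by (simp add: coset_act)
    qed
  qed
  ultimately show "v \<in> leading M r (x \<otimes> g)" unfolding leading_def by blast
qed

text \<open>Leading modules grow along \<open>xs\<close>, so a submodule \<open>Z\<close> reached at
  one position is available at all later ones without further generators. Every new generator
  enlarges \<open>Z\<close> strictly and so uses up one unit of its height; n of them serve the
  whole chain. In the conclusion, \<open>M'\<close> stands for whatever module the generators of all
  chains will finally generate, so growth along \<open>xs\<close> is assumed for submodules of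
  \<open>M\<close> as well.\<close>

lemma chain_generators:
  assumes M: "W.inv_sub A M" and A: "A \<subseteq> carrier G" and KA: "K \<subseteq> A"
    and step: "\<And>M'. \<lbrakk>W.inv_sub A M'; M' \<subseteq> M\<rbrakk> \<Longrightarrow> successively (\<lambda>x y. leading M' r x \<subseteq> leading M' r y) xs"
    and xs: "set xs \<subseteq> carrier G" and Z: "subK Z" "xs \<noteq> [] \<Longrightarrow> Z \<subseteq> leading M r (hd xs)" and h: "height_le subK n Z"
  shows "\<exists>S\<subseteq>M. finite S \<and> card S \<le> n \<and> (\<forall>M'. W.inv_sub A M' \<and> M' \<subseteq> M \<and> S \<subseteq> M'
    \<and> (xs \<noteq> [] \<longrightarrow> Z \<subseteq> leading M' r (hd xs)) \<longrightarrow> (\<forall>x\<in>set xs. leading M r x \<subseteq> leading M' r x))"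
  using step xs Z h
proof (induction xs arbitrary: n Z)
  case Nil
  then show ?case by (intro exI[of _ "{}"]) auto
next
  case (Cons x xs)
  note stepC = Cons.prems(1)
  have x: "x \<in> carrier G" using Cons.prems by simp
  have step': "successively (\<lambda>x y. leading M' r x \<subseteq> leading M' r y) xs" if "W.inv_sub A M'" "M' \<subseteq> M" for M'
    using stepC[OF that] by (cases xs) auto
  have hd_step: "xs \<noteq> [] \<Longrightarrow> leading M' r x \<subseteq> leading M' r (hd xs)" if "W.inv_sub A M'" "M' \<subseteq> M" for M'
    using stepC[OF that] by (cases xs) auto
  have sub_x: "subK (leading M' r x)" if "W.inv_sub A M'" for M'
    by (rule subK_leading[OF that A KA x])
  from Cons.prems(3-5) show ?case
  proof (induction n arbitrary: Z)
    case 0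
    then have "\<not> Z \<subset> leading M r x" using sub_x[OF M] by simp
    then have Z: "Z = leading M r x" using 0 by auto
    have "xs \<noteq> [] \<Longrightarrow> Z \<subseteq> leading M r (hd xs)" using hd_step[OF M subset_refl] Z by simp
    from Cons.IH[OF step' _ 0(1) this 0(3)] Cons.prems(2)
    obtain S where S: "S \<subseteq> M" "finite S" "card S \<le> 0" "\<And>M'. \<lbrakk>W.inv_sub A M'; M' \<subseteq> M; S \<subseteq> M';
      xs \<noteq> [] \<longrightarrow> Z \<subseteq> leading M' r (hd xs)\<rbrakk> \<Longrightarrow> \<forall>x\<in>set xs. leading M r x \<subseteq> leading M' r x" by auto
    show ?case
    proof (intro exI[of _ S] conjI S(1-3) allI impI)
      fix M' assume M': "W.inv_sub A M' \<and> M' \<subseteq> M \<and> S \<subseteq> M' \<and> (x # xs \<noteq> [] \<longrightarrow> Z \<subseteq> leading M' r (hd (x # xs)))"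
      then have "Z \<subseteq> leading M' r x" by simp
      moreover from this have "xs \<noteq> [] \<longrightarrow> Z \<subseteq> leading M' r (hd xs)" using hd_step[of M'] M' by blast
      ultimately show "\<forall>y\<in>set (x # xs). leading M r y \<subseteq> leading M' r y" using S(4)[of M'] M' Z by simp
    qed
  next
    case (Suc n)
    show ?case
    proof (cases "Z = leading M r x")
      case Z: True
      \<comment> \<open>Nothing is missing at \<open>x\<close>, so \<open>Z\<close> is handed on to
        the next position with the height unchanged.\<close>
      have "xs \<noteq> [] \<Longrightarrow> Z \<subseteq> leading M r (hd xs)" using hd_step[OF M subset_refl] Z by simp
      from Cons.IH[OF step' _ Suc.prems(1) this Suc.prems(3)] Cons.prems(2)
      obtain S where S: "S \<subseteq> M" "finite S" "card S \<le> Suc n" "\<And>M'. \<lbrakk>W.inv_sub A M'; M' \<subseteq> M; S \<subseteq> M';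
        xs \<noteq> [] \<longrightarrow> Z \<subseteq> leading M' r (hd xs)\<rbrakk> \<Longrightarrow> \<forall>x\<in>set xs. leading M r x \<subseteq> leading M' r x" by auto
      show ?thesis
      proof (intro exI[of _ S] conjI S(1-3) allI impI)
        fix M' assume M': "W.inv_sub A M' \<and> M' \<subseteq> M \<and> S \<subseteq> M' \<and> (x # xs \<noteq> [] \<longrightarrow> Z \<subseteq> leading M' r (hd (x # xs)))"
        then have "Z \<subseteq> leading M' r x" by simp
        moreover from this have "xs \<noteq> [] \<longrightarrow> Z \<subseteq> leading M' r (hd xs)" using hd_step[of M'] M' by blast
        ultimately show "\<forall>y\<in>set (x # xs). leading M r y \<subseteq> leading M' r y" using S(4)[of M'] M' Z by simp
      qed
    next
      case False
      then obtain v where v: "v \<in> leading M r x" "v \<notin> Z" using Suc.prems(2) by auto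
      then obtain f where f: "v = f x" "f \<in> M" "\<forall>y\<in>carrier G. f y \<noteq> 0 \<longrightarrow> r (H #> y) \<le> r (H #> x)"
        by (auto simp: leading_def)
      \<comment> \<open>A function with a leading coefficient outside \<open>Z\<close> becomes a
        generator, and the same position is treated again with the larger submodule and smaller
        height.\<close>
      define Z1 where "Z1 = V.gen K (insert v Z)"
      have vZ: "insert v Z \<subseteq> leading M r x" using v Suc.prems(2) by simp
      have KC: "K \<subseteq> carrier (G\<lparr>carrier := H\<rparr>)" using KH by simp
      have "insert v Z \<subseteq> vecs V" using vZ sub_x[OF M] unfolding submod_def by blast
      from V.inv_sub_gen[OF KC this] have Z1: "subK Z1" unfolding Z1_def by simp
      have "Z \<subset> Z1" using V.gen_superset[of "insert v Z" K] v unfolding Z1_def by auto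
      then have h1: "height_le subK n Z1" using Suc.prems(3) Z1 by simp
      have Z1_least: "Z1 \<subseteq> X" if "subK X" "insert v Z \<subseteq> X" for X
        unfolding Z1_def using V.gen_least[of K X] that by simp
      obtain S where S: "S \<subseteq> M" "finite S" "card S \<le> n" "\<And>M'. \<lbrakk>W.inv_sub A M'; M' \<subseteq> M; S \<subseteq> M';
        Z1 \<subseteq> leading M' r x\<rbrakk> \<Longrightarrow> \<forall>y\<in>set (x # xs). leading M r y \<subseteq> leading M' r y"
        using Suc.IH[OF Z1 _ h1] Z1_least[OF sub_x[OF M] vZ] by auto
      show ?thesis
      proof (intro exI[of _ "insert f S"] conjI allI impI)
        show "insert f S \<subseteq> M" "finite (insert f S)" using S f by auto
        show "card (insert f S) \<le> Suc n" using S by (simp add: card_insert_if)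
        fix M' assume M': "W.inv_sub A M' \<and> M' \<subseteq> M \<and> insert f S \<subseteq> M' \<and> (x # xs \<noteq> [] \<longrightarrow> Z \<subseteq> leading M' r (hd (x # xs)))"
        then have "v \<in> leading M' r x" using f unfolding leading_def by blast
        then have "Z1 \<subseteq> leading M' r x" using M' by (intro Z1_least sub_x) auto
        then show "\<forall>y\<in>set (x # xs). leading M r y \<subseteq> leading M' r y" using S(4)[of M'] M' by auto
      qed
    qed
  qed
qed

text \<open>Leading modules are compared at compatible representatives only. These arise from the
  first one by successive multiplication with the elements of \<open>N\<close> that realise the
  steps of the chain.\<close>

lemma coset_chain_reps:
  assumes "successively (\<Omega>.lower_le N D r) (C # cs)" and "N \<subseteq> carrier G" and "x \<in> carrier G" "C = H #> x"
  shows "\<exists>xs. set xs \<subseteq> carrier G \<and> map (\<lambda>x. H #> x) (x # xs) = C # cs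
    \<and> successively (\<lambda>x y. H #> x \<in> D \<and> (\<exists>g\<in>N. y = x \<otimes> g \<and> (\<forall>C\<in>D. r C < r (H #> x) \<longrightarrow> r (C #> g) < r (H #> y)))) (x # xs)"
  using assms
proof (induction cs arbitrary: C x)
  case Nil
  then show ?case by (intro exI[of _ "[]"]) simp
next
  case (Cons C' cs)
  have "\<Omega>.lower_le N D r C C'" using Cons.prems by simp
  then obtain g where g: "g \<in> N" "C #> g = C'" "C \<in> D" "\<forall>E\<in>D. r E < r C \<longrightarrow> r (E #> g) < r C'"
    unfolding \<Omega>.lower_le_def by blast
  have gG: "g \<in> carrier G" using g Cons.prems(2) by blast
  have C': "C' = H #> (x \<otimes> g)" using g(2) Cons.prems gG by (simp add: coset_act)
  obtain xs where xs: "set xs \<subseteq> carrier G" "map (\<lambda>x. H #> x) ((x \<otimes> g) # xs) = C' # cs"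
    "successively (\<lambda>x y. H #> x \<in> D \<and> (\<exists>g\<in>N. y = x \<otimes> g \<and> (\<forall>C\<in>D. r C < r (H #> x) \<longrightarrow> r (C #> g) < r (H #> y)))) ((x \<otimes> g) # xs)"
    using Cons.IH[of C' "x \<otimes> g"] Cons.prems gG C' by auto
  show ?case
    using xs g gG Cons.prems(3,4) C' by (intro exI[of _ "(x \<otimes> g) # xs"]) auto
qed

text \<open>With l generators from each chain, the generated module has the same leading modules as
  \<open>M\<close> at some representative of each coset in \<open>D\<close>. Cancelling leading
  terms then shows that it is all of \<open>M\<close>.\<close>

lemma gen_by_chains:
  assumes N: "subgroup N G" and part: "\<Omega>.chain_partition N D r css" and DX: "D \<subseteq> rcosets H"
    and l: "height_le subK l {0}"
  shows "gen_by (N \<union> K) (l * length css) D"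
  unfolding gen_by_def
proof (intro allI impI)
  let ?A = "N \<union> K"
  fix M assume "W.inv_sub ?A M \<and> M \<subseteq> supported D"
  then have M: "W.inv_sub ?A M" and MD: "M \<subseteq> supported D" by auto
  have NG: "N \<subseteq> carrier G" and AG: "?A \<subseteq> carrier G"
    using subgroup.subset[OF N] subgroup.subset[OF K] by auto
  have inj: "inj_on r D" and cover: "\<Union> (set ` set css) = D"
    and succ: "\<And>cs. cs \<in> set css \<Longrightarrow> successively (\<Omega>.lower_le N D r) cs"
    using part by (auto simp: \<Omega>.chain_partition_def)
  have sub0: "subK {0}" using V.inv_sub_0[of K] KH by simp
  have "\<exists>S\<subseteq>M. finite S \<and> card S \<le> l \<and> (\<forall>M'. W.inv_sub ?A M' \<and> M' \<subseteq> M \<and> S \<subseteq> M' \<longrightarrow>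
     (\<forall>C\<in>set cs. \<exists>x\<in>carrier G. C = H #> x \<and> leading M r x \<subseteq> leading M' r x))" if cs: "cs \<in> set css" for cs
  proof (cases cs)
    case Nil
    then show ?thesis by (intro exI[of _ "{}"]) auto
  next
    case (Cons C cs')
    have "C \<in> D" using cs Cons cover by force
    then obtain x where x: "x \<in> carrier G" "C = H #> x" using DX rcosetE by blast
    obtain xs where xs: "set xs \<subseteq> carrier G" "map (\<lambda>x. H #> x) (x # xs) = cs"
      "successively (\<lambda>x y. H #> x \<in> D \<and> (\<exists>g\<in>N. y = x \<otimes> g \<and> (\<forall>C\<in>D. r C < r (H #> x) \<longrightarrow> r (C #> g) < r (H #> y)))) (x # xs)"
      using coset_chain_reps[OF succ[OF cs, unfolded Cons] NG x] Cons by auto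
    have s1: "successively (\<lambda>x y. leading M' r x \<subseteq> leading M' r y) (x # xs)"
      if M': "W.inv_sub ?A M'" "M' \<subseteq> M" for M'
    proof (rule successively_mono[OF xs(3)])
      fix y z assume y: "y \<in> set (x # xs)" "z \<in> set (x # xs)"
        and "H #> y \<in> D \<and> (\<exists>g\<in>N. z = y \<otimes> g \<and> (\<forall>C\<in>D. r C < r (H #> y) \<longrightarrow> r (C #> g) < r (H #> z)))"
      then obtain g where g: "H #> y \<in> D" "g \<in> N" "z = y \<otimes> g"
        "\<And>C. \<lbrakk>C \<in> D; r C < r (H #> y)\<rbrakk> \<Longrightarrow> r (C #> g) < r (H #> (y \<otimes> g))" by blast
      have "y \<in> carrier G" using y x xs by auto
      then show "leading M' r y \<subseteq> leading M' r z"
        unfolding g(3) using leading_mono[OF inj _ M'(1) _ g(1) _ _ g(4)] g(2) NG MD M'(2) by blast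
    qed
    have s2: "set (x # xs) \<subseteq> carrier G" using x xs by simp
    have s3: "{0} \<subseteq> leading M r (hd (x # xs))" if "x # xs \<noteq> []"
      using V.inv_subD(3)[of K] subK_leading[OF M AG _ x(1)] by simp
    have "\<exists>S\<subseteq>M. finite S \<and> card S \<le> l \<and> (\<forall>M'. W.inv_sub ?A M' \<and> M' \<subseteq> M \<and> S \<subseteq> M'
        \<and> (x # xs \<noteq> [] \<longrightarrow> {0} \<subseteq> leading M' r (hd (x # xs)))
        \<longrightarrow> (\<forall>x\<in>set (x # xs). leading M r x \<subseteq> leading M' r x))"
    proof (rule chain_generators[OF M AG Un_upper2 _ s2 sub0 _ l])
      show "successively (\<lambda>x y. leading M' r x \<subseteq> leading M' r y) (x # xs)"
        if "W.inv_sub ?A M'" "M' \<subseteq> M" for M' by (rule s1[OF that])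
      show "{0} \<subseteq> leading M r (hd (x # xs))" if "x # xs \<noteq> []" by (rule s3[OF that])
    qed
    then obtain S where S: "S \<subseteq> M" "finite S" "card S \<le> l"
      and S4: "\<forall>M'. W.inv_sub ?A M' \<and> M' \<subseteq> M \<and> S \<subseteq> M'
        \<and> (x # xs \<noteq> [] \<longrightarrow> {0} \<subseteq> leading M' r (hd (x # xs)))
        \<longrightarrow> (\<forall>x\<in>set (x # xs). leading M r x \<subseteq> leading M' r x)"
      by (elim exE conjE)
    show ?thesis
    proof (intro exI[of _ S] conjI S(1-3) allI impI ballI)
      fix M' C assume M': "W.inv_sub ?A M' \<and> M' \<subseteq> M \<and> S \<subseteq> M'" and C: "C \<in> set cs"
      have "{0} \<subseteq> leading M' r x" using V.inv_subD(3)[of K] subK_leading[of ?A M' x] M' AG x(1) by simp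
      then have "\<forall>x\<in>set (x # xs). leading M r x \<subseteq> leading M' r x"
        using M' by (intro S4[THEN spec, THEN mp]) simp
      moreover obtain y where "y \<in> set (x # xs)" "C = H #> y" using C xs(2) by (metis (no_types, lifting) image_iff list.set_map)
      moreover from this have "y \<in> carrier G" using x xs by auto
      ultimately show "\<exists>x\<in>carrier G. C = H #> x \<and> leading M r x \<subseteq> leading M' r x" by blast
    qed
  qed
  then obtain S where S: "\<And>cs. cs \<in> set css \<Longrightarrow> S cs \<subseteq> M \<and> finite (S cs) \<and> card (S cs) \<le> l
    \<and> (\<forall>M'. W.inv_sub ?A M' \<and> M' \<subseteq> M \<and> S cs \<subseteq> M' \<longrightarrow>
     (\<forall>C\<in>set cs. \<exists>x\<in>carrier G. C = H #> x \<and> leading M r x \<subseteq> leading M' r x))" by metis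
  define T where "T = (\<Union>cs\<in>set css. S cs)"
  have TM: "T \<subseteq> M" using S unfolding T_def by blast
  define M' where "M' = W.gen ?A T"
  have "T \<subseteq> vecs W" using TM W.inv_subD(1)[OF M] by blast
  then have M': "W.inv_sub ?A M'" unfolding M'_def by (rule W.inv_sub_gen[OF AG])
  have M'M: "M' \<subseteq> M" unfolding M'_def by (rule W.gen_least[OF M TM])
  have lead: "\<exists>x\<in>carrier G. C = H #> x \<and> leading M r x \<subseteq> leading M' r x" if CD: "C \<in> D" for C
  proof -
    obtain cs where cs: "cs \<in> set css" "C \<in> set cs" using CD cover by blast
    have "S cs \<subseteq> M'" using W.gen_superset[of T ?A] cs by (auto simp: M'_def T_def)
    then show ?thesis using S[OF cs(1)] M' M'M cs(2) by blast
  qed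
  \<comment> \<open>Induction on a strict bound for the ranks in the support: subtracting an element
    of \<open>M'\<close> with the same leading coefficient lowers the bound by 1.\<close>
  have all: "f \<in> M'" if "f \<in> M" "\<forall>y\<in>carrier G. f y \<noteq> 0 \<longrightarrow> r (H #> y) < n" for f n
    using that
  proof (induction n arbitrary: f)
    case 0
    have "f = 0"
    proof
      fix x show "f x = 0 x" using 0 WD(2)[of f x] W.inv_subD(1)[OF M] by (cases "x \<in> carrier G") auto
    qed
    show ?case unfolding \<open>f = 0\<close> by (rule W.inv_subD(3)[OF M'])
  next
    case (Suc n)
    show ?case
    proof (cases "\<exists>C\<in>D. r C = n")
      case False
      have "\<forall>y\<in>carrier G. f y \<noteq> 0 \<longrightarrow> r (H #> y) < n"
      proof (intro ballI impI)
        fix y assume y: "y \<in> carrier G" "f y \<noteq> 0"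
        then have "H #> y \<in> D" using Suc.prems(1) MD by (auto simp: supported_def)
        then show "r (H #> y) < n" using False Suc.prems(2) y by (metis less_antisym)
      qed
      then show ?thesis using Suc by blast
    next
      case True
      then obtain C where C: "C \<in> D" "r C = n" by blast
      obtain x where x: "x \<in> carrier G" "C = H #> x" "leading M r x \<subseteq> leading M' r x" using lead[OF C(1)] by blast
      have "f x \<in> leading M r x"
        unfolding leading_def using Suc.prems C x by (intro CollectI exI[of _ f]) auto
      then have "f x \<in> leading M' r x" using x by blast
      then obtain f' where f': "f' \<in> M'" "f' x = f x" "\<forall>y\<in>carrier G. f' y \<noteq> 0 \<longrightarrow> r (H #> y) \<le> n"
        using C x by (auto simp: leading_def)
      have f'M: "f' \<in> M" using f' M'M by blast
      have fW: "f \<in> vecs W" "f' \<in> vecs W" using Suc.prems(1) f'M W.inv_subD(1)[OF M] by auto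
      have "f - f' \<in> M'"
      proof (rule Suc.IH)
        show "f - f' \<in> M" by (rule W.inv_subD(5)[OF M Suc.prems(1) f'M])
        show "\<forall>y\<in>carrier G. (f - f') y \<noteq> 0 \<longrightarrow> r (H #> y) < n"
        proof (intro ballI impI)
          fix y assume y: "y \<in> carrier G" "(f - f') y \<noteq> 0"
          then have "f y \<noteq> 0 \<or> f' y \<noteq> 0" by auto
          then have le: "r (H #> y) \<le> n" and yD: "H #> y \<in> D"
            using Suc.prems f' y f'M MD by (auto simp: supported_def less_Suc_eq_le)
          \<comment> \<open>The difference vanishes at \<open>x\<close> and therefore on its whole
            coset, where all values are determined by the one at \<open>x\<close>.\<close>
          have "r (H #> y) \<noteq> n"
          proof
            assume "r (H #> y) = n"
            then have "H #> y = H #> x" using inj C x yD by (metis inj_onD)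
            then have "y \<in> H #> x" using rcos_self[OF y(1) H] by simp
            then obtain h where h: "h \<in> H" "y = h \<otimes> x" by (auto simp: r_coset_def)
            then have "f y = f' y" using WD(3)[OF fW(1) h(1) x(1)] WD(3)[OF fW(2) h(1) x(1)] f'(2) by simp
            then show False using y by simp
          qed
          then show "r (H #> y) < n" using le by simp
        qed
      qed
      then have "f - f' + f' \<in> M'" using W.inv_subD(4)[OF M'] f'(1) by blast
      then show ?thesis by simp
    qed
  qed
  show "\<exists>S\<subseteq>M. finite S \<and> card S \<le> l * length css \<and> M \<subseteq> W.gen ?A S"
  proof (intro exI[of _ T] conjI TM)
    show "finite T" using S by (auto simp: T_def)
    have "card T \<le> (\<Sum>cs\<in>set css. card (S cs))" unfolding T_def by (rule card_UN_le) simp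
    also have "\<dots> \<le> (\<Sum>cs\<in>set css. l)" using S by (intro sum_mono) blast
    also have "\<dots> \<le> l * length css" using card_length[of css] by (simp add: mult.commute)
    finally show "card T \<le> l * length css" .
    show "M \<subseteq> W.gen ?A T"
    proof
      fix f assume f: "f \<in> M"
      have "finite ((\<lambda>y. r (H #> y)) ` carrier G)" using fin by simp
      then obtain n where "\<And>y. y \<in> carrier G \<Longrightarrow> r (H #> y) < n"
        by (metis finite_nat_set_iff_bounded imageI)
      then show "f \<in> W.gen ?A T" using all[OF f] unfolding M'_def by blast
    qed
  qed
qed

subsection \<open>Operators of order prime to the characteristic\<close>

abbreviation tens :: "'g \<Rightarrow> 'v \<Rightarrow> 'g \<Rightarrow> 'v" where "tens x v \<equiv> ind_tensor G H V v x"

lemma tens_value: "\<lbrakk>x \<in> carrier G; v \<in> vecs V\<rbrakk> \<Longrightarrow> tens x v x = v"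
  using rcos_self[OF _ H] V.act_one by (simp add: ind_tensor_def)

lemma tens_0: "x \<in> carrier G \<Longrightarrow> tens x 0 = 0"
  using ind_tensor_smul[OF H V, of 0 x 0] V.subspace_0[OF V.subspace_vecs] by (simp add: W.scale_zero_left)

lemma tens_K:
  assumes "x \<in> carrier G" "v \<in> vecs V" "k \<in> K"
  shows "act W (tens x v) k = tens x (act V v (x \<otimes> k \<otimes> inv x))"
proof -
  have "x \<otimes> k \<otimes> inv x \<in> H" using K_normal[OF assms(1,3)] KH by blast
  moreover have "(x \<otimes> k \<otimes> inv x) \<otimes> x = x \<otimes> k" using assms KG by (simp add: m_assoc)
  ultimately show ?thesis
    using ind_tensor_act[OF H V assms(2,1), of k] ind_tensor_balanced[OF H V assms(2) _ assms(1), of "x \<otimes> k \<otimes> inv x"] assms KG by simp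
qed

text \<open>A function is the sum of its parts on the single cosets, and each part is the tensor of
  its value at a representative.\<close>

lemma supported_tens:
  assumes C: "W.inv_sub A C" and "D \<subseteq> rcosets H"
    and D: "\<And>E. E \<in> D \<Longrightarrow> \<exists>x\<in>carrier G. E = H #> x \<and> tens x ` vecs V \<subseteq> C"
  shows "supported D \<subseteq> C"
proof -
  have "finite D" using assms(2) fin by (auto intro: finite_subset simp: RCOSETS_def)
  then show ?thesis using assms(2,3)
  proof (induction D rule: finite_induct)
    case empty
    have "f = 0" if "f \<in> supported {}" for f
    proof
      fix x show "f x = 0 x" using that WD(2)[of f x] by (auto simp: supported_def)
    qed
    then show ?case using W.inv_subD(3)[OF C] by blast
  next
    case (insert E D)
    obtain x where x: "x \<in> carrier G" "E = H #> x" "tens x ` vecs V \<subseteq> C" using insert.prems by blast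
    show ?case
    proof
      fix f assume f: "f \<in> supported (insert E D)"
      then have fW: "f \<in> vecs W" by (simp add: supported_def)
      note fx = WD(1)[OF fW x(1)]
      have tC: "tens x (f x) \<in> C" using x fx by blast
      have tW: "tens x (f x) \<in> vecs W" by (rule ind_tensor_mem[OF H V fx x(1)])
      have "f - tens x (f x) \<in> supported D"
        unfolding supported_def
      proof (intro CollectI conjI ballI impI)
        show "f - tens x (f x) \<in> vecs W" by (rule W.subspace_diff[OF W.subspace_vecs fW tW])
        fix y assume y: "y \<in> carrier G" "(f - tens x (f x)) y \<noteq> 0"
        show "H #> y \<in> D"
        proof (cases "y \<in> H #> x")
          case True
          then obtain h where h: "h \<in> H" "y = h \<otimes> x" by (auto simp: r_coset_def)
          have "f y = tens x (f x) y"
            using WD(3)[OF fW h(1) x(1)] WD(3)[OF tW h(1) x(1)] tens_value[OF x(1) fx] h by simp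
          then show ?thesis using y by simp
        next
          case False
          then have "f y \<noteq> 0" using y by (simp add: ind_tensor_def)
          moreover have "H #> y \<noteq> E" using False x(2) rcos_self[OF y(1) H] by auto
          ultimately show ?thesis using f y by (auto simp: supported_def)
        qed
      qed
      then have "f - tens x (f x) \<in> C" using insert.IH insert.prems by blast
      then have "f - tens x (f x) + tens x (f x) \<in> C" using W.inv_subD(4)[OF C] tC by blast
      then show "f \<in> C" by simp
    qed
  qed
qed

text \<open>A submodule \<open>C\<close> is enlarged by relative Maschke steps, each at the cost of
  one generator. Progress is measured only on the summand of the induced module at the
  representative \<open>x\<close>: once \<open>C\<close> contains this summand, transitivity of
  \<open>P\<close> on its orbit gives everything supported there. Hence the number of steps is
  bounded by a height in V and does not depend on the length of the orbit.\<close>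

lemma gen_by_coprime:
  assumes P: "subgroup P G" and char: "of_nat (card P) \<noteq> (0 :: 'f)" and E: "E \<in> rcosets H"
    and l: "height_le subK l {0}"
  shows "gen_by (P \<union> K) l (\<Omega>.rorbit P E)"
  unfolding gen_by_def
proof (intro allI impI)
  let ?A = "P \<union> K" and ?D = "\<Omega>.rorbit P E"
  fix M assume "W.inv_sub ?A M \<and> M \<subseteq> supported ?D"
  then have M: "W.inv_sub ?A M" and MD: "M \<subseteq> supported ?D" by auto
  have PG: "P \<subseteq> carrier G" and AG: "?A \<subseteq> carrier G"
    using subgroup.subset[OF P] subgroup.subset[OF K] by auto
  obtain x where x: "x \<in> carrier G" "E = H #> x" using rcosetE[OF E] .
  have KC: "K \<subseteq> carrier (G\<lparr>carrier := H\<rparr>)" using KH by simp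
  \<comment> \<open>The part of \<open>C\<close> in the summand at \<open>x\<close>, transported to
    V; it is a K-submodule because conjugation by \<open>x\<close> preserves
    \<open>K\<close>.\<close>
  define tr where "tr C = {v \<in> vecs V. tens x v \<in> C}" for C
  have conj: "inv x \<otimes> k \<otimes> x \<in> K" "x \<otimes> (inv x \<otimes> k \<otimes> x) \<otimes> inv x = k" if "k \<in> K" for k
    using K_normal[of "inv x" k] that x KG by (auto simp: m_assoc) (simp add: m_assoc[symmetric])
  have subK_tr: "subK (tr C)" if C: "W.inv_sub K C" for C
    unfolding submod_def V.subspace_def
  proof (intro conjI ballI allI)
    note sub = W.inv_subD[OF C]
    have V0: "0 \<in> vecs V" by (rule V.subspace_0[OF V.subspace_vecs])
    show "tr C \<subseteq> vecs V" by (auto simp: tr_def)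
    show "0 \<in> tr C" using sub(3) tens_0[OF x(1)] V0 by (simp add: tr_def)
    show "v + w \<in> tr C" if "v \<in> tr C" "w \<in> tr C" for v w
      using that sub(4) V.subspace_add[OF V.subspace_vecs] by (simp add: tr_def ind_tensor_add[OF H V _ _ x(1)])
    show "smul V c v \<in> tr C" if "v \<in> tr C" for c v
      using that sub(6) V.subspace_scale[OF V.subspace_vecs] by (simp add: tr_def ind_tensor_smul[OF H V _ x(1)])
    fix v k assume v: "v \<in> tr C" and "k \<in> carrier (G\<lparr>carrier := K\<rparr>)"
    then have k: "k \<in> K" by simp
    have "tens x (act V v k) = act W (tens x v) (inv x \<otimes> k \<otimes> x)"
      using tens_K[OF x(1) _ conj(1)[OF k], of v] v conj(2)[OF k] by (simp add: tr_def)
    then show "act V v k \<in> tr C"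
      using v sub(7)[of "tens x v"] conj(1)[OF k] V.act_closed[of v k] k KH by (auto simp: tr_def)
  qed
  have full: "supported ?D \<subseteq> C" if C: "W.inv_sub ?A C" "tr C = vecs V" for C
  proof (rule supported_tens[OF C(1)])
    show "?D \<subseteq> rcosets H" by (rule \<Omega>.rorbit_subset[OF PG E])
    fix F assume "F \<in> ?D"
    then obtain y where y: "y \<in> P" "F = E #> y" by (auto simp: \<Omega>.rorbit_def)
    have yG: "y \<in> carrier G" using y PG by blast
    have "tens (x \<otimes> y) v \<in> C" if v: "v \<in> vecs V" for v
    proof -
      have "tens x v \<in> C" using C(2) v by (auto simp: tr_def)
      then have "act W (tens x v) y \<in> C" using W.inv_subD(7)[OF C(1), of _ y] y by blast
      then show ?thesis using ind_tensor_act[OF H V v x(1) yG] by simp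
    qed
    then show "\<exists>x\<in>carrier G. F = H #> x \<and> tens x ` vecs V \<subseteq> C"
      using x y yG by (intro bexI[of _ "x \<otimes> y"]) (auto simp: coset_act)
  qed
  \<comment> \<open>Generation modulo \<open>C\<close>, by induction on the height of
    \<open>tr C\<close>; the case of interest is the zero submodule.\<close>
  have main: "\<exists>S\<subseteq>M. finite S \<and> card S \<le> n \<and> (\<forall>f\<in>M. \<exists>f'\<in>W.gen ?A S. f - f' \<in> C)"
    if "W.inv_sub ?A C" "height_le subK n (tr C)" for n C
    using that
  proof (induction n arbitrary: C)
    case (0 C)
    have "subK (vecs V)" using V.inv_sub_vecs[OF KC] by simp
    then have "\<not> tr C \<subset> vecs V" using 0(2) by simp
    then have "tr C = vecs V" by (auto simp: tr_def)
    then have "M \<subseteq> C" using full[OF 0(1)] MD by blast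
    moreover have "0 \<in> W.gen ?A {}" by (rule W.inv_subD(3)[OF W.inv_sub_gen[OF AG]]) simp
    ultimately show ?case by (intro exI[of _ "{}"]) (auto intro!: bexI[of _ 0])
  next
    case (Suc n C)
    show ?case
    proof (cases "tr C = vecs V")
      case True
      then have "M \<subseteq> C" using full[OF Suc.prems(1)] MD by blast
      moreover have "0 \<in> W.gen ?A {}" by (rule W.inv_subD(3)[OF W.inv_sub_gen[OF AG]]) simp
      ultimately show ?thesis by (intro exI[of _ "{}"]) (auto intro!: bexI[of _ 0])
    next
      case False
      then have "tr C \<subset> vecs V" by (auto simp: tr_def)
      moreover have "subK (vecs V)" using V.inv_sub_vecs[OF KC] by simp
      \<comment> \<open>A K-submodule minimal above \<open>tr C\<close> gives a translate
        \<open>TT\<close> that is simple modulo \<open>C\<close>, as the Maschke step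
        requires.\<close>
      ultimately obtain T where T: "subK T" "tr C \<subset> T" "\<And>T'. \<lbrakk>subK T'; tr C \<subset> T'; T' \<subseteq> T\<rbrakk> \<Longrightarrow> T' = T"
        using minimal_above[of subK "Suc n" "tr C" "vecs V"] Suc.prems(2) by metis
      have TV: "T \<subseteq> vecs V" using T(1) by (simp add: submod_def)
      note subT = V.inv_subD[of K T, simplified, OF T(1)]
      define TT where "TT = tens x ` T"
      have TT: "W.inv_sub K TT"
        unfolding submod_def W.subspace_def
      proof (intro conjI ballI allI)
        show "TT \<subseteq> vecs W" unfolding TT_def using ind_tensor_mem[OF H V _ x(1)] TV by blast
        show "0 \<in> TT" unfolding TT_def using subT(3) tens_0[OF x(1)] by (metis imageI)
        show "v + w \<in> TT" if "v \<in> TT" "w \<in> TT" for v w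
          using that subT(4) ind_tensor_add[OF H V _ _ x(1), symmetric] TV unfolding TT_def by (auto simp: subset_iff)
        show "smul W c v \<in> TT" if "v \<in> TT" for c v
          using that subT(6) ind_tensor_smul[OF H V _ x(1), symmetric] TV unfolding TT_def by (auto simp: subset_iff)
        fix w k assume w: "w \<in> TT" and "k \<in> carrier (G\<lparr>carrier := K\<rparr>)"
        then have k: "k \<in> K" by simp
        obtain v where v: "v \<in> T" "w = tens x v" using w by (auto simp: TT_def)
        have "act W w k = tens x (act V v (x \<otimes> k \<otimes> inv x))" using tens_K[OF x(1) _ k] v TV by blast
        moreover have "act V v (x \<otimes> k \<otimes> inv x) \<in> T" using subT(7)[OF v(1)] K_normal[OF x(1) k] by simp
        ultimately show "act W w k \<in> TT" by (auto simp: TT_def)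
      qed
      obtain t where t: "t \<in> T" "t \<notin> tr C" using T(2) by blast
      have e: "tens x t \<in> TT" "tens x t \<notin> C" using t TV by (auto simp: TT_def tr_def)
      have simple: "T' = TT \<inter> C \<or> T' = TT" if T': "W.inv_sub K T'" "TT \<inter> C \<subseteq> T'" "T' \<subseteq> TT" for T'
      proof -
        have "subK (tr T')" by (rule subK_tr[OF T'(1)])
        moreover have "tr T' \<subseteq> T"
        proof
          fix v assume v: "v \<in> tr T'"
          then obtain u where u: "u \<in> T" "tens x v = tens x u" using T'(3) by (auto simp: tr_def TT_def)
          have "v = u" using tens_value[OF x(1), of v] tens_value[OF x(1), of u] u v TV by (auto simp: tr_def)
          then show "v \<in> T" using u by simp
        qed
        moreover have "tr C \<subseteq> tr T'"
        proof
          fix v assume v: "v \<in> tr C"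
          then have "tens x v \<in> TT \<inter> C" using T(2) by (auto simp: tr_def TT_def)
          then show "v \<in> tr T'" using v T'(2) by (auto simp: tr_def)
        qed
        ultimately consider "tr T' = tr C" | "tr T' = T" using T(3)[of "tr T'"] by blast
        then show ?thesis
        proof cases
          case 1
          have "T' \<subseteq> C"
          proof
            fix w assume w: "w \<in> T'"
            then obtain u where u: "u \<in> T" "w = tens x u" using T'(3) by (auto simp: TT_def)
            then have "u \<in> tr T'" using w TV by (auto simp: tr_def)
            then show "w \<in> C" using 1 u by (auto simp: tr_def)
          qed
          then show ?thesis using T'(2,3) by blast
        next
          case 2
          then have "TT \<subseteq> T'" by (auto simp: TT_def tr_def)
          then show ?thesis using T'(3) by blast
        qed
      qed
      define C' where "C' = W.gen ?A (C \<union> TT)"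
      have CT: "C \<union> TT \<subseteq> vecs W" using W.inv_subD(1)[OF Suc.prems(1)] W.inv_subD(1)[OF TT] by blast
      have C': "W.inv_sub ?A C'" unfolding C'_def by (rule W.inv_sub_gen[OF AG CT])
      have CC': "C \<subseteq> C'" "TT \<subseteq> C'" using W.gen_superset[of "C \<union> TT" ?A] by (auto simp: C'_def)
      have "tr C \<subset> tr C'"
        using CC' e t TV by (auto simp: tr_def)
      moreover have "subK (tr C')" using subK_tr[OF W.inv_sub_mono[OF C']] by blast
      ultimately have "height_le subK n (tr C')" using Suc.prems(2) by simp
      from Suc.IH[OF C' this] obtain S where S: "S \<subseteq> M" "finite S" "card S \<le> n"
        "\<And>f. f \<in> M \<Longrightarrow> \<exists>f'\<in>W.gen ?A S. f - f' \<in> C'" by blast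
      have "\<exists>b\<in>M. \<forall>f\<in>M \<inter> C'. \<exists>f'\<in>W.gen ?A {b}. f - f' \<in> C"
      proof (rule W.relative_maschke_step[OF fin K _ P char M Suc.prems(1) TT _ e])
        show "g \<otimes> k \<otimes> inv g \<in> K" if "g \<in> carrier G" "k \<in> K" for g k by (rule K_normal[OF that])
        show "T' = TT \<inter> C \<or> T' = TT" if "W.inv_sub K T'" "TT \<inter> C \<subseteq> T'" "T' \<subseteq> TT" for T'
          by (rule simple[OF that])
        fix b assume "b \<in> M" "\<And>f. f \<in> M \<inter> W.gen ?A (C \<union> TT) \<Longrightarrow> \<exists>f'\<in>W.gen ?A {b}. f - f' \<in> C"
        then show "\<exists>b\<in>M. \<forall>f\<in>M \<inter> C'. \<exists>f'\<in>W.gen ?A {b}. f - f' \<in> C" unfolding C'_def by blast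
      qed
      then obtain b where b: "b \<in> M" "\<And>f. f \<in> M \<inter> C' \<Longrightarrow> \<exists>f'\<in>W.gen ?A {b}. f - f' \<in> C" by blast
      have bS: "insert b S \<subseteq> M" using b S by simp
      have g: "W.inv_sub ?A (W.gen ?A (insert b S))"
        using bS W.inv_subD(1)[OF M] by (intro W.inv_sub_gen[OF AG]) blast
      show ?thesis
      proof (intro exI[of _ "insert b S"] conjI ballI bS)
        show "finite (insert b S)" using S by simp
        show "card (insert b S) \<le> Suc n" using S by (simp add: card_insert_if)
        fix f assume f: "f \<in> M"
        obtain f1 where f1: "f1 \<in> W.gen ?A S" "f - f1 \<in> C'" using S(4)[OF f] by blast
        have "f1 \<in> M" using f1 W.gen_least[OF M S(1)] by blast
        then have "f - f1 \<in> M \<inter> C'" using f1 f W.inv_subD(5)[OF M] by blast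
        then obtain f2 where f2: "f2 \<in> W.gen ?A {b}" "f - f1 - f2 \<in> C" using b(2) by blast
        have "f1 \<in> W.gen ?A (insert b S)" "f2 \<in> W.gen ?A (insert b S)"
          using f1 f2 W.gen_mono[of ?A ?A S "insert b S"] W.gen_mono[of ?A ?A "{b}" "insert b S"] by auto
        then have "f1 + f2 \<in> W.gen ?A (insert b S)" by (rule W.inv_subD(4)[OF g])
        moreover have "f - (f1 + f2) \<in> C" using f2 by (simp add: diff_diff_eq)
        ultimately show "\<exists>f'\<in>W.gen ?A (insert b S). f - f' \<in> C" by blast
      qed
    qed
  qed
  have "tr {0} = {0}"
    using tens_value[OF x(1)] tens_0[OF x(1)] V.subspace_0[OF V.subspace_vecs] by (force simp: tr_def)
  then obtain S where S: "S \<subseteq> M" "finite S" "card S \<le> l" "\<forall>f\<in>M. \<exists>f'\<in>W.gen ?A S. f - f' \<in> {0}"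
    using main[OF W.inv_sub_0[OF AG], of l] l by auto
  then have "M \<subseteq> W.gen ?A S" by auto
  then show "\<exists>S\<subseteq>M. finite S \<and> card S \<le> l \<and> M \<subseteq> W.gen ?A S" using S by blast
qed

end

section \<open>Lengths of chains of submodules\<close>

context group_module begin

definition strict_chain :: "'g set \<Rightarrow> nat \<Rightarrow> (nat \<Rightarrow> 'v set) \<Rightarrow> bool" where
  "strict_chain A n c \<longleftrightarrow> (\<forall>i\<le>n. inv_sub A (c i)) \<and> (\<forall>i<n. c i \<subset> c (Suc i))"

lemma strict_chain_mono:
  assumes "strict_chain A n c" "i \<le> j" "j \<le> n"
  shows "c i \<subseteq> c j"
  using assms(2,3)
proof (induction j rule: dec_induct)
  case (step j)
  then have "c j \<subset> c (Suc j)" using assms(1) by (auto simp: strict_chain_def)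
  then show ?case using step by auto
qed simp

lemma strict_chain_subset: "strict_chain A n c \<Longrightarrow> B \<subseteq> A \<Longrightarrow> strict_chain B n c"
  unfolding strict_chain_def using inv_sub_mono by blast

text \<open>Both terms of a step are invariant under \<open>X\<close>, so the orbit of a vector
  chosen from their difference stays in it. Different steps therefore yield different orbits of
  non-zero vectors.\<close>

lemma strict_chain_le_vector_orbits:
  assumes X: "subgroup X G" and c: "strict_chain X n c" and fin: "finite (vector_orbits G X V)"
  shows "n \<le> card (vector_orbits G X V)"
proof -
  have "\<exists>v. v \<in> c (Suc i) \<and> v \<notin> c i" if "i < n" for i
    using c that by (auto simp: strict_chain_def)
  then obtain v where v: "\<And>i. i < n \<Longrightarrow> v i \<in> c (Suc i) \<and> v i \<notin> c i" by metis
  define ob where "ob i = orbit (G\<lparr>carrier := X\<rparr>) (\<lambda>g v. act V v g) (v i)" for i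
  have sub: "inv_sub X (c i)" if "i \<le> n" for i using c that by (simp add: strict_chain_def)
  have o_sub: "ob i \<subseteq> c (Suc i) - c i" if i: "i < n" for i
  proof
    fix w assume "w \<in> ob i"
    then obtain x where x: "x \<in> X" "w = act V (v i) x" by (auto simp: ob_def orbit_def)
    have xG: "x \<in> carrier G" using subgroup.mem_carrier[OF X x(1)] .
    have vi: "v i \<in> vecs V" using v[OF i] inv_subD(1)[OF sub, of "Suc i"] i by auto
    have "w \<in> c (Suc i)" using inv_subD(7)[OF sub, of "Suc i" "v i" x] v[OF i] x i by simp
    moreover have "w \<notin> c i"
    proof
      assume "w \<in> c i"
      then have "act V w (inv x) \<in> c i"
        using inv_subD(7)[OF sub, of i w "inv x"] subgroup.m_inv_closed[OF X x(1)] i by simp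
      then show False using v[OF i] act_inv_cancel[OF vi xG] x by simp
    qed
    ultimately show "w \<in> c (Suc i) - c i" by blast
  qed
  have v_o: "v i \<in> ob i" if i: "i < n" for i
  proof -
    have "v i \<in> vecs V" using v[OF i] inv_subD(1)[OF sub, of "Suc i"] i by auto
    then have "v i = act V (v i) \<one>" by (simp add: act_one)
    then show ?thesis using subgroup.one_closed[OF X] by (auto simp: ob_def orbit_def)
  qed
  have "inj_on ob {..<n}"
  proof (rule inj_onI)
    have False if "i < j" "j < n" "ob i = ob j" for i j
    proof -
      have "ob i \<subseteq> c (Suc i)" using o_sub[of i] that by auto
      also have "\<dots> \<subseteq> c j" by (rule strict_chain_mono[OF c]) (use that in auto)
      finally show False using that v_o[of j] o_sub[of j] by auto
    qed
    then show "i = j" if "i \<in> {..<n}" "j \<in> {..<n}" "ob i = ob j" for i j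
      using that by (metis lessThan_iff linorder_neqE_nat)
  qed
  moreover have "ob ` {..<n} \<subseteq> vector_orbits G X V"
  proof
    fix y assume "y \<in> ob ` {..<n}"
    then obtain i where i: "i < n" "y = ob i" by auto
    have "v i \<in> vecs V - {0}"
      using v[OF i(1)] inv_subD(1)[OF sub, of "Suc i"] inv_subD(3)[OF sub, of i] i by auto
    then show "y \<in> vector_orbits G X V" using i by (auto simp: vector_orbits_def orbits_def ob_def)
  qed
  ultimately show ?thesis using card_inj_on_le[OF _ _ fin] by fastforce
qed

text \<open>Each chosen vector lies outside a term of the chain that contains the span of all
  vectors chosen at smaller indices.\<close>

lemma independent_chain:
  assumes c: "strict_chain A n c" and "finite I" and "\<And>i. i \<in> I \<Longrightarrow> i < n \<and> v i \<in> c (Suc i) \<and> v i \<notin> c i"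
  shows "independent (v ` I) \<and> inj_on v I"
  using assms(2,3)
proof (induction I rule: finite_linorder_max_induct)
  case empty
  then show ?case by (simp add: independent_empty)
next
  case (insert b I)
  have b: "b < n" "v b \<in> c (Suc b)" "v b \<notin> c b" using insert.prems by auto
  have sub: "subspace (c b)" using c b inv_subD(2)[of A "c b"] by (simp add: strict_chain_def)
  have "v ` I \<subseteq> c b"
  proof
    fix w assume "w \<in> v ` I"
    then obtain i where i: "i \<in> I" "w = v i" by blast
    then have "v i \<in> c (Suc i)" "Suc i \<le> b" using insert by auto
    then show "w \<in> c b" using strict_chain_mono[OF c, of "Suc i" b] b i by auto
  qed
  then have "span (v ` I) \<subseteq> c b" using sub by (rule span_minimal)
  then have "v b \<notin> span (v ` I)" using b by blast
  moreover have IH: "independent (v ` I) \<and> inj_on v I" using insert by auto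
  moreover have "v b \<notin> v ` I" using \<open>v b \<notin> span (v ` I)\<close> by (metis span_base)
  moreover have "independent (insert (v b) (v ` I))"
    by (rule independent_insertI) (use \<open>v b \<notin> span (v ` I)\<close> IH in auto)
  moreover have "v b \<notin> v ` (I - {b})" using \<open>v b \<notin> v ` I\<close> by blast
  ultimately show ?case by simp
qed

section \<open>Dimensions of the factors in a chain of submodules\<close>

lemma subspace_basis:
  assumes "subspace B" "B \<subseteq> span T" "finite T" and S: "S \<subseteq> B" "independent S"
  obtains C where "S \<subseteq> C" "finite C" "independent C" "span C = B"
proof -
  obtain C where C: "S \<subseteq> C" "C \<subseteq> B" "independent C" "B \<subseteq> span C"
    using maximal_independent_subset_extend[OF S] by blast
  have "finite C" using independent_span_bound[OF assms(3) C(3)] C(2) assms(2) by blast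
  moreover have "span C = B" using C span_minimal[OF C(2) assms(1)] by blast
  ultimately show ?thesis using that C by blast
qed

lemma dim_less_subspace:
  assumes A: "subspace A" and B: "subspace B" "B \<subseteq> span T" "finite T" and AB: "A \<subset> B"
  shows "dim A < dim B"
proof -
  obtain A0 where A0: "{} \<subseteq> A0" "finite A0" "independent A0" "span A0 = A"
    using subspace_basis[OF A _ B(3), of "{}"] AB B by (metis dual_order.trans empty_subsetI independent_empty psubset_imp_subset)
  have "A0 \<subseteq> B" using A0 AB span_superset by blast
  then obtain B0 where B0: "A0 \<subseteq> B0" "finite B0" "independent B0" "span B0 = B"
    using subspace_basis[OF B _ A0(3)] by blast
  have "A0 \<noteq> B0" using A0 B0 AB by auto
  then have "card A0 < card B0" using B0 by (simp add: psubset_card_mono psubsetI)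
  moreover have "dim A = card A0" using A0 dim_eq_card_independent dim_span by metis
  moreover have "dim B = card B0" using B0 dim_eq_card_independent dim_span by metis
  ultimately show ?thesis by simp
qed

text \<open>A basis of \<open>A\<close> is extended to a basis of \<open>B\<close>; the new vectors give matrices for the action on \<open>B / A\<close>.\<close>

lemma min_rep_dim_le_factor:
  assumes X: "subgroup X G" and A: "inv_sub X A" and B: "inv_sub X B" "B \<subseteq> span T" "finite T" and AB: "A \<subseteq> B"
    and nontrivial: "v0 \<in> B" "x0 \<in> X" "act V v0 x0 - v0 \<notin> A"
  shows "dim A + min_rep_dim TYPE('f) (G\<lparr>carrier := X\<rparr>) \<le> dim B"
    and "min_rep_dim TYPE('f) (G\<lparr>carrier := X\<rparr>) > 0"
proof -
  note XG = subgroup.mem_carrier[OF X]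
  note subA = inv_subD[OF A] and subB = inv_subD[OF B(1)]
  obtain A0 where A0: "{} \<subseteq> A0" "finite A0" "independent A0" "span A0 = A"
    using subspace_basis[OF subA(2) _ B(3), of "{}"] AB B(2) by (metis dual_order.trans empty_subsetI independent_empty)
  have "A0 \<subseteq> B" using A0 AB span_superset by blast
  then obtain B0 where B0: "A0 \<subseteq> B0" "finite B0" "independent B0" "span B0 = B"
    using subspace_basis[OF subB(2) B(2,3) _ A0(3)] by blast
  define D where "D = B0 - A0"
  define r where "r = card D"
  have finD: "finite D" using B0 by (simp add: D_def)
  obtain d where d: "bij_betw d {..<r} D"
    using ex_bij_betw_nat_finite[OF finD] by (auto simp: r_def atLeast0LessThan)
  have dB: "d i \<in> B" "d i \<in> B0" "d i \<notin> A0" if "i < r" for i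
  proof -
    have "d i \<in> D" using d that by (auto simp: bij_betw_def)
    then show "d i \<in> B0" "d i \<notin> A0" by (auto simp: D_def)
    then show "d i \<in> B" using span_superset B0(4) by blast
  qed
  \<comment> \<open>Coordinates along the added basis vectors, that is, coordinates modulo
    \<open>A\<close>.\<close>
  define \<phi> where "\<phi> j v = representation B0 v (d j)" for j v
  have \<phi>_add: "\<phi> j (v + w) = \<phi> j v + \<phi> j w" if "v \<in> B" "w \<in> B" for j v w
    using that by (simp add: \<phi>_def representation_add[OF B0(3)] B0(4))
  have \<phi>_smul: "\<phi> j (smul V c v) = c * \<phi> j v" if "v \<in> B" for j c v
    using that by (simp add: \<phi>_def representation_scale[OF B0(3)] B0(4))
  have \<phi>_sum: "\<phi> j (\<Sum>i\<in>I. w i) = (\<Sum>i\<in>I. \<phi> j (w i))" if "\<And>i. i \<in> I \<Longrightarrow> w i \<in> B" for j I and w :: "nat \<Rightarrow> 'v"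
    using that by (simp add: \<phi>_def representation_sum[OF B0(3)] B0(4))
  have \<phi>_A: "\<phi> j a = 0" if "a \<in> A" "j < r" for j a
  proof -
    have "representation B0 a = representation A0 a"
      by (rule representation_extend[OF B0(3) _ B0(1)]) (use that A0 in simp)
    then show ?thesis using representation_ne_zero[of A0 a "d j"] dB(3)[OF that(2)] by (auto simp: \<phi>_def)
  qed
  have \<phi>_d: "\<phi> j (d i) = (if i = j then 1 else 0)" if "i < r" "j < r" for i j
    using representation_basis[OF B0(3) dB(2)[OF that(1)]] d that by (auto simp: \<phi>_def bij_betw_def inj_on_def)
  have expand: "v - (\<Sum>j<r. smul V (\<phi> j v) (d j)) \<in> A" if v: "v \<in> B" for v
  proof -
    have "v = (\<Sum>b\<in>B0. smul V (representation B0 v b) b)"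
      using sum_representation_eq[OF B0(3) _ B0(2) subset_refl] v B0(4) by simp
    also have "\<dots> = (\<Sum>b\<in>A0. smul V (representation B0 v b) b) + (\<Sum>b\<in>D. smul V (representation B0 v b) b)"
      unfolding D_def by (subst sum.subset_diff[OF B0(1,2)]) (rule add.commute)
    also have "(\<Sum>b\<in>D. smul V (representation B0 v b) b) = (\<Sum>j<r. smul V (\<phi> j v) (d j))"
      unfolding \<phi>_def by (rule sum.reindex_bij_betw[OF d, symmetric])
    finally have eq: "v = (\<Sum>b\<in>A0. smul V (representation B0 v b) b) + (\<Sum>j<r. smul V (\<phi> j v) (d j))" .
    have "v - (\<Sum>j<r. smul V (\<phi> j v) (d j)) = (\<Sum>b\<in>A0. smul V (representation B0 v b) b)"
      unfolding diff_eq_eq by (rule eq)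
    also have "\<dots> \<in> A"
      unfolding A0(4)[symmetric] by (intro span_sum span_scale span_base)
    finally show ?thesis .
  qed
  have actB: "act V v x \<in> B" if "v \<in> B" "x \<in> X" for v x using subB(7) that by blast
  \<comment> \<open>The group acts on the right, so the images of the basis vectors form the rows;
    then the matrices multiply in the order of the group.\<close>
  define \<rho> where "\<rho> x = Matrix.mat r r (\<lambda>(i, j). \<phi> j (act V (d i) x))" for x
  have \<rho>_carrier: "\<rho> x \<in> carrier_mat r r" for x by (simp add: \<rho>_def)
  have \<rho>_mult: "\<rho> (x \<otimes> y) = \<rho> x * \<rho> y" if x: "x \<in> X" and y: "y \<in> X" for x y
  proof (rule eq_matI)
    fix i k assume "i < dim_row (\<rho> x * \<rho> y)" "k < dim_col (\<rho> x * \<rho> y)"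
    then have i: "i < r" and k: "k < r" by (auto simp: \<rho>_def)
    define w where "w = act V (d i) x"
    have w: "w \<in> B" using actB dB(1)[OF i] x by (simp add: w_def)
    define a where "a = w - (\<Sum>j<r. smul V (\<phi> j w) (d j))"
    have a: "a \<in> A" unfolding a_def by (rule expand[OF w])
    have s: "smul V (\<phi> j w) (d j) \<in> B" if "j < r" for j using subB(6) dB(1)[OF that] by blast
    have BV: "b \<in> vecs V" if "b \<in> B" for b using that subB(1) by blast
    have yG: "y \<in> carrier G" using XG[OF y] .
    have "act V (d i) (x \<otimes> y) = act V w y"
      using BV[OF dB(1)[OF i]] XG x y by (simp add: w_def act_mult)
    also have "w = (\<Sum>j<r. smul V (\<phi> j w) (d j)) + a" by (simp add: a_def)
    also have "act V ((\<Sum>j<r. smul V (\<phi> j w) (d j)) + a) y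
      = (\<Sum>j<r. act V (smul V (\<phi> j w) (d j)) y) + act V a y"
      using s BV a AB yG by (subst act_add) (auto intro!: act_sum BV inv_sub_sum[OF B(1)])
    also have "(\<Sum>j<r. act V (smul V (\<phi> j w) (d j)) y) = (\<Sum>j<r. smul V (\<phi> j w) (act V (d j) y))"
      using dB(1) BV yG by (intro sum.cong refl act_smul) auto
    finally have e: "act V (d i) (x \<otimes> y) = (\<Sum>j<r. smul V (\<phi> j w) (act V (d j) y)) + act V a y" .
    have sB: "smul V (\<phi> j w) (act V (d j) y) \<in> B" if "j < r" for j
      using subB(6) actB dB(1)[OF that] y by blast
    have "\<phi> k (act V (d i) (x \<otimes> y)) = (\<Sum>j<r. \<phi> k (smul V (\<phi> j w) (act V (d j) y))) + \<phi> k (act V a y)"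
      unfolding e using sB actB a AB y
      by (subst \<phi>_add) (auto intro!: \<phi>_sum inv_sub_sum[OF B(1)])
    also have "\<phi> k (act V a y) = 0" using \<phi>_A subA(7) a y k by blast
    also have "(\<Sum>j<r. \<phi> k (smul V (\<phi> j w) (act V (d j) y))) = (\<Sum>j<r. \<phi> j w * \<phi> k (act V (d j) y))"
      using actB dB(1) y by (intro sum.cong refl \<phi>_smul) auto
    finally show "\<rho> (x \<otimes> y) $$ (i, k) = (\<rho> x * \<rho> y) $$ (i, k)"
      using i k by (simp add: \<rho>_def w_def scalar_prod_def atLeast0LessThan)
  qed (auto simp: \<rho>_def)
  have \<rho>_one: "\<rho> \<one> = 1\<^sub>m r"
    using dB(1) subB(1) by (intro eq_matI) (auto simp: \<rho>_def act_one \<phi>_d subset_iff)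
  have units: "\<rho> x \<in> Units (ring_mat TYPE('f) r ())" if x: "x \<in> X" for x
  proof -
    have ix: "inv x \<in> X" using subgroup.m_inv_closed[OF X x] .
    have "\<rho> x * \<rho> (inv x) = 1\<^sub>m r" "\<rho> (inv x) * \<rho> x = 1\<^sub>m r"
      using \<rho>_mult[OF x ix] \<rho>_mult[OF ix x] XG[OF x] \<rho>_one by simp_all
    then show ?thesis using \<rho>_carrier unfolding Units_def by (auto simp: ring_mat_def)
  qed
  have hom: "\<rho> \<in> hom (G\<lparr>carrier := X\<rparr>) (units_of (ring_mat TYPE('f) r ()))"
    using units \<rho>_mult by (auto simp: hom_def units_of_def ring_mat_def)
  \<comment> \<open>If every matrix were the identity, \<open>x0\<close> would move each added basis
    vector, and with them \<open>v0\<close>, only by elements of \<open>A\<close>.\<close>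
  have "\<exists>x\<in>X. \<rho> x \<noteq> 1\<^sub>m r"
  proof (rule ccontr)
    assume "\<not> ?thesis"
    then have triv: "\<rho> x = 1\<^sub>m r" if "x \<in> X" for x using that by blast
    have dA: "act V (d i) x0 - d i \<in> A" if i: "i < r" for i
    proof -
      have "\<phi> j (act V (d i) x0) = (if i = j then 1 else 0)" if "j < r" for j
        using arg_cong[OF triv[OF nontrivial(2)], of "\<lambda>M. M $$ (i, j)"] i that by (simp add: \<rho>_def)
      then have "(\<Sum>j<r. smul V (\<phi> j (act V (d i) x0)) (d j)) = (\<Sum>j<r. if j = i then d i else 0)"
        by (intro sum.cong) auto
      also have "\<dots> = d i" using i by simp
      finally show ?thesis using expand[OF actB[OF dB(1)[OF i] nontrivial(2)]] by simp
    qed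
    define a where "a = v0 - (\<Sum>j<r. smul V (\<phi> j v0) (d j))"
    have a: "a \<in> A" unfolding a_def by (rule expand[OF nontrivial(1)])
    have BV: "b \<in> vecs V" if "b \<in> B" for b using that subB(1) by blast
    have xG: "x0 \<in> carrier G" using XG[OF nontrivial(2)] .
    have s: "smul V (\<phi> j v0) (d j) \<in> B" if "j < r" for j using subB(6) dB(1)[OF that] by blast
    have v0: "v0 = (\<Sum>j<r. smul V (\<phi> j v0) (d j)) + a" by (simp add: a_def)
    have "act V ((\<Sum>j<r. smul V (\<phi> j v0) (d j)) + a) x0 = (\<Sum>j<r. act V (smul V (\<phi> j v0) (d j)) x0) + act V a x0"
      using s BV a AB xG by (subst act_add) (auto intro!: act_sum BV inv_sub_sum[OF B(1)])
    also have "(\<Sum>j<r. act V (smul V (\<phi> j v0) (d j)) x0) = (\<Sum>j<r. smul V (\<phi> j v0) (act V (d j) x0))"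
      using dB(1) BV xG by (intro sum.cong refl act_smul) auto
    finally have "act V v0 x0 = (\<Sum>j<r. smul V (\<phi> j v0) (act V (d j) x0)) + act V a x0"
      using v0 by simp
    then have "act V v0 x0 - v0 = ((\<Sum>j<r. smul V (\<phi> j v0) (act V (d j) x0)) + act V a x0)
        - ((\<Sum>j<r. smul V (\<phi> j v0) (d j)) + a)"
      using v0 by simp
    also have "\<dots> = (\<Sum>j<r. smul V (\<phi> j v0) (act V (d j) x0 - d j)) + (act V a x0 - a)"
      by (simp add: scale_right_diff_distrib sum_subtractf algebra_simps)
    also have "\<dots> \<in> A"
      using dA subA(6) a subA(7)[OF a nontrivial(2)]
      by (intro subA(4) inv_sub_sum[OF A] subA(5)) auto
    finally show False using nontrivial(3) by blast
  qed
  then have rep: "\<exists>\<rho>\<in>hom (G\<lparr>carrier := X\<rparr>) (units_of (ring_mat TYPE('f) r ())).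
      \<exists>x\<in>carrier (G\<lparr>carrier := X\<rparr>). \<rho> x \<noteq> 1\<^sub>m r"
    using hom by auto
  have "dim B = card B0" "dim A = card A0"
    using A0 B0 dim_eq_card_independent dim_span by metis+
  moreover have "card B0 = card A0 + r"
    using B0 A0 by (simp add: r_def D_def card_Diff_subset card_mono)
  moreover have "min_rep_dim TYPE('f) (G\<lparr>carrier := X\<rparr>) \<le> r"
    unfolding min_rep_dim_def by (rule Least_le) (rule rep)
  ultimately show "dim A + min_rep_dim TYPE('f) (G\<lparr>carrier := X\<rparr>) \<le> dim B" by simp
  define R where "R = min_rep_dim TYPE('f) (G\<lparr>carrier := X\<rparr>)"
  have "\<exists>\<rho>\<in>hom (G\<lparr>carrier := X\<rparr>) (units_of (ring_mat TYPE('f) R ())).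
      \<exists>x\<in>carrier (G\<lparr>carrier := X\<rparr>). \<rho> x \<noteq> 1\<^sub>m R"
    unfolding R_def min_rep_dim_def by (rule LeastI) (rule rep)
  then obtain \<sigma> x where \<sigma>: "\<sigma> \<in> hom (G\<lparr>carrier := X\<rparr>) (units_of (ring_mat TYPE('f) R ()))"
    "x \<in> X" "\<sigma> x \<noteq> 1\<^sub>m R" by auto
  have "\<sigma> x \<in> carrier_mat R R"
    using \<sigma> by (auto simp: hom_def units_of_def Units_def ring_mat_def)
  \<comment> \<open>All 0 by 0 matrices coincide, so a nontrivial representation has positive
    dimension. This makes the later division by \<open>R\<close> legitimate.\<close>
  then have "R \<noteq> 0" using \<sigma>(3) by (auto simp: mat_eq_iff)
  then show "min_rep_dim TYPE('f) (G\<lparr>carrier := X\<rparr>) > 0" by (simp add: R_def)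
qed

text \<open>What the count of trivial factors requires of Q: a non-zero factor with trivial action
  is witnessed by a fixed vector of the larger submodule. Groups of order prime to the
  characteristic have this property by averaging, and groups for which V is semisimple by
  complements, so that one count serves all parts.\<close>

definition fixed_lifting :: "'g set \<Rightarrow> bool" where
  "fixed_lifting Q \<longleftrightarrow> (\<forall>A B v. inv_sub Q A \<longrightarrow> inv_sub Q B \<longrightarrow> A \<subseteq> B \<longrightarrow> v \<in> B \<longrightarrow> v \<notin> A
     \<longrightarrow> (\<forall>v\<in>B. \<forall>q\<in>Q. act V v q - v \<in> A) \<longrightarrow> (\<exists>u\<in>B. u \<notin> A \<and> (\<forall>q\<in>Q. act V u q = u)))"

text \<open>The average of \<open>v\<close> over \<open>Q\<close> is fixed and differs from
  \<open>v\<close> by an element of \<open>A\<close>, so it is still outside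
  \<open>A\<close>.\<close>

lemma fixed_lifting_coprime:
  assumes Q: "subgroup Q G" and fin: "finite Q" and char: "of_nat (card Q) \<noteq> (0 :: 'f)"
  shows "fixed_lifting Q"
  unfolding fixed_lifting_def
proof (intro allI impI)
  fix A B v
  assume A: "inv_sub Q A" and B: "inv_sub Q B" and "A \<subseteq> B" and v: "v \<in> B" "v \<notin> A"
    and triv: "\<forall>v\<in>B. \<forall>q\<in>Q. act V v q - v \<in> A"
  note QG = subgroup.mem_carrier[OF Q]
  define c where "c = inverse (of_nat (card Q) :: 'f)"
  define u where "u = smul V c (\<Sum>q\<in>Q. act V v q)"
  have vV: "v \<in> vecs V" using v inv_subD(1)[OF B] by blast
  have "u \<in> B" unfolding u_def using inv_subD(6,7)[OF B] v by (intro inv_subD(6)[OF B] inv_sub_sum[OF B]) auto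
  moreover have "u \<notin> A"
  proof
    assume "u \<in> A"
    have "smul V c (\<Sum>q\<in>Q. v) = v" using char by (simp add: sum_constant_scale c_def)
    then have "u - v = smul V c (\<Sum>q\<in>Q. act V v q - v)"
      by (simp add: u_def sum_subtractf scale_right_diff_distrib)
    also have "\<dots> \<in> A" using triv v by (intro inv_subD(6)[OF A] inv_sub_sum[OF A]) auto
    finally have "u - (u - v) \<in> A" using inv_subD(5)[OF A \<open>u \<in> A\<close>] by blast
    then show False using v by simp
  qed
  moreover have "act V u z = u" if z: "z \<in> Q" for z
  proof -
    have zG: "z \<in> carrier G" using QG[OF z] .
    have "act V u z = smul V c (\<Sum>q\<in>Q. act V (act V v q) z)"
      unfolding u_def using vV QG zG by (simp add: act_smul act_sum[OF fin] act_closed subspace_sum[OF subspace_vecs])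
    also have "(\<Sum>q\<in>Q. act V (act V v q) z) = (\<Sum>q\<in>Q. act V v (q \<otimes> z))"
      using vV QG zG by (intro sum.cong refl act_mult[symmetric]) auto
    also have "\<dots> = (\<Sum>q\<in>Q. act V v q)"
      by (rule sum.reindex_bij_witness[where i = "\<lambda>q. q \<otimes> inv z" and j = "\<lambda>q. q \<otimes> z"])
        (use QG zG z subgroup.m_closed[OF Q] subgroup.m_inv_closed[OF Q] in \<open>auto simp: m_assoc\<close>)
    finally show ?thesis by (simp add: u_def)
  qed
  ultimately show "\<exists>u\<in>B. u \<notin> A \<and> (\<forall>q\<in>Q. act V u q = u)" by blast
qed

text \<open>A submodule C of largest dimension among those meeting \<open>A\<close> trivially is a
  complement: a simple summand not inside A + C would meet A + C trivially and could be added to C.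
  The finite spanning set \<open>T\<close> bounds these dimensions.\<close>

lemma semisimple_complement:
  assumes Q: "subgroup Q G" and ss: "semisimple (G\<lparr>carrier := Q\<rparr>) V" and A: "inv_sub Q A"
    and T: "finite T" "vecs V \<subseteq> span T"
  obtains C where "inv_sub Q C" "C \<inter> A = {0}" "\<And>v. v \<in> vecs V \<Longrightarrow> \<exists>a\<in>A. \<exists>c\<in>C. v = a + c"
proof -
  obtain \<S> where S: "\<forall>S\<in>\<S>. simple_submod (G\<lparr>carrier := Q\<rparr>) V S" "span (\<Union>\<S>) = vecs V"
    using ss unfolding semisimple_def by (elim exE conjE) (rule that; assumption)
  have QG: "Q \<subseteq> carrier G" by (rule subgroup.subset[OF Q])
  define P where "P C \<longleftrightarrow> inv_sub Q C \<and> C \<inter> A = {0}" for C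
  have dim: "dim C \<le> card T" if "P C" for C
    using that T inv_subD(1)[of Q C] unfolding P_def by (metis dim_le_card order.trans)
  have "P {0}" unfolding P_def using inv_sub_0[OF QG] inv_subD(3)[OF A] by blast
  define k where "k = Max (dim ` Collect P)"
  have fin: "finite (dim ` Collect P)" by (rule finite_subset[of _ "{..card T}"]) (use dim in auto)
  have "k \<in> dim ` Collect P" unfolding k_def using \<open>P {0}\<close> by (intro Max_in[OF fin]) auto
  then obtain C where C: "P C" "dim C = k" by auto
  have max: "dim C' \<le> k" if "P C'" for C' unfolding k_def using that by (intro Max_ge[OF fin]) auto
  have CQ: "inv_sub Q C" and CA: "C \<inter> A = {0}" using C by (auto simp: P_def)
  define AC where "AC = {a + c | a c. a \<in> A \<and> c \<in> C}"
  have AC: "inv_sub Q AC" unfolding AC_def by (rule inv_sub_plus[OF QG A CQ])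
  have "A \<subseteq> AC" "C \<subseteq> AC" using inv_subD(3)[OF A] inv_subD(3)[OF CQ] unfolding AC_def by force+
  have "S \<subseteq> AC" if "S \<in> \<S>" for S
  proof (rule ccontr)
    assume not: "\<not> S \<subseteq> AC"
    have simple: "inv_sub Q S" "S \<noteq> {0}" "\<And>R. inv_sub Q R \<Longrightarrow> R \<subseteq> S \<Longrightarrow> R = {0} \<or> R = S"
      using S(1)[rule_format, OF that] unfolding simple_submod_def by blast+
    have "S \<inter> AC = {0}" using simple(3)[OF inv_sub_Int[OF simple(1) AC]] not by blast
    define C' where "C' = {c + s | c s. c \<in> C \<and> s \<in> S}"
    have C': "inv_sub Q C'" unfolding C'_def by (rule inv_sub_plus[OF QG CQ simple(1)])
    have "C \<subseteq> C'" "S \<subseteq> C'" using inv_subD(3)[OF CQ] inv_subD(3)[OF simple(1)] unfolding C'_def by force+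
    have "P C'"
      unfolding P_def
    proof (intro conjI C' equalityI subsetI)
      fix x assume "x \<in> C' \<inter> A"
      then obtain c s where x: "x = c + s" "c \<in> C" "s \<in> S" "x \<in> A" by (auto simp: C'_def)
      have "s = x - c" using x by simp
      then have "s \<in> AC" using x \<open>A \<subseteq> AC\<close> \<open>C \<subseteq> AC\<close> inv_subD(5)[OF AC] by blast
      then have "s = 0" using x \<open>S \<inter> AC = {0}\<close> by blast
      then show "x \<in> {0}" using x CA by auto
    qed (use inv_subD(3)[OF C'] inv_subD(3)[OF A] in auto)
    moreover have "C \<subset> C'" using \<open>C \<subseteq> C'\<close> \<open>S \<subseteq> C'\<close> not \<open>C \<subseteq> AC\<close> by blast
    ultimately have "dim C < dim C'"
      using dim_less_subspace[OF inv_subD(2)[OF CQ] inv_subD(2)[OF C'] _ T(1)] inv_subD(1)[OF C'] T(2) by blast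
    then show False using max[OF \<open>P C'\<close>] C by simp
  qed
  then have "vecs V \<subseteq> AC" using S(2) span_minimal[of "\<Union>\<S>" AC] inv_subD(2)[OF AC] by blast
  then show ?thesis using that[OF CQ CA] unfolding AC_def by blast
qed

text \<open>Under \<open>Q\<close>, the component of \<open>v\<close> in a complement of
  \<open>A\<close> is displaced by an element of \<open>A\<close> and of the complement, hence not
  at all.\<close>

lemma fixed_lifting_semisimple:
  assumes Q: "subgroup Q G" and ss: "semisimple (G\<lparr>carrier := Q\<rparr>) V"
    and T: "finite T" "vecs V \<subseteq> span T"
  shows "fixed_lifting Q"
  unfolding fixed_lifting_def
proof (intro allI impI)
  fix A B v
  assume A: "inv_sub Q A" and B: "inv_sub Q B" and AB: "A \<subseteq> B" and v: "v \<in> B" "v \<notin> A"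
    and triv: "\<forall>v\<in>B. \<forall>q\<in>Q. act V v q - v \<in> A"
  obtain C where C: "inv_sub Q C" "C \<inter> A = {0}" "\<And>v. v \<in> vecs V \<Longrightarrow> \<exists>a\<in>A. \<exists>c\<in>C. v = a + c"
    using semisimple_complement[OF Q ss A T] by blast
  obtain a c where ac: "a \<in> A" "c \<in> C" "v = a + c" using C(3)[of v] v inv_subD(1)[OF B] by blast
  have "c = v - a" using ac by simp
  then have "c \<in> B" using v ac AB inv_subD(5)[OF B] by blast
  moreover have "c \<notin> A" using ac v inv_subD(4)[OF A] by blast
  moreover have "act V c q = c" if "q \<in> Q" for q
  proof -
    have "act V c q - c \<in> A" using triv \<open>c \<in> B\<close> that by blast
    moreover have "act V c q - c \<in> C" using inv_subD(5,7)[OF C(1)] ac that by blast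
    ultimately have "act V c q - c \<in> {0}" using C(2) by blast
    then show ?thesis by simp
  qed
  ultimately show "\<exists>u\<in>B. u \<notin> A \<and> (\<forall>q\<in>Q. act V u q = u)" by blast
qed

text \<open>Let t of the factors have trivial action of \<open>X\<close>, let J be the number of the
  others and R the least dimension of a nontrivial representation. Fixed vectors of \<open>Q\<close>
  witnessing trivial factors are independent, so t \<le> a k, and adding dimensions gives t + R J
  \<le> a d. For R \<ge> 1 the bound t + (a d - t) / R on the number of steps does not decrease in
  t, so t may be replaced by a k.\<close>

lemma strict_chain_le_rep_bound:
  assumes X: "subgroup X G" and Q: "subgroup Q G" "Q \<subseteq> X" and lift: "fixed_lifting Q"
    and c: "strict_chain X n c"
    and T1: "finite T1" "card T1 \<le> a * k" "{v \<in> vecs V. \<forall>q\<in>Q. act V v q = v} \<subseteq> span T1"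
    and T0: "finite T0" "card T0 \<le> a * d" "vecs V \<subseteq> span T0" and kd: "k \<le> d"
  shows "real n \<le> rep_bound TYPE('f) G a d X k"
proof -
  define triv where "triv i \<longleftrightarrow> (\<forall>v\<in>c (Suc i). \<forall>x\<in>X. act V v x - v \<in> c i)" for i
  define I where "I = {i. i < n \<and> triv i}"
  have sub: "inv_sub X (c i)" if "i \<le> n" for i using c that by (simp add: strict_chain_def)
  have strict: "c i \<subset> c (Suc i)" if "i < n" for i using c that by (simp add: strict_chain_def)
  have finI: "finite I" by (simp add: I_def)
  have "\<exists>u\<in>c (Suc i). u \<notin> c i \<and> (\<forall>q\<in>Q. act V u q = u)" if i: "i \<in> I" for i
  proof -
    have i: "i < n" "triv i" using i by (auto simp: I_def)
    obtain v where "v \<in> c (Suc i)" "v \<notin> c i" using strict[OF i(1)] by blast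
    moreover have "\<forall>v\<in>c (Suc i). \<forall>q\<in>Q. act V v q - v \<in> c i" using i(2) Q(2) unfolding triv_def by blast
    moreover have "inv_sub Q (c i)" "inv_sub Q (c (Suc i))"
      using inv_sub_mono[OF sub Q(2)] i(1) by auto
    ultimately show ?thesis using lift strict[OF i(1)] unfolding fixed_lifting_def by blast
  qed
  then obtain u where u: "\<And>i. i \<in> I \<Longrightarrow> u i \<in> c (Suc i) \<and> u i \<notin> c i \<and> (\<forall>q\<in>Q. act V (u i) q = u i)" by metis
  have ind: "independent (u ` I) \<and> inj_on u I"
    by (rule independent_chain[OF c finI]) (use u in \<open>auto simp: I_def\<close>)
  have "u ` I \<subseteq> {v \<in> vecs V. \<forall>q\<in>Q. act V v q = v}"
  proof
    fix w assume "w \<in> u ` I"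
    then obtain i where i: "i \<in> I" "w = u i" by blast
    then have "u i \<in> vecs V" using u[OF i(1)] inv_subD(1)[OF sub, of "Suc i"] by (auto simp: I_def)
    then show "w \<in> {v \<in> vecs V. \<forall>q\<in>Q. act V v q = v}" using u[OF i(1)] i by simp
  qed
  then have "u ` I \<subseteq> span T1" using T1(3) by blast
  then have "card (u ` I) \<le> card T1" using independent_span_bound[OF T1(1)] ind by blast
  then have I_le: "card I \<le> a * k" using ind T1(2) by (simp add: card_image)
  define R where "R = min_rep_dim TYPE('f) (G\<lparr>carrier := X\<rparr>)"
  have cT: "c i \<subseteq> span T0" if "i \<le> n" for i using inv_subD(1)[OF sub[OF that]] T0(3) by blast
  have "card {i. i < m \<and> triv i} + R * card {i. i < m \<and> \<not> triv i} \<le> dim (c m)" if "m \<le> n" for m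
    using that
  proof (induction m)
    case (Suc m)
    have mn: "m < n" using Suc.prems by simp
    have IH: "card {i. i < m \<and> triv i} + R * card {i. i < m \<and> \<not> triv i} \<le> dim (c m)" using Suc by simp
    show ?case
    proof (cases "triv m")
      case True
      have "{i. i < Suc m \<and> triv i} = insert m {i. i < m \<and> triv i}" "{i. i < Suc m \<and> \<not> triv i} = {i. i < m \<and> \<not> triv i}"
        using True by (auto simp: less_Suc_eq)
      moreover have "dim (c m) < dim (c (Suc m))"
        using dim_less_subspace[OF inv_subD(2)[OF sub] inv_subD(2)[OF sub] cT T0(1) strict[OF mn]] mn Suc.prems by simp
      ultimately show ?thesis using IH by simp
    next
      case False
      have "{i. i < Suc m \<and> \<not> triv i} = insert m {i. i < m \<and> \<not> triv i}" "{i. i < Suc m \<and> triv i} = {i. i < m \<and> triv i}"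
        using False by (auto simp: less_Suc_eq)
      moreover obtain v x where vx: "v \<in> c (Suc m)" "x \<in> X" "act V v x - v \<notin> c m"
        using False unfolding triv_def by blast
      moreover have "dim (c m) + R \<le> dim (c (Suc m))"
        unfolding R_def
        by (rule min_rep_dim_le_factor(1)[OF X sub sub cT T0(1) psubset_imp_subset[OF strict[OF mn]] vx])
          (use mn in auto)
      ultimately show ?thesis using IH by simp
    qed
  qed simp
  from this[of n] have "card I + R * card {i. i < n \<and> \<not> triv i} \<le> dim (c n)" by (simp add: I_def)
  also have "dim (c n) \<le> card T0" by (rule dim_le_card[OF cT T0(1)]) simp
  also note T0(2)
  finally have total: "card I + R * card {i. i < n \<and> \<not> triv i} \<le> a * d" .
  have "{..<n} = I \<union> {i. i < n \<and> \<not> triv i}" by (auto simp: I_def)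
  moreover have "card (I \<union> {i. i < n \<and> \<not> triv i}) = card I + card {i. i < n \<and> \<not> triv i}"
    by (rule card_Un_disjoint) (auto simp: I_def)
  ultimately have n: "n = card I + card {i. i < n \<and> \<not> triv i}" by (metis card_lessThan)
  define J where "J = card {i. i < n \<and> \<not> triv i}"
  have ad: "real (a * k) \<le> real (a * d)" using kd by (simp add: mult_left_mono)
  show ?thesis
  proof (cases "J = 0")
    case True
    have "n = card I + J" using n by (simp only: J_def)
    then have "n \<le> a * k" using True I_le by simp
    then have "real n \<le> real (a * k)" by (simp only: of_nat_le_iff)
    moreover have "0 \<le> (real (a * d) - real (a * k)) / real R" using ad by simp
    ultimately show ?thesis by (auto simp: rep_bound_def R_def)
  next
    case False
    then obtain i where i: "i < n" "\<not> triv i" unfolding J_def by (metis (mono_tags, lifting) Collect_empty_eq card.empty)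
    then obtain v x where vx: "v \<in> c (Suc i)" "x \<in> X" "act V v x - v \<notin> c i" unfolding triv_def by blast
    have R: "R > 0" unfolding R_def
      by (rule min_rep_dim_le_factor(2)[OF X sub sub cT T0(1) psubset_imp_subset[OF strict[OF i(1)]] vx])
        (use i in auto)
    have "X \<noteq> {\<one>}"
    proof
      assume "X = {\<one>}"
      have "v \<in> vecs V" using vx inv_subD(1)[OF sub, of "Suc i"] i by auto
      then have "act V v x - v = 0" using vx \<open>X = {\<one>}\<close> act_one by simp
      then show False using vx(3) inv_subD(3)[OF sub, of i] i by simp
    qed
    have "real (card I) + real R * real J \<le> real (a * d)"
      using total unfolding J_def by (metis of_nat_add of_nat_le_iff of_nat_mult)
    then have "real J \<le> (real (a * d) - real (card I)) / real R" using R by (simp add: pos_le_divide_eq mult.commute)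
    then have "real n \<le> real (card I) + (real (a * d) - real (card I)) / real R" using n by (simp add: J_def)
    also have "\<dots> \<le> real (a * k) + (real (a * d) - real (a * k)) / real R"
    proof -
      have "0 \<le> real (a * k) - real (card I)" using I_le by (simp only: diff_ge_0_iff_ge of_nat_le_iff)
      then have "(real (a * k) - real (card I)) / real R \<le> (real (a * k) - real (card I)) / 1"
        using R by (intro divide_left_mono) auto
      then show ?thesis by (simp add: diff_divide_distrib)
    qed
    finally show ?thesis using \<open>X \<noteq> {\<one>}\<close> by (simp add: rep_bound_def R_def)
  qed
qed

text \<open>This provides a member for the set over which the minimum m is taken. For the trivial
  group the lines spanned by basis vectors are simple.\<close>

lemma semisimple_trivial_group:
  assumes dim: "has_dimension V a"
  shows "semisimple (G\<lparr>carrier := {\<one>}\<rparr>) V"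
proof -
  obtain B where B: "finite B" "independent B" "span B = vecs V" using dim by (auto simp: has_dimension_def)
  define \<S> where "\<S> = (\<lambda>b. span {b}) ` B"
  have BV: "b \<in> vecs V" if "b \<in> B" for b using that B(3) span_base by blast
  have spanV: "span {b} \<subseteq> vecs V" if "b \<in> B" for b using span_minimal[OF _ subspace_vecs, of "{b}"] BV[OF that] by simp
  have triv: "inv_sub {\<one>} S" if "subspace S" "S \<subseteq> vecs V" for S
    using that act_one by (auto simp: submod_def)
  have b0: "b \<noteq> 0" if "b \<in> B" for b using that B(2) dependent_zero by blast
  have "simple_submod (G\<lparr>carrier := {\<one>}\<rparr>) V (span {b})" if b: "b \<in> B" for b
    unfolding simple_submod_def
  proof (intro conjI allI impI)
    show "inv_sub {\<one>} (span {b})" by (rule triv[OF subspace_span spanV[OF b]])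
    show "span {b} \<noteq> {0}" using b0[OF b] span_base[of b "{b}"] by auto
    fix T assume T: "inv_sub {\<one>} T \<and> T \<subseteq> span {b}"
    show "T = {0} \<or> T = span {b}"
    proof (cases "T = {0}")
      case False
      then obtain t where t: "t \<in> T" "t \<noteq> 0" using T inv_subD(3) by blast
      then obtain k where k: "t = smul V k b" using T by (auto simp: span_singleton)
      then have "k \<noteq> 0" using t by auto
      then have "b = smul V (inverse k) t" using k by simp
      then have "b \<in> T" using T t inv_subD(6) by metis
      then have "span {b} \<subseteq> T" using T inv_subD(2) by (intro span_minimal) auto
      then show ?thesis using T by blast
    qed simp
  qed
  moreover have "span {b} \<inter> span (\<Union> (\<S> - {span {b}})) = {0}" if b: "b \<in> B" for b
  proof
    have "\<Union> (\<S> - {span {b}}) \<subseteq> span (B - {b})"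
    proof
      fix x assume "x \<in> \<Union> (\<S> - {span {b}})"
      then obtain b' where b': "b' \<in> B" "b' \<noteq> b" "x \<in> span {b'}" by (auto simp: \<S>_def)
      then show "x \<in> span (B - {b})" using span_mono[of "{b'}" "B - {b}"] by blast
    qed
    then have sub: "span (\<Union> (\<S> - {span {b}})) \<subseteq> span (B - {b})" by (intro span_minimal subspace_span)
    show "span {b} \<inter> span (\<Union> (\<S> - {span {b}})) \<subseteq> {0}"
    proof
      fix x assume x: "x \<in> span {b} \<inter> span (\<Union> (\<S> - {span {b}}))"
      then obtain k where k: "x = smul V k b" by (auto simp: span_singleton)
      show "x \<in> {0}"
      proof (cases "k = 0")
        case False
        then have "b = smul V (inverse k) x" using k by simp
        moreover have "x \<in> span (B - {b})" using x sub by blast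
        ultimately have "b \<in> span (B - {b})" by (metis span_scale)
        then show ?thesis using B(2) b dependent_def by blast
      qed (use k in simp)
    qed
  qed (auto simp: span_zero)
  moreover have "span (\<Union>\<S>) = vecs V"
  proof
    show "span (\<Union>\<S>) \<subseteq> vecs V" using spanV by (intro span_minimal subspace_vecs) (auto simp: \<S>_def)
    have "B \<subseteq> \<Union>\<S>" using span_base by (auto simp: \<S>_def)
    then show "vecs V \<subseteq> span (\<Union>\<S>)" using span_mono B(3) by blast
  qed
  ultimately show ?thesis unfolding semisimple_def by (intro exI[of _ \<S>]) (auto simp: \<S>_def)
qed

end

text \<open>A fixed function is determined by its values at one representative for each orbit of
  \<open>Q\<close> on the cosets, and each of these values lies in a space spanned by a
  vectors.\<close>

lemma (in group) induced_fixed_span: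
  assumes L: "subgroup L G" and U: "group_module (G\<lparr>carrier := L\<rparr>) U" and dimU: "has_dimension U a"
    and Q: "subgroup Q G" and fin: "finite (carrier G)"
  obtains T where "finite T" "card T \<le> a * card (coset_orbits G Q (rcosets L))"
    "{f \<in> vecs (induced G L U). \<forall>q\<in>Q. act (induced G L U) f q = f} \<subseteq> module.span (smul (induced G L U)) T"
proof -
  interpret U: group_module "G\<lparr>carrier := L\<rparr>" U by (fact U)
  interpret W: group_module G "induced G L U" by (rule group_module_induced[OF L U])
  interpret \<Omega>: right_action G "rcosets L" "(#>)" by (rule right_action_rcosets[OF L])
  note LG = subgroup.mem_carrier[OF L] and QG = subgroup.mem_carrier[OF Q]
  let ?O = "coset_orbits G Q (rcosets L)"
  have O_eq: "?O = \<Omega>.rorbit Q ` (rcosets L)"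
    by (auto simp: coset_orbits_def orbits_def orbit_def \<Omega>.rorbit_def image_def)
  have finO: "finite ?O" unfolding O_eq using fin by (simp add: RCOSETS_def)
  obtain B where B: "finite B" "card B = a" "U.independent B" "U.span B = vecs U"
    using dimU by (auto simp: has_dimension_def)
  have "\<exists>x\<in>carrier G. ob = \<Omega>.rorbit Q (L #> x)" if "ob \<in> ?O" for ob
    using that unfolding O_eq by (auto simp: RCOSETS_def)
  then obtain x where x: "\<And>ob. ob \<in> ?O \<Longrightarrow> x ob \<in> carrier G \<and> ob = \<Omega>.rorbit Q (L #> x ob)" by metis
  have in_coset: "L #> y \<in> rcosets L" if "y \<in> carrier G" for y using that by (auto simp: RCOSETS_def)
  have decomp: "\<exists>h. h \<in> L \<and> (\<exists>q\<in>Q. y = h \<otimes> x ob \<otimes> q)" if ob: "ob \<in> ?O" "L #> y \<in> ob" "y \<in> carrier G" for ob y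
  proof -
    have xo: "x ob \<in> carrier G" "ob = \<Omega>.rorbit Q (L #> x ob)" using x[OF ob(1)] by auto
    then obtain q where q: "q \<in> Q" "L #> y = L #> x ob #> q" using ob(2) by (auto simp: \<Omega>.rorbit_def)
    then have "L #> y = L #> (x ob \<otimes> q)" using xo(1) QG subgroup.subset[OF L] by (simp add: coset_mult_assoc)
    then have "y \<in> L #> (x ob \<otimes> q)" using rcos_self[OF ob(3) L] by simp
    then obtain h where "h \<in> L" "y = h \<otimes> (x ob \<otimes> q)" by (auto simp: r_coset_def)
    then show ?thesis using q xo LG QG by (auto simp: m_assoc)
  qed
  define h where "h ob y = (SOME h. h \<in> L \<and> (\<exists>q\<in>Q. y = h \<otimes> x ob \<otimes> q))" for ob y
  have h: "h ob y \<in> L \<and> (\<exists>q\<in>Q. y = h ob y \<otimes> x ob \<otimes> q)" if "ob \<in> ?O" "L #> y \<in> ob" "y \<in> carrier G" for ob y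
    unfolding h_def by (rule someI_ex[OF decomp[OF that]])
  \<comment> \<open>The value \<open>u\<close> at the representative is spread over the orbit by the
    chosen factorisations. The result need not be fixed, nor lie in the induced module; but a fixed
    function is reproduced from its values whatever factorisations are chosen, and only a spanning
    set is wanted.\<close>
  define E where "E ob u = (\<lambda>y. if y \<in> carrier G \<and> L #> y \<in> ob then act U u (inv (h ob y)) else 0)" for ob u
  define T where "T = (\<lambda>(ob, b). E ob b) ` (?O \<times> B)"
  have hi: "inv (h ob y) \<in> L" if "ob \<in> ?O" "L #> y \<in> ob" "y \<in> carrier G" for ob y
    using h[OF that] subgroup.m_inv_closed[OF L] by blast
  have E_span: "E ob u \<in> W.span T" if ob: "ob \<in> ?O" and u: "u \<in> vecs U" for ob u
  proof -
    let ?Z = "{u \<in> vecs U. E ob u \<in> W.span T}"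
    have "U.subspace ?Z"
      unfolding U.subspace_def
    proof (intro conjI ballI allI)
      have "E ob 0 = 0" using hi[OF ob] U.act_0 by (auto simp: E_def fun_eq_iff)
      then show "0 \<in> ?Z" using U.subspace_0[OF U.subspace_vecs] W.span_zero by simp
      show "v + w \<in> ?Z" if "v \<in> ?Z" "w \<in> ?Z" for v w
      proof -
        have "E ob (v + w) = E ob v + E ob w" using that hi[OF ob] by (auto simp: E_def fun_eq_iff U.act_add)
        then show ?thesis using that W.span_add U.subspace_add[OF U.subspace_vecs] by simp
      qed
      show "smul U c v \<in> ?Z" if "v \<in> ?Z" for c v
      proof -
        have "E ob (smul U c v) = smul (induced G L U) c (E ob v)"
          using that hi[OF ob] by (auto simp: E_def fun_eq_iff U.act_smul induced_def)
        then show ?thesis using that W.span_scale U.subspace_scale[OF U.subspace_vecs] by simp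
      qed
    qed
    moreover have "B \<subseteq> ?Z"
      using ob B U.span_base by (auto simp: T_def intro!: W.span_base)
    ultimately have "U.span B \<subseteq> ?Z" by (rule U.span_minimal[rotated])
    then show ?thesis using B(4) u by blast
  qed
  show ?thesis
  proof (rule that[of T])
    show "finite T" using finO B by (simp add: T_def)
    have "card T \<le> card (?O \<times> B)" unfolding T_def using finO B by (intro card_image_le) auto
    then show "card T \<le> a * card ?O" using B by (simp add: card_cartesian_product mult.commute)
    show "{f \<in> vecs (induced G L U). \<forall>q\<in>Q. act (induced G L U) f q = f} \<subseteq> W.span T"
    proof
      fix f assume "f \<in> {f \<in> vecs (induced G L U). \<forall>q\<in>Q. act (induced G L U) f q = f}"
      then have f: "f \<in> vecs (induced G L U)" "\<And>q. q \<in> Q \<Longrightarrow> act (induced G L U) f q = f" by auto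
      have fU: "f y \<in> vecs U" if "y \<in> carrier G" for y using f(1) that by (simp add: induced_def)
      have f_out: "f y = 0" if "y \<notin> carrier G" for y using f(1) that by (simp add: induced_def)
      have f_h: "f (k \<otimes> y) = act U (f y) (inv k)" if "k \<in> L" "y \<in> carrier G" for k y
        using f(1) that by (simp add: induced_def)
      have f_q: "f (y \<otimes> q) = f y" if "q \<in> Q" "y \<in> carrier G" for y q
      proof -
        have "act (induced G L U) f (inv q) y = f y" using f(2) subgroup.m_inv_closed[OF Q that(1)] by simp
        then show ?thesis using that QG by (simp add: induced_def)
      qed
      have fy: "f y = E ob (f (x ob)) y" if ob: "ob \<in> ?O" "L #> y \<in> ob" "y \<in> carrier G" for ob y
      proof -
        obtain q where q: "h ob y \<in> L" "q \<in> Q" "y = h ob y \<otimes> x ob \<otimes> q" using h[OF ob] by blast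
        have xo: "x ob \<in> carrier G" using x[OF ob(1)] by blast
        have "f y = f (h ob y \<otimes> x ob \<otimes> q)" using q(3) by simp
        also have "\<dots> = f (h ob y \<otimes> x ob)" by (rule f_q[OF q(2)]) (use xo LG q(1) in simp)
        also have "\<dots> = act U (f (x ob)) (inv (h ob y))" using f_h q xo by simp
        finally show ?thesis using ob by (simp add: E_def)
      qed
      have "f = (\<Sum>ob\<in>?O. E ob (f (x ob)))"
      proof
        fix y
        have "(\<Sum>ob\<in>S. E ob (f (x ob))) y = (\<Sum>ob\<in>S. E ob (f (x ob)) y)" if "finite S" for S
          using that by (induction S rule: finite_induct) auto
        note app = this[OF finO]
        show "f y = (\<Sum>ob\<in>?O. E ob (f (x ob))) y"
        proof (cases "y \<in> carrier G")
          case True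
          define o0 where "o0 = \<Omega>.rorbit Q (L #> y)"
          have o0: "o0 \<in> ?O" "L #> y \<in> o0"
            using \<Omega>.rorbit_self[OF Q in_coset[OF True]] in_coset[OF True] by (auto simp: o0_def O_eq)
          have "E ob (f (x ob)) y = 0" if ob: "ob \<in> ?O - {o0}" for ob
          proof -
            have "L #> y \<notin> ob"
            proof
              assume "L #> y \<in> ob"
              moreover obtain C where "C \<in> rcosets L" "ob = \<Omega>.rorbit Q C" using ob unfolding O_eq by blast
              ultimately have "ob = o0" using \<Omega>.rorbit_eq[OF Q] by (simp add: o0_def)
              then show False using ob by blast
            qed
            then show ?thesis by (simp add: E_def)
          qed
          then have "(\<Sum>ob\<in>?O. E ob (f (x ob)) y) = E o0 (f (x o0)) y"
            using sum.remove[OF finO o0(1), of "\<lambda>ob. E ob (f (x ob)) y"] by simp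
          then show ?thesis using app fy[OF o0 True] by simp
        next
          case False
          then show ?thesis using f_out app by (simp add: E_def)
        qed
      qed
      also have "\<dots> \<in> W.span T" using E_span fU x by (intro W.span_sum) auto
      finally show "f \<in> W.span T" .
    qed
  qed
qed

section \<open>Hall subgroups of soluble groups\<close>

context group begin

lemma finite_mult_closed_subgroup:
  assumes fin: "finite (carrier G)" and Z: "Z \<subseteq> carrier G" "Z \<noteq> {}"
    and mult: "\<And>x y. \<lbrakk>x \<in> Z; y \<in> Z\<rbrakk> \<Longrightarrow> x \<otimes> y \<in> Z"
  shows "subgroup Z G"
proof (rule subgroupI[OF Z _ mult])
  fix x assume x: "x \<in> Z"
  then have xG: "x \<in> carrier G" using Z by blast
  have pow: "x [^] Suc n \<in> Z" for n by (induction n) (use x xG mult in auto)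
  have "order G > 0" using fin by (simp add: order_gt_0_iff_finite)
  then have "Suc (2 * order G - 2) = 2 * order G - 1" "2 * order G - 1 + 1 = 2 * order G" by auto
  then have "x [^] (2 * order G - 1) \<otimes> x [^] (1::nat) = x [^] (2 * order G)"
    using nat_pow_mult[OF xG, of "2 * order G - 1" 1] by simp
  also have "\<dots> = \<one>"
    using pow_order_eq_1[OF xG] nat_pow_pow[OF xG, of "order G" 2] by (simp add: mult.commute)
  finally have "inv x = x [^] (2 * order G - 1)" using xG by (metis inv_equality nat_pow_closed nat_pow_eone)
  then show "inv x \<in> Z" using pow[of "2 * order G - 2"] \<open>Suc (2 * order G - 2) = 2 * order G - 1\<close> by simp
qed

text \<open>
  The Schur--Zassenhaus argument for an abelian kernel: the factor set of a transversal is made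
  trivial modulo \<open>B\<close> by averaging over the transversal. The map \<open>\<kappa>\<close> identifies \<open>C / B\<close> with
  a subgroup of the abelian group \<open>Q\<close>.
\<close>

lemma abelian_complement:
  fixes Q :: "('q, 'c) monoid_scheme"
  assumes fin: "finite (carrier G)" and Y: "subgroup Y G" and C: "subgroup C G" "C \<subseteq> Y"
    and B: "subgroup B G" "B \<subseteq> C"
    and C_normal: "\<And>y c. \<lbrakk>y \<in> Y; c \<in> C\<rbrakk> \<Longrightarrow> y \<otimes> c \<otimes> inv y \<in> C"
    and B_normal: "\<And>y b. \<lbrakk>y \<in> Y; b \<in> B\<rbrakk> \<Longrightarrow> y \<otimes> b \<otimes> inv y \<in> B"
    and Q: "comm_group Q" and \<kappa>: "\<And>c. c \<in> C \<Longrightarrow> \<kappa> c \<in> carrier Q"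
      "\<And>c c'. \<lbrakk>c \<in> C; c' \<in> C\<rbrakk> \<Longrightarrow> \<kappa> (c \<otimes> c') = \<kappa> c \<otimes>\<^bsub>Q\<^esub> \<kappa> c'"
      "\<And>c. c \<in> C \<Longrightarrow> \<kappa> c = \<one>\<^bsub>Q\<^esub> \<longleftrightarrow> c \<in> B"
    and exp: "\<And>c. c \<in> C \<Longrightarrow> \<kappa> c [^]\<^bsub>Q\<^esub> (m::nat) = \<one>\<^bsub>Q\<^esub>" and card: "card Y = card C * n" and coprime: "coprime n m"
  shows "\<exists>Z. subgroup Z G \<and> B \<subseteq> Z \<and> Z \<subseteq> Y \<and> card Z = card B * n"
proof -
  interpret Q: comm_group Q by (fact Q)
  note YG = subgroup.mem_carrier[OF Y] and CG = subgroup.mem_carrier[OF C(1)] and BG = subgroup.mem_carrier[OF B(1)]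
  have CY: "c \<in> Y" if "c \<in> C" for c using that C by blast
  have BC: "b \<in> C" if "b \<in> B" for b using that B by blast
  note Ym = subgroup.m_closed[OF Y] and Yi = subgroup.m_inv_closed[OF Y]
    and Cm = subgroup.m_closed[OF C(1)] and Ci = subgroup.m_inv_closed[OF C(1)]
    and Bm = subgroup.m_closed[OF B(1)] and Bi = subgroup.m_inv_closed[OF B(1)]
  have finY: "finite Y" using fin finite_subset[OF subgroup.subset[OF Y]] by blast
  have \<kappa>_one: "\<kappa> \<one> = \<one>\<^bsub>Q\<^esub>" using \<kappa>(3) subgroup.one_closed C(1) B(1) by metis
  have \<kappa>_inv: "\<kappa> (inv c) = inv\<^bsub>Q\<^esub> \<kappa> c" if "c \<in> C" for c
  proof -
    have "\<kappa> (inv c) \<otimes>\<^bsub>Q\<^esub> \<kappa> c = \<one>\<^bsub>Q\<^esub>"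
      using \<kappa>(2)[OF Ci[OF that] that] that CG \<kappa>_one by simp
    then show ?thesis using \<kappa>(1) that Ci by (metis Q.inv_equality)
  qed
  have \<kappa>_pow: "\<kappa> (c [^] (k::nat)) = \<kappa> c [^]\<^bsub>Q\<^esub> k \<and> c [^] k \<in> C" if "c \<in> C" for c k
    using that by (induction k) (auto simp: \<kappa>_one \<kappa>(2) Cm subgroup.one_closed[OF C(1)])
  have conj_mult: "y \<otimes> (a \<otimes> b) \<otimes> inv y = (y \<otimes> a \<otimes> inv y) \<otimes> (y \<otimes> b \<otimes> inv y)"
    if "y \<in> carrier G" "a \<in> carrier G" "b \<in> carrier G" for y a b
  proof -
    have "(y \<otimes> a \<otimes> inv y) \<otimes> (y \<otimes> b \<otimes> inv y) = y \<otimes> a \<otimes> (inv y \<otimes> y) \<otimes> b \<otimes> inv y"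
      using that by (simp only: m_assoc m_closed inv_closed)
    then show ?thesis using that by (simp add: m_assoc)
  qed
  \<comment> \<open>Conjugation is available on \<open>C\<close> but not on \<open>Q\<close>, so a
    finite product of values of \<kappa> is lifted to \<open>C\<close>. The value of \<kappa> after
    conjugation does not depend on the lift, because \<open>B\<close> is the kernel and is
    normalised by \<open>Y\<close>.\<close>
  have \<kappa>_conj: "\<exists>c\<in>C. \<kappa> c = finprod Q (\<lambda>z. \<kappa> (g z)) S \<and>
      (\<forall>c\<in>C. \<kappa> c = finprod Q (\<lambda>z. \<kappa> (g z)) S \<longrightarrow> \<kappa> (y \<otimes> c \<otimes> inv y) = finprod Q (\<lambda>z. \<kappa> (y \<otimes> g z \<otimes> inv y)) S)"
    if "finite S" "\<And>z. z \<in> S \<Longrightarrow> g z \<in> C" "y \<in> Y" for g S y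
    using that(1,2)
  proof (induction S rule: finite_induct)
    case empty
    have "\<kappa> (y \<otimes> c \<otimes> inv y) = \<one>\<^bsub>Q\<^esub>" if "c \<in> C" "\<kappa> c = \<one>\<^bsub>Q\<^esub>" for c
      using that \<kappa>(3) B_normal[OF \<open>y \<in> Y\<close>] C_normal[OF \<open>y \<in> Y\<close>] by metis
    then show ?case using \<kappa>_one subgroup.one_closed[OF C(1)] by auto
  next
    case (insert z S)
    obtain c0 where c0: "c0 \<in> C" "\<kappa> c0 = finprod Q (\<lambda>z. \<kappa> (g z)) S"
      and all: "\<And>c. \<lbrakk>c \<in> C; \<kappa> c = finprod Q (\<lambda>z. \<kappa> (g z)) S\<rbrakk> \<Longrightarrow>
        \<kappa> (y \<otimes> c \<otimes> inv y) = finprod Q (\<lambda>z. \<kappa> (y \<otimes> g z \<otimes> inv y)) S" using insert by auto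
    have gz: "g z \<in> C" using insert.prems by simp
    have p1: "finprod Q (\<lambda>z. \<kappa> (g z)) (insert z S) = \<kappa> (g z) \<otimes>\<^bsub>Q\<^esub> finprod Q (\<lambda>z. \<kappa> (g z)) S"
      using insert \<kappa>(1) by (intro Q.finprod_insert) auto
    have p2: "finprod Q (\<lambda>z. \<kappa> (y \<otimes> g z \<otimes> inv y)) (insert z S)
        = \<kappa> (y \<otimes> g z \<otimes> inv y) \<otimes>\<^bsub>Q\<^esub> finprod Q (\<lambda>z. \<kappa> (y \<otimes> g z \<otimes> inv y)) S"
      using insert \<kappa>(1) C_normal[OF \<open>y \<in> Y\<close>] by (intro Q.finprod_insert) auto
    show ?case
    proof (intro bexI[of _ "g z \<otimes> c0"] conjI ballI impI)
      show "\<kappa> (g z \<otimes> c0) = finprod Q (\<lambda>z. \<kappa> (g z)) (insert z S)" using p1 c0 gz \<kappa>(2) by simp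
      show "g z \<otimes> c0 \<in> C" using gz c0 Cm by blast
      fix c assume c: "c \<in> C" "\<kappa> c = finprod Q (\<lambda>z. \<kappa> (g z)) (insert z S)"
      define c' where "c' = inv (g z) \<otimes> c"
      have c': "c' \<in> C" "c = g z \<otimes> c'" using c gz Cm Ci CG by (auto simp: c'_def m_assoc[symmetric])
      have "\<kappa> (g z) \<otimes>\<^bsub>Q\<^esub> \<kappa> c' = \<kappa> (g z) \<otimes>\<^bsub>Q\<^esub> \<kappa> c0" using c c' p1 c0 gz \<kappa>(2) by metis
      then have "\<kappa> c' = \<kappa> c0" using \<kappa>(1) gz c' c0 by (metis Q.Units_eq Q.Units_l_cancel)
      then have "\<kappa> (y \<otimes> c' \<otimes> inv y) = finprod Q (\<lambda>z. \<kappa> (y \<otimes> g z \<otimes> inv y)) S" using all c' c0 by simp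
      then show "\<kappa> (y \<otimes> c \<otimes> inv y) = finprod Q (\<lambda>z. \<kappa> (y \<otimes> g z \<otimes> inv y)) (insert z S)"
        using p2 c'(2) conj_mult[OF YG[OF \<open>y \<in> Y\<close>] CG[OF gz] CG[OF c'(1)]]
          \<kappa>(2)[OF C_normal[OF \<open>y \<in> Y\<close> gz] C_normal[OF \<open>y \<in> Y\<close> c'(1)]] by simp
    qed
  qed
  \<comment> \<open>The representative is chosen from the coset as a set, so that \<tau> depends on
    the coset only.\<close>
  define \<tau> where "\<tau> y = (SOME t. t \<in> C #> y)" for y
  have \<tau>_coset: "\<tau> y \<in> C #> y" if "y \<in> Y" for y
    unfolding \<tau>_def using rcos_self[OF YG[OF that] C(1)] by (rule someI)
  have \<tau>_ex: "\<exists>c\<in>C. \<tau> y = c \<otimes> y" if "y \<in> Y" for y using \<tau>_coset[OF that] by (auto simp: r_coset_def)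
  have \<tau>Y: "\<tau> y \<in> Y" if "y \<in> Y" for y using \<tau>_ex[OF that] CY Ym that by auto
  have \<tau>G: "\<tau> y \<in> carrier G" if "y \<in> Y" for y using YG \<tau>Y that by blast
  have coset_eq: "C #> (c \<otimes> y) = C #> y" if "c \<in> C" "y \<in> carrier G" for c y
    using that CG coset_mult_assoc[OF subgroup.subset[OF C(1)], of c y] subgroup.rcos_const[OF C(1) is_group] by simp
  have \<tau>_mult: "\<tau> (c \<otimes> y) = \<tau> y" if "c \<in> C" "y \<in> Y" for c y
    unfolding \<tau>_def using coset_eq[OF that(1) YG[OF that(2)]] by simp
  have \<tau>_conj: "\<tau> (x \<otimes> c \<otimes> y) = \<tau> (x \<otimes> y)" if "x \<in> Y" "c \<in> C" "y \<in> Y" for x c y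
  proof -
    have "x \<otimes> c \<otimes> y = (x \<otimes> c \<otimes> inv x) \<otimes> (x \<otimes> y)" using that YG CG by (simp add: m_assoc inv_solve_left)
    then show ?thesis using \<tau>_mult[OF C_normal[OF that(1,2)] Ym[OF that(1,3)]] by simp
  qed
  have \<tau>_right: "\<tau> (x \<otimes> \<tau> y) = \<tau> (x \<otimes> y)" if xy: "x \<in> Y" "y \<in> Y" for x y
  proof -
    obtain c where "c \<in> C" "\<tau> y = c \<otimes> y" using \<tau>_ex[OF xy(2)] by blast
    then show ?thesis using \<tau>_conj[OF xy(1) _ xy(2), of c] xy YG CG by (simp add: m_assoc)
  qed
  have \<tau>_idem: "\<tau> (\<tau> y) = \<tau> y" if "y \<in> Y" for y
    using \<tau>_ex[OF that] \<tau>_mult[OF _ that] by auto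
  have \<tau>_eqD: "\<exists>c\<in>C. y = c \<otimes> x" if xy: "\<tau> x = \<tau> y" "x \<in> Y" "y \<in> Y" for x y
  proof -
    obtain c d where cd: "c \<in> C" "d \<in> C" "\<tau> x = c \<otimes> x" "\<tau> y = d \<otimes> y" using \<tau>_ex[OF xy(2)] \<tau>_ex[OF xy(3)] by blast
    then have "y = inv d \<otimes> (c \<otimes> x)" using xy YG CG by (metis inv_solve_left m_closed)
    then have "y = (inv d \<otimes> c) \<otimes> x" using cd xy YG CG by (simp add: m_assoc)
    then show ?thesis using cd Cm Ci by blast
  qed
  define R where "R = \<tau> ` Y"
  have finR: "finite R" using finY by (simp add: R_def)
  have RY: "z \<in> Y" "\<tau> z = z" if "z \<in> R" for z using that \<tau>Y \<tau>_idem by (auto simp: R_def)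
  have cardR: "card R = n"
  proof -
    have "bij_betw (\<lambda>(c, t). c \<otimes> t) (C \<times> R) Y"
      unfolding bij_betw_def
    proof (intro conjI inj_onI)
      fix a b assume ab: "a \<in> C \<times> R" "b \<in> C \<times> R" "(case a of (c, t) \<Rightarrow> c \<otimes> t) = (case b of (c, t) \<Rightarrow> c \<otimes> t)"
      then obtain c t c' t' where e: "a = (c, t)" "b = (c', t')" "c \<in> C" "t \<in> R" "c' \<in> C" "t' \<in> R" "c \<otimes> t = c' \<otimes> t'" by auto
      then have "t = t'" using \<tau>_mult RY by metis
      then show "a = b" using e CG YG RY by auto
    next
      show "(\<lambda>(c, t). c \<otimes> t) ` (C \<times> R) = Y"
      proof
        show "(\<lambda>(c, t). c \<otimes> t) ` (C \<times> R) \<subseteq> Y" using CY RY Ym by auto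
        show "Y \<subseteq> (\<lambda>(c, t). c \<otimes> t) ` (C \<times> R)"
        proof
          fix y assume y: "y \<in> Y"
          obtain c where c: "c \<in> C" "y = c \<otimes> \<tau> y" using \<tau>_eqD[OF \<tau>_idem[OF y] \<tau>Y[OF y] y] by blast
          then have "(c, \<tau> y) \<in> C \<times> R" using y by (auto simp: R_def)
          then show "y \<in> (\<lambda>(c, t). c \<otimes> t) ` (C \<times> R)" using c(2) by force
        qed
      qed
    qed
    then have "card Y = card C * card R" by (metis bij_betw_same_card card_cartesian_product)
    moreover have "card C > 0" using finite_subset[OF C(2) finY] subgroup.one_closed[OF C(1)] by (auto simp: card_gt_0_iff)
    ultimately show ?thesis using card by simp
  qed
  \<comment> \<open>The factor set of the transversal; \<open>cocycle\<close> expresses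
    associativity in terms of it.\<close>
  define f where "f x y = \<tau> x \<otimes> \<tau> y \<otimes> inv (\<tau> (x \<otimes> y))" for x y
  have fC: "f x y \<in> C" if xy: "x \<in> Y" "y \<in> Y" for x y
  proof -
    have "\<tau> (\<tau> x \<otimes> \<tau> y) = \<tau> (x \<otimes> y)"
    proof -
      obtain c where "c \<in> C" "\<tau> x = c \<otimes> x" using \<tau>_ex[OF xy(1)] by blast
      then have "\<tau> (\<tau> x \<otimes> \<tau> y) = \<tau> (x \<otimes> \<tau> y)"
        using \<tau>_mult[of c "x \<otimes> \<tau> y"] xy \<tau>Y Ym CG YG by (simp add: m_assoc)
      then show ?thesis using \<tau>_right[OF xy] by simp
    qed
    then have "\<tau> (\<tau> (x \<otimes> y)) = \<tau> (\<tau> x \<otimes> \<tau> y)" using \<tau>_idem Ym xy by simp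
    then obtain c where "c \<in> C" "\<tau> x \<otimes> \<tau> y = c \<otimes> \<tau> (x \<otimes> y)"
      using \<tau>_eqD[of "\<tau> (x \<otimes> y)" "\<tau> x \<otimes> \<tau> y"] \<tau>Y Ym xy by blast
    then show ?thesis unfolding f_def using CG \<tau>G Ym xy by (simp add: m_assoc)
  qed
  have f_right: "f x y = f x (\<tau> y)" if "x \<in> Y" "y \<in> Y" for x y
    using \<tau>_right[OF that] \<tau>_idem[OF that(2)] by (simp add: f_def)
  have cocycle: "f x y \<otimes> f (x \<otimes> y) z = (\<tau> x \<otimes> f y z \<otimes> inv (\<tau> x)) \<otimes> f x (y \<otimes> z)"
    if xyz: "x \<in> Y" "y \<in> Y" "z \<in> Y" for x y z
  proof -
    have cl: "\<tau> x \<in> carrier G" "\<tau> y \<in> carrier G" "\<tau> z \<in> carrier G" "\<tau> (x \<otimes> y) \<in> carrier G"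
      "\<tau> (y \<otimes> z) \<in> carrier G" "\<tau> (x \<otimes> y \<otimes> z) \<in> carrier G" using xyz \<tau>G Ym by simp_all
    have "x \<otimes> (y \<otimes> z) = x \<otimes> y \<otimes> z" using xyz YG by (simp add: m_assoc)
    have cancel: "inv a \<otimes> (a \<otimes> b) = b" if "a \<in> carrier G" "b \<in> carrier G" for a b
      using that by (simp add: m_assoc[symmetric])
    have "f x y \<otimes> f (x \<otimes> y) z = \<tau> x \<otimes> (\<tau> y \<otimes> (\<tau> z \<otimes> inv (\<tau> (x \<otimes> y \<otimes> z))))"
      unfolding f_def using cl by (simp add: m_assoc cancel)
    moreover have "(\<tau> x \<otimes> f y z \<otimes> inv (\<tau> x)) \<otimes> f x (y \<otimes> z) = \<tau> x \<otimes> (\<tau> y \<otimes> (\<tau> z \<otimes> inv (\<tau> (x \<otimes> y \<otimes> z))))"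
      unfolding f_def \<open>x \<otimes> (y \<otimes> z) = x \<otimes> y \<otimes> z\<close> using cl by (simp add: m_assoc cancel)
    ultimately show ?thesis by simp
  qed
  define F where "F y = finprod Q (\<lambda>z. \<kappa> (f y z)) R" for y
  define \<Phi> where "\<Phi> y = (SOME c. c \<in> C \<and> \<kappa> c = F y)" for y
  have \<Phi>: "\<Phi> y \<in> C" "\<kappa> (\<Phi> y) = F y" if y: "y \<in> Y" for y
  proof -
    have "\<exists>c. c \<in> C \<and> \<kappa> c = F y"
      unfolding F_def using \<kappa>_conj[OF finR, of "f y" \<one>] fC y RY(1) subgroup.one_closed[OF Y] by blast
    then have "\<Phi> y \<in> C \<and> \<kappa> (\<Phi> y) = F y" unfolding \<Phi>_def by (rule someI_ex)
    then show "\<Phi> y \<in> C" "\<kappa> (\<Phi> y) = F y" by auto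
  qed
  \<comment> \<open>The cocycle identity is multiplied over the transversal, so that the n-th power
    of the factor set appears as a coboundary. In the last factor, z \<mapsto> \<tau> (y z) permutes
    the transversal, and \<open>f\<close> depends on its second argument only through the
    coset.\<close>
  have F_mult: "\<kappa> (f x y) [^]\<^bsub>Q\<^esub> n \<otimes>\<^bsub>Q\<^esub> F (x \<otimes> y) = \<kappa> (\<tau> x \<otimes> \<Phi> y \<otimes> inv (\<tau> x)) \<otimes>\<^bsub>Q\<^esub> F x"
    if xy: "x \<in> Y" "y \<in> Y" for x y
  proof -
    have xyY: "x \<otimes> y \<in> Y" using xy Ym by blast
    have yz: "y \<otimes> z \<in> Y" if "z \<in> R" for z using that RY xy Ym by blast
    have conjC: "\<tau> x \<otimes> f y z \<otimes> inv (\<tau> x) \<in> C" if "z \<in> R" for z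
      using C_normal[OF \<tau>Y[OF xy(1)] fC[OF xy(2)]] RY that by blast
    have "finprod Q (\<lambda>z. \<kappa> (f x y)) R = \<kappa> (f x y) [^]\<^bsub>Q\<^esub> n"
      using Q.finprod_const[of "\<kappa> (f x y)" R] \<kappa>(1) fC xy cardR by simp
    then have "\<kappa> (f x y) [^]\<^bsub>Q\<^esub> n \<otimes>\<^bsub>Q\<^esub> F (x \<otimes> y)
      = finprod Q (\<lambda>z. \<kappa> (f x y)) R \<otimes>\<^bsub>Q\<^esub> finprod Q (\<lambda>z. \<kappa> (f (x \<otimes> y) z)) R" by (simp add: F_def)
    also have "\<dots> = finprod Q (\<lambda>z. \<kappa> (f x y) \<otimes>\<^bsub>Q\<^esub> \<kappa> (f (x \<otimes> y) z)) R"
      using \<kappa>(1) fC xy xyY RY by (intro Q.finprod_multf[symmetric]) auto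
    also have "\<dots> = finprod Q (\<lambda>z. \<kappa> (\<tau> x \<otimes> f y z \<otimes> inv (\<tau> x)) \<otimes>\<^bsub>Q\<^esub> \<kappa> (f x (y \<otimes> z))) R"
    proof (rule Q.finprod_cong')
      fix z assume z: "z \<in> R"
      have "\<kappa> (f x y) \<otimes>\<^bsub>Q\<^esub> \<kappa> (f (x \<otimes> y) z) = \<kappa> (f x y \<otimes> f (x \<otimes> y) z)"
        using \<kappa>(2)[OF fC[OF xy] fC[OF xyY RY(1)[OF z]]] by simp
      also have "\<dots> = \<kappa> (\<tau> x \<otimes> f y z \<otimes> inv (\<tau> x)) \<otimes>\<^bsub>Q\<^esub> \<kappa> (f x (y \<otimes> z))"
        unfolding cocycle[OF xy RY(1)[OF z]] using \<kappa>(2)[OF conjC[OF z] fC[OF xy(1) yz[OF z]]] .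
      finally show "\<kappa> (f x y) \<otimes>\<^bsub>Q\<^esub> \<kappa> (f (x \<otimes> y) z) = \<kappa> (\<tau> x \<otimes> f y z \<otimes> inv (\<tau> x)) \<otimes>\<^bsub>Q\<^esub> \<kappa> (f x (y \<otimes> z))" .
    qed (use \<kappa>(1) conjC fC xy yz in auto)
    also have "\<dots> = finprod Q (\<lambda>z. \<kappa> (\<tau> x \<otimes> f y z \<otimes> inv (\<tau> x))) R \<otimes>\<^bsub>Q\<^esub> finprod Q (\<lambda>z. \<kappa> (f x (y \<otimes> z))) R"
      using \<kappa>(1) conjC fC xy yz by (intro Q.finprod_multf) auto
    also have "finprod Q (\<lambda>z. \<kappa> (\<tau> x \<otimes> f y z \<otimes> inv (\<tau> x))) R = \<kappa> (\<tau> x \<otimes> \<Phi> y \<otimes> inv (\<tau> x))"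
    proof -
      have "\<kappa> (\<Phi> y) = finprod Q (\<lambda>z. \<kappa> (f y z)) R" using \<Phi>(2)[OF xy(2)] by (simp add: F_def)
      moreover have "f y z \<in> C" if "z \<in> R" for z using fC[OF xy(2) RY(1)[OF that]] .
      ultimately show ?thesis using \<kappa>_conj[OF finR, of "f y" "\<tau> x"] \<Phi>(1)[OF xy(2)] \<tau>Y[OF xy(1)] by auto
    qed
    also have "finprod Q (\<lambda>z. \<kappa> (f x (y \<otimes> z))) R = F x"
    proof -
      have inj: "inj_on (\<lambda>z. \<tau> (y \<otimes> z)) R"
      proof (rule inj_onI)
        fix z w assume z: "z \<in> R" and w: "w \<in> R" and e: "\<tau> (y \<otimes> z) = \<tau> (y \<otimes> w)"
        obtain c where c: "c \<in> C" "y \<otimes> w = c \<otimes> (y \<otimes> z)" using \<tau>_eqD[OF e yz[OF z] yz[OF w]] by blast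
        have yi: "inv y \<in> Y" using Yi xy by blast
        have "w = inv y \<otimes> (y \<otimes> w)" using xy w RY YG by (simp add: m_assoc[symmetric])
        also have "\<dots> = inv y \<otimes> c \<otimes> (y \<otimes> z)" using c xy z RY YG CG by (simp add: m_assoc)
        finally have "\<tau> w = \<tau> (inv y \<otimes> (y \<otimes> z))" using \<tau>_conj[OF yi c(1) yz[OF z]] by simp
        also have "inv y \<otimes> (y \<otimes> z) = z" using xy z RY YG by (simp add: m_assoc[symmetric])
        finally show "z = w" using RY z w by simp
      qed
      have "(\<lambda>z. \<tau> (y \<otimes> z)) ` R \<subseteq> R" using yz by (auto simp: R_def)
      then have img: "(\<lambda>z. \<tau> (y \<otimes> z)) ` R = R" using endo_inj_surj[OF finR _ inj] by blast
      have "F x = finprod Q (\<lambda>z. \<kappa> (f x z)) ((\<lambda>z. \<tau> (y \<otimes> z)) ` R)" using img by (simp add: F_def)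
      also have "\<dots> = finprod Q (\<lambda>z. \<kappa> (f x (\<tau> (y \<otimes> z)))) R"
        using inj img \<kappa>(1) fC xy RY by (intro Q.finprod_reindex) auto
      also have "\<dots> = finprod Q (\<lambda>z. \<kappa> (f x (y \<otimes> z))) R"
        using f_right[OF xy(1) yz, symmetric] \<kappa>(1) fC xy yz by (intro Q.finprod_cong') auto
      finally show ?thesis ..
    qed
    finally show ?thesis .
  qed
  \<comment> \<open>Raising to the power n is invertible here, as n is prime to the exponent m. If n
    = 0, coprimality forces m = 1 and all values of \<kappa> are trivial.\<close>
  obtain n' where n': "\<And>c. c \<in> C \<Longrightarrow> (\<kappa> c [^]\<^bsub>Q\<^esub> n) [^]\<^bsub>Q\<^esub> (n'::nat) = \<kappa> c"
  proof (cases "n = 0")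
    case True
    then have "m = 1" using coprime by simp
    then have "\<kappa> c = \<one>\<^bsub>Q\<^esub>" if "c \<in> C" for c using exp[OF that] \<kappa>(1)[OF that] by simp
    then show ?thesis using that[of 1] by simp
  next
    case False
    then obtain u v where uv: "n * u = m * v + 1"
      using bezout_nat[of n m] coprime by (auto simp: coprime_iff_gcd_eq_1)
    have "(\<kappa> c [^]\<^bsub>Q\<^esub> n) [^]\<^bsub>Q\<^esub> u = \<kappa> c" if c: "c \<in> C" for c
    proof -
      have "(\<kappa> c [^]\<^bsub>Q\<^esub> n) [^]\<^bsub>Q\<^esub> u = \<kappa> c [^]\<^bsub>Q\<^esub> (m * v + 1)" using \<kappa>(1)[OF c] uv by (simp add: Q.nat_pow_pow)
      also have "\<dots> = (\<kappa> c [^]\<^bsub>Q\<^esub> m) [^]\<^bsub>Q\<^esub> v \<otimes>\<^bsub>Q\<^esub> \<kappa> c" using \<kappa>(1)[OF c] by (simp add: Q.nat_pow_pow)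
      finally show ?thesis using exp[OF c] \<kappa>(1)[OF c] by (simp add: Q.nat_pow_one)
    qed
    then show ?thesis by (rule that)
  qed
  \<comment> \<open>The inverse of an n-th root of \<open>F y\<close>, lifted to \<open>C\<close>;
    this correction makes \<sigma> multiplicative modulo \<open>B\<close>.\<close>
  define a where "a y = inv (\<Phi> y) [^] n'" for y
  define \<sigma> where "\<sigma> y = a y \<otimes> \<tau> y" for y
  have aC: "a y \<in> C" if "y \<in> Y" for y unfolding a_def using \<kappa>_pow[OF Ci[OF \<Phi>(1)[OF that]]] by blast
  have \<sigma>Y: "\<sigma> y \<in> Y" if "y \<in> Y" for y unfolding \<sigma>_def using aC CY \<tau>Y Ym that by blast
  have \<sigma>_mult: "\<exists>b\<in>B. \<sigma> x \<otimes> \<sigma> y = b \<otimes> \<sigma> (x \<otimes> y)" if xy: "x \<in> Y" "y \<in> Y" for x y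
  proof -
    have xyY: "x \<otimes> y \<in> Y" using xy Ym by blast
    define d where "d = \<tau> x \<otimes> \<Phi> y \<otimes> inv (\<tau> x)"
    have d: "d \<in> C" unfolding d_def by (rule C_normal[OF \<tau>Y[OF xy(1)] \<Phi>(1)[OF xy(2)]])
    have conj_inv: "\<tau> x \<otimes> inv (\<Phi> y) \<otimes> inv (\<tau> x) = inv d"
      unfolding d_def using CG[OF \<Phi>(1)[OF xy(2)]] \<tau>G[OF xy(1)] by (simp add: inv_mult_group m_assoc)
    have conj_pow: "\<tau> x \<otimes> (inv (\<Phi> y) [^] (k::nat)) \<otimes> inv (\<tau> x) = inv d [^] k" for k
    proof (induction k)
      case (Suc k)
      then show ?case
        using conj_mult[OF \<tau>G[OF xy(1)], of "inv (\<Phi> y) [^] k" "inv (\<Phi> y)"] CG[OF \<Phi>(1)[OF xy(2)]] conj_inv by simp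
    qed (use \<tau>G[OF xy(1)] in simp)
    define b where "b = a x \<otimes> (\<tau> x \<otimes> a y \<otimes> inv (\<tau> x)) \<otimes> f x y \<otimes> inv (a (x \<otimes> y))"
    have da: "\<tau> x \<otimes> a y \<otimes> inv (\<tau> x) = inv d [^] n'" unfolding a_def by (rule conj_pow)
    have daC: "inv d [^] n' \<in> C" using \<kappa>_pow[OF Ci[OF d]] by blast
    have bC: "b \<in> C" unfolding b_def da by (intro Cm Ci aC fC xy xyY daC)
    have kQ: "F x \<in> carrier Q" "F (x \<otimes> y) \<in> carrier Q" "\<kappa> d \<in> carrier Q" "\<kappa> (f x y) \<in> carrier Q"
      using \<kappa>(1) \<Phi>[OF xy(1)] \<Phi>[OF xyY] d fC xy by metis+
    have ka: "\<kappa> (a w) = inv\<^bsub>Q\<^esub> (F w) [^]\<^bsub>Q\<^esub> n'" if "w \<in> Y" for w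
      unfolding a_def using \<kappa>_pow[OF Ci[OF \<Phi>(1)[OF that]]] \<kappa>_inv[OF \<Phi>(1)[OF that]] \<Phi>(2)[OF that] by simp
    have "\<kappa> b = \<kappa> (a x) \<otimes>\<^bsub>Q\<^esub> \<kappa> (inv d [^] n') \<otimes>\<^bsub>Q\<^esub> \<kappa> (f x y) \<otimes>\<^bsub>Q\<^esub> \<kappa> (inv (a (x \<otimes> y)))"
      unfolding b_def da using aC[OF xy(1)] aC[OF xyY] daC fC[OF xy] Cm Ci by (simp add: \<kappa>(2))
    also have "\<dots> = inv\<^bsub>Q\<^esub> (F x) [^]\<^bsub>Q\<^esub> n' \<otimes>\<^bsub>Q\<^esub> (inv\<^bsub>Q\<^esub> \<kappa> d) [^]\<^bsub>Q\<^esub> n' \<otimes>\<^bsub>Q\<^esub> \<kappa> (f x y) \<otimes>\<^bsub>Q\<^esub> inv\<^bsub>Q\<^esub> (inv\<^bsub>Q\<^esub> (F (x \<otimes> y)) [^]\<^bsub>Q\<^esub> n')"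
      using ka[OF xy(1)] ka[OF xyY] \<kappa>_inv[OF aC[OF xyY]] \<kappa>_pow[OF Ci[OF d]] \<kappa>_inv[OF d] by simp
    also have "\<dots> = inv\<^bsub>Q\<^esub> (F x [^]\<^bsub>Q\<^esub> n') \<otimes>\<^bsub>Q\<^esub> inv\<^bsub>Q\<^esub> (\<kappa> d [^]\<^bsub>Q\<^esub> n') \<otimes>\<^bsub>Q\<^esub> \<kappa> (f x y) \<otimes>\<^bsub>Q\<^esub> F (x \<otimes> y) [^]\<^bsub>Q\<^esub> n'"
      using kQ by (simp add: Q.nat_pow_inv)
    also have "\<dots> = inv\<^bsub>Q\<^esub> (\<kappa> d [^]\<^bsub>Q\<^esub> n' \<otimes>\<^bsub>Q\<^esub> F x [^]\<^bsub>Q\<^esub> n') \<otimes>\<^bsub>Q\<^esub> (\<kappa> (f x y) \<otimes>\<^bsub>Q\<^esub> F (x \<otimes> y) [^]\<^bsub>Q\<^esub> n')"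
      using kQ by (simp add: Q.inv_mult_group Q.m_assoc)
    also have "\<kappa> (f x y) \<otimes>\<^bsub>Q\<^esub> F (x \<otimes> y) [^]\<^bsub>Q\<^esub> n' = (\<kappa> (f x y) [^]\<^bsub>Q\<^esub> n \<otimes>\<^bsub>Q\<^esub> F (x \<otimes> y)) [^]\<^bsub>Q\<^esub> n'"
      using kQ n'[OF fC[OF xy]] by (simp add: Q.nat_pow_distrib)
    also have "\<dots> = \<kappa> d [^]\<^bsub>Q\<^esub> n' \<otimes>\<^bsub>Q\<^esub> F x [^]\<^bsub>Q\<^esub> n'"
      unfolding F_mult[OF xy] d_def[symmetric] using kQ by (simp add: Q.nat_pow_distrib)
    also have "inv\<^bsub>Q\<^esub> (\<kappa> d [^]\<^bsub>Q\<^esub> n' \<otimes>\<^bsub>Q\<^esub> F x [^]\<^bsub>Q\<^esub> n') \<otimes>\<^bsub>Q\<^esub> (\<kappa> d [^]\<^bsub>Q\<^esub> n' \<otimes>\<^bsub>Q\<^esub> F x [^]\<^bsub>Q\<^esub> n') = \<one>\<^bsub>Q\<^esub>"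
      using kQ by simp
    finally have "b \<in> B" using \<kappa>(3)[OF bC] by simp
    moreover have "\<sigma> x \<otimes> \<sigma> y = b \<otimes> \<sigma> (x \<otimes> y)"
    proof -
      have cl: "\<tau> x \<in> carrier G" "\<tau> y \<in> carrier G" "\<tau> (x \<otimes> y) \<in> carrier G" "a x \<in> carrier G"
        "a y \<in> carrier G" "a (x \<otimes> y) \<in> carrier G" using \<tau>G aC CG xy xyY by auto
      have cancel: "inv a \<otimes> (a \<otimes> b) = b" if "a \<in> carrier G" "b \<in> carrier G" for a b
        using that by (simp add: m_assoc[symmetric])
      show ?thesis unfolding \<sigma>_def b_def f_def using cl by (simp add: m_assoc cancel)
    qed
    ultimately show ?thesis by blast
  qed
  \<comment> \<open>As \<sigma> depends on the coset only, \<open>Z\<close> is already exhausted by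
    the products of \<open>B\<close> with the values of \<sigma> on the transversal.\<close>
  have \<sigma>_coset: "\<sigma> (c \<otimes> y) = \<sigma> y" if "c \<in> C" "y \<in> Y" for c y
  proof -
    have "f (c \<otimes> y) z = f y z" if "z \<in> Y" for z
      using \<tau>_mult[OF \<open>c \<in> C\<close> \<open>y \<in> Y\<close>] \<tau>_mult[OF \<open>c \<in> C\<close> Ym[OF \<open>y \<in> Y\<close> that]] CG[OF \<open>c \<in> C\<close>] YG[OF \<open>y \<in> Y\<close>] YG[OF that]
      by (simp add: f_def m_assoc)
    then have "F (c \<otimes> y) = F y"
      unfolding F_def using RY \<kappa>(1) fC \<open>y \<in> Y\<close> by (intro Q.finprod_cong') auto
    then have "a (c \<otimes> y) = a y" by (simp add: a_def \<Phi>_def)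
    then show ?thesis using \<tau>_mult[OF that] by (simp add: \<sigma>_def)
  qed
  define Z where "Z = {b \<otimes> \<sigma> y | b y. b \<in> B \<and> y \<in> Y}"
  have ZY: "Z \<subseteq> Y" unfolding Z_def using BC CY \<sigma>Y Ym by blast
  have Z_mult: "z \<otimes> w \<in> Z" if zw: "z \<in> Z" "w \<in> Z" for z w
  proof -
    obtain b x where z: "z = b \<otimes> \<sigma> x" "b \<in> B" "x \<in> Y" using zw by (auto simp: Z_def)
    obtain b' y where w: "w = b' \<otimes> \<sigma> y" "b' \<in> B" "y \<in> Y" using zw by (auto simp: Z_def)
    obtain e where e: "e \<in> B" "\<sigma> x \<otimes> \<sigma> y = e \<otimes> \<sigma> (x \<otimes> y)" using \<sigma>_mult z w by blast
    have cl: "b \<in> carrier G" "b' \<in> carrier G" "e \<in> carrier G" "\<sigma> x \<in> carrier G" "\<sigma> y \<in> carrier G" "\<sigma> (x \<otimes> y) \<in> carrier G"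
      using z w e BG \<sigma>Y YG Ym by auto
    have "z \<otimes> w = b \<otimes> (\<sigma> x \<otimes> b' \<otimes> inv (\<sigma> x)) \<otimes> (\<sigma> x \<otimes> \<sigma> y)"
      unfolding z w using cl by (simp add: m_assoc inv_solve_left)
    also have "\<dots> = (b \<otimes> (\<sigma> x \<otimes> b' \<otimes> inv (\<sigma> x)) \<otimes> e) \<otimes> \<sigma> (x \<otimes> y)"
      unfolding e(2) using cl by (simp add: m_assoc)
    finally show ?thesis
      unfolding Z_def using Bm[OF Bm[OF z(2) B_normal[OF \<sigma>Y[OF z(3)] w(2)]] e(1)] Ym[OF z(3) w(3)] by blast
  qed
  have oneY: "\<one> \<in> Y" by (rule subgroup.one_closed[OF Y])
  have \<sigma>1: "\<sigma> \<one> \<in> B"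
  proof -
    obtain b where b: "b \<in> B" "\<sigma> \<one> \<otimes> \<sigma> \<one> = b \<otimes> \<sigma> \<one>" using \<sigma>_mult[OF oneY oneY] by auto
    then have "\<sigma> \<one> = b" using YG[OF \<sigma>Y[OF oneY]] BG by (metis right_cancel)
    then show ?thesis using b by simp
  qed
  have BZ: "B \<subseteq> Z"
  proof
    fix b assume b: "b \<in> B"
    have "b = (b \<otimes> inv (\<sigma> \<one>)) \<otimes> \<sigma> \<one>" using b \<sigma>1 BG by (simp add: m_assoc)
    then show "b \<in> Z" unfolding Z_def using Bm[OF b Bi[OF \<sigma>1]] oneY by blast
  qed
  have "subgroup Z G"
  proof (rule finite_mult_closed_subgroup[OF fin])
    show "Z \<subseteq> carrier G" using ZY YG by blast
    show "Z \<noteq> {}" using BZ subgroup.one_closed[OF B(1)] by blast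
  qed (rule Z_mult)
  moreover have "card Z = card B * n"
  proof -
    have "bij_betw (\<lambda>(b, t). b \<otimes> \<sigma> t) (B \<times> R) Z"
      unfolding bij_betw_def
    proof (intro conjI inj_onI)
      fix u w assume uw: "u \<in> B \<times> R" "w \<in> B \<times> R" "(case u of (b, t) \<Rightarrow> b \<otimes> \<sigma> t) = (case w of (b, t) \<Rightarrow> b \<otimes> \<sigma> t)"
      then obtain b t b' t' where e: "u = (b, t)" "w = (b', t')" "b \<in> B" "t \<in> R" "b' \<in> B" "t' \<in> R" "b \<otimes> \<sigma> t = b' \<otimes> \<sigma> t'" by auto
      have "\<tau> (b \<otimes> \<sigma> t) = t" if "b \<in> B" "t \<in> R" for b t
      proof -
        have tY: "t \<in> Y" using RY that by blast
        have "b \<otimes> \<sigma> t = (b \<otimes> a t) \<otimes> \<tau> t" unfolding \<sigma>_def using BG[OF that(1)] CG[OF aC[OF tY]] \<tau>G[OF tY] by (simp add: m_assoc)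
        moreover have "b \<otimes> a t \<in> C" using BC that aC[OF tY] Cm by blast
        ultimately show ?thesis using \<tau>_mult \<tau>Y[OF tY] \<tau>_idem[OF tY] RY(2)[OF that(2)] by simp
      qed
      then have "t = t'" using e by metis
      then show "u = w" using e BG YG[OF \<sigma>Y] RY by auto
    next
      show "(\<lambda>(b, t). b \<otimes> \<sigma> t) ` (B \<times> R) = Z"
      proof
        show "(\<lambda>(b, t). b \<otimes> \<sigma> t) ` (B \<times> R) \<subseteq> Z" using RY(1) by (auto simp: Z_def)
        show "Z \<subseteq> (\<lambda>(b, t). b \<otimes> \<sigma> t) ` (B \<times> R)"
        proof
          fix z assume "z \<in> Z"
          then obtain b y where z: "z = b \<otimes> \<sigma> y" "b \<in> B" "y \<in> Y" by (auto simp: Z_def)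
          have "\<sigma> (\<tau> y) = \<sigma> y" using \<tau>_ex[OF z(3)] \<sigma>_coset[OF _ z(3)] by auto
          then show "z \<in> (\<lambda>(b, t). b \<otimes> \<sigma> t) ` (B \<times> R)" using z by (intro image_eqI[of _ _ "(b, \<tau> y)"]) (auto simp: R_def)
        qed
      qed
    qed
    then show ?thesis using cardR by (metis bij_betw_same_card card_cartesian_product)
  qed
  ultimately show ?thesis using BZ ZY by blast
qed

end

section \<open>Complements of the p-part along the derived series\<close>

lemma prime_power_if_prime_factors:
  fixes u p :: nat
  assumes "u > 0" "prime p" "\<And>q. \<lbrakk>prime q; q dvd u\<rbrakk> \<Longrightarrow> q = p"
  obtains k where "u = p ^ k"
proof -
  obtain v where v: "u = p ^ multiplicity p u * v" "\<not> p dvd v"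
    using multiplicity_decompose'[of u p] assms(1,2) by (metis not_prime_unit less_numeral_extra(3))
  have "v = 1"
  proof (rule ccontr)
    assume "v \<noteq> 1"
    then obtain q where "prime q" "q dvd v" using prime_factor_nat by blast
    then show False using assms(3)[of q] v by (metis dvd_mult)
  qed
  then show ?thesis using v that by simp
qed

context group begin

lemma sylow_subgroup_exists:
  assumes fin: "finite (carrier G)" and A: "subgroup A G" and q: "prime q"
  obtains S r where "subgroup S G" "S \<subseteq> A" "card S = q ^ multiplicity q (card A)"
    "card A = q ^ multiplicity q (card A) * r" "\<not> q dvd r"
proof -
  have finA: "finite A" using fin finite_subset[OF subgroup.subset[OF A]] by blast
  have pos: "card A > 0" using finA subgroup.one_closed[OF A] by (auto simp: card_gt_0_iff)
  obtain r where r: "card A = q ^ multiplicity q (card A) * r" "\<not> q dvd r"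
    using multiplicity_decompose'[of "card A" q] pos q by (metis not_prime_unit less_numeral_extra(3))
  have "order (G\<lparr>carrier := A\<rparr>) = q ^ multiplicity q (card A) * r" using r by (simp add: order_def)
  then obtain S where S: "subgroup S (G\<lparr>carrier := A\<rparr>)" "card S = q ^ multiplicity q (card A)"
    using sylow_thm[OF q subgroup.subgroup_is_group[OF A is_group]] finA by auto
  show ?thesis
    by (rule that[OF incl_subgroup[OF A S(1)] _ S(2) r]) (use subgroup.subset[OF S(1)] in simp)
qed

lemma subgroup_pow_card:
  assumes S: "subgroup S G" and x: "x \<in> S"
  shows "x [^] card S = \<one>"
proof -
  interpret S: group "G\<lparr>carrier := S\<rparr>" by (rule subgroup.subgroup_is_group[OF S is_group])
  have "x [^]\<^bsub>G\<lparr>carrier := S\<rparr>\<^esub> order (G\<lparr>carrier := S\<rparr>) = \<one>\<^bsub>G\<lparr>carrier := S\<rparr>\<^esub>"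
    by (rule S.pow_order_eq_1) (use x in simp)
  then show ?thesis by (simp add: order_def nat_pow_consistent[symmetric])
qed

text \<open>Let B be the derived subgroup of \<open>A\<close> and C / B the p-part of the abelian
  group A / B. Then Y / C has order prime to p, and a complement of C / B in Y / B loses exactly a
  power of p from the order.\<close>

lemma p_complement_step:
  assumes fin: "finite (carrier G)" and p: "prime p" and A: "A \<lhd> G" and Y: "subgroup Y G" "A \<subseteq> Y"
    and card: "card Y = card A * m" "\<not> p dvd m"
  shows "\<exists>Z m' k. subgroup Z G \<and> derived G A \<subseteq> Z \<and> Z \<subseteq> Y \<and> card Z = card (derived G A) * m' \<and> \<not> p dvd m'
    \<and> card Y = card Z * p ^ k"
proof -
  define B where "B = derived G A"
  note As = normal_imp_subgroup[OF A]
  have AG: "A \<subseteq> carrier G" by (rule subgroup.subset[OF As])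
  have B: "B \<lhd> G" unfolding B_def by (rule derived_is_normal[OF A])
  note Bs = normal_imp_subgroup[OF B]
  have BA: "B \<subseteq> A" unfolding B_def by (rule derived_incl[OF subset_refl As])
  define Q where "Q = (G\<lparr>carrier := A\<rparr>) Mod B"
  have Q: "comm_group Q" unfolding Q_def B_def by (rule derived_quot_of_subgroup_is_comm_group[OF As])
  interpret Q: comm_group Q by (fact Q)
  define \<kappa> where "\<kappa> c = B #> c" for c
  have \<kappa>1: "\<kappa> c \<in> carrier Q" if "c \<in> A" for c
    using that by (auto simp: Q_def FactGroup_def RCOSETS_def \<kappa>_def r_coset_def)
  have \<kappa>2: "\<kappa> (c \<otimes> c') = \<kappa> c \<otimes>\<^bsub>Q\<^esub> \<kappa> c'" if "c \<in> A" "c' \<in> A" for c c'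
  proof -
    have "(B #> c) <#> (B #> c') = B #> (c \<otimes> c')" using normal.rcos_sum[OF B] that AG by blast
    then show ?thesis by (simp add: Q_def FactGroup_def \<kappa>_def set_mult_def)
  qed
  have one_Q: "\<one>\<^bsub>Q\<^esub> = B" by (simp add: Q_def FactGroup_def)
  have \<kappa>3: "\<kappa> c = \<one>\<^bsub>Q\<^esub> \<longleftrightarrow> c \<in> B" if "c \<in> A" for c
    unfolding one_Q \<kappa>_def using that AG subgroup.rcos_const[OF Bs is_group] rcos_self[OF _ Bs] by blast
  have \<kappa>_pow: "\<kappa> (c [^] (k::nat)) = \<kappa> c [^]\<^bsub>Q\<^esub> k \<and> c [^] k \<in> A" if "c \<in> A" for c k
  proof (induction k)
    case 0
    then show ?case using \<kappa>3 subgroup.one_closed[OF As] subgroup.one_closed[OF Bs] by simp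
  next
    case (Suc k)
    then show ?case using \<kappa>2 that subgroup.m_closed[OF As] by simp
  qed
  \<comment> \<open>The p-part of the order of G annihilates every p-element, so that
    \<open>C\<close> is the preimage of the whole p-part of A / B.\<close>
  define N where "N = p ^ multiplicity p (order G)"
  define C where "C = {c \<in> A. c [^] N \<in> B}"
  have C_iff: "c \<in> C \<longleftrightarrow> c \<in> A \<and> \<kappa> c [^]\<^bsub>Q\<^esub> N = \<one>\<^bsub>Q\<^esub>" for c
  proof -
    have "c [^] N \<in> B \<longleftrightarrow> \<kappa> c [^]\<^bsub>Q\<^esub> N = \<one>\<^bsub>Q\<^esub>" if "c \<in> A"
      using \<kappa>_pow[OF that, of N] \<kappa>3[of "c [^] N"] by metis
    then show ?thesis unfolding C_def by blast
  qed
  have CA: "C \<subseteq> A" by (auto simp: C_def)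
  have Cs: "subgroup C G"
  proof (rule finite_mult_closed_subgroup[OF fin])
    show "C \<subseteq> carrier G" using CA AG by blast
    show "C \<noteq> {}" using subgroup.one_closed[OF As] subgroup.one_closed[OF Bs] by (auto simp: C_def)
    show "x \<otimes> y \<in> C" if "x \<in> C" "y \<in> C" for x y
      using that \<kappa>1 \<kappa>2 subgroup.m_closed[OF As] unfolding C_iff by (simp add: Q.nat_pow_distrib)
  qed
  have pow_conj: "y \<otimes> c [^] (k::nat) \<otimes> inv y = (y \<otimes> c \<otimes> inv y) [^] k" if "y \<in> carrier G" "c \<in> carrier G" for y c k
  proof (induction k)
    case (Suc k)
    have "y \<otimes> c [^] Suc k \<otimes> inv y = (y \<otimes> c [^] k \<otimes> inv y) \<otimes> (y \<otimes> c \<otimes> inv y)"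
      using that by (simp add: m_assoc inv_solve_left)
    then show ?case using Suc by simp
  qed (use that in simp)
  have BC: "B \<subseteq> C"
  proof
    fix b assume b: "b \<in> B"
    have "b [^] (k::nat) \<in> B" for k by (induction k) (use b subgroup.one_closed[OF Bs] subgroup.m_closed[OF Bs] in auto)
    then show "b \<in> C" using b BA by (auto simp: C_def)
  qed
  have normalB: "y \<otimes> b \<otimes> inv y \<in> B" if "y \<in> carrier G" "b \<in> B" for y b by (rule normal.inv_op_closed2[OF B that])
  have normalC: "y \<otimes> c \<otimes> inv y \<in> C" if "y \<in> carrier G" "c \<in> C" for y c
  proof -
    have "y \<otimes> c \<otimes> inv y \<in> A" using normal.inv_op_closed2[OF A] that CA by blast
    moreover have "(y \<otimes> c \<otimes> inv y) [^] N = y \<otimes> c [^] N \<otimes> inv y" using pow_conj that CA AG by auto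
    ultimately show ?thesis using normalB[of y "c [^] N"] that by (simp add: C_def)
  qed
  have finC: "finite C" by (rule finite_subset[OF _ fin]) (use CA AG in blast)
  have posC: "card C > 0" using finC subgroup.one_closed[OF Cs] by (auto simp: card_gt_0_iff)
  obtain u where u: "card C = card B * u" using card_subgroup_dvd[OF Bs Cs BC] by (elim dvdE)
  obtain t where t: "card A = card C * t" using card_subgroup_dvd[OF Cs As CA] by (elim dvdE)
  \<comment> \<open>A Sylow p-subgroup of \<open>A\<close> is annihilated by \<open>N\<close>, hence
    contained in \<open>C\<close>, and the index of \<open>C\<close> in \<open>A\<close> is prime to
    p.\<close>
  have "\<not> p dvd t"
  proof -
    obtain S r where S: "subgroup S G" "S \<subseteq> A" "card S = p ^ multiplicity p (card A)"
      "card A = p ^ multiplicity p (card A) * r" "\<not> p dvd r"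
      using sylow_subgroup_exists[OF fin As p] by blast
    have "card S dvd order G" using card_subgroup_dvd[OF S(1) subgroup_self] subgroup.subset[OF S(1)] by (simp add: order_def)
    moreover have "order G > 0" using fin by (simp add: order_gt_0_iff_finite)
    ultimately have "multiplicity p (card A) \<le> multiplicity p (order G)"
      using S(3) p by (intro multiplicity_geI) auto
    then have "card S dvd N" unfolding S(3) N_def by (rule le_imp_power_dvd)
    then obtain w where w: "N = card S * w" by (elim dvdE)
    have "S \<subseteq> C"
    proof
      fix x assume x: "x \<in> S"
      have xG: "x \<in> carrier G" using x S AG by blast
      have "x [^] N = (x [^] card S) [^] w" using xG by (simp add: w nat_pow_pow)
      then have "x [^] N = \<one>" using subgroup_pow_card[OF S(1) x] by simp
      then show "x \<in> C" using x S(2) subgroup.one_closed[OF Bs] by (auto simp: C_def)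
    qed
    from card_subgroup_dvd[OF S(1) Cs this] obtain v where "card C = card S * v" by (elim dvdE)
    then have "card S * (v * t) = card S * r" using t S by simp
    then have "r = v * t" using S(3) p by (simp add: prime_gt_0_nat)
    then show ?thesis using S(5) by auto
  qed
  have upos: "u > 0" using u posC by (auto intro: Nat.gr0I)
  \<comment> \<open>For a prime q other than p, a Sylow q-subgroup of \<open>C\<close> has order
    prime to \<open>N\<close> and therefore lies in \<open>B\<close>; so only p can divide the index
    of \<open>B\<close> in \<open>C\<close>.\<close>
  obtain k where k: "u = p ^ k"
  proof (rule prime_power_if_prime_factors[OF upos p])
    fix q assume q: "prime q" "q dvd u"
    show "q = p"
    proof (rule ccontr)
      assume "q \<noteq> p"
      obtain S r where S: "subgroup S G" "S \<subseteq> C" "card S = q ^ multiplicity q (card C)"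
        "card C = q ^ multiplicity q (card C) * r" "\<not> q dvd r"
        using sylow_subgroup_exists[OF fin Cs q(1)] by blast
      have "coprime (card S) N"
        unfolding S(3) N_def using q p \<open>q \<noteq> p\<close> by (simp add: primes_coprime)
      moreover have "card S \<noteq> 0" using S(3) q by simp
      ultimately obtain i j where ij: "card S * i = N * j + 1"
        using bezout_nat[of "card S" N] by (auto simp: coprime_iff_gcd_eq_1)
      have "S \<subseteq> B"
      proof
        fix x assume x: "x \<in> S"
        have xA: "x \<in> A" and xN: "\<kappa> x [^]\<^bsub>Q\<^esub> N = \<one>\<^bsub>Q\<^esub>" using x S(2) C_iff by auto
        have "\<kappa> x [^]\<^bsub>Q\<^esub> (card S * i) = \<kappa> (x [^] (card S * i))" using \<kappa>_pow[OF xA] by simp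
        also have "x [^] (card S * i) = (x [^] card S) [^] i" using xA AG by (simp add: nat_pow_pow subset_iff)
        also have "\<dots> = \<one>" using subgroup_pow_card[OF S(1) x] by simp
        also have "\<kappa> \<one> = \<one>\<^bsub>Q\<^esub>" using \<kappa>3[OF subgroup.one_closed[OF As]] subgroup.one_closed[OF Bs] by simp
        finally have "\<one>\<^bsub>Q\<^esub> = \<kappa> x [^]\<^bsub>Q\<^esub> (N * j + 1)" using ij by simp
        also have "\<dots> = (\<kappa> x [^]\<^bsub>Q\<^esub> N) [^]\<^bsub>Q\<^esub> j \<otimes>\<^bsub>Q\<^esub> \<kappa> x" using \<kappa>1[OF xA] by (simp add: Q.nat_pow_pow)
        also have "\<dots> = \<kappa> x" using xN \<kappa>1[OF xA] by simp
        finally show "x \<in> B" using \<kappa>3[OF xA] by simp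
      qed
      from card_subgroup_dvd[OF S(1) Bs this] obtain v where v: "card B = card S * v" by (elim dvdE)
      then have "card S * (v * u) = card S * r" using u S by simp
      then have "r = v * u" using \<open>card S \<noteq> 0\<close> by simp
      then show False using S(5) q(2) by auto
    qed
  qed (rule that)
  have cardYC: "card Y = card C * (t * m)" using card t by simp
  have "\<not> p dvd t * m" using \<open>\<not> p dvd t\<close> card(2) p by (simp add: prime_dvd_mult_iff)
  then have "coprime (t * m) N" unfolding N_def using p by (metis coprime_commute coprime_power_left_iff prime_imp_coprime)
  then have "\<exists>Z. subgroup Z G \<and> B \<subseteq> Z \<and> Z \<subseteq> Y \<and> card Z = card B * (t * m)"
    using subgroup.mem_carrier[OF Y(1)] CA Y(2) BC \<kappa>1 \<kappa>2 \<kappa>3 C_iff normalB normalC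
    by (intro abelian_complement[OF fin Y(1) Cs _ Bs BC _ _ Q, of \<kappa> N]) (auto simp: cardYC)
  then obtain Z where Z: "subgroup Z G" "B \<subseteq> Z" "Z \<subseteq> Y" "card Z = card B * (t * m)" by blast
  have "card Y = card Z * p ^ k" using cardYC u k Z(4) by simp
  then show ?thesis using Z \<open>\<not> p dvd t * m\<close> unfolding B_def by blast
qed

text \<open>Descent along the derived series: a subgroup Y of p-power index in G contains the i-th
  term with index prime to p. When the term is trivial, the order of Y itself is prime to p.\<close>

lemma solvable_p_complement:
  assumes fin: "finite (carrier G)" and p: "prime p" and solv: "solvable G"
  obtains P k where "subgroup P G" "\<not> p dvd card P" "order G = card P * p ^ k"
proof -
  obtain n where n: "(derived G ^^ n) (carrier G) = {\<one>}" using solv solvable_iff_trivial_derived_seq by blast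
  have normal: "(derived G ^^ i) (carrier G) \<lhd> G" for i
  proof (induction i)
    case 0
    show ?case using normal_invI[OF subgroup_self] by simp
  next
    case (Suc i)
    then show ?case using derived_is_normal by simp
  qed
  have "\<exists>Y m k. subgroup Y G \<and> (derived G ^^ i) (carrier G) \<subseteq> Y
    \<and> card Y = card ((derived G ^^ i) (carrier G)) * m \<and> \<not> p dvd m \<and> order G = card Y * p ^ k" for i
  proof (induction i)
    case 0
    show ?case
      using subgroup_self p by (intro exI[of _ "carrier G"] exI[of _ 1] exI[of _ 0]) (auto simp: order_def)
  next
    case (Suc i)
    then obtain Y m k where Y: "subgroup Y G" "(derived G ^^ i) (carrier G) \<subseteq> Y"
      "card Y = card ((derived G ^^ i) (carrier G)) * m" "\<not> p dvd m" "order G = card Y * p ^ k" by blast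
    obtain Z m' k' where "subgroup Z G" "(derived G ^^ Suc i) (carrier G) \<subseteq> Z"
      "card Z = card ((derived G ^^ Suc i) (carrier G)) * m'" "\<not> p dvd m'" "card Y = card Z * p ^ k'"
      using p_complement_step[OF fin p normal Y(1-4)] unfolding funpow.simps o_apply by blast
    then show ?case using Y(5) by (intro exI[of _ Z] exI[of _ m'] exI[of _ "k' + k"]) (auto simp: power_add)
  qed
  from this[of n] show ?thesis using that n by (auto simp: mult.commute)
qed

section \<open>The core and the action on cosets\<close>

lemma core_iff:
  assumes H: "subgroup H G"
  shows "g \<in> core G H \<longleftrightarrow> g \<in> carrier G \<and> (\<forall>x\<in>carrier G. x \<otimes> g \<otimes> inv x \<in> H)"
proof -
  have "g \<in> inv x <# H #> x \<longleftrightarrow> g \<in> carrier G \<and> x \<otimes> g \<otimes> inv x \<in> H" if x: "x \<in> carrier G" for x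
  proof
    assume "g \<in> inv x <# H #> x"
    then obtain h where h: "h \<in> H" "g = inv x \<otimes> h \<otimes> x" by (auto simp: r_coset_def l_coset_def)
    then show "g \<in> carrier G \<and> x \<otimes> g \<otimes> inv x \<in> H"
      using x subgroup.mem_carrier[OF H] by (simp add: m_assoc) (simp add: m_assoc[symmetric])
  next
    assume g: "g \<in> carrier G \<and> x \<otimes> g \<otimes> inv x \<in> H"
    then have "g = inv x \<otimes> (x \<otimes> g \<otimes> inv x) \<otimes> x" using x by (simp add: m_assoc) (simp add: m_assoc[symmetric])
    then show "g \<in> inv x <# H #> x" using g unfolding r_coset_def l_coset_def by blast
  qed
  then show ?thesis unfolding core_def using one_closed by blast
qed

lemma core_subgroup:
  assumes H: "subgroup H G"
  shows "subgroup (core G H) G" "core G H \<subseteq> H"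
    "\<lbrakk>g \<in> carrier G; k \<in> core G H\<rbrakk> \<Longrightarrow> g \<otimes> k \<otimes> inv g \<in> core G H"
proof -
  note HG = subgroup.mem_carrier[OF H]
  show sub: "core G H \<subseteq> H"
  proof
    fix g assume "g \<in> core G H"
    then have "g \<in> carrier G" "\<one> \<otimes> g \<otimes> inv \<one> \<in> H" using core_iff[OF H] one_closed by blast+
    then show "g \<in> H" by simp
  qed
  show "subgroup (core G H) G"
  proof (rule subgroupI)
    show "core G H \<subseteq> carrier G" using sub HG by blast
    show "core G H \<noteq> {}" using core_iff[OF H, of \<one>] subgroup.one_closed[OF H] by auto
    show "inv a \<in> core G H" if a: "a \<in> core G H" for a
    proof -
      have "x \<otimes> inv a \<otimes> inv x \<in> H" if x: "x \<in> carrier G" for x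
      proof -
        have "inv (x \<otimes> a \<otimes> inv x) \<in> H" using a x core_iff[OF H] subgroup.m_inv_closed[OF H] by blast
        then show ?thesis using a x core_iff[OF H] by (simp add: inv_mult_group m_assoc)
      qed
      then show ?thesis using a core_iff[OF H] by auto
    qed
    show "a \<otimes> b \<in> core G H" if ab: "a \<in> core G H" "b \<in> core G H" for a b
    proof -
      have abG: "a \<in> carrier G" "b \<in> carrier G" using ab core_iff[OF H] by auto
      have "x \<otimes> (a \<otimes> b) \<otimes> inv x \<in> H" if x: "x \<in> carrier G" for x
      proof -
        have "(x \<otimes> a \<otimes> inv x) \<otimes> (x \<otimes> b \<otimes> inv x) \<in> H" using ab x core_iff[OF H] subgroup.m_closed[OF H] by blast
        moreover have "(x \<otimes> a \<otimes> inv x) \<otimes> (x \<otimes> b \<otimes> inv x) = x \<otimes> a \<otimes> (inv x \<otimes> x) \<otimes> b \<otimes> inv x"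
          using x abG by (simp only: m_assoc m_closed inv_closed)
        ultimately show ?thesis using x abG by (simp add: m_assoc)
      qed
      then show ?thesis using ab core_iff[OF H] by auto
    qed
  qed
  show "g \<otimes> k \<otimes> inv g \<in> core G H" if g: "g \<in> carrier G" and k: "k \<in> core G H" for g k
  proof -
    have kG: "k \<in> carrier G" using k core_iff[OF H] by blast
    have "x \<otimes> (g \<otimes> k \<otimes> inv g) \<otimes> inv x \<in> H" if x: "x \<in> carrier G" for x
    proof -
      have "(x \<otimes> g) \<otimes> k \<otimes> inv (x \<otimes> g) \<in> H" using k g x core_iff[OF H] by blast
      then show ?thesis using g x kG by (simp add: inv_mult_group m_assoc)
    qed
    then show ?thesis using g kG core_iff[OF H] by auto
  qed
qed

text \<open>Right multiplication of cosets composes in the order opposite to that of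
  \<open>BijGroup\<close>. Precomposed with inversion it becomes a homomorphism \<psi> with the same
  image of \<open>N\<close>. Since elements of the kernel of \<psi> lie in the core, the derived
  series of \<open>N\<close> enters the core once that of the image is trivial.\<close>

lemma solvable_induced_perm_group:
  assumes H: "subgroup H G" and N: "subgroup N G" and solv: "solvable (induced_perm_group G N (rcosets H))"
  obtains n where "(derived G ^^ n) N \<subseteq> core G H"
proof -
  interpret \<Omega>: right_action G "rcosets H" "(#>)" by (rule right_action_rcosets[OF H])
  let ?B = "BijGroup (rcosets H)"
  define \<phi> where "\<phi> g = (\<lambda>C\<in>rcosets H. C #> g)" for g
  have \<phi>_mult: "compose (rcosets H) (\<phi> h) (\<phi> g) = \<phi> (g \<otimes> h)" if "g \<in> carrier G" "h \<in> carrier G" for g h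
    using that by (auto simp: compose_def \<phi>_def fun_eq_iff \<Omega>.act_in \<Omega>.act_m)
  have \<phi>_Bij: "\<phi> g \<in> Bij (rcosets H)" if g: "g \<in> carrier G" for g
  proof -
    have "bij_betw (\<phi> g) (rcosets H) (rcosets H)"
      by (rule bij_betw_byWitness[where f' = "\<phi> (inv g)"])
        (use g in \<open>auto simp: \<phi>_def \<Omega>.act_in \<Omega>.act_inv \<Omega>.act_inv'\<close>)
    then show ?thesis by (auto simp: Bij_def \<phi>_def)
  qed
  define \<psi> where "\<psi> g = \<phi> (inv g)" for g
  interpret B: group ?B by (rule group_BijGroup)
  interpret \<psi>: group_hom G ?B \<psi>
  proof (unfold_locales, rule homI)
    show "\<psi> g \<in> carrier ?B" if "g \<in> carrier G" for g using that \<phi>_Bij by (simp add: \<psi>_def BijGroup_def)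
    show "\<psi> (g \<otimes> h) = \<psi> g \<otimes>\<^bsub>?B\<^esub> \<psi> h" if "g \<in> carrier G" "h \<in> carrier G" for g h
      using that \<phi>_Bij \<phi>_mult[of "inv h" "inv g"] by (simp add: \<psi>_def BijGroup_def inv_mult_group)
  qed
  have img: "\<phi> ` N = \<psi> ` N"
  proof
    show "\<phi> ` N \<subseteq> \<psi> ` N"
    proof
      fix y assume "y \<in> \<phi> ` N"
      then obtain g where g: "g \<in> N" "y = \<phi> g" by blast
      then have "y = \<psi> (inv g)" using subgroup.mem_carrier[OF N] by (simp add: \<psi>_def)
      then show "y \<in> \<psi> ` N" using g subgroup.m_inv_closed[OF N] by blast
    qed
    show "\<psi> ` N \<subseteq> \<phi> ` N" using subgroup.m_inv_closed[OF N] by (auto simp: \<psi>_def)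
  qed
  have X: "induced_perm_group G N (rcosets H) = ?B\<lparr>carrier := \<psi> ` N\<rparr>"
    by (simp add: induced_perm_group_def img[symmetric] \<phi>_def[abs_def])
  have sub: "subgroup (\<psi> ` N) ?B" by (rule \<psi>.subgroup_img_is_subgroup[OF N])
  interpret X: group "?B\<lparr>carrier := \<psi> ` N\<rparr>" by (rule subgroup.subgroup_is_group[OF sub B.is_group])
  obtain n where n: "(derived (?B\<lparr>carrier := \<psi> ` N\<rparr>) ^^ n) (\<psi> ` N) = {\<one>\<^bsub>?B\<^esub>}"
    using solv X.solvable_iff_trivial_derived_seq unfolding X by auto
  have cons: "(derived (?B\<lparr>carrier := \<psi> ` N\<rparr>) ^^ i) (\<psi> ` N) = (derived ?B ^^ i) (\<psi> ` N)
    \<and> (derived ?B ^^ i) (\<psi> ` N) \<subseteq> \<psi> ` N" for i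
  proof (induction i)
    case (Suc i)
    have "derived (?B\<lparr>carrier := \<psi> ` N\<rparr>) ((derived ?B ^^ i) (\<psi> ` N)) = derived ?B ((derived ?B ^^ i) (\<psi> ` N))"
      using B.derived_consistent[OF _ sub] Suc by simp
    moreover have "derived ?B ((derived ?B ^^ i) (\<psi> ` N)) \<subseteq> \<psi> ` N" using B.derived_incl[OF _ sub] Suc by blast
    ultimately show ?case using Suc by simp
  qed simp
  have "\<psi> ` ((derived G ^^ n) N) = {\<one>\<^bsub>?B\<^esub>}"
    using \<psi>.exp_of_derived_img[OF subgroup.subset[OF N], of n] n cons[of n] by simp
  moreover have DN: "(derived G ^^ n) N \<subseteq> carrier G" by (rule exp_of_derived_in_carrier[OF subgroup.subset[OF N]])
  ultimately have "(derived G ^^ n) N \<subseteq> core G H"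
  proof (intro subsetI)
    fix g assume g: "g \<in> (derived G ^^ n) N" and e: "\<psi> ` ((derived G ^^ n) N) = {\<one>\<^bsub>?B\<^esub>}"
    have gG: "g \<in> carrier G" using DN g by blast
    have "\<psi> g = \<one>\<^bsub>?B\<^esub>" using e g by blast
    then have fixC: "C #> inv g = C" if "C \<in> rcosets H" for C
      using that by (auto simp: \<psi>_def \<phi>_def BijGroup_def fun_eq_iff restrict_def dest!: spec[of _ C])
    have "x \<otimes> g \<otimes> inv x \<in> H" if x: "x \<in> carrier G" for x
    proof -
      have C: "H #> x \<in> rcosets H" using x by (auto simp: RCOSETS_def)
      have "H #> x #> g = H #> x" using fixC[OF C] \<Omega>.act_inv'[OF C gG] by simp
      then have "x \<otimes> g \<in> H #> x"
        using x gG rcos_self[OF _ H, of "x \<otimes> g"] subgroup.subset[OF H] by (simp add: coset_mult_assoc)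
      then obtain h where "h \<in> H" "x \<otimes> g = h \<otimes> x" by (auto simp: r_coset_def)
      then show ?thesis using x gG subgroup.mem_carrier[OF H] by (simp add: m_assoc)
    qed
    then show "g \<in> core G H" using core_iff[OF H] gG by blast
  qed
  then show ?thesis by (rule that)
qed

end

section \<open>Assembling the bounds\<close>

context induced_module begin

lemma orbit_invariant:
  assumes N: "subgroup N G" and D: "D \<in> \<Omega>.rorbit N ` (rcosets H)" and C: "C \<in> rcosets H" and g: "g \<in> N \<union> K"
  shows "C #> g \<in> D \<longleftrightarrow> C \<in> D"
proof (cases "g \<in> K")
  case True
  then show ?thesis using K_trivial[OF C] by simp
next
  case False
  then have gN: "g \<in> N" using g by blast
  note gG = subgroup.mem_carrier[OF N gN]
  obtain E where E: "E \<in> rcosets H" "D = \<Omega>.rorbit N E" using D by blast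
  have "C #> g #> inv g = C" by (rule \<Omega>.act_inv[OF C gG])
  then show ?thesis
    using \<Omega>.rorbit_act[OF N E(1), of C g] \<Omega>.rorbit_act[OF N E(1), of "C #> g" "inv g"]
      subgroup.m_inv_closed[OF N gN] gN unfolding E(2) by auto
qed

lemma finite_rcosets: "finite (rcosets H)"
  using fin by (simp add: RCOSETS_def)

lemma NK_carrier: "subgroup N G \<Longrightarrow> N \<union> K \<subseteq> carrier G"
  using subgroup.subset[of N G] subgroup.subset[OF K] by auto

lemma min_gens_le_sum:
  assumes N: "subgroup N G" and M: "submod G W M"
    and w: "\<And>D. D \<in> \<Omega>.rorbit N ` (rcosets H) \<Longrightarrow> gen_by (N \<union> K) (l * w D) D"
  shows "min_gens G W M \<le> l * (\<Sum>D\<in>\<Omega>.rorbit N ` (rcosets H). w D)"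
proof -
  have "gen_by (N \<union> K) (\<Sum>D\<in>\<Omega>.rorbit N ` (rcosets H). l * w D) (\<Union> (\<Omega>.rorbit N ` (rcosets H)))"
    using finite_rcosets by (intro gen_by_Union[OF NK_carrier[OF N]] w orbit_invariant[OF N]) auto
  moreover have "\<Union> (\<Omega>.rorbit N ` (rcosets H)) = rcosets H"
    using \<Omega>.rorbit_self[OF N] \<Omega>.rorbit_subset[OF subgroup.subset[OF N]] by blast
  ultimately show ?thesis using min_gens_le[OF NK_carrier[OF N] _ M] by (simp add: sum_distrib_left)
qed

lemma gen_by_soluble:
  assumes N: "prime_series G K N" and E: "E \<in> rcosets H" and l: "height_le subK l {0}"
  obtains w where "gen_by (N \<union> K) (l * w) (\<Omega>.rorbit N E)" "real w \<le> omega_tilde (card (\<Omega>.rorbit N E))"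
proof -
  obtain r css qs where *: "\<Omega>.chain_partition N (\<Omega>.rorbit N E) r css" "\<forall>q\<in>set qs. prime q"
    "prod_list qs = card (\<Omega>.rorbit N E)" "map length css = hook_lengths qs"
    using \<Omega>.prime_series_chain_partition[OF N fin E K_trivial[OF E]] by blast
  note Ns = prime_series_subgroup[OF N]
  show ?thesis
  proof (rule that)
    show "gen_by (N \<union> K) (l * length css) (\<Omega>.rorbit N E)"
      by (rule gen_by_chains[OF Ns *(1) \<Omega>.rorbit_subset[OF subgroup.subset[OF Ns] E] l])
    have "length css = length (hook_lengths qs)" using *(4) by (metis length_map)
    then show "real (length css) \<le> omega_tilde (card (\<Omega>.rorbit N E))"
      using length_hook_lengths_prime[OF *(2)] *(3) by simp
  qed
qed

text \<open>The orbit of \<open>N\<close> splits into at most c orbits of the Hall subgroup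
  \<open>P\<close>, each of which needs l generators.\<close>

lemma gen_by_hall:
  assumes N: "subgroup N G" and P: "subgroup P G" "P \<subseteq> N" and char: "of_nat (card P) \<noteq> (0 :: 'f)"
    and E: "E \<in> rcosets H" and card: "card N = card P * m" "card (\<Omega>.rorbit N E) = s' * c"
    and coprime: "coprime (card P) m" "coprime s' m" and pos: "s' > 0" and l: "height_le subK l {0}"
  shows "gen_by (N \<union> K) (l * c) (\<Omega>.rorbit N E)"
proof -
  have finN: "finite N" using finite_subset[OF subgroup.subset[OF N] fin] .
  let ?D = "\<Omega>.rorbit P ` \<Omega>.rorbit N E"
  have NX: "\<Omega>.rorbit N E \<subseteq> rcosets H" by (rule \<Omega>.rorbit_subset[OF subgroup.subset[OF N] E])
  have "gen_by (P \<union> K) (\<Sum>D\<in>?D. l) (\<Union>?D)"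
  proof (rule gen_by_Union[OF NK_carrier[OF P(1)]])
    show "finite ?D" using finite_subset[OF NX finite_rcosets] by simp
    show "gen_by (P \<union> K) l D" if "D \<in> ?D" for D
      using that NX gen_by_coprime[OF P(1) char _ l] by auto
    show "C #> g \<in> D \<longleftrightarrow> C \<in> D" if "D \<in> ?D" "C \<in> rcosets H" "g \<in> P \<union> K" for D C g
      by (rule orbit_invariant[OF P(1) _ that(2,3)]) (use that(1) NX in blast)
  qed
  moreover have "\<Union>?D = \<Omega>.rorbit N E"
  proof
    show "\<Union>?D \<subseteq> \<Omega>.rorbit N E" using \<Omega>.rorbit_act[OF N E] P(2) by (force simp: \<Omega>.rorbit_def[of P])
    show "\<Omega>.rorbit N E \<subseteq> \<Union>?D" using \<Omega>.rorbit_self[OF P(1)] NX by blast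
  qed
  moreover have "(\<Sum>D\<in>?D. l) \<le> l * c"
    using \<Omega>.card_rorbits_hall_le[OF N finN P E card coprime pos] by (simp add: mult.commute)
  moreover have "P \<union> K \<subseteq> N \<union> K" using P(2) by blast
  ultimately show ?thesis using gen_by_mono by metis
qed

lemma rorbit_carrier:
  assumes E: "E \<in> rcosets H"
  shows "\<Omega>.rorbit (carrier G) E = rcosets H"
proof
  show "\<Omega>.rorbit (carrier G) E \<subseteq> rcosets H" by (rule \<Omega>.rorbit_subset[OF subset_refl E])
  show "rcosets H \<subseteq> \<Omega>.rorbit (carrier G) E"
  proof
    fix C assume "C \<in> rcosets H"
    then obtain y where y: "y \<in> carrier G" "C = H #> y" using rcosetE by blast
    obtain x where x: "x \<in> carrier G" "E = H #> x" using rcosetE[OF E] .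
    have "E #> (inv x \<otimes> y) = C" using x y by (simp add: coset_act m_assoc[symmetric])
    then show "C \<in> \<Omega>.rorbit (carrier G) E" using x y by (force simp: \<Omega>.rorbit_def)
  qed
qed

text \<open>The previous bound with \<open>G\<close> in the role of \<open>N\<close>: all cosets
  form a single orbit.\<close>

lemma min_gens_le_hall:
  assumes P: "subgroup P G" and char: "of_nat (card P) \<noteq> (0 :: 'f)"
    and card: "order G = card P * m" "card (rcosets H) = s' * c"
    and coprime: "coprime (card P) m" "coprime s' m" and pos: "s' > 0" and l: "height_le subK l {0}"
    and M: "submod G W M"
  shows "min_gens G W M \<le> l * c"
proof -
  have E: "H \<in> rcosets H" by (rule subgroup.subgroup_in_rcosets[OF H is_group])
  have "gen_by (carrier G \<union> K) (l * c) (rcosets H)"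
    using gen_by_hall[OF subgroup_self P subgroup.subset[OF P] char E _ _ coprime pos l]
      card unfolding rorbit_carrier[OF E] by (simp add: order_def)
  then show ?thesis by (rule min_gens_le[OF NK_carrier[OF subgroup_self] _ M])
qed

lemma coset_orbits_eq: "coset_orbits G N (rcosets H) = \<Omega>.rorbit N ` (rcosets H)"
  by (auto simp: coset_orbits_def orbits_def orbit_def \<Omega>.rorbit_def image_def)

end

lemma prime_series_mono: "prime_series G K N \<Longrightarrow> K \<subseteq> K' \<Longrightarrow> prime_series G K' N"
proof (induction rule: prime_series.induct)
  case (base N)
  then show ?case by (intro prime_series.base) auto
next
  case (step N' N q x)
  then show ?case by (intro prime_series.step[of G K' N' N q x]) auto
qed

text \<open>\<open>K_sum\<close> takes the value j (p - 1) at p^j, and p \<le> 2^(p-1) makes this at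
  least the logarithm of p^j. The separate parameter s serves to compare all orbits with one common
  lower bound for their lengths.\<close>

lemma omega_tilde_prime_power_le:
  assumes p: "prime p" and s: "s > 1" "s \<le> p ^ j"
  shows "omega_tilde (p ^ j) \<le> sqrt (2 / pi) * real (p ^ j) / sqrt (log 2 (real s))"
proof -
  have "K_sum (p ^ j) = j * (p - 1)"
    using K_sum_prod_list[of "replicate j p"] p by (simp add: prod_list_replicate sum_list_replicate)
  moreover have "p \<le> 2 ^ (p - 1)"
    using less_exp[of "p - 1"] prime_gt_0_nat[OF p] by linarith
  then have "p ^ j \<le> 2 ^ (j * (p - 1))" by (metis mult.commute power_mono power_mult zero_le)
  ultimately have "s \<le> 2 ^ K_sum (p ^ j)" using s by simp
  then have "real s \<le> 2 powr real (K_sum (p ^ j))" by (simp add: powr_realpow of_nat_le_iff[symmetric] del: of_nat_le_iff)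
  then have le: "log 2 (real s) \<le> real (K_sum (p ^ j))" using s by (simp add: log_le_iff)
  have pos: "0 < log 2 (real s)" using s by simp
  have "omega_tilde (p ^ j) \<le> sqrt (2 / pi) * real (p ^ j) / sqrt (real (K_sum (p ^ j)))"
    by (rule omega_tilde_le) (use p le pos in \<open>auto simp: prime_gt_0_nat\<close>)
  also have "\<dots> \<le> sqrt (2 / pi) * real (p ^ j) / sqrt (log 2 (real s))"
    using le pos by (intro divide_left_mono) auto
  finally show ?thesis .
qed

lemma r_part_decomp:
  assumes "prime q" "n > 0"
  obtains c where "n = r_part q n * c" "\<not> q dvd c" "r_part q n > 0"
  using multiplicity_decompose'[of n q] assms unfolding r_part_def
  by (metis less_numeral_extra(3) not_prime_unit prime_gt_0_nat zero_less_power)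

lemma real_le_min_card: "real n \<le> r \<Longrightarrow> (finite A \<Longrightarrow> n \<le> card A) \<Longrightarrow> real n \<le> min_card r A"
  by (simp add: min_card_def)

theorem theorem4p24:
  fixes G :: "('g, 'b) monoid_scheme"
    and U :: "('f::field, 'g, 'u::ab_group_add) gmodule"
    and V :: "('f, 'g, 'g \<Rightarrow> 'u) gmodule"
    and W :: "('f, 'g, 'g \<Rightarrow> 'g \<Rightarrow> 'u) gmodule"
    and M :: "('g \<Rightarrow> 'g \<Rightarrow> 'u) set"
    and H H1 K K' P' :: "'g set"
    and \<Omega> \<Omega>1 :: "'g set set"
    and s d a p m :: nat
  assumes "group G" and "finite (carrier G)"
    and "subgroup H G" and "\<Omega> = rcosets\<^bsub>G\<^esub> H" and "card \<Omega> = s" and "s \<ge> 2"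
    and "subgroup H1 (G\<lparr>carrier := H\<rparr>)" and "\<Omega>1 = rcosets\<^bsub>G\<lparr>carrier := H\<rparr>\<^esub> H1"
    and "card \<Omega>1 = d" and "d \<ge> 1"
    and "CHAR('f) = p" and "p > 0"
    and "group_module (G\<lparr>carrier := H1\<rparr>) U" and "has_dimension U a"
    and "V = induced (G\<lparr>carrier := H\<rparr>) H1 U" and "W = induced G H V"
    and "K = core G H" and "subgroup K' G" and "K' \<subseteq> K"
    and "m = Min {card (coset_orbits G Q \<Omega>1) | Q.
                    subgroup Q G \<and> Q \<subseteq> K' \<and> semisimple (G\<lparr>carrier := Q\<rparr>) V}"
    and "maximal_p'_subgroup G p P'"
    and "submod G W M"
  shows
    \<comment> \<open>(i)\<close>
    "(solvable G \<longrightarrow>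
        real (min_gens G W M) \<le>
          min_card (rep_bound TYPE('f) G a d (P' \<inter> K) (card (coset_orbits G (P' \<inter> K) \<Omega>1)))
                   (vector_orbits G (P' \<inter> K) V)
          * real (r_part p s))
     \<and>
     (\<forall>N. subgroup N G \<and> solvable (induced_perm_group G N \<Omega>) \<longrightarrow>
        \<comment> \<open>(ii)(a)\<close>
        real (min_gens G W M) \<le>
          min_card (rep_bound TYPE('f) G a d (N \<inter> P' \<inter> K)
                      (card (coset_orbits G (N \<inter> P' \<inter> K) \<Omega>1)))
                   (vector_orbits G (N \<inter> P' \<inter> K) V)
          * (\<Sum>orb\<in>coset_orbits G N \<Omega>. omega_tilde (card orb))
        \<and>
        \<comment> \<open>(ii)(b)\<close>
        (\<forall>PN. solvable (G\<lparr>carrier := N\<rparr>) \<and> p_complement (G\<lparr>carrier := N\<rparr>) p PN \<longrightarrow>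
           real (min_gens G W M) \<le>
             min_card (rep_bound TYPE('f) G a d (PN \<inter> K) (card (coset_orbits G (PN \<inter> K) \<Omega>1)))
                      (vector_orbits G (PN \<inter> K) V)
             * (\<Sum>orb\<in>coset_orbits G N \<Omega>. E_sol (card orb) p)))
     \<and>
     \<comment> \<open>(iii)\<close>
     (\<forall>q Pq. prime q \<and> q \<noteq> p \<and> sylow_subgroup G q Pq \<longrightarrow>
        real (min_gens G W M) \<le>
          min_card (rep_bound TYPE('f) G a d (Pq \<inter> K) (card (coset_orbits G (Pq \<inter> K) \<Omega>1)))
                   (vector_orbits G (Pq \<inter> K) V)
          * (real s / real (r_part q s)))
     \<and>
     \<comment> \<open>(iv)\<close>
     (r_part p s > 1 \<longrightarrow>
        real (min_gens G W M) \<le>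
          min_card (rep_bound TYPE('f) G a d K' m) (vector_orbits G K V)
          * real_of_int \<lfloor>sqrt (2 / pi) * real s / sqrt (log 2 (real (r_part p s)))\<rfloor>)"
proof -
  interpret group G by fact
  note fin = \<open>finite (carrier G)\<close> and H = \<open>subgroup H G\<close> and M = \<open>submod G W M\<close>
  note \<Omega>_eq = \<open>\<Omega> = rcosets\<^bsub>G\<^esub> H\<close> and V_eq = \<open>V = induced (G\<lparr>carrier := H\<rparr>) H1 U\<close>
    and W_eq = \<open>W = induced G H V\<close> and K_eq = \<open>K = core G H\<close>
    and \<Omega>1_eq = \<open>\<Omega>1 = rcosets\<^bsub>G\<lparr>carrier := H\<rparr>\<^esub> H1\<close>
  interpret GH: group "G\<lparr>carrier := H\<rparr>" by (rule subgroup.subgroup_is_group[OF H is_group])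
  note H1 = \<open>subgroup H1 (G\<lparr>carrier := H\<rparr>)\<close>
  have U: "group_module (G\<lparr>carrier := H\<rparr>\<lparr>carrier := H1\<rparr>) U" using \<open>group_module (G\<lparr>carrier := H1\<rparr>) U\<close> by simp
  have V: "group_module (G\<lparr>carrier := H\<rparr>) V" unfolding V_eq by (rule GH.group_module_induced[OF H1 U])
  have Ks: "subgroup K G" "K \<subseteq> H" and Kn: "\<And>g k. \<lbrakk>g \<in> carrier G; k \<in> K\<rbrakk> \<Longrightarrow> g \<otimes>\<^bsub>G\<^esub> k \<otimes>\<^bsub>G\<^esub> inv\<^bsub>G\<^esub> g \<in> K"
    using core_subgroup[OF H] unfolding K_eq by auto
  interpret induced_module G H K V
    by (intro induced_module.intro induced_module_axioms.intro is_group fin H V Ks Kn)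
  have finH: "finite (carrier (G\<lparr>carrier := H\<rparr>))" using finite_subset[OF subgroup.subset[OF H] fin] by simp
  have p: "prime p" using \<open>CHAR('f) = p\<close> \<open>p > 0\<close> prime_CHAR_semidom[where 'a = 'f] by simp
  have char: "of_nat n \<noteq> (0 :: 'f) \<longleftrightarrow> \<not> p dvd n" for n
    using \<open>CHAR('f) = p\<close> by (simp add: of_nat_eq_0_iff_char_dvd)
  have M': "submod G (induced G H V) M" using M W_eq by simp
  have subH: "subgroup X (G\<lparr>carrier := H\<rparr>)" if "subgroup X G" "X \<subseteq> K" for X
    using subgroup_incl[OF that(1) H] that(2) KH by blast
  have coset_orbits_H: "coset_orbits (G\<lparr>carrier := H\<rparr>) Q \<Omega>1 = coset_orbits G Q \<Omega>1" for Q
    by (simp add: coset_orbits_def r_coset_def)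
  have fin\<Omega>1: "finite \<Omega>1" using finH unfolding \<Omega>1_eq by (simp add: RCOSETS_def)
  have orbits_le: "card (coset_orbits G Q \<Omega>1) \<le> d" for Q
  proof -
    have "coset_orbits G Q \<Omega>1 = orbit (G\<lparr>carrier := Q\<rparr>) (\<lambda>g C. C #>\<^bsub>G\<^esub> g) ` \<Omega>1"
      by (auto simp: coset_orbits_def orbits_def)
    then show ?thesis using card_image_le[OF fin\<Omega>1] \<open>card \<Omega>1 = d\<close> by metis
  qed
  have fixed_span: "\<exists>T. finite T \<and> card T \<le> a * card (coset_orbits G Q \<Omega>1)
      \<and> {f \<in> vecs V. \<forall>q\<in>Q. act V f q = f} \<subseteq> V.span T" if Q: "subgroup Q G" "Q \<subseteq> K" for Q
  proof -
    note span = GH.induced_fixed_span[OF H1 U \<open>has_dimension U a\<close> subH[OF Q] finH,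
      folded V_eq \<Omega>1_eq, unfolded coset_orbits_H]
    obtain T where "finite T" "card T \<le> a * card (coset_orbits G Q \<Omega>1)"
      "{f \<in> vecs V. \<forall>q\<in>Q. act V f q = f} \<subseteq> V.span T" by (rule span)
    then show ?thesis by blast
  qed
  have one_K: "subgroup {\<one>\<^bsub>G\<^esub>} G" "{\<one>\<^bsub>G\<^esub>} \<subseteq> K"
    using triv_subgroup subgroup.one_closed[OF K] by auto
  \<comment> \<open>The trivial subgroup fixes all of V, so the bound for spaces of fixed vectors
    also bounds the dimension of V by a d.\<close>
  have "\<exists>T. finite T \<and> card T \<le> a * d \<and> vecs V \<subseteq> V.span T"
  proof -
    obtain T where T: "finite T" "card T \<le> a * card (coset_orbits G {\<one>\<^bsub>G\<^esub>} \<Omega>1)"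
      "{f \<in> vecs V. \<forall>q\<in>{\<one>\<^bsub>G\<^esub>}. act V f q = f} \<subseteq> V.span T" using fixed_span[OF one_K] by blast
    have "{f \<in> vecs V. \<forall>q\<in>{\<one>\<^bsub>G\<^esub>}. act V f q = f} = vecs V" using V.act_one by auto
    moreover have "card T \<le> a * d" using T(2) orbits_le by (meson mult_le_mono2 order.trans)
    ultimately show ?thesis using T by metis
  qed
  then obtain T0 where T0: "finite T0" "card T0 \<le> a * d" "vecs V \<subseteq> V.span T0" by blast
  have rep_le: "real n \<le> rep_bound TYPE('f) G a d X (card (coset_orbits G Q \<Omega>1))"
    if c: "V.strict_chain K n c" and X: "subgroup X G" "X \<subseteq> K" and Q: "subgroup Q G" "Q \<subseteq> X" "V.fixed_lifting Q" for n c X Q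
  proof -
    have QK: "Q \<subseteq> K" using X Q by blast
    obtain T1 where T1: "finite T1" "card T1 \<le> a * card (coset_orbits G Q \<Omega>1)"
      "{f \<in> vecs V. \<forall>q\<in>Q. act V f q = f} \<subseteq> V.span T1" using fixed_span[OF Q(1) QK] by blast
    have "real n \<le> rep_bound TYPE('f) (G\<lparr>carrier := H\<rparr>) a d X (card (coset_orbits G Q \<Omega>1))"
      by (rule V.strict_chain_le_rep_bound[OF subH[OF X] subH[OF Q(1) QK] Q(2,3) V.strict_chain_subset[OF c X(2)] T1 T0 orbits_le])
    then show ?thesis unfolding rep_bound_def by (cases "X = {\<one>\<^bsub>G\<^esub>}") simp_all
  qed
  have orb_le: "n \<le> card (vector_orbits G X V)"
    if "V.strict_chain K n c" "subgroup X G" "X \<subseteq> K" "finite (vector_orbits G X V)" for n c X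
    using V.strict_chain_le_vector_orbits[OF subH[OF that(2,3)] V.strict_chain_subset[OF that(1,3)]] that(4)
    by (simp add: vector_orbits_def)
  have lift_p': "V.fixed_lifting Q" if "subgroup Q G" "Q \<subseteq> K" "\<not> p dvd card Q" for Q
    using V.fixed_lifting_coprime[OF subH[OF that(1,2)]] char that(3) finite_subset[OF subgroup.subset[OF that(1)] fin] by blast
  have sub0: "subK {0}" using V.inv_sub_0[of K] KH by simp
  \<comment> \<open>The least admissible height l is attained by a chain of exactly l steps: the
    height governs the number of generators, and the chain is compared with the bounds on V.\<close>
  have "\<exists>l c. height_le subK l {0} \<and> V.strict_chain K l c"
  proof -
    have chain: "\<exists>c. V.strict_chain K (Suc n) c" if nh: "\<not> height_le subK n {0}" for n
    proof -
      obtain c where c: "c 0 = {0}" "\<And>i. i < Suc n \<Longrightarrow> subK (c (Suc i)) \<and> c i \<subset> c (Suc i)"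
        using not_height_le_chain[OF nh] by blast
      have "subK (c i)" if "i \<le> Suc n" for i using c sub0 that by (cases i) auto
      then show ?thesis unfolding V.strict_chain_def using c(2) by (intro exI[of _ c]) auto
    qed
    \<comment> \<open>The bound for the trivial subgroup excludes arbitrarily long chains, so that
      some height exists at all.\<close>
    define r where "r = rep_bound TYPE('f) G a d {\<one>\<^bsub>G\<^esub>} (card (coset_orbits G {\<one>\<^bsub>G\<^esub>} \<Omega>1))"
    have lift1: "V.fixed_lifting {\<one>\<^bsub>G\<^esub>}" by (rule lift_p'[OF one_K]) (use p in \<open>simp add: prime_nat_iff\<close>)
    have "\<exists>l. height_le subK l {0}"
    proof (rule ccontr)
      assume "\<nexists>l. height_le subK l {0}"
      then have "real (Suc n) \<le> r" for n
        using chain rep_le[OF _ one_K one_K(1) subset_refl lift1] unfolding r_def by blast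
      then have "real (Suc (nat \<lceil>r\<rceil>)) \<le> r" by blast
      then show False by linarith
    qed
    define l where "l = (LEAST l. height_le subK l {0})"
    have l: "height_le subK l {0}" unfolding l_def using \<open>\<exists>l. height_le subK l {0}\<close> by (rule LeastI_ex)
    show ?thesis
    proof (cases l)
      case 0
      have "V.strict_chain K 0 (\<lambda>_. {0})" using sub0 by (simp add: V.strict_chain_def)
      then show ?thesis using l 0 by blast
    next
      case (Suc n)
      then have "\<not> height_le subK n {0}" using not_less_Least[of n "\<lambda>l. height_le subK l {0}"] by (simp add: l_def)
      then show ?thesis using chain l Suc by blast
    qed
  qed
  then obtain l c where l: "height_le subK l {0}" and chain: "V.strict_chain K l c" by blast
  have bound: "real l \<le> min_card (rep_bound TYPE('f) G a d X (card (coset_orbits G X \<Omega>1))) (vector_orbits G X V)"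
    if "subgroup X G" "X \<subseteq> K" "\<not> p dvd card X" for X
    by (rule real_le_min_card[OF rep_le[OF chain that(1,2) that(1) subset_refl lift_p'[OF that]] orb_le[OF chain that(1,2)]])
  have bound_Int: "real l \<le> min_card (rep_bound TYPE('f) G a d (X \<inter> K) (card (coset_orbits G (X \<inter> K) \<Omega>1))) (vector_orbits G (X \<inter> K) V)"
    if X: "subgroup X G" "\<not> p dvd card X" for X
  proof (rule bound)
    show XK: "subgroup (X \<inter> K) G" by (rule subgroups_Inter_pair[OF X(1) K])
    have "card (X \<inter> K) dvd card X" by (rule card_subgroup_dvd[OF XK X(1)]) simp
    then show "\<not> p dvd card (X \<inter> K)" using X(2) by (metis dvd_trans)
  qed simp
  have s0: "s > 0" using \<open>s \<ge> 2\<close> by simp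
  have card\<Omega>: "card (rcosets\<^bsub>G\<^esub> H) = s" using \<open>card \<Omega> = s\<close> \<Omega>_eq by simp
  have ord: "order G > 0" using fin by (simp add: order_gt_0_iff_finite)
  have P': "subgroup P' G" "\<not> p dvd card P'"
    using \<open>maximal_p'_subgroup G p P'\<close> by (auto simp: maximal_p'_subgroup_def p'_subgroup_def)
  have orbits_eq: "coset_orbits G N \<Omega> = \<Omega>.rorbit N ` (rcosets\<^bsub>G\<^esub> H)" for N
    unfolding \<Omega>_eq by (rule coset_orbits_eq)
  have fin\<Omega>: "finite (rcosets\<^bsub>G\<^esub> H)" by (rule finite_rcosets)
  show ?thesis
  proof (intro conjI impI allI; (elim conjE)?)
    assume "solvable G"
    \<comment> \<open>The subgroup whose orbits are counted, a Hall p'-subgroup, and the subgroup of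
      K that bounds l are chosen independently of each other.\<close>
    then obtain P k where P: "subgroup P G" "\<not> p dvd card P" "order G = card P * p ^ k"
      using solvable_p_complement[OF fin p] by blast
    obtain s' where s': "s = r_part p s * s'" "\<not> p dvd s'" using r_part_decomp[OF p s0] by blast
    have cop: "coprime x (p ^ k)" if "\<not> p dvd x" for x
      using prime_imp_coprime[OF p that] by (simp add: coprime_commute)
    have "s' > 0" using s' s0 by (auto intro: Nat.gr0I)
    have "min_gens G W M \<le> l * r_part p s"
      unfolding W_eq
      by (rule min_gens_le_hall[OF P(1) _ P(3) _ cop[OF P(2)] cop[OF s'(2)] \<open>s' > 0\<close> l M'])
        (use char P(2) s'(1) card\<Omega> in \<open>simp_all add: mult.commute\<close>)
    then have "real (min_gens G W M) \<le> real l * real (r_part p s)" by (metis of_nat_le_iff of_nat_mult)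
    also have "\<dots> \<le> min_card (rep_bound TYPE('f) G a d (P' \<inter> K) (card (coset_orbits G (P' \<inter> K) \<Omega>1)))
        (vector_orbits G (P' \<inter> K) V) * real (r_part p s)"
      by (intro mult_right_mono bound_Int P') simp
    finally show "real (min_gens G W M) \<le> min_card (rep_bound TYPE('f) G a d (P' \<inter> K) (card (coset_orbits G (P' \<inter> K) \<Omega>1)))
        (vector_orbits G (P' \<inter> K) V) * real (r_part p s)" .
  next
    fix N assume N: "subgroup N G" and solv: "solvable (induced_perm_group G N \<Omega>)"
    obtain n where "(derived G ^^ n) N \<subseteq> K"
      using solvable_induced_perm_group[OF H N] solv unfolding \<Omega>_eq K_eq by blast
    then have series: "prime_series G K N" by (rule prime_series_derived[OF fin N])
    have "\<exists>w. gen_by (N \<union> K) (l * w) D \<and> real w \<le> omega_tilde (card D)" if "D \<in> \<Omega>.rorbit N ` (rcosets\<^bsub>G\<^esub> H)" for D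
      using that gen_by_soluble[OF series _ l] by blast
    then obtain w where w: "\<And>D. D \<in> \<Omega>.rorbit N ` (rcosets\<^bsub>G\<^esub> H) \<Longrightarrow> gen_by (N \<union> K) (l * w D) D \<and> real (w D) \<le> omega_tilde (card D)"
      by metis
    have "subgroup (N \<inter> P') G" by (rule subgroups_Inter_pair[OF N P'(1)])
    moreover from this have "card (N \<inter> P') dvd card P'" by (rule card_subgroup_dvd[OF _ P'(1)]) simp
    then have "\<not> p dvd card (N \<inter> P')" using P'(2) by (metis dvd_trans)
    ultimately have bNP: "real l \<le> min_card (rep_bound TYPE('f) G a d (N \<inter> P' \<inter> K) (card (coset_orbits G (N \<inter> P' \<inter> K) \<Omega>1)))
      (vector_orbits G (N \<inter> P' \<inter> K) V)" by (rule bound_Int)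
    have total: "real (min_gens G W M) \<le> B * (\<Sum>orb\<in>coset_orbits G N \<Omega>. e (card orb))"
      if "real l \<le> B" "\<And>D. D \<in> \<Omega>.rorbit N ` (rcosets\<^bsub>G\<^esub> H) \<Longrightarrow> gen_by (N \<union> K) (l * u D) D \<and> real (u D) \<le> e (card D)"
      for B e u
    proof -
      have "min_gens G W M \<le> l * (\<Sum>D\<in>\<Omega>.rorbit N ` (rcosets\<^bsub>G\<^esub> H). u D)"
        unfolding W_eq by (rule min_gens_le_sum[OF N M']) (use that(2) in blast)
      then have "real (min_gens G W M) \<le> real l * (\<Sum>D\<in>\<Omega>.rorbit N ` (rcosets\<^bsub>G\<^esub> H). real (u D))"
        by (metis of_nat_le_iff of_nat_mult of_nat_sum)
      also have "\<dots> \<le> B * (\<Sum>D\<in>\<Omega>.rorbit N ` (rcosets\<^bsub>G\<^esub> H). e (card D))"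
        using that by (intro mult_mono sum_mono sum_nonneg) auto
      finally show ?thesis unfolding orbits_eq .
    qed
    show "real (min_gens G W M) \<le> min_card (rep_bound TYPE('f) G a d (N \<inter> P' \<inter> K) (card (coset_orbits G (N \<inter> P' \<inter> K) \<Omega>1)))
        (vector_orbits G (N \<inter> P' \<inter> K) V) * (\<Sum>orb\<in>coset_orbits G N \<Omega>. omega_tilde (card orb))"
      by (rule total[OF bNP w])
    fix PN assume "p_complement (G\<lparr>carrier := N\<rparr>) p PN"
    then obtain k where PN: "subgroup PN (G\<lparr>carrier := N\<rparr>)" "\<not> p dvd card PN" "card (rcosets\<^bsub>G\<lparr>carrier := N\<rparr>\<^esub> PN) = p ^ k"
      by (auto simp: p_complement_def p'_subgroup_def)
    have PNs: "subgroup PN G" by (rule incl_subgroup[OF N PN(1)])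
    have PN_N: "PN \<subseteq> N" using subgroup.subset[OF PN(1)] by simp
    have cardN: "card N = card PN * p ^ k"
      using group.lagrange[OF subgroup.subgroup_is_group[OF N is_group] PN(1)] PN(3) by (simp add: order_def mult.commute)
    have cop: "coprime x (p ^ k)" if "\<not> p dvd x" for x
      using prime_imp_coprime[OF p that] by (simp add: coprime_commute)
    have gen_p: "gen_by (N \<union> K) (l * r_part p (card D)) D" if D: "D \<in> \<Omega>.rorbit N ` (rcosets\<^bsub>G\<^esub> H)" for D
    proof -
      obtain E where E: "E \<in> rcosets\<^bsub>G\<^esub> H" "D = \<Omega>.rorbit N E" using D by blast
      have "finite D" "E \<in> D"
        using finite_subset[OF \<Omega>.rorbit_subset[OF subgroup.subset[OF N] E(1)] fin\<Omega>] \<Omega>.rorbit_self[OF N E(1)] E(2) by auto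
      then have "card D > 0" by (auto simp: card_gt_0_iff)
      then obtain s' where s': "card D = r_part p (card D) * s'" "\<not> p dvd s'" using r_part_decomp[OF p] by blast
      have "s' > 0" using s' \<open>card D > 0\<close> by (auto intro: Nat.gr0I)
      show ?thesis
        unfolding E(2)
        by (rule gen_by_hall[OF N PNs PN_N _ E(1) cardN _ cop[OF PN(2)] cop[OF s'(2)] \<open>s' > 0\<close> l])
          (use char PN(2) s'(1) E(2) in \<open>simp_all add: mult.commute\<close>)
    qed
    show "real (min_gens G W M) \<le> min_card (rep_bound TYPE('f) G a d (PN \<inter> K) (card (coset_orbits G (PN \<inter> K) \<Omega>1)))
        (vector_orbits G (PN \<inter> K) V) * (\<Sum>orb\<in>coset_orbits G N \<Omega>. E_sol (card orb) p)"
    \<comment> \<open>On each orbit separately the smaller of the two numbers of generators is used,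
      as a sum of minima demands.\<close>
    proof (rule total[OF bound_Int[OF PNs PN(2)], where u = "\<lambda>D. min (w D) (r_part p (card D))"])
      fix D assume D: "D \<in> \<Omega>.rorbit N ` (rcosets\<^bsub>G\<^esub> H)"
      show "gen_by (N \<union> K) (l * min (w D) (r_part p (card D))) D \<and> real (min (w D) (r_part p (card D))) \<le> E_sol (card D) p"
        using w[OF D] gen_p[OF D] by (auto simp: min_def E_sol_def)
    qed
  next
    fix q Pq assume q: "prime q" "q \<noteq> p" and "sylow_subgroup G q Pq"
    then have Pq: "subgroup Pq G" "card Pq = r_part q (order G)" by (auto simp: sylow_subgroup_def)
    obtain m' where m': "order G = r_part q (order G) * m'" "\<not> q dvd m'" using r_part_decomp[OF q(1) ord] by blast
    obtain c where c: "s = r_part q s * c" "r_part q s > 0" using r_part_decomp[OF q(1) s0] by blast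
    have cop: "coprime (r_part q x) m'" for x
      unfolding r_part_def using prime_imp_coprime[OF q(1) m'(2)] by simp
    have np: "\<not> p dvd card Pq"
      unfolding Pq(2) r_part_def using p q by (metis prime_dvd_power primes_dvd_imp_eq)
    have "min_gens G W M \<le> l * c"
      unfolding W_eq
      by (rule min_gens_le_hall[OF Pq(1) _ m'(1)[folded Pq(2)] _ _ cop c(2) l M'])
        (use char np c(1) card\<Omega> cop Pq(2) in simp_all)
    then have "real (min_gens G W M) \<le> real l * real c" by (metis of_nat_le_iff of_nat_mult)
    also have "real c = real s / real (r_part q s)"
      using c by (metis nonzero_mult_div_cancel_left of_nat_0_less_iff of_nat_mult order_less_irrefl)
    also have "real l * (real s / real (r_part q s)) \<le> min_card (rep_bound TYPE('f) G a d (Pq \<inter> K) (card (coset_orbits G (Pq \<inter> K) \<Omega>1)))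
        (vector_orbits G (Pq \<inter> K) V) * (real s / real (r_part q s))"
      by (intro mult_right_mono bound_Int Pq(1) np) simp
    finally show "real (min_gens G W M) \<le> min_card (rep_bound TYPE('f) G a d (Pq \<inter> K) (card (coset_orbits G (Pq \<inter> K) \<Omega>1)))
        (vector_orbits G (Pq \<inter> K) V) * (real s / real (r_part q s))" .
  next
    assume sp: "1 < r_part p s"
    let ?Qs = "{card (coset_orbits G Q \<Omega>1) | Q. subgroup Q G \<and> Q \<subseteq> K' \<and> semisimple (G\<lparr>carrier := Q\<rparr>) V}"
    have K': "subgroup K' G" "K' \<subseteq> K" by fact+
    have "finite ?Qs"
      by (rule finite_subset[of _ "(\<lambda>Q. card (coset_orbits G Q \<Omega>1)) ` Pow (carrier G)"])
        (use fin subgroup.subset in \<open>auto simp: fin\<close>)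
    moreover have "semisimple (G\<lparr>carrier := {\<one>\<^bsub>G\<^esub>}\<rparr>) V"
    proof -
      obtain B where "B \<subseteq> vecs V" "V.independent B" "vecs V \<subseteq> V.span B"
        using V.maximal_independent_subset by blast
      moreover from this have "V.span B = vecs V" using V.span_minimal[OF _ V.subspace_vecs] by blast
      moreover have "finite B" using V.independent_span_bound[OF T0(1) _] calculation T0(3) by blast
      ultimately have "has_dimension V (card B)" unfolding has_dimension_def by blast
      then show ?thesis using V.semisimple_trivial_group by simp
    qed
    then have "?Qs \<noteq> {}" using one_K(1) subgroup.one_closed[OF K'(1)] by blast
    ultimately have "m \<in> ?Qs" unfolding \<open>m = Min ?Qs\<close> by (rule Min_in)
    then obtain Q where Q: "m = card (coset_orbits G Q \<Omega>1)" "subgroup Q G" "Q \<subseteq> K'" "semisimple (G\<lparr>carrier := Q\<rparr>) V" by blast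
    have "V.fixed_lifting Q"
      using V.fixed_lifting_semisimple[OF subH[OF Q(2)] _ T0(1,3)] Q(3,4) K'(2) by simp
    \<comment> \<open>The first entry uses K' together with a subgroup Q that attains the minimum m,
      the second entry the orbits of the whole of K.\<close>
    then have bK: "real l \<le> min_card (rep_bound TYPE('f) G a d K' m) (vector_orbits G K V)"
      unfolding Q(1) by (intro real_le_min_card rep_le[OF chain K' Q(2,3)] orb_le[OF chain K subset_refl])
    \<comment> \<open>The orbits of a Sylow p-subgroup have p-power lengths, all at least s_p. Hence
      each coset contributes at most the same amount \<beta>, and the orbit lengths add up to
      s.\<close>
    obtain P r where *: "subgroup P G" "P \<subseteq> carrier G" "card P = p ^ multiplicity p (order G)"
      "order G = p ^ multiplicity p (order G) * r" "\<not> p dvd r"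
      by (rule sylow_subgroup_exists[OF fin subgroup_self p, folded order_def])
    note P = *(1,3,4,5)
    have finP: "finite P" using finite_subset[OF subgroup.subset[OF P(1)] fin] .
    have series: "prime_series G K P"
      by (rule prime_series_mono[OF prime_series_p_group[OF fin p P(1,2)] one_K(2)])
    let ?O = "\<Omega>.rorbit P ` (rcosets\<^bsub>G\<^esub> H)"
    have "\<exists>w. gen_by (P \<union> K) (l * w) D \<and> real w \<le> omega_tilde (card D)" if "D \<in> ?O" for D
      using that gen_by_soluble[OF series _ l] by blast
    then obtain w where w: "\<And>D. D \<in> ?O \<Longrightarrow> gen_by (P \<union> K) (l * w D) D \<and> real (w D) \<le> omega_tilde (card D)"
      by metis
    have le: "min_gens G W M \<le> l * (\<Sum>D\<in>?O. w D)"
      unfolding W_eq by (rule min_gens_le_sum[OF P(1) M']) (use w in blast)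
    define \<beta> where "\<beta> = sqrt (2 / pi) / sqrt (log 2 (real (r_part p s)))"
    have w_le: "real (w D) \<le> \<beta> * real (card D)" if D: "D \<in> ?O" for D
    proof -
      obtain E where E: "E \<in> rcosets\<^bsub>G\<^esub> H" "D = \<Omega>.rorbit P E" using D by blast
      have "card D dvd p ^ multiplicity p (order G)"
        using \<Omega>.card_rorbit_rstab[OF P(1) finP E(1)] P(2) E(2) by (metis dvd_triv_left)
      then obtain j where j: "card D = p ^ j" using p by (metis divides_primepow_nat)
      obtain c where c: "s = r_part p s * c" using r_part_decomp[OF p s0] by blast
      have "coprime p r" using prime_imp_coprime[OF p P(4)] .
      then have "r_part p s \<le> card (\<Omega>.rorbit P E)"
        using c card\<Omega> P
        by (intro \<Omega>.card_rorbit_hall_ge[OF subgroup_self fin P(1) subgroup.subset[OF P(1)] E(1), of r "r_part p s" c])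
          (simp_all add: rorbit_carrier[OF E(1)] order_def r_part_def)
      then have "omega_tilde (card D) \<le> \<beta> * real (card D)"
        using omega_tilde_prime_power_le[OF p sp, of j] j E(2) by (simp add: \<beta>_def)
      then show ?thesis using w[OF D] by linarith
    qed
    have "real (\<Sum>D\<in>?O. w D) \<le> (\<Sum>D\<in>?O. \<beta> * real (card D))"
      unfolding of_nat_sum by (rule sum_mono) (rule w_le)
    also have "\<dots> = \<beta> * real (\<Sum>D\<in>?O. card D)" by (simp add: sum_distrib_left)
    also have "(\<Sum>D\<in>?O. card D) = card (\<Union>?O)"
    proof (rule card_Union_disjoint[symmetric])
      show "pairwise disjnt ?O"
      proof (rule pairwise_imageI)
        fix x y assume xy: "x \<in> rcosets\<^bsub>G\<^esub> H" "y \<in> rcosets\<^bsub>G\<^esub> H" "\<Omega>.rorbit P x \<noteq> \<Omega>.rorbit P y"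
        then show "disjnt (\<Omega>.rorbit P x) (\<Omega>.rorbit P y)"
          using \<Omega>.rorbit_eq[OF P(1), of x] \<Omega>.rorbit_eq[OF P(1), of y] unfolding disjnt_iff by blast
      qed
      show "finite D" if "D \<in> ?O" for D using that finP by (auto simp: \<Omega>.rorbit_def)
    qed
    also have "\<Union>?O = rcosets\<^bsub>G\<^esub> H"
      using \<Omega>.rorbit_self[OF P(1)] \<Omega>.rorbit_subset[OF subgroup.subset[OF P(1)]] by blast
    also have "\<beta> * real (card (rcosets\<^bsub>G\<^esub> H)) = sqrt (2 / pi) * real s / sqrt (log 2 (real (r_part p s)))"
      unfolding card\<Omega> by (simp add: \<beta>_def)
    \<comment> \<open>The factor multiplying l is an integer, which is why the floor may be
      taken.\<close>
    finally have "int (\<Sum>D\<in>?O. w D) \<le> \<lfloor>sqrt (2 / pi) * real s / sqrt (log 2 (real (r_part p s)))\<rfloor>"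
      by (simp add: le_floor_iff)
    then have fl: "real (\<Sum>D\<in>?O. w D) \<le> real_of_int \<lfloor>sqrt (2 / pi) * real s / sqrt (log 2 (real (r_part p s)))\<rfloor>"
      by (metis of_int_le_iff of_int_of_nat_eq)
    have "real (min_gens G W M) \<le> real l * real (\<Sum>D\<in>?O. w D)" using le by (metis of_nat_le_iff of_nat_mult)
    also have "\<dots> \<le> min_card (rep_bound TYPE('f) G a d K' m) (vector_orbits G K V)
        * real_of_int \<lfloor>sqrt (2 / pi) * real s / sqrt (log 2 (real (r_part p s)))\<rfloor>"
      by (rule mult_mono[OF bK fl order_trans[OF of_nat_0_le_iff bK] of_nat_0_le_iff])
    finally show "real (min_gens G W M) \<le> min_card (rep_bound TYPE('f) G a d K' m) (vector_orbits G K V)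
        * real_of_int \<lfloor>sqrt (2 / pi) * real s / sqrt (log 2 (real (r_part p s)))\<rfloor>" .
  qed
qed

end
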